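(* Let $(X_i)_{i\in\mathbb{Z}}$, $X_i=X_0\circ\mathbb{T}^i$, be an ergodic stationary sequence of centered random variables with values in $\mathbf{L}^1(\mu)$. Assume that for every $t\in\mathbf{T}$, $\mathbb{E}(X_0(t)\mid\mathcal{F}_{-\infty})=0$ and $\mathbb{E}(X_0(t)\mid\mathcal{F}_{\infty})=X_0(t)$, that $$\int_{\mathbf{T}}\|X_0(t)\|_2\,\mu(dt)<\infty,$$ and that $$\sum_{k\in\mathbb{Z}}\int_{\mathbf{T}}\|P_0(X_k(t))\|_2\,\mu(dt)<\infty .$$ Then $$n^{-1/2}\sum_{i=1}^n X_0\circ\mathbb{T}^i\ \underset{n\to\infty}{\longrightarrow}\ G\quad\text{in law in }\mathbf{L}^1(\mu),$$ where $G$ is an $\mathbf{L}^1(\mu)$-valued centered Gaussian random variable with covariance operator given by: for any $f\in\mathbf{L}^\infty(\mu)$, $$\Phi_G(f,f)=\mathbb{E}\Big(\Big(f\Big(\sum_{k\in\mathbb{Z}}P_0(X_k)\Big)\Big)^2\Big)=\sum_{k\in\mathbb{Z}}\mathrm{Cov}(f(X_0),f(X_k)).$$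
   Context: $\mu$ is a $\sigma$-finite measure on $\mathbf{T}$; $\mathbf{L}^1(\mu)=\mathbf{L}^1(\mathbf{T},\mu)$ is the Banach space of $\mu$-integrable real functions on $\mathbf{T}$ with norm $\|x\|_{1,\mu}=\int_{\mathbf{T}}|x(t)|\,\mu(dt)$, and $\mathbf{L}^\infty(\mu)$ is its dual space; for $f\in\mathbf{L}^\infty(\mu)$ and $x\in\mathbf{L}^1(\mu)$, $f(x)=\int_{\mathbf{T}}f(t)x(t)\,\mu(dt)$. $(\Omega,\mathcal{A},\mathbb{P})$ is a probability space and $\mathbb{T}:\Omega\to\Omega$ is a bijective bimeasurable transformation preserving $\mathbb{P}$. $\mathcal{F}_0\subseteq\mathcal{A}$ is a sub-$\sigma$-field with $\mathcal{F}_0\subseteq\mathbb{T}^{-1}(\mathcal{F}_0)$, and $\mathcal{F}_i=\mathbb{T}^{-i}(\mathcal{F}_0)$ for $i\in\mathbb{Z}$; $\mathcal{F}_{-\infty}=\bigcap_{i}\mathcal{F}_i$ and $\mathcal{F}_\infty=\sigma\big(\bigcup_i\mathcal{F}_i\big)$. $X_k(t)$ denotes the value of $X_k$ at $t$ (for a jointly measurable version in $(t,\omega)$). For a real random variable $Y$, $\|Y\|_2=\mathbb{E}(|Y|^2)^{1/2}$. The projection $P_0$ is defined by $P_0(X_k(t))=\mathbb{E}(X_k(t)\mid\mathcal{F}_0)-\mathbb{E}(X_k(t)\mid\mathcal{F}_{-1})$, and $P_0(X_k)$ is the $\mathbf{L}^1(\mu)$-valued variable $t\mapsto P_0(X_k(t))$.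 For a centered Gaussian $G$ in $\mathbf{L}^1(\mu)$, $\Phi_G(f,g)=\mathbb{E}(f(G)g(G))$. *)

theory Defs
  imports "HOL-Probability.Probability"
begin

section \<open>The space \<open>L\<^sup>1(\<mu>)\<close> and its dual\<close>

definition L1_class :: "'t measure \<Rightarrow> ('t \<Rightarrow> real) \<Rightarrow> ('t \<Rightarrow> real) set" where
  "L1_class mu x = {y. integrable mu y \<and> (AE t in mu. y t = x t)}"

definition L1_carrier :: "'t measure \<Rightarrow> ('t \<Rightarrow> real) set set" where
  "L1_carrier mu = L1_class mu ` {x. integrable mu x}"

definition L1_dist :: "'t measure \<Rightarrow> ('t \<Rightarrow> real) set \<Rightarrow> ('t \<Rightarrow> real) set \<Rightarrow> real" where
  "L1_dist mu A B =
     (if A \<in> L1_carrier mu \<and> B \<in> L1_carrier mu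
      then THE r. \<exists>x\<in>A. \<exists>y\<in>B. r = (\<integral>t. \<bar>x t - y t\<bar> \<partial>mu) else 0)"

definition L1_space :: "'t measure \<Rightarrow> ('t \<Rightarrow> real) set metric" where
  "L1_space mu = metric (L1_carrier mu, L1_dist mu)"

text \<open>The next lemmas justify the use of \<open>THE\<close> and of the type constructor \<open>metric\<close> above; the
  default value \<open>0\<close> of \<open>L1_dist\<close> is there because \<open>Metric_space\<close> asks for nonnegativity and
  symmetry outside the carrier as well.\<close>

lemma L1_class_self: "integrable mu x \<Longrightarrow> x \<in> L1_class mu x"
  by (simp add: L1_class_def)

lemma L1_class_eq_iff:
  assumes "integrable mu x" "integrable mu y"
  shows "L1_class mu x = L1_class mu y \<longleftrightarrow> (AE t in mu. x t = y t)"
proof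
  assume "L1_class mu x = L1_class mu y"
  then have "x \<in> L1_class mu y" using L1_class_self assms(1) by blast
  then show "AE t in mu. x t = y t" by (simp add: L1_class_def)
next
  assume *: "AE t in mu. x t = y t"
  have "(AE t in mu. z t = x t) \<longleftrightarrow> (AE t in mu. z t = y t)" for z
    by (rule eventually_subst) (use * in eventually_elim, simp)
  then show "L1_class mu x = L1_class mu y" by (simp add: L1_class_def)
qed

lemma L1_dist_class:
  assumes x: "integrable mu x" and y: "integrable mu y"
  shows "L1_dist mu (L1_class mu x) (L1_class mu y) = (\<integral>t. \<bar>x t - y t\<bar> \<partial>mu)"
proof -
  have "(THE r. \<exists>x'\<in>L1_class mu x. \<exists>y'\<in>L1_class mu y. r = (\<integral>t. \<bar>x' t - y' t\<bar> \<partial>mu))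
      = (\<integral>t. \<bar>x t - y t\<bar> \<partial>mu)"
  proof (rule the_equality)
    show "\<exists>x'\<in>L1_class mu x. \<exists>y'\<in>L1_class mu y.
        (\<integral>t. \<bar>x t - y t\<bar> \<partial>mu) = (\<integral>t. \<bar>x' t - y' t\<bar> \<partial>mu)"
      using L1_class_self[OF x] L1_class_self[OF y] by blast
  next
    fix r
    assume "\<exists>x'\<in>L1_class mu x. \<exists>y'\<in>L1_class mu y. r = (\<integral>t. \<bar>x' t - y' t\<bar> \<partial>mu)"
    then obtain x' y' where x': "integrable mu x'" "AE t in mu. x' t = x t"
      and y': "integrable mu y'" "AE t in mu. y' t = y t"
      and r: "r = (\<integral>t. \<bar>x' t - y' t\<bar> \<partial>mu)"
      by (auto simp: L1_class_def)
    show "r = (\<integral>t. \<bar>x t - y t\<bar> \<partial>mu)"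
      unfolding r
    proof (rule integral_cong_AE)
      show "(\<lambda>t. \<bar>x' t - y' t\<bar>) \<in> borel_measurable mu"
        using x'(1) y'(1) by measurable
      show "(\<lambda>t. \<bar>x t - y t\<bar>) \<in> borel_measurable mu"
        using x y by measurable
      show "AE t in mu. \<bar>x' t - y' t\<bar> = \<bar>x t - y t\<bar>"
        using x'(2) y'(2) by eventually_elim simp
    qed
  qed
  then show ?thesis using x y by (simp add: L1_dist_def L1_carrier_def)
qed

lemma Metric_space_L1: "Metric_space (L1_carrier mu) (L1_dist mu)"
proof -
  have nonneg: "0 \<le> L1_dist mu A B" for A B
  proof (cases "A \<in> L1_carrier mu \<and> B \<in> L1_carrier mu")
    case True
    then show ?thesis by (auto simp: L1_carrier_def L1_dist_class)
  qed (auto simp: L1_dist_def)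
  have sym: "L1_dist mu A B = L1_dist mu B A" for A B
  proof (cases "A \<in> L1_carrier mu \<and> B \<in> L1_carrier mu")
    case True
    then show ?thesis by (auto simp: L1_carrier_def L1_dist_class abs_minus_commute)
  qed (auto simp: L1_dist_def)
  have zero: "L1_dist mu A B = 0 \<longleftrightarrow> A = B"
    if AB: "A \<in> L1_carrier mu" "B \<in> L1_carrier mu" for A B
  proof -
    obtain x y where x: "integrable mu x" "A = L1_class mu x"
      and y: "integrable mu y" "B = L1_class mu y"
      using AB by (auto simp: L1_carrier_def)
    have "integrable mu (\<lambda>t. \<bar>x t - y t\<bar>)" using x y by simp
    then have "(\<integral>t. \<bar>x t - y t\<bar> \<partial>mu) = 0 \<longleftrightarrow> (AE t in mu. \<bar>x t - y t\<bar> = 0)"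
      by (rule integral_nonneg_eq_0_iff_AE) simp
    then show ?thesis
      using x y by (simp add: L1_dist_class L1_class_eq_iff)
  qed
  have triangle: "L1_dist mu A C \<le> L1_dist mu A B + L1_dist mu B C"
    if ABC: "A \<in> L1_carrier mu" "B \<in> L1_carrier mu" "C \<in> L1_carrier mu" for A B C
  proof -
    obtain x y z where x: "integrable mu x" "A = L1_class mu x"
      and y: "integrable mu y" "B = L1_class mu y"
      and z: "integrable mu z" "C = L1_class mu z"
      using ABC by (auto simp: L1_carrier_def)
    have "(\<integral>t. \<bar>x t - z t\<bar> \<partial>mu) \<le> (\<integral>t. \<bar>x t - y t\<bar> + \<bar>y t - z t\<bar> \<partial>mu)"
      using x y z by (intro integral_mono) auto
    also have "\<dots> = (\<integral>t. \<bar>x t - y t\<bar> \<partial>mu) + (\<integral>t. \<bar>y t - z t\<bar> \<partial>mu)"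
      using x y z by (intro Bochner_Integration.integral_add) auto
    finally show ?thesis
      using x y z by (simp add: L1_dist_class)
  qed
  show ?thesis
    by unfold_locales (use nonneg sym zero triangle in auto)
qed

lemma mspace_L1_space: "mspace (L1_space mu) = L1_carrier mu"
  and mdist_L1_space: "mdist (L1_space mu) = L1_dist mu"
  unfolding L1_space_def
  using Metric_space.mspace_metric[OF Metric_space_L1] Metric_space.mdist_metric[OF Metric_space_L1]
  by auto

definition L1_borel :: "'t measure \<Rightarrow> ('t \<Rightarrow> real) set measure" where
  "L1_borel mu = sigma (mspace (L1_space mu)) {U. openin (mtopology_of (L1_space mu)) U}"

definition Linfty :: "'t measure \<Rightarrow> ('t \<Rightarrow> real) set" where
  "Linfty mu = {f \<in> borel_measurable mu. \<exists>C. AE t in mu. \<bar>f t\<bar> \<le> C}"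

definition L1_pair :: "'t measure \<Rightarrow> ('t \<Rightarrow> real) \<Rightarrow> ('t \<Rightarrow> real) \<Rightarrow> real" where
  "L1_pair mu f x = (\<integral>t. f t * x t \<partial>mu)"

definition L1_has_sum :: "'t measure \<Rightarrow> ('i \<Rightarrow> 't \<Rightarrow> real) \<Rightarrow> ('t \<Rightarrow> real) \<Rightarrow> bool" where
  "L1_has_sum mu x s \<longleftrightarrow> (\<forall>k. integrable mu (x k)) \<and> integrable mu s \<and>
     ((\<lambda>K. \<integral>t. \<bar>s t - (\<Sum>k\<in>K. x k t)\<bar> \<partial>mu) \<longlongrightarrow> 0) (finite_subsets_at_top UNIV)"


section \<open>Random variables with values in \<open>L\<^sup>1(\<mu>)\<close>\<close>

text \<open>A random variable with values in \<open>L\<^sup>1(\<mu>)\<close> is given by a version that is jointly measurable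
  in \<open>(\<omega>, t)\<close>; \<open>X \<omega> t\<close> is the value of \<open>X\<close> at \<open>t\<close>, and the random element of the quotient is
  \<open>\<lambda>\<omega>. L1_class mu (X \<omega>)\<close>.\<close>

definition L1_random_variable ::
    "'w measure \<Rightarrow> 't measure \<Rightarrow> ('w \<Rightarrow> 't \<Rightarrow> real) \<Rightarrow> bool" where
  "L1_random_variable P mu X \<longleftrightarrow>
     (\<lambda>(\<omega>, t). X \<omega> t) \<in> borel_measurable (P \<Otimes>\<^sub>M mu) \<and> (\<forall>\<omega>\<in>space P. integrable mu (X \<omega>))"

definition L1_centered :: "'w measure \<Rightarrow> 't measure \<Rightarrow> ('w \<Rightarrow> 't \<Rightarrow> real) \<Rightarrow> bool" where
  "L1_centered P mu X \<longleftrightarrow>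
     (\<forall>f\<in>Linfty mu. integrable P (\<lambda>\<omega>. L1_pair mu f (X \<omega>)) \<and>
        (\<integral>\<omega>. L1_pair mu f (X \<omega>) \<partial>P) = 0)"

definition real_gaussian :: "'w measure \<Rightarrow> ('w \<Rightarrow> real) \<Rightarrow> bool" where
  "real_gaussian P Y \<longleftrightarrow> Y \<in> borel_measurable P \<and>
     (\<exists>m. (AE \<omega> in P. Y \<omega> = m) \<or> (\<exists>\<sigma>>0. distributed P lborel Y (normal_density m \<sigma>)))"

definition L1_gaussian :: "'w measure \<Rightarrow> 't measure \<Rightarrow> ('w \<Rightarrow> 't \<Rightarrow> real) \<Rightarrow> bool" where
  "L1_gaussian P mu G \<longleftrightarrow> L1_random_variable P mu G \<and>
     (\<forall>f\<in>Linfty mu. real_gaussian P (\<lambda>\<omega>. L1_pair mu f (G \<omega>)))"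

definition L1_covariance ::
    "'w measure \<Rightarrow> 't measure \<Rightarrow> ('w \<Rightarrow> 't \<Rightarrow> real) \<Rightarrow> ('t \<Rightarrow> real) \<Rightarrow> ('t \<Rightarrow> real) \<Rightarrow> real" where
  "L1_covariance P mu G f g = (\<integral>\<omega>. L1_pair mu f (G \<omega>) * L1_pair mu g (G \<omega>) \<partial>P)"

text \<open>The limit may live on another probability space; \<open>nat \<Rightarrow> real\<close> is large enough as a type of
  outcomes, since a jointly measurable \<open>L\<^sup>1(\<mu>)\<close>-valued variable has separable range.\<close>

definition L1_converges_in_law ::
    "'w measure \<Rightarrow> 't measure \<Rightarrow> (nat \<Rightarrow> 'w \<Rightarrow> 't \<Rightarrow> real) \<Rightarrow> 'v measure \<Rightarrow> ('v \<Rightarrow> 't \<Rightarrow> real) \<Rightarrow> bool" where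
  "L1_converges_in_law P mu Y Q G \<longleftrightarrow>
     (\<forall>h. continuous_map (mtopology_of (L1_space mu)) euclideanreal h \<and>
          bounded (h ` mspace (L1_space mu)) \<longrightarrow>
        (\<lambda>n. \<integral>\<omega>. h (L1_class mu (Y n \<omega>)) \<partial>P) \<longlonglongrightarrow> (\<integral>\<omega>. h (L1_class mu (G \<omega>)) \<partial>Q))"

definition Cov :: "'w measure \<Rightarrow> ('w \<Rightarrow> real) \<Rightarrow> ('w \<Rightarrow> real) \<Rightarrow> real" where
  "Cov P Y Z = (\<integral>\<omega>. (Y \<omega> - (\<integral>\<omega>'. Y \<omega>' \<partial>P)) * (Z \<omega> - (\<integral>\<omega>'. Z \<omega>' \<partial>P)) \<partial>P)"

text \<open>Extended-valued, so that finiteness of integrals and sums of such norms is a genuine condition.\<close>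

definition norm2 :: "'w measure \<Rightarrow> ('w \<Rightarrow> real) \<Rightarrow> ennreal" where
  "norm2 P Y = (if integrable P (\<lambda>\<omega>. (Y \<omega>)\<^sup>2) then ennreal (sqrt (\<integral>\<omega>. (Y \<omega>)\<^sup>2 \<partial>P)) else \<infinity>)"


section \<open>Stationary sequences and filtrations\<close>

definition preserving_bijection :: "'w measure \<Rightarrow> ('w \<Rightarrow> 'w) \<Rightarrow> bool" where
  "preserving_bijection P T \<longleftrightarrow> bij_betw T (space P) (space P) \<and>
     T \<in> measurable P P \<and> inv_into (space P) T \<in> measurable P P \<and> distr P P T = P"

definition int_iterate :: "'w measure \<Rightarrow> ('w \<Rightarrow> 'w) \<Rightarrow> int \<Rightarrow> 'w \<Rightarrow> 'w" where
  "int_iterate P T i =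
     (if i \<ge> 0 then T ^^ nat i else inv_into (space P) T ^^ nat (- i))"

definition translates ::
    "'w measure \<Rightarrow> ('w \<Rightarrow> 'w) \<Rightarrow> ('w \<Rightarrow> 't \<Rightarrow> real) \<Rightarrow> int \<Rightarrow> 'w \<Rightarrow> 't \<Rightarrow> real" where
  "translates P T X0 i = X0 \<circ> int_iterate P T i"

text \<open>Ergodicity of the sequence: every shift-invariant event of the path space has probability
  \<open>0\<close> or \<open>1\<close> under the law of the sequence.\<close>

definition L1_ergodic_sequence ::
    "'w measure \<Rightarrow> 't measure \<Rightarrow> (int \<Rightarrow> 'w \<Rightarrow> 't \<Rightarrow> real) \<Rightarrow> bool" where
  "L1_ergodic_sequence P mu X \<longleftrightarrow>
     (let path = Pi\<^sub>M (UNIV :: int set) (\<lambda>_. L1_borel mu) in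
      \<forall>A\<in>sets path. {y \<in> space path. (\<lambda>i. y (i + 1)) \<in> A} = A \<longrightarrow>
        measure P {\<omega> \<in> space P. (\<lambda>i. L1_class mu (X i \<omega>)) \<in> A} \<in> {0, 1})"

text \<open>\<open>T\<^sup>-\<^sup>i(F\<^sub>0)\<close> consists of the preimages of the sets of \<open>F\<^sub>0\<close> under \<open>T\<^sup>i\<close>.\<close>

definition filt :: "'w measure \<Rightarrow> ('w \<Rightarrow> 'w) \<Rightarrow> 'w measure \<Rightarrow> int \<Rightarrow> 'w measure" where
  "filt P T F0 i = vimage_algebra (space P) (int_iterate P T i) F0"

definition filt_minf :: "'w measure \<Rightarrow> ('w \<Rightarrow> 'w) \<Rightarrow> 'w measure \<Rightarrow> 'w measure" where
  "filt_minf P T F0 = sigma (space P) (\<Inter>i. sets (filt P T F0 i))"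

definition filt_inf :: "'w measure \<Rightarrow> ('w \<Rightarrow> 'w) \<Rightarrow> 'w measure \<Rightarrow> 'w measure" where
  "filt_inf P T F0 = sigma (space P) (\<Union>i. sets (filt P T F0 i))"

definition P0 :: "'w measure \<Rightarrow> ('w \<Rightarrow> 'w) \<Rightarrow> 'w measure \<Rightarrow> ('w \<Rightarrow> real) \<Rightarrow> 'w \<Rightarrow> real" where
  "P0 P T F0 Y \<omega> = real_cond_exp P F0 Y \<omega> - real_cond_exp P (filt P T F0 (-1)) Y \<omega>"

text \<open>\<open>real_cond_exp\<close> selects, for each \<open>t\<close> separately, some version of the conditional expectation;
  \<open>t \<mapsto> P0 P T F0 (\<lambda>\<omega>. X \<omega> t)\<close> is an \<open>L\<^sup>1(\<mu>)\<close>-valued variable only after passing to a jointly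
  measurable version \<open>D\<close>, which is determined up to a null set of \<open>P \<Otimes>\<^sub>M mu\<close>.\<close>

definition L1_version_P0 :: "'w measure \<Rightarrow> 't measure \<Rightarrow> ('w \<Rightarrow> 'w) \<Rightarrow> 'w measure \<Rightarrow>
    ('w \<Rightarrow> 't \<Rightarrow> real) \<Rightarrow> ('w \<Rightarrow> 't \<Rightarrow> real) \<Rightarrow> bool" where
  "L1_version_P0 P mu T F0 X D \<longleftrightarrow> L1_random_variable P mu D \<and>
     (AE t in mu. AE \<omega> in P. D \<omega> t = P0 P T F0 (\<lambda>\<omega>'. X \<omega>' t) \<omega>)"

end

theory Submission
 imports Defs
begin

text \<open>The norm \<open>\<integral> \<parallel>Y(t)\<parallel>\<^sub>2 \<mu>(dt)\<close> dominates \<open>E \<parallel>Y\<parallel>\<^sub>1\<close> and can be computed from second moments for each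
 \<open>t\<close>. Since \<open>X\<^sub>0 = \<Sum>\<^sub>k P\<^sub>0(X\<^sub>k) \<circ> T\<^sup>-\<^sup>k\<close>, the partial sums of \<open>X\<close> differ in this norm by \<open>o(\<surd>n)\<close> from those of the
 stationary martingale difference sequence generated by \<open>S = \<Sum>\<^sub>k P\<^sub>0(X\<^sub>k)\<close>.

 Applying \<open>f \<in> L\<^sup>\<infinity>\<close> gives real martingale differences, for which a central limit theorem with variance
 \<open>E f(S)\<^sup>2\<close> is proved by characteristic functions. Only the sequence \<open>f(X\<^sub>k)\<close> is known to be ergodic, so the
 conditional variances are averaged by means of the block sums of \<open>f(X\<^sub>k)\<close>.

 There are countably many \<open>f\<^sub>j \<in> L\<^sup>\<infinity>\<close> such that \<open>e\<^sub>j = f\<^sub>j(S)\<close> is orthonormal (up to zeros) and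
 \<open>S(t) = \<Sum>\<^sub>j c\<^sub>j(t) e\<^sub>j\<close> with \<open>c\<^sub>j(t) = E(e\<^sub>j S(t))\<close>, convergent in the mixed norm. The finite-rank maps
 \<open>x \<mapsto> \<Sum>j<m. f\<^sub>j(x) c\<^sub>j\<close> approximate the normalised martingale uniformly in \<open>n\<close>, which replaces tightness; replacing
 \<open>e\<^sub>j\<close> by independent standard normal variables gives the limit \<open>G\<close>.\<close>

text \<open>Measurability shapes much of the proof. \<open>real_cond_exp\<close> picks a version for
  each t separately, so the projections must be replaced by versions measurable in both variables
  before they can be summed or integrated over t. Since mu is only sigma-finite, L1(mu) need not be
  separable; wherever separability is used it comes from joint measurability, which confines the
  sections to a separable set.

  The error o(sqrt n) is an orthogonality count. The sums over i \<le> n of P0(X_k) at the times i -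
  k and i share all but min(n,|k|) terms on each side, so they differ by at most 2 sqrt(min(n,|k|))
  times the mixed norm of P0(X_k); dominated convergence in k does the rest.

  The e_j have to be functionals f_j(S) with bounded f_j. Joint limits are known only through
  functionals, and x -> sum f_j(x) c_j is then a bounded operator on L1(mu) that commutes with sums
  along the orbit. What it leaves of S is again a martingale difference, so the normalised sums of
  the remainder have, for every n, at most the mixed norm of a single term.\<close>

text \<open>The same names without prefix denote facts on the gauge integral.\<close>

lemmas Bintegrable_add = Bochner_Integration.integrable_add
 and Bintegrable_bound = Bochner_Integration.integrable_bound
 and Bintegrable_cong = Bochner_Integration.integrable_cong
 and Bintegrable_diff = Bochner_Integration.integrable_diff
 and Bintegrable_sum = Bochner_Integration.integrable_sum
 and Bintegral_add = Bochner_Integration.integral_add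
 and Bintegral_cong = Bochner_Integration.integral_cong
 and Bintegral_diff = Bochner_Integration.integral_diff
 and Bintegral_sum = Bochner_Integration.integral_sum

abbreviation bmeas :: "'a measure => ('a => 'b::topological_space) => bool" where
 "bmeas M f \<equiv> f \<in> borel_measurable M"

abbreviation counting :: "'a measure" where "counting \<equiv> count_space UNIV"

abbreviation joint_meas :: "'a measure => 'b measure => ('a => 'b => 'c::topological_space) => bool" where
 "joint_meas M N Y \<equiv> (%(x, t). Y x t) \<in> borel_measurable (M \<Otimes>\<^sub>M N)"

abbreviation null_seq :: "(nat => 'a::{topological_space,zero}) => bool" where
 "null_seq X \<equiv> X \<longlonglongrightarrow> 0"

abbreviation dL1 :: "'a measure => ('a => real) => ('a => real) => real" where
 "dL1 M x y \<equiv> LINT t|M. \<bar>x t - y t\<bar>"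

section \<open>Square-integrable functions and the mixed norm\<close>

definition L2fun :: "'a measure => ('a => real) => bool" where
 "L2fun M Y \<longleftrightarrow> Y \<in> borel_measurable M \<and> integrable M (%x. (Y x)\<^sup>2)"

text \<open>The Bochner integral has the value 0 when the square is not integrable, so
  \<open>nrm\<close> is informative only together with \<open>L2fun\<close>. The extended-valued
  \<open>norm2\<close> takes over where finiteness is not known beforehand.\<close>

definition nrm :: "'a measure => ('a => real) => real" where
 "nrm M Y = sqrt (LINT x|M. (Y x)\<^sup>2)"

lemma L2fun_measurable [measurable_dest]: "L2fun M Y ==> Y \<in> borel_measurable M"
 by (simp add: L2fun_def)

lemma L2fun_square: "L2fun M Y ==> integrable M (%x. (Y x)\<^sup>2)"
 by (simp add: L2fun_def)

lemma nrm_nonneg [simp]: "0 \<le> nrm M Y"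
 by (simp add: nrm_def)

lemma nrm_power2: "(nrm M Y)\<^sup>2 = (LINT x|M. (Y x)\<^sup>2)"
 by (simp add: nrm_def)

lemma L2fun_mult_integrable:
 assumes "L2fun M Y" "L2fun M Z"
 shows "integrable M (%x. Y x * Z x)"
proof (rule Bintegrable_bound)
 show "integrable M (%x. (Y x)\<^sup>2 + (Z x)\<^sup>2)"
  using assms by (auto intro: L2fun_square)
 show "bmeas M (%x. Y x * Z x)"
  using assms[THEN L2fun_measurable] by measurable
 have "\<bar>a * b\<bar> \<le> a\<^sup>2 + b\<^sup>2" for a b :: real
 proof -
  have "0 \<le> (\<bar>a\<bar> - \<bar>b\<bar>)\<^sup>2" by simp
  then have "2 * (\<bar>a\<bar> * \<bar>b\<bar>) \<le> a\<^sup>2 + b\<^sup>2" by (simp add: power2_eq_square algebra_simps)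
  moreover have "0 \<le> \<bar>a\<bar> * \<bar>b\<bar>" by simp
  ultimately show ?thesis unfolding abs_mult by linarith
 qed
 then show "AE x in M. norm (Y x * Z x) \<le> norm ((Y x)\<^sup>2 + (Z x)\<^sup>2)" by simp
qed

lemma L2fun_add: "L2fun M Y ==> L2fun M Z ==> L2fun M (%x. Y x + Z x)"
 using L2fun_mult_integrable[of M Y Z]
 by (auto simp: L2fun_def power2_sum mult.assoc)

lemma L2fun_cmult: "L2fun M Y ==> L2fun M (%x. c * Y x)"
 by (auto simp: L2fun_def power_mult_distrib)

lemma L2fun_uminus: "L2fun M Y ==> L2fun M (%x. - Y x)"
 by (simp add: L2fun_def)

lemma L2fun_diff: "L2fun M Y ==> L2fun M Z ==> L2fun M (%x. Y x - Z x)"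
 using L2fun_add[of M Y "%x. - Z x"] L2fun_uminus by auto

lemma L2fun_zero [simp]: "L2fun M (%x. 0)"
 by (simp add: L2fun_def)

lemma L2fun_sum: "(\<And>i. i \<in> I ==> L2fun M (Y i)) ==> L2fun M (%x. \<Sum>i\<in>I. Y i x)"
 by (induction I rule: infinite_finite_induct) (auto intro: L2fun_add)

lemma nn_integral_power2_finite_iff:
 "Y \<in> borel_measurable M ==> L2fun M Y \<longleftrightarrow> (\<integral>\<^sup>+x. ennreal ((Y x)\<^sup>2) \<partial>M) < \<infinity>"
 by (simp add: L2fun_def integrable_iff_bounded)

lemma L2fun_bound:
 assumes "L2fun M Z" "bmeas M Y" "AE x in M. \<bar>Y x\<bar> \<le> \<bar>Z x\<bar>"
 shows "L2fun M Y"
 unfolding L2fun_def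
proof
 show "integrable M (%x. (Y x)\<^sup>2)"
  using assms(2) by (intro Bintegrable_bound[OF L2fun_square[OF assms(1)]])
   (use assms(3) in \<open>auto elim!: eventually_mono simp: abs_le_square_iff\<close>)
qed fact

lemma (in finite_measure) L2fun_const: "L2fun M (%x. c)"
 by (simp add: L2fun_def)

lemma (in finite_measure) L2fun_integrable: "L2fun M Y ==> integrable M Y"
 using L2fun_mult_integrable[OF _ L2fun_const[of 1]] by auto

lemma nrm_ennreal: "L2fun M Y ==> (\<integral>\<^sup>+x. ennreal ((Y x)\<^sup>2) \<partial>M) = ennreal ((nrm M Y)\<^sup>2)"
 by (simp add: nrm_power2 nn_integral_eq_integral L2fun_square)

lemma L2fun_CS_abs:
 assumes "L2fun M Y" "L2fun M Z"
 shows "(LINT x|M. \<bar>Y x * Z x\<bar>) \<le> nrm M Y * nrm M Z"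
proof -
 have [measurable]: "bmeas M Y" "bmeas M Z"
  using assms by (auto dest: L2fun_measurable)
 have i: "integrable M (%x. \<bar>Y x * Z x\<bar>)" using L2fun_mult_integrable[OF assms] by simp
 have "(ennreal (LINT x|M. \<bar>Y x * Z x\<bar>))\<^sup>2 = (\<integral>\<^sup>+x. ennreal \<bar>Y x * Z x\<bar> \<partial>M)\<^sup>2"
  using nn_integral_eq_integral[OF i] by simp
 also have "... = (\<integral>\<^sup>+x. ennreal \<bar>Y x\<bar> * ennreal \<bar>Z x\<bar> \<partial>M)\<^sup>2"
  by (simp add: abs_mult ennreal_mult)
 also have "... \<le> (\<integral>\<^sup>+x. (ennreal \<bar>Y x\<bar>)\<^sup>2 \<partial>M) * (\<integral>\<^sup>+x. (ennreal \<bar>Z x\<bar>)\<^sup>2 \<partial>M)"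
  by (rule Cauchy_Schwarz_nn_integral) measurable
 also have "... = ennreal ((nrm M Y)\<^sup>2) * ennreal ((nrm M Z)\<^sup>2)"
  by (simp add: ennreal_power nrm_ennreal[OF assms(1)] nrm_ennreal[OF assms(2)])
 finally have "(LINT x|M. \<bar>Y x * Z x\<bar>)\<^sup>2 \<le> (nrm M Y * nrm M Z)\<^sup>2"
  by (simp add: ennreal_power ennreal_mult[symmetric] power_mult_distrib)
 then show ?thesis by (rule power2_le_imp_le) simp
qed

lemma L2fun_CS:
 assumes "L2fun M Y" "L2fun M Z"
 shows "\<bar>\<integral>x. Y x * Z x \<partial>M\<bar> \<le> nrm M Y * nrm M Z"
 by (rule order_trans[OF integral_abs_bound L2fun_CS_abs[OF assms]])

lemma nrm_power2_add:
 assumes "L2fun M Y" "L2fun M Z"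
 shows "(nrm M (%x. Y x + Z x))\<^sup>2 = (nrm M Y)\<^sup>2 + (nrm M Z)\<^sup>2 + 2 * (LINT x|M. Y x * Z x)"
 using L2fun_mult_integrable[OF assms] assms[THEN L2fun_square]
 by (simp add: nrm_power2 power2_sum mult.assoc)

lemma nrm_uminus [simp]: "nrm M (%x. - Y x) = nrm M Y"
 by (simp add: nrm_def)

lemma nrm_zero [simp]: "nrm M (%x. 0) = 0"
 by (simp add: nrm_def)

lemma nrm_power2_diff:
 assumes "L2fun M Y" "L2fun M Z"
 shows "(nrm M (%x. Y x - Z x))\<^sup>2 = (nrm M Y)\<^sup>2 + (nrm M Z)\<^sup>2 - 2 * (LINT x|M. Y x * Z x)"
 using nrm_power2_add[OF assms(1) L2fun_uminus[OF assms(2)]] by simp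

lemma nrm_triangle:
 assumes "L2fun M Y" "L2fun M Z"
 shows "nrm M (%x. Y x + Z x) \<le> nrm M Y + nrm M Z"
proof (rule power2_le_imp_le)
 show "(nrm M (%x. Y x + Z x))\<^sup>2 \<le> (nrm M Y + nrm M Z)\<^sup>2"
  using L2fun_CS[OF assms] by (simp add: nrm_power2_add[OF assms] power2_sum)
qed simp

lemma nrm_triangle_diff:
 assumes "L2fun M Y" "L2fun M Z"
 shows "nrm M (%x. Y x - Z x) \<le> nrm M Y + nrm M Z"
 using nrm_triangle[OF assms(1) L2fun_uminus[OF assms(2)]] by simp

lemma nrm_triangle3:
 assumes "L2fun M X" "L2fun M Y" "L2fun M Z"
 shows "nrm M (%x. X x - Z x) \<le> nrm M (%x. X x - Y x) + nrm M (%x. Y x - Z x)"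
 using nrm_triangle[OF L2fun_diff[OF assms(1,2)] L2fun_diff[OF assms(2,3)]] by simp

lemma nrm_commute: "nrm M (%x. Y x - Z x) = nrm M (%x. Z x - Y x)"
 by (simp add: nrm_def power2_commute)

lemma nrm_abs_diff_le:
 assumes "L2fun M Y" "L2fun M Z"
 shows "\<bar>nrm M Y - nrm M Z\<bar> \<le> nrm M (%x. Y x - Z x)"
 using nrm_triangle3[OF assms(1,2) L2fun_zero] nrm_triangle3[OF assms(2,1) L2fun_zero]
 by (simp add: nrm_commute[of M Z Y])

lemma nrm_cmult: "nrm M (%x. c * Y x) = \<bar>c\<bar> * nrm M Y"
 by (simp add: nrm_def power_mult_distrib real_sqrt_mult)

lemma nrm_cong_AE:
 assumes "AE x in M. Y x = Z x" "bmeas M Y" "bmeas M Z"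
 shows "nrm M Y = nrm M Z"
proof -
 have "(LINT x|M. (Y x)\<^sup>2) = (LINT x|M. (Z x)\<^sup>2)"
  by (rule integral_cong_AE) (use assms in auto)
 then show ?thesis by (simp add: nrm_def)
qed

lemma L2fun_cong_AE:
 assumes "AE x in M. Y x = Z x" "L2fun M Y" "bmeas M Z"
 shows "L2fun M Z"
 by (rule L2fun_bound[OF assms(2,3)]) (use assms(1) in auto)

lemma nrm_mono:
 assumes "L2fun M Z" "bmeas M Y" "AE x in M. \<bar>Y x\<bar> \<le> \<bar>Z x\<bar>"
 shows "nrm M Y \<le> nrm M Z"
 unfolding nrm_def
 by (rule real_sqrt_le_mono, rule integral_mono_AE)
  (use assms L2fun_bound[OF assms] in \<open>auto simp: L2fun_square abs_le_square_iff\<close>)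

lemma (in prob_space) L2fun_norm1_le: "L2fun M Y ==> (LINT x|M. \<bar>Y x\<bar>) \<le> nrm M Y"
 using L2fun_CS_abs[of M Y "%_. 1"] by (simp add: L2fun_const nrm_def[of M "%_. 1"] prob_space)

lemma nrm_eq_0_AE:
 assumes "L2fun M Y" "nrm M Y = 0" shows "AE x in M. Y x = 0"
proof -
 have "(LINT x|M. (Y x)\<^sup>2) = 0" using assms(2) nrm_power2[of M Y] by simp
 then have "AE x in M. (Y x)\<^sup>2 = 0"
  using integral_nonneg_eq_0_iff_AE[OF L2fun_square[OF assms(1)]] by simp
 then show ?thesis by simp
qed

section \<open>The extended-valued norm\<close>

lemma norm2_L2: "L2fun M Y ==> norm2 M Y = ennreal (nrm M Y)"
 by (simp add: norm2_def L2fun_def nrm_def)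

lemma norm2_not_L2: "Y \<in> borel_measurable M ==> \<not> L2fun M Y ==> norm2 M Y = \<infinity>"
 by (simp add: norm2_def L2fun_def)

lemma norm2_finite_iff: "Y \<in> borel_measurable M ==> norm2 M Y < \<infinity> \<longleftrightarrow> L2fun M Y"
 by (simp add: norm2_def L2fun_def)

text \<open>Both branches of \<open>norm2\<close> square to the nonnegative integral of the square;
  from here on inequalities can be proved for nonnegative integrals without asking for square
  integrability.\<close>

lemma norm2_power2:
 assumes "bmeas M Y"
 shows "(norm2 M Y)\<^sup>2 = (\<integral>\<^sup>+x. ennreal ((Y x)\<^sup>2) \<partial>M)"
proof (cases "L2fun M Y")
 case True
 then show ?thesis by (simp add: norm2_L2 nrm_ennreal ennreal_power)
next
 case False
 then show ?thesis
  using nn_integral_power2_finite_iff[OF assms] by (simp add: norm2_not_L2 assms top_unique not_less)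
qed

lemma ennreal_power2_le_imp_le: "a\<^sup>2 \<le> b\<^sup>2 ==> a \<le> (b::ennreal)"
proof (rule ccontr)
 assume ab: "a\<^sup>2 \<le> b\<^sup>2" "\<not> a \<le> b"
 then have ba: "b < a" by simp
 have fin: "b < \<infinity>" using less_le_trans[OF ba top_greatest] by simp
 show False
 proof (cases "a = \<infinity>")
  case True
  then show ?thesis using ab(1) fin
   by (simp add: power2_eq_square ennreal_mult_eq_top_iff top_unique)
 next
  case False
  then obtain x y where "a = ennreal x" "0 \<le> x" "b = ennreal y" "0 \<le> y"
   using fin by (metis ennreal_cases infinity_ennreal_def less_irrefl)
  then show ?thesis using ab ba
   by (simp add: ennreal_power)
 qed
qed

lemma norm2_mono:
 assumes "bmeas M Z" "bmeas M Y" "AE x in M. \<bar>Y x\<bar> \<le> \<bar>Z x\<bar>"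
 shows "norm2 M Y \<le> norm2 M Z"
 using assms by (cases "L2fun M Z")
  (auto simp: norm2_L2 norm2_not_L2 nrm_mono L2fun_bound)

lemma norm2_cong_AE:
 assumes "AE x in M. Y x = Z x" "bmeas M Z" "bmeas M Y"
 shows "norm2 M Y = norm2 M Z"
 by (rule antisym; rule norm2_mono) (use assms in auto)

lemma norm2_triangle:
 assumes "bmeas M Z" "bmeas M Y"
 shows "norm2 M (%x. Y x + Z x) \<le> norm2 M Y + norm2 M Z"
proof (cases "L2fun M Y \<and> L2fun M Z")
 case True
 then show ?thesis
  by (simp add: norm2_L2 L2fun_add ennreal_plus[symmetric] nrm_triangle del: ennreal_plus)
qed (auto simp: norm2_not_L2 assms)

lemma norm2_cmult:
 assumes "bmeas M Y"
 shows "norm2 M (%x. c * Y x) = ennreal \<bar>c\<bar> * norm2 M Y"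
proof (cases "L2fun M Y")
 case True
 then show ?thesis by (simp add: norm2_L2 L2fun_cmult nrm_cmult ennreal_mult)
next
 case False
 show ?thesis
 proof (cases "c = 0")
  case True
  then show ?thesis by (simp add: norm2_def)
 next
  case c: False
  then have "\<not> L2fun M (%x. c * Y x)"
   using False L2fun_cmult[of M "%x. c * Y x" "1 / c"] by auto
  then show ?thesis using False c assms
   by (simp add: norm2_not_L2 ennreal_mult_top)
 qed
qed

lemma norm2_uminus [simp]: "norm2 M (%x. - Y x) = norm2 M Y"
 by (simp add: norm2_def)

lemma norm2_zero [simp]: "norm2 M (%x. 0) = 0"
 by (simp add: norm2_def)

lemma norm2_triangle_diff:
 assumes "bmeas M Z" "bmeas M Y"
 shows "norm2 M (%x. Y x - Z x) \<le> norm2 M Y + norm2 M Z"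
 using norm2_triangle[of "%x. - Z x" M Y] assms by simp

lemma norm2_sum_le:
 "(\<And>i. i \<in> I ==> Y i \<in> borel_measurable M) ==>
  norm2 M (%x. \<Sum>i\<in>I. Y i x) \<le> (\<Sum>i\<in>I. norm2 M (Y i))"
proof (induction I rule: infinite_finite_induct)
 case (insert i I)
 have "norm2 M (%x. Y i x + (\<Sum>i\<in>I. Y i x)) \<le> norm2 M (Y i) + norm2 M (%x. \<Sum>i\<in>I. Y i x)"
  using insert by (intro norm2_triangle) auto
 then show ?case using insert by (force intro: order_trans add_left_mono)
qed auto

lemma norm2_CS:
 assumes [measurable]: "bmeas M Y" "bmeas M Z"
 shows "(\<integral>\<^sup>+x. ennreal \<bar>Y x\<bar> * ennreal \<bar>Z x\<bar> \<partial>M) \<le> norm2 M Y * norm2 M Z"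
proof (rule ennreal_power2_le_imp_le)
 have "(\<integral>\<^sup>+x. ennreal \<bar>Y x\<bar> * ennreal \<bar>Z x\<bar> \<partial>M)\<^sup>2
   \<le> (\<integral>\<^sup>+x. (ennreal \<bar>Y x\<bar>)\<^sup>2 \<partial>M) * (\<integral>\<^sup>+x. (ennreal \<bar>Z x\<bar>)\<^sup>2 \<partial>M)"
  by (rule Cauchy_Schwarz_nn_integral) measurable
 also have "... = (norm2 M Y * norm2 M Z)\<^sup>2"
  by (simp add: ennreal_power norm2_power2 power_mult_distrib)
 finally show "(\<integral>\<^sup>+x. ennreal \<bar>Y x\<bar> * ennreal \<bar>Z x\<bar> \<partial>M)\<^sup>2 \<le> (norm2 M Y * norm2 M Z)\<^sup>2" .
qed

lemma (in prob_space) norm1_le_norm2: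
 assumes "bmeas M Y"
 shows "(\<integral>\<^sup>+x. ennreal \<bar>Y x\<bar> \<partial>M) \<le> norm2 M Y"
 using norm2_CS[OF assms, of "%_. 1"] by (simp add: norm2_L2 L2fun_const nrm_def prob_space)

text \<open>Replaces the Bochner integral and the integrability test by one nonnegative integral,
  whose measurability in a parameter is part of Fubini's theorem.\<close>

lemma norm2_alt: "Y \<in> borel_measurable M ==>
  norm2 M Y = (if (\<integral>\<^sup>+x. ennreal ((Y x)\<^sup>2) \<partial>M) < \<infinity>
   then ennreal (sqrt (enn2real (\<integral>\<^sup>+x. ennreal ((Y x)\<^sup>2) \<partial>M))) else \<infinity>)"
 using nn_integral_power2_finite_iff[of Y M]
 by (cases "L2fun M Y") (simp_all add: norm2_L2 norm2_not_L2 nrm_ennreal)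

lemma (in sigma_finite_measure) norm2_measurable:
 assumes [measurable]: "joint_meas M N Y"
 shows "bmeas N (%t. norm2 M (%x. Y x t))"
proof -
 have "joint_meas N M (%t x. Y x t)"
  using measurable_pair_swap[OF assms] by (simp add: case_prod_unfold)
 then have [measurable]: "bmeas N (%t. \<integral>\<^sup>+x. ennreal ((Y x t)\<^sup>2) \<partial>M)"
  by (intro borel_measurable_nn_integral) (simp add: case_prod_unfold)
 have "(%t. if (\<integral>\<^sup>+x. ennreal ((Y x t)\<^sup>2) \<partial>M) < \<infinity>
   then ennreal (sqrt (enn2real (\<integral>\<^sup>+x. ennreal ((Y x t)\<^sup>2) \<partial>M))) else \<infinity>) \<in> borel_measurable N"
  by measurable
 then show ?thesis
  by (rule measurable_cong[THEN iffD2, rotated]) (rule norm2_alt, measurable)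
qed

text \<open>Minkowski's integral inequality for exponent two: the square of the inner integral is a
  double integral in s and t, the integration over x is moved inside, and Cauchy-Schwarz bounds each
  mixed product. Where a section is not integrable, its Bochner integral is 0 and the bound
  persists.\<close>

lemma norm2_integral_le:
 fixes Y :: "'a => 'b => real"
 assumes "sigma_finite_measure M" "sigma_finite_measure N"
  and [measurable]: "joint_meas M N Y"
 shows "norm2 M (%x. \<integral>t. Y x t \<partial>N) \<le> (\<integral>\<^sup>+t. norm2 M (%x. Y x t) \<partial>N)"
proof (rule ennreal_power2_le_imp_le)
 interpret M: sigma_finite_measure M by fact
 interpret N: sigma_finite_measure N by fact
 interpret pair_sigma_finite M N ..
 have sw [measurable]: "joint_meas N M (%t x. Y x t)"
  using measurable_pair_swap[OF assms(3)] by (simp add: case_prod_unfold)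
 note [measurable] = M.norm2_measurable[OF assms(3)]
 let ?g = "%x t. ennreal \<bar>Y x t\<bar>" and ?n = "%t. norm2 M (%x. Y x t)"
 have "(norm2 M (%x. \<integral>t. Y x t \<partial>N))\<^sup>2 = (\<integral>\<^sup>+x. ennreal ((LINT t|N. Y x t)\<^sup>2) \<partial>M)"
  by (rule norm2_power2) measurable
 also have "... \<le> (\<integral>\<^sup>+x. (\<integral>\<^sup>+t. ?g x t \<partial>N)\<^sup>2 \<partial>M)"
 proof (rule nn_integral_mono)
  fix x assume "x \<in> space M"
  have "ennreal \<bar>\<integral>t. Y x t \<partial>N\<bar> \<le> (\<integral>\<^sup>+t. ?g x t \<partial>N)"
   using integral_norm_bound_ennreal[of N "Y x"]
   by (cases "integrable N (Y x)") (auto simp: not_integrable_integral_eq)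
  then show "ennreal ((LINT t|N. Y x t)\<^sup>2) \<le> (\<integral>\<^sup>+t. ?g x t \<partial>N)\<^sup>2"
   using power_mono[of "ennreal \<bar>\<integral>t. Y x t \<partial>N\<bar>" _ 2] by (simp add: ennreal_power)
 qed
 also have "... = (\<integral>\<^sup>+x. \<integral>\<^sup>+s. \<integral>\<^sup>+t. ?g x s * ?g x t \<partial>N \<partial>N \<partial>M)"
  by (intro nn_integral_cong)
   (simp add: power2_eq_square nn_integral_cmult nn_integral_multc)
 also have "... = (\<integral>\<^sup>+s. \<integral>\<^sup>+x. \<integral>\<^sup>+t. ?g x s * ?g x t \<partial>N \<partial>M \<partial>N)"
  by (rule Fubini'[symmetric]) measurable
 also have "... = (\<integral>\<^sup>+s. \<integral>\<^sup>+t. \<integral>\<^sup>+x. ?g x s * ?g x t \<partial>M \<partial>N \<partial>N)"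
  by (intro nn_integral_cong Fubini'[symmetric]) measurable
 also have "... \<le> (\<integral>\<^sup>+s. \<integral>\<^sup>+t. ?n s * ?n t \<partial>N \<partial>N)"
  by (intro nn_integral_mono norm2_CS) measurable
 also have "... = (\<integral>\<^sup>+t. ?n t \<partial>N)\<^sup>2"
  by (simp add: power2_eq_square nn_integral_cmult nn_integral_multc)
 finally show "(norm2 M (%x. \<integral>t. Y x t \<partial>N))\<^sup>2 \<le> (\<integral>\<^sup>+t. ?n t \<partial>N)\<^sup>2" .
qed

section \<open>Jointly measurable versions\<close>

text \<open>Dynkin class argument. On a rectangle A x B the version is a conditional expectation of
  the indicator of A times the indicator of B; complements and disjoint unions are handled by
  additivity. The exceptional null set may depend on t.\<close>

lemma joint_nn_cond_exp_set:
 assumes "sigma_finite_subalgebra P F" "E \<in> sets (P \<Otimes>\<^sub>M mu)"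
 shows "\<exists>Y\<in>borel_measurable (F \<Otimes>\<^sub>M mu). \<forall>t\<in>space mu.
  AE w in P. Y (w, t) = nn_cond_exp P F (%w. indicator E (w, t)) w"
proof -
 interpret sigma_finite_subalgebra P F by fact
 have sp: "space F = space P" using subalg by (simp add: subalgebra_def)
 have E: "E \<in> sigma_sets (space P \<times> space mu) {a \<times> b |a b. a \<in> sets P \<and> b \<in> sets mu}"
  using assms(2) by (simp add: sets_pair_measure)
 have sub: "{a \<times> b |a b. a \<in> sets P \<and> b \<in> sets mu} \<subseteq> Pow (space P \<times> space mu)"
  by (rule pair_measure_closed)
 show ?thesis
  using Int_stable_pair_measure_generator[of P mu] sub E
 proof (induction rule: sigma_sets_induct_disjoint)
  case (basic E)
  then obtain A B where E: "E = A \<times> B" and [measurable]: "A \<in> sets P" "B \<in> sets mu" by auto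
  let ?Y = "%(w, t). nn_cond_exp P F (indicator A) w * indicator B t"
  have "bmeas (F \<Otimes>\<^sub>M mu) ?Y" by measurable
  moreover have "AE w in P. ?Y (w, t) = nn_cond_exp P F (%w. indicator E (w, t)) w" for t
  proof -
   have "AE w in P. indicator B t * nn_cond_exp P F (indicator A) w
     = nn_cond_exp P F (%w. indicator B t * indicator A w) w"
    by (rule nn_cond_exp_prod) measurable
   then show ?thesis by (simp add: E indicator_times mult.commute)
  qed
  ultimately show ?case by blast
 next
  case empty
  have "AE w in P. 0 = nn_cond_exp P F (%w. 0) w" by (rule nn_cond_exp_F_meas) auto
  then show ?case by (intro bexI[of _ "%_. 0"]) auto
 next
  case (compl E)
  then have E: "E \<in> sets (P \<Otimes>\<^sub>M mu)" by (simp add: sets_pair_measure)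
  from compl obtain Y where [measurable]: "bmeas (F \<Otimes>\<^sub>M mu) Y"
   and Y: "\<And>t. t \<in> space mu ==> AE w in P. Y (w, t) = nn_cond_exp P F (%w. indicator E (w, t)) w"
   by blast
  let ?E = "space P \<times> space mu - E"
  have "AE w in P. 1 - Y (w, t) = nn_cond_exp P F (%w. indicator ?E (w, t)) w"
   if t: "t \<in> space mu" for t
  proof -
   have m1 [measurable]: "bmeas P (%w. indicator E (w, t) :: ennreal)"
    using E t by (intro measurable_compose[OF measurable_Pair2'[OF t]]) auto
   have "?E \<in> sets (P \<Otimes>\<^sub>M mu)"
    using E by (metis space_pair_measure sets.compl_sets)
   then have m2 [measurable]: "bmeas P (%w. indicator ?E (w, t) :: ennreal)"
    using t by (intro measurable_compose[OF measurable_Pair2'[OF t]]) auto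
   have "AE w in P. nn_cond_exp P F (%w. indicator E (w, t)) w
     + nn_cond_exp P F (%w. indicator ?E (w, t)) w
     = nn_cond_exp P F (%w. indicator E (w, t) + indicator ?E (w, t)) w"
    by (rule nn_cond_exp_sum) measurable
   moreover have "AE w in P. nn_cond_exp P F (%w. indicator E (w, t) + indicator ?E (w, t)) w
     = nn_cond_exp P F (%w. 1) w"
   proof (rule nn_cond_exp_cong)
    show "AE w in P. indicator E (w, t) + indicator ?E (w, t) = (1::ennreal)"
     using t by (auto simp: indicator_def)
   qed measurable
   moreover have "AE w in P. 1 = nn_cond_exp P F (%w. 1) w"
    by (rule nn_cond_exp_F_meas) auto
   ultimately show ?thesis using Y[OF t]
   proof eventually_elim
    case (elim w)
    then have *: "Y (w, t) + nn_cond_exp P F (%w. indicator ?E (w, t)) w = 1" by simp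
    \<comment> \<open>Finiteness comes first, because cancellation by subtraction fails at
      infinity.\<close>
    then have "Y (w, t) \<noteq> top" by auto
    then show ?case using * ennreal_add_diff_cancel_left[of "Y (w, t)" "nn_cond_exp P F (%w. indicator ?E (w, t)) w"]
     by simp
   qed
  qed
  then show ?case by (intro bexI[of _ "%x. 1 - Y x"]) auto
 next
  case (union E)
  then have E: "E i \<in> sets (P \<Otimes>\<^sub>M mu)" for i by (auto simp: sets_pair_measure)
  have "\<exists>Y. \<forall>i. Y i \<in> borel_measurable (F \<Otimes>\<^sub>M mu) \<and> (\<forall>t\<in>space mu.
    AE w in P. Y i (w, t) = nn_cond_exp P F (%w. indicator (E i) (w, t)) w)"
   by (rule choice) (use union(3) in blast)
  then obtain Y where [measurable]: "\<And>i. Y i \<in> borel_measurable (F \<Otimes>\<^sub>M mu)"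
   and Y: "\<And>i t. t \<in> space mu ==> AE w in P. Y i (w, t) = nn_cond_exp P F (%w. indicator (E i) (w, t)) w"
   by blast
  have "AE w in P. (\<Sum>i. Y i (w, t)) = nn_cond_exp P F (%w. indicator (\<Union>i. E i) (w, t)) w"
   if t: "t \<in> space mu" for t
  proof (rule nn_cond_exp_charact)
   have [measurable]: "bmeas P (%w. indicator (E i) (w, t) :: ennreal)" for i
    using E t by (intro measurable_compose[OF measurable_Pair2'[OF t]]) auto
   have sw: "(\<Sum>i. indicator (E i) (w, t)) = (indicator (\<Union>i. E i) (w, t) :: ennreal)" for w
    using union(1) by (rule suminf_indicator)
   show [measurable]: "bmeas P (%w. indicator (\<Union>i. E i) (w, t) :: ennreal)"
    unfolding sw[symmetric] by measurable
   show "bmeas F (%w. \<Sum>i. Y i (w, t))"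
    using t by measurable
   fix A assume A: "A \<in> sets F"
   then have [measurable]: "A \<in> sets P" using subalg by (auto simp: subalgebra_def)
   have [measurable]: "bmeas P (%w. Y i (w, t))" for i
    by (rule measurable_from_subalg[OF subalg]) (use t in measurable)
   have Y': "AE w in P. indicator A w * nn_cond_exp P F (%w. indicator (E i) (w, t)) w = indicator A w * Y i (w, t)" for i
    using Y[OF t, of i] by eventually_elim simp
   have "(\<integral>\<^sup>+w\<in>A. indicator (\<Union>i. E i) (w, t) \<partial>P) = (\<integral>\<^sup>+w. (\<Sum>i. indicator A w * indicator (E i) (w, t)) \<partial>P)"
    by (intro nn_integral_cong) (simp add: sw[symmetric] mult.commute)
   also have "... = (\<Sum>i. \<integral>\<^sup>+w. indicator A w * indicator (E i) (w, t) \<partial>P)"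
    by (rule nn_integral_suminf) measurable
   also have "... = (\<Sum>i. \<integral>\<^sup>+w. indicator A w * nn_cond_exp P F (%w. indicator (E i) (w, t)) w \<partial>P)"
    by (intro suminf_cong nn_cond_exp_intg[symmetric]) (use A in auto)
   also have "... = (\<Sum>i. \<integral>\<^sup>+w. indicator A w * Y i (w, t) \<partial>P)"
    by (intro suminf_cong nn_integral_cong_AE Y')
   also have "... = (\<integral>\<^sup>+w. (\<Sum>i. indicator A w * Y i (w, t)) \<partial>P)"
    by (rule nn_integral_suminf[symmetric]) measurable
   finally show "(\<integral>\<^sup>+w\<in>A. indicator (\<Union>i. E i) (w, t) \<partial>P) = (\<integral>\<^sup>+w\<in>A. (\<Sum>i. Y i (w, t)) \<partial>P)"
    by (simp add: mult.commute)
  qed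
  then show ?case by (intro bexI[of _ "%x. \<Sum>i. Y i x"]) auto
 qed
qed

text \<open>Extension from indicators to nonnegative functions. In the case of a supremum the chosen
  versions increase only almost surely, separately for each t, so monotone convergence is applied in
  its almost-everywhere form.\<close>

lemma joint_nn_cond_exp:
 assumes "sigma_finite_subalgebra P F" "bmeas (P \<Otimes>\<^sub>M mu) u"
 shows "\<exists>Y\<in>borel_measurable (F \<Otimes>\<^sub>M mu). \<forall>t\<in>space mu.
  AE w in P. Y (w, t) = nn_cond_exp P F (%w. u (w, t)) w"
 using assms(2)
proof (induction rule: borel_measurable_induct)
 case (cong f g)
 interpret sigma_finite_subalgebra P F by fact
 from cong(4) obtain Y where [measurable]: "bmeas (F \<Otimes>\<^sub>M mu) Y"
   and Y: "\<And>t. t \<in> space mu ==> AE w in P. Y (w, t) = nn_cond_exp P F (%w. g (w, t)) w"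
  by blast
 have "AE w in P. Y (w, t) = nn_cond_exp P F (%w. f (w, t)) w" if t: "t \<in> space mu" for t
 proof -
  have "AE w in P. nn_cond_exp P F (%w. f (w, t)) w = nn_cond_exp P F (%w. g (w, t)) w"
   by (rule nn_cond_exp_cong)
    (use cong(1,2) t in \<open>auto simp: cong(3) space_pair_measure intro!: AE_I2\<close>)
  then show ?thesis using Y[OF t] by eventually_elim simp
 qed
 then show ?case by (intro bexI[of _ Y]) simp_all
next
 case (set A)
 show ?case using joint_nn_cond_exp_set[OF assms(1) set] .
next
 case (mult u c)
 interpret sigma_finite_subalgebra P F by fact
 from mult(4) obtain Y where [measurable]: "bmeas (F \<Otimes>\<^sub>M mu) Y"
   and Y: "\<And>t. t \<in> space mu ==> AE w in P. Y (w, t) = nn_cond_exp P F (%w. u (w, t)) w"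
  by blast
 have "AE w in P. c * Y (w, t) = nn_cond_exp P F (%w. c * u (w, t)) w" if t: "t \<in> space mu" for t
 proof -
  have "AE w in P. c * nn_cond_exp P F (%w. u (w, t)) w = nn_cond_exp P F (%w. c * u (w, t)) w"
   by (rule nn_cond_exp_prod) (use mult(2) t in measurable)
  then show ?thesis using Y[OF t] by eventually_elim simp
 qed
 then show ?case by (intro bexI[of _ "%x. c * Y x"]) auto
next
 case (add u v)
 interpret sigma_finite_subalgebra P F by fact
 from add.IH(1) obtain Y where [measurable]: "bmeas (F \<Otimes>\<^sub>M mu) Y"
   and Y: "\<And>t. t \<in> space mu ==> AE w in P. Y (w, t) = nn_cond_exp P F (%w. u (w, t)) w"
  by blast
 from add.IH(2) obtain Z where [measurable]: "bmeas (F \<Otimes>\<^sub>M mu) Z"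
   and Z: "\<And>t. t \<in> space mu ==> AE w in P. Z (w, t) = nn_cond_exp P F (%w. v (w, t)) w"
  by blast
 have "AE w in P. Z (w, t) + Y (w, t) = nn_cond_exp P F (%w. v (w, t) + u (w, t)) w" if t: "t \<in> space mu" for t
 proof -
  have "AE w in P. nn_cond_exp P F (%w. v (w, t)) w + nn_cond_exp P F (%w. u (w, t)) w
    = nn_cond_exp P F (%w. v (w, t) + u (w, t)) w"
   by (rule nn_cond_exp_sum) (use add(1,3) t in measurable)
  then show ?thesis using Y[OF t] Z[OF t] by eventually_elim simp
 qed
 then show ?case by (intro bexI[of _ "%x. Z x + Y x"]) auto
next
 case (seq U)
 interpret sigma_finite_subalgebra P F by fact
 note [measurable] = seq(1)
 have "\<exists>Y. \<forall>i. Y i \<in> borel_measurable (F \<Otimes>\<^sub>M mu) \<and> (\<forall>t\<in>space mu.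
   AE w in P. Y i (w, t) = nn_cond_exp P F (%w. U i (w, t)) w)"
  by (rule choice) (use seq.IH in blast)
 then obtain Y where [measurable]: "\<And>i. Y i \<in> borel_measurable (F \<Otimes>\<^sub>M mu)"
  and Y: "\<And>i t. t \<in> space mu ==> AE w in P. Y i (w, t) = nn_cond_exp P F (%w. U i (w, t)) w"
  by blast
 have "AE w in P. (SUP i. Y i (w, t)) = nn_cond_exp P F (%w. (SUP i. U i) (w, t)) w"
  if t: "t \<in> space mu" for t
 proof (rule nn_cond_exp_charact)
  have [measurable]: "bmeas P (%w. U i (w, t))" for i
   using t by measurable
  show [measurable]: "bmeas P (%w. (SUP i. U i) (w, t))"
   by (simp add: image_comp)
  show "bmeas F (%w. SUP i. Y i (w, t))"
   using t by measurable
  fix A assume A: "A \<in> sets F"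
  then have [measurable]: "A \<in> sets P" using subalg by (auto simp: subalgebra_def)
  have [measurable]: "bmeas P (%w. Y i (w, t))" for i
   by (rule measurable_from_subalg[OF subalg]) (use t in measurable)
  have mono: "AE w in P. Y i (w, t) \<le> Y (Suc i) (w, t)" for i
  proof -
   have "AE w in P. nn_cond_exp P F (%w. U i (w, t)) w \<le> nn_cond_exp P F (%w. U (Suc i) (w, t)) w"
    by (rule nn_cond_exp_mono) (use seq(3) in \<open>auto simp: incseq_Suc_iff le_fun_def\<close>)
   then show ?thesis using Y[OF t, of i] Y[OF t, of "Suc i"] by eventually_elim simp
  qed
  have Y': "AE w in P. indicator A w * nn_cond_exp P F (%w. U i (w, t)) w = indicator A w * Y i (w, t)" for i
    using Y[OF t, of i] by eventually_elim simp
   have mono': "AE w in P. indicator A w * Y i (w, t) \<le> indicator A w * Y (Suc i) (w, t)" for i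
   using mono[of i] by eventually_elim (rule mult_left_mono, auto)
  have "(\<integral>\<^sup>+w\<in>A. (SUP i. U i) (w, t) \<partial>P) = (\<integral>\<^sup>+w. (SUP i. indicator A w * U i (w, t)) \<partial>P)"
   by (intro nn_integral_cong) (simp add: image_comp SUP_mult_left_ennreal mult.commute)
  also have "... = (SUP i. \<integral>\<^sup>+w. indicator A w * U i (w, t) \<partial>P)"
   by (rule nn_integral_monotone_convergence_SUP)
    (use seq(3) in \<open>auto simp: incseq_def le_fun_def intro!: mult_left_mono\<close>)
  also have "... = (SUP i. \<integral>\<^sup>+w. indicator A w * nn_cond_exp P F (%w. U i (w, t)) w \<partial>P)"
   by (intro SUP_cong refl nn_cond_exp_intg[symmetric]) (use A in auto)
  also have "... = (SUP i. \<integral>\<^sup>+w. indicator A w * Y i (w, t) \<partial>P)"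
   by (intro SUP_cong refl nn_integral_cong_AE Y')
  also have "... = (\<integral>\<^sup>+w. (SUP i. indicator A w * Y i (w, t)) \<partial>P)"
   by (rule nn_integral_monotone_convergence_SUP_AE[symmetric])
    (use mono' in auto)
  finally show "(\<integral>\<^sup>+w\<in>A. (SUP i. U i) (w, t) \<partial>P) = (\<integral>\<^sup>+w\<in>A. (SUP i. Y i (w, t)) \<partial>P)"
   by (simp add: SUP_mult_left_ennreal mult.commute)
 qed
 then show ?case by (intro bexI[of _ "%x. SUP i. Y i x"]) auto
qed


text \<open>\<open>real_cond_exp\<close> is defined from the nonnegative conditional expectations of
  the positive and the negative part, so the nonnegative case is applied to each.\<close>

lemma joint_real_cond_exp:
 fixes X :: "'w => 't => real"
 assumes "sigma_finite_subalgebra P F" and [measurable]: "joint_meas P mu X"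
 shows "\<exists>Y. joint_meas F mu Y \<and>
  (\<forall>t\<in>space mu. AE w in P. Y w t = real_cond_exp P F (%w. X w t) w)"
proof -
 obtain U where [measurable]: "bmeas (F \<Otimes>\<^sub>M mu) U"
  and U: "\<And>t. t \<in> space mu ==> AE w in P. U (w, t) = nn_cond_exp P F (%w. (%(w, t). ennreal (X w t)) (w, t)) w"
  using joint_nn_cond_exp[OF assms(1), of "%(w, t). ennreal (X w t)" mu] by auto
 obtain V where [measurable]: "bmeas (F \<Otimes>\<^sub>M mu) V"
  and V: "\<And>t. t \<in> space mu ==> AE w in P. V (w, t) = nn_cond_exp P F (%w. (%(w, t). ennreal (- X w t)) (w, t)) w"
  using joint_nn_cond_exp[OF assms(1), of "%(w, t). ennreal (- X w t)" mu] by auto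
 show ?thesis
 proof (intro exI[of _ "%w t. enn2real (U (w, t)) - enn2real (V (w, t))"] conjI ballI)
  fix t assume "t \<in> space mu"
  from U[OF this] V[OF this]
  show "AE w in P. enn2real (U (w, t)) - enn2real (V (w, t)) = real_cond_exp P F (%w. X w t) w"
   by eventually_elim (simp add: real_cond_exp_def)
 qed measurable
qed

lemma measurable_pair_subalgebra:
 assumes "subalgebra P F" "f \<in> measurable (F \<Otimes>\<^sub>M mu) N"
 shows "f \<in> measurable (P \<Otimes>\<^sub>M mu) N"
proof -
 have "(%x. x) \<in> measurable P F"
  by (rule measurable_from_subalg[OF assms(1)]) simp
 then have "(%x. (fst x, snd x)) \<in> measurable (P \<Otimes>\<^sub>M mu) (F \<Otimes>\<^sub>M mu)"
  by (intro measurable_Pair measurable_compose[OF measurable_fst, of "%x. x"]) auto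
 from measurable_compose[OF this assms(2)] show ?thesis by simp
qed

text \<open>\<open>L1_random_variable\<close> asks for integrable sections at every outcome.
  Sections with infinite integral are replaced by 0; whether this happens is decided by an
  F-measurable integral, so joint measurability with respect to the smaller sigma-field survives.
  The martingale property will need exactly that.\<close>

lemma L1_modification:
 fixes Y :: "'w => 't => real"
 assumes "subalgebra P F" "sigma_finite_measure mu"
  and [measurable]: "joint_meas F mu Y"
  and "AE w in P. (\<integral>\<^sup>+t. ennreal \<bar>Y w t\<bar> \<partial>mu) < \<infinity>"
 shows "\<exists>Z. joint_meas F mu Z \<and> L1_random_variable P mu Z \<and>
  (AE w in P. \<forall>t. Z w t = Y w t)"
proof -
 interpret mu: sigma_finite_measure mu by fact
 have sp: "space F = space P" using assms(1) by (simp add: subalgebra_def)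
 let ?Z = "%w t. if (\<integral>\<^sup>+t. ennreal \<bar>Y w t\<bar> \<partial>mu) < \<infinity> then Y w t else 0"
 have Z: "joint_meas F mu ?Z" by measurable
 have "integrable mu (?Z w)" if "w \<in> space P" for w
 proof -
  have "bmeas mu (%t. Y w t)"
   using measurable_compose[OF measurable_Pair1'[of w F mu] assms(3)] that sp by simp
  then show ?thesis
   by (cases "(\<integral>\<^sup>+t. ennreal \<bar>Y w t\<bar> \<partial>mu) < \<infinity>") (simp_all add: integrable_iff_bounded)
 qed
 moreover have "AE w in P. \<forall>t. ?Z w t = Y w t"
  using assms(4) by eventually_elim simp
 ultimately show ?thesis
  using measurable_pair_subalgebra[OF assms(1) Z] Z
  by (intro exI[of _ ?Z]) (simp add: L1_random_variable_def)
qed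

section \<open>The mixed norm and series convergent in it\<close>

definition mixn :: "'w measure => 't measure => ('w => 't => real) => ennreal" where
 "mixn P mu Y = (\<integral>\<^sup>+t. norm2 P (%w. Y w t) \<partial>mu)"

lemma integrable_count_space_has_sum:
 fixes r :: "'i => real"
 assumes "integrable counting r"
 shows "(r has_sum (LINT k|counting. r k)) UNIV"
proof -
 have a: "Infinite_Set_Sum.abs_summable_on r UNIV"
  using assms by (simp add: Infinite_Set_Sum.abs_summable_on_def)
 then have "r summable_on UNIV"
  using abs_summable_equivalent[of r UNIV] abs_summable_summable by blast
 then show ?thesis
  using infsetsum_infsum[OF a] by (simp add: infsetsum_def has_sum_infsum)
qed

lemma count_space_tail:
 fixes a :: "'i => ennreal"
 assumes "(\<integral>\<^sup>+k. a k \<partial>counting) < \<infinity>"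
 shows "((%K. \<integral>\<^sup>+k. indicator (- K) k * a k \<partial>counting) \<longlongrightarrow> 0) (finite_subsets_at_top UNIV)"
proof -
 define r where "r k = enn2real (a k)" for k
 have fin: "a k < \<infinity>" for k
  using nn_integral_ge_point[of k UNIV a] assms by (simp add: order_le_less_trans)
 then have a: "a k = ennreal (r k)" for k by (simp add: r_def)
 have r0: "0 \<le> r k" for k by (simp add: r_def)
 have int: "integrable counting r"
  using assms r0 by (simp add: integrable_iff_bounded a)
 have int': "integrable counting (%k. indicator K k * r k)" for K
  by (rule Bintegrable_bound[OF int]) (auto simp: indicator_def r0)
 have "(\<integral>\<^sup>+k. indicator (- K) k * a k \<partial>counting) = ennreal ((LINT k|counting. r k) - sum r K)"
  if "finite K" for K
 proof -
  have "(\<integral>\<^sup>+k. indicator (- K) k * a k \<partial>counting)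
    = (\<integral>\<^sup>+k. ennreal (indicator (- K) k * r k) \<partial>counting)"
   by (intro nn_integral_cong) (auto simp: a indicator_def)
  also have "... = ennreal (LINT k|counting. indicator (- K) k * r k)"
   by (rule nn_integral_eq_integral[OF int']) (simp add: r0)
  also have "(LINT k|counting. indicator (- K) k * r k)
    = (LINT k|counting. r k - indicator K k * r k)"
   by (intro Bintegral_cong) (auto simp: indicator_def)
  also have "... = (LINT k|counting. r k) - (LINT k|counting. indicator K k * r k)"
   by (intro Bintegral_diff int int')
  also have "(LINT k|counting. indicator K k * r k) = infsetsum r K"
   by (simp add: infsetsum_altdef set_lebesgue_integral_def)
  also have "infsetsum r K = sum r K" using that by simp
  finally show ?thesis .
 qed
 then have ev: "\<forall>\<^sub>F K in finite_subsets_at_top UNIV.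
   ennreal ((LINT k|counting. r k) - sum r K) = (\<integral>\<^sup>+k. indicator (- K) k * a k \<partial>counting)"
  by (intro eventually_finite_subsets_at_top_weakI) simp
 have "((%K. (LINT k|counting. r k) - sum r K) \<longlongrightarrow>
   (LINT k|counting. r k) - (LINT k|counting. r k)) (finite_subsets_at_top UNIV)"
  using integrable_count_space_has_sum[OF int] by (intro tendsto_diff tendsto_const) (simp add: has_sum_def)
 then have "((%K. ennreal ((LINT k|counting. r k) - sum r K)) \<longlongrightarrow> ennreal 0) (finite_subsets_at_top UNIV)"
  by (intro tendsto_ennrealI) simp
 then show ?thesis
  using Lim_transform_eventually[OF _ ev] by simp
qed

text \<open>Passes from the unordered sum in which the hypothesis is stated to integration against
  counting measure, to which Fubini's theorem and dominated convergence apply.\<close>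

lemma infsum_ennreal_finite_imp_count_space:
 fixes a :: "'i => ennreal"
 assumes "(\<Sum>\<^sub>\<infinity>k. a k) < \<infinity>"
 shows "(\<integral>\<^sup>+k. a k \<partial>counting) < \<infinity>"
proof -
 have le: "sum a K \<le> (\<Sum>\<^sub>\<infinity>k. a k)" if "finite K" for K
  using that by (subst nonneg_infsum_complete) (auto intro: SUP_upper)
 have "a k < \<infinity>" for k using le[of "{k}"] assms by (simp add: order_le_less_trans)
 define r where "r k = enn2real (a k)" for k
 have a: "a k = ennreal (r k)" for k using \<open>\<And>k. a k < \<infinity>\<close> by (simp add: r_def)
 have r0: "0 \<le> r k" for k by (simp add: r_def)
 have "sum r K \<le> enn2real (\<Sum>\<^sub>\<infinity>k. a k)" if "finite K" for K
 proof -
  have "ennreal (sum r K) \<le> (\<Sum>\<^sub>\<infinity>k. a k)"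
   using le[OF that] by (simp add: a sum_ennreal r0)
  then show ?thesis using assms
   by (metis enn2real_mono enn2real_ennreal sum_nonneg r0 infinity_ennreal_def)
 qed
 then have "r summable_on UNIV"
  by (intro nonneg_bdd_above_summable_on) (auto simp: r0 bdd_above_def)
 then have "Infinite_Set_Sum.abs_summable_on r UNIV"
  using r0 by (subst abs_summable_equivalent[symmetric]) simp
 then have "integrable counting r"
  by (simp add: Infinite_Set_Sum.abs_summable_on_def)
 then show ?thesis using r0 by (simp add: integrable_iff_bounded a)
qed


text \<open>Summation is written as integration so that joint measurability comes from Fubini's theorem.\<close>

definition serfun :: "('i => 'w => 't => real) => 'w => 't => real" where
 "serfun D w t = (LINT k|counting. D k w t)"

text \<open>Countability of the index type enters here: with a discrete countable factor, joint
  measurability reduces to measurability for each index.\<close>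

lemma measurable_count_space_pair:
 fixes D :: "'i::countable => 'a => 'b :: topological_space"
 assumes "\<And>k. D k \<in> borel_measurable N"
 shows "bmeas (N \<Otimes>\<^sub>M counting) (%(x, k). D k x)"
proof -
 have "bmeas (N \<Otimes>\<^sub>M counting) (%p. (%k x. D k (fst x)) (snd p) p)"
  by (rule measurable_compose_countable[OF measurable_compose[OF measurable_fst assms] measurable_snd])
 then show ?thesis by (simp add: case_prod_unfold)
qed

lemma serfun_measurable:
 fixes D :: "'i::countable => 'w => 't => real"
 assumes "\<And>k. (%(w, t). D k w t) \<in> borel_measurable N"
 shows "bmeas N (%(w, t). serfun D w t)"
proof -
 interpret sigma_finite_measure "count_space (UNIV :: 'i set)"
  by (rule sigma_finite_measure_count_space)
 have "bmeas N (%x. \<integral>k. (%(w, t). D k w t) x \<partial>counting)"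
  by (rule borel_measurable_lebesgue_integral, rule measurable_count_space_pair, rule assms)
 then show ?thesis by (simp add: serfun_def case_prod_unfold)
qed

context
 fixes P :: "'w measure" and mu :: "'t measure" and D :: "'i::countable => 'w => 't => real"
 assumes P: "prob_space P" and mu: "sigma_finite_measure mu"
  and D [measurable]: "\<And>k. joint_meas P mu (D k)"
  and fin: "(\<integral>\<^sup>+k. mixn P mu (D k) \<partial>counting) < \<infinity>"
begin

interpretation P: prob_space P by (rule P)
interpretation mu: sigma_finite_measure mu by (rule mu)
interpretation C: sigma_finite_measure "count_space (UNIV :: 'i set)"
 by (rule sigma_finite_measure_count_space)
interpretation muC: pair_sigma_finite mu "count_space (UNIV :: 'i set)" ..
interpretation PC: pair_sigma_finite P "count_space (UNIV :: 'i set)" ..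
interpretation Pmu: pair_sigma_finite P mu ..

lemma D_section: "t \<in> space mu ==> (%w. D k w t) \<in> borel_measurable P"
 using measurable_compose[OF measurable_Pair2'[of t mu P] D[of k]] by simp

text \<open>Minkowski's integral inequality against counting measure, for each t at which the norms
  are summable, followed by Fubini in t and k. The other t form a null set by finiteness of the
  total.\<close>

lemma mixn_serfun_diff:
 assumes "finite K"
 shows "mixn P mu (%w t. serfun D w t - (\<Sum>k\<in>K. D k w t))
  \<le> (\<integral>\<^sup>+k. indicator (- K) k * mixn P mu (D k) \<partial>counting)"
proof -
 have n2m [measurable]: "bmeas mu (%t. norm2 P (%w. D k w t))" for k
  by (rule P.norm2_measurable) measurable
 have n2m' [measurable]: "bmeas (mu \<Otimes>\<^sub>M counting) (%(t, k). norm2 P (%w. D k w t))"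
  by (rule measurable_count_space_pair) measurable
 have "(\<integral>\<^sup>+t. \<integral>\<^sup>+k. norm2 P (%w. D k w t) \<partial>counting \<partial>mu) < \<infinity>"
  using fin muC.Fubini'[OF n2m'] by (simp add: mixn_def)
 then have "AE t in mu. (\<integral>\<^sup>+k. norm2 P (%w. D k w t) \<partial>counting) < \<infinity>"
  using nn_integral_PInf_AE[of "%t. \<integral>\<^sup>+k. norm2 P (%w. D k w t) \<partial>counting" mu]
  by (auto simp: less_top C.borel_measurable_nn_integral[OF n2m'])
 moreover have "norm2 P (%w. serfun D w t - (\<Sum>k\<in>K. D k w t))
   \<le> (\<integral>\<^sup>+k. indicator (- K) k * norm2 P (%w. D k w t) \<partial>counting)"
  if t: "t \<in> space mu" and ft: "(\<integral>\<^sup>+k. norm2 P (%w. D k w t) \<partial>counting) < \<infinity>" for t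
 proof -
  note [measurable] = D_section[OF t]
  have m [measurable]: "bmeas (P \<Otimes>\<^sub>M counting) (%(w, k). D k w t)"
   by (rule measurable_count_space_pair) measurable
  have m2 [measurable]: "bmeas (P \<Otimes>\<^sub>M counting) (%(w, k). indicator (- K) k * D k w t)"
   by (rule measurable_count_space_pair) measurable
  have "(\<integral>\<^sup>+w. \<integral>\<^sup>+k. ennreal \<bar>D k w t\<bar> \<partial>counting \<partial>P)
    = (\<integral>\<^sup>+k. \<integral>\<^sup>+w. ennreal \<bar>D k w t\<bar> \<partial>P \<partial>counting)"
   by (rule PC.Fubini'[symmetric]) measurable
  also have "... \<le> (\<integral>\<^sup>+k. norm2 P (%w. D k w t) \<partial>counting)"
   by (intro nn_integral_mono P.norm1_le_norm2) measurable
  finally have "(\<integral>\<^sup>+w. \<integral>\<^sup>+k. ennreal \<bar>D k w t\<bar> \<partial>counting \<partial>P) < \<infinity>"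
   using ft by simp
  then have "AE w in P. (\<integral>\<^sup>+k. ennreal \<bar>D k w t\<bar> \<partial>counting) < \<infinity>"
   using nn_integral_PInf_AE[of "%w. \<integral>\<^sup>+k. ennreal \<bar>D k w t\<bar> \<partial>counting" P]
   by (auto simp: less_top)
  then have "AE w in P. serfun D w t - (\<Sum>k\<in>K. D k w t)
    = (LINT k|counting. indicator (- K) k * D k w t)"
  proof eventually_elim
   case (elim w)
   then have int: "integrable counting (%k. D k w t)"
    by (simp add: integrable_iff_bounded)
   have int': "integrable counting (%k. indicator K k * D k w t)"
    by (rule Bintegrable_bound[OF int]) (auto simp: indicator_def)
   have "(LINT k|counting. indicator (- K) k * D k w t)
     = (LINT k|counting. D k w t - indicator K k * D k w t)"
    by (intro Bintegral_cong) (auto simp: indicator_def)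
   also have "... = serfun D w t - (LINT k|counting. indicator K k * D k w t)"
    unfolding serfun_def by (intro Bintegral_diff int int')
   also have "(LINT k|counting. indicator K k * D k w t) = infsetsum (%k. D k w t) K"
    by (simp add: infsetsum_altdef set_lebesgue_integral_def)
   finally show ?case using assms by simp
  qed
  then have "norm2 P (%w. serfun D w t - (\<Sum>k\<in>K. D k w t))
    = norm2 P (%w. \<integral>k. indicator (- K) k * D k w t \<partial>counting)"
  proof (rule norm2_cong_AE)
   show "bmeas P (%w. serfun D w t - (\<Sum>k\<in>K. D k w t))"
    unfolding serfun_def by (intro borel_measurable_diff borel_measurable_sum D_section[OF t]) measurable
  qed measurable
  also have "... \<le> (\<integral>\<^sup>+k. norm2 P (%w. indicator (- K) k * D k w t) \<partial>counting)"
   by (rule norm2_integral_le) (measurable, simp_all add: C.sigma_finite_measure_axioms P.sigma_finite_measure_axioms)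
  also have "... = (\<integral>\<^sup>+k. indicator (- K) k * norm2 P (%w. D k w t) \<partial>counting)"
   by (intro nn_integral_cong) (auto simp: indicator_def)
  finally show ?thesis .
 qed
 ultimately have "mixn P mu (%w t. serfun D w t - (\<Sum>k\<in>K. D k w t))
   \<le> (\<integral>\<^sup>+t. \<integral>\<^sup>+k. indicator (- K) k * norm2 P (%w. D k w t) \<partial>counting \<partial>mu)"
  unfolding mixn_def by (intro nn_integral_mono_AE) auto
 also have "... = (\<integral>\<^sup>+k. \<integral>\<^sup>+t. indicator (- K) k * norm2 P (%w. D k w t) \<partial>mu \<partial>counting)"
  by (rule muC.Fubini'[symmetric], rule measurable_count_space_pair) measurable
 also have "... = (\<integral>\<^sup>+k. indicator (- K) k * mixn P mu (D k) \<partial>counting)"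
  by (intro nn_integral_cong) (simp add: nn_integral_cmult mixn_def)
 finally show ?thesis .
qed

lemma mixn_serfun_tendsto:
 "((%K. mixn P mu (%w t. serfun D w t - (\<Sum>k\<in>K. D k w t))) \<longlongrightarrow> 0) (finite_subsets_at_top UNIV)"
proof (rule tendsto_sandwich[OF _ _ tendsto_const count_space_tail[OF fin]])
 show "\<forall>\<^sub>F K in finite_subsets_at_top UNIV. mixn P mu (%w t. serfun D w t - (\<Sum>k\<in>K. D k w t))
  \<le> (\<integral>\<^sup>+k. indicator (- K) k * mixn P mu (D k) \<partial>counting)"
  by (intro eventually_finite_subsets_at_top_weakI mixn_serfun_diff)
qed simp

text \<open>First moments are bounded by second moments, so the integral of |D_k(w,t)| over k, t and
  w is finite. For almost every w the series is therefore absolutely convergent in L1(mu), and its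
  tails bound the distance to the partial sums.\<close>

lemma serfun_L1_has_sum:
 "AE w in P. L1_has_sum mu (%k. D k w) (serfun D w)"
 "AE w in P. (\<integral>\<^sup>+t. ennreal \<bar>serfun D w t\<bar> \<partial>mu) < \<infinity>"
proof -
 have m3: "bmeas ((P \<Otimes>\<^sub>M mu) \<Otimes>\<^sub>M counting) (%((w, t), k). ennreal \<bar>D k w t\<bar>)"
  using measurable_count_space_pair[of "%k (w, t). ennreal \<bar>D k w t\<bar>" "P \<Otimes>\<^sub>M mu"]
  by (simp add: case_prod_unfold)
 have m4 [measurable]: "bmeas P (%w. \<integral>\<^sup>+t. ennreal \<bar>D k w t\<bar> \<partial>mu)" for k
  by measurable
 have m5 [measurable]: "bmeas (P \<Otimes>\<^sub>M counting) (%(w, k). \<integral>\<^sup>+t. ennreal \<bar>D k w t\<bar> \<partial>mu)"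
  by (rule measurable_count_space_pair) measurable
 have "(\<integral>\<^sup>+w. \<integral>\<^sup>+k. \<integral>\<^sup>+t. ennreal \<bar>D k w t\<bar> \<partial>mu \<partial>counting \<partial>P)
   = (\<integral>\<^sup>+k. \<integral>\<^sup>+w. \<integral>\<^sup>+t. ennreal \<bar>D k w t\<bar> \<partial>mu \<partial>P \<partial>counting)"
  by (rule PC.Fubini'[symmetric]) measurable
 also have "... = (\<integral>\<^sup>+k. \<integral>\<^sup>+t. \<integral>\<^sup>+w. ennreal \<bar>D k w t\<bar> \<partial>P \<partial>mu \<partial>counting)"
  by (intro nn_integral_cong Pmu.Fubini'[symmetric]) measurable
 also have "... \<le> (\<integral>\<^sup>+k. mixn P mu (D k) \<partial>counting)"
  unfolding mixn_def by (intro nn_integral_mono P.norm1_le_norm2 D_section)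
 finally have "(\<integral>\<^sup>+w. \<integral>\<^sup>+k. \<integral>\<^sup>+t. ennreal \<bar>D k w t\<bar> \<partial>mu \<partial>counting \<partial>P) < \<infinity>"
  using fin by simp
 then have ae: "AE w in P. (\<integral>\<^sup>+k. \<integral>\<^sup>+t. ennreal \<bar>D k w t\<bar> \<partial>mu \<partial>counting) < \<infinity>"
  using nn_integral_PInf_AE[of "%w. \<integral>\<^sup>+k. \<integral>\<^sup>+t. ennreal \<bar>D k w t\<bar> \<partial>mu \<partial>counting" P]
  by (auto simp: less_top)
 have main: "L1_has_sum mu (%k. D k w) (serfun D w) \<and> (\<integral>\<^sup>+t. ennreal \<bar>serfun D w t\<bar> \<partial>mu) < \<infinity>"
  if w: "w \<in> space P" and fw: "(\<integral>\<^sup>+k. \<integral>\<^sup>+t. ennreal \<bar>D k w t\<bar> \<partial>mu \<partial>counting) < \<infinity>" for w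
 proof -
  have Dm [measurable]: "bmeas mu (D k w)" for k
   using measurable_compose[OF measurable_Pair1'[OF w] D[of k]] by simp
  have mm [measurable]: "bmeas (mu \<Otimes>\<^sub>M counting) (%(t, k). D k w t)"
   by (rule measurable_count_space_pair) measurable
  have mm' [measurable]: "bmeas (mu \<Otimes>\<^sub>M counting) (%(t, k). indicator (- K) k * D k w t)" for K
   by (rule measurable_count_space_pair) measurable
  have mm2 [measurable]: "bmeas (mu \<Otimes>\<^sub>M counting) (%(t, k). ennreal \<bar>D k w t\<bar>)"
   by (rule measurable_count_space_pair) measurable
  have sm [measurable]: "bmeas mu (serfun D w)"
   unfolding serfun_def[abs_def] by measurable
  have fk: "(\<integral>\<^sup>+t. ennreal \<bar>D k w t\<bar> \<partial>mu) < \<infinity>" for k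
   using nn_integral_ge_point[of k UNIV "%k. \<integral>\<^sup>+t. ennreal \<bar>D k w t\<bar> \<partial>mu"] fw
   by (simp add: order_le_less_trans)
  have Di: "integrable mu (D k w)" for k
   using fk[of k] by (simp add: integrable_iff_bounded)
  have "(\<integral>\<^sup>+t. \<integral>\<^sup>+k. ennreal \<bar>D k w t\<bar> \<partial>counting \<partial>mu) < \<infinity>"
   using fw muC.Fubini'[OF mm2] by simp
  then have aet: "AE t in mu. (\<integral>\<^sup>+k. ennreal \<bar>D k w t\<bar> \<partial>counting) < \<infinity>"
   using nn_integral_PInf_AE[of "%t. \<integral>\<^sup>+k. ennreal \<bar>D k w t\<bar> \<partial>counting" mu]
   by (auto simp: less_top C.borel_measurable_nn_integral[OF mm2])
  have bd: "(\<integral>\<^sup>+t. ennreal \<bar>serfun D w t - (\<Sum>k\<in>K. D k w t)\<bar> \<partial>mu)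
    \<le> (\<integral>\<^sup>+k. indicator (- K) k * (\<integral>\<^sup>+t. ennreal \<bar>D k w t\<bar> \<partial>mu) \<partial>counting)" if K: "finite K" for K
  proof -
   have "(\<integral>\<^sup>+t. ennreal \<bar>serfun D w t - (\<Sum>k\<in>K. D k w t)\<bar> \<partial>mu)
     \<le> (\<integral>\<^sup>+t. \<integral>\<^sup>+k. indicator (- K) k * ennreal \<bar>D k w t\<bar> \<partial>counting \<partial>mu)"
   proof (rule nn_integral_mono_AE, use aet in eventually_elim)
    case (elim t)
    then have int: "integrable counting (%k. D k w t)"
     by (simp add: integrable_iff_bounded)
    have int': "integrable counting (%k. indicator K k * D k w t)" for K
     by (rule Bintegrable_bound[OF int]) (auto simp: indicator_def)
    have "(LINT k|counting. indicator (- K) k * D k w t)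
      = (LINT k|counting. D k w t - indicator K k * D k w t)"
     by (intro Bintegral_cong) (auto simp: indicator_def)
    also have "... = serfun D w t - (LINT k|counting. indicator K k * D k w t)"
     unfolding serfun_def by (intro Bintegral_diff int int')
    also have "(LINT k|counting. indicator K k * D k w t) = infsetsum (%k. D k w t) K"
     by (simp add: infsetsum_altdef set_lebesgue_integral_def)
    finally have "serfun D w t - (\<Sum>k\<in>K. D k w t) = (LINT k|counting. indicator (- K) k * D k w t)"
     using K by simp
    then have "ennreal \<bar>serfun D w t - (\<Sum>k\<in>K. D k w t)\<bar>
      \<le> (\<integral>\<^sup>+k. ennreal \<bar>indicator (- K) k * D k w t\<bar> \<partial>counting)"
     using integral_norm_bound_ennreal[OF int'[of "- K"]] by simp
    also have "... = (\<integral>\<^sup>+k. indicator (- K) k * ennreal \<bar>D k w t\<bar> \<partial>counting)"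
     by (intro nn_integral_cong) (auto simp: indicator_def)
    finally show ?case .
   qed
   also have "... = (\<integral>\<^sup>+k. \<integral>\<^sup>+t. indicator (- K) k * ennreal \<bar>D k w t\<bar> \<partial>mu \<partial>counting)"
    by (rule muC.Fubini'[symmetric], rule measurable_count_space_pair) measurable
   also have "... = (\<integral>\<^sup>+k. indicator (- K) k * (\<integral>\<^sup>+t. ennreal \<bar>D k w t\<bar> \<partial>mu) \<partial>counting)"
    by (intro nn_integral_cong) (simp add: nn_integral_cmult)
   finally show ?thesis .
  qed
  have Sfin: "(\<integral>\<^sup>+t. ennreal \<bar>serfun D w t\<bar> \<partial>mu) < \<infinity>"
   using bd[of "{}"] fw by simp
  then have Si: "integrable mu (serfun D w)" by (simp add: integrable_iff_bounded)
  have tl: "((%K. \<integral>\<^sup>+t. ennreal \<bar>serfun D w t - (\<Sum>k\<in>K. D k w t)\<bar> \<partial>mu) \<longlongrightarrow> ennreal 0) (finite_subsets_at_top UNIV)"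
   unfolding ennreal_0
   by (rule tendsto_sandwich[OF _ _ tendsto_const count_space_tail[OF fw]])
    (auto intro!: eventually_finite_subsets_at_top_weakI bd)
  have "((%K. \<integral>t. \<bar>serfun D w t - (\<Sum>k\<in>K. D k w t)\<bar> \<partial>mu) \<longlongrightarrow> 0) (finite_subsets_at_top UNIV)"
  proof -
   have "(\<integral>\<^sup>+t. ennreal \<bar>serfun D w t - (\<Sum>k\<in>K. D k w t)\<bar> \<partial>mu)
     = ennreal (LINT t|mu. \<bar>serfun D w t - (\<Sum>k\<in>K. D k w t)\<bar>)" for K
    by (rule nn_integral_eq_integral) (auto intro!: Bochner_Integration.integrable_abs Bintegrable_diff Si Di Bintegrable_sum)
   note eq = this
   from tl have "((%K. ennreal (LINT t|mu. \<bar>serfun D w t - (\<Sum>k\<in>K. D k w t)\<bar>)) \<longlongrightarrow> ennreal 0) (finite_subsets_at_top UNIV)"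
    unfolding eq .
   then show ?thesis by (subst (asm) tendsto_ennreal_iff) (auto intro!: always_eventually)
  qed
  then show ?thesis using Di Si Sfin by (simp add: L1_has_sum_def)
 qed
 show "AE w in P. L1_has_sum mu (%k. D k w) (serfun D w)"
  by (rule AE_mp[OF ae AE_I2]) (use main in blast)
 show "AE w in P. (\<integral>\<^sup>+t. ennreal \<bar>serfun D w t\<bar> \<partial>mu) < \<infinity>"
  by (rule AE_mp[OF ae AE_I2]) (use main in blast)
qed

end

section \<open>Stationarity\<close>

locale shift = prob_space P for P :: "'w measure" +
 fixes T :: "'w => 'w" and F0 :: "'w measure"
 assumes T: "preserving_bijection P T"
  and F0: "subalgebra P F0"
  and filtration: "sets F0 \<subseteq> {T -` A \<inter> space P | A. A \<in> sets F0}"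
begin

abbreviation "tau \<equiv> int_iterate P T"
abbreviation "Fil \<equiv> filt P T F0"

lemma T_space: "w \<in> space P ==> T w \<in> space P"
 using T by (auto simp: preserving_bijection_def bij_betw_def)

lemma Tinv_space: "w \<in> space P ==> inv_into (space P) T w \<in> space P"
 using T by (auto simp: preserving_bijection_def bij_betw_def inv_into_into)

lemma T_Tinv: "w \<in> space P ==> T (inv_into (space P) T w) = w"
 using T by (auto simp: preserving_bijection_def bij_betw_def f_inv_into_f)

lemma Tinv_T: "w \<in> space P ==> inv_into (space P) T (T w) = w"
 using T by (auto simp: preserving_bijection_def bij_betw_def inv_into_f_f)

lemma Tinv_pow_space: "w \<in> space P ==> (inv_into (space P) T ^^ n) w \<in> space P"
 by (induction n) (auto intro: Tinv_space)

lemma T_pow_space: "w \<in> space P ==> (T ^^ n) w \<in> space P"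
 by (induction n) (auto intro: T_space)

lemma tau_space [simp]: "w \<in> space P ==> tau i w \<in> space P"
 by (simp add: int_iterate_def Tinv_pow_space T_pow_space)

lemma tau_0 [simp]: "tau 0 w = w"
 by (simp add: int_iterate_def)

lemma T_tau: "w \<in> space P ==> T (tau i w) = tau (i + 1) w"
proof (cases "i \<ge> 0")
 case True
 then show ?thesis by (simp add: int_iterate_def nat_add_distrib)
next
 case False
 assume w: "w \<in> space P"
 define n where "n = nat (- i - 1)"
 have i: "i = - int (Suc n)" using False by (simp add: n_def)
 have "T (tau i w) = (inv_into (space P) T ^^ n) w"
  using w by (simp add: i int_iterate_def T_Tinv Tinv_pow_space nat_add_distrib)
 moreover have "tau (i + 1) w = (inv_into (space P) T ^^ n) w"
  by (cases n) (auto simp: i int_iterate_def nat_add_distrib)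
 ultimately show ?thesis by simp
qed

text \<open>Induction in both directions. The downward step applies \<open>T\<close> to both sides
  and cancels it, which is legitimate on \<open>space P\<close>, where \<open>T\<close> is
  injective.\<close>

lemma tau_add: "w \<in> space P ==> tau i (tau j w) = tau (i + j) w"
proof (induction i rule: int_induct[where k = 0])
 case base
 then show ?case by simp
next
 case (step1 i)
 then show ?case
  using T_tau[of "tau j w" i] T_tau[of w "i + j"] by (simp add: algebra_simps)
next
 case (step2 i)
 have "T (tau (i - 1) (tau j w)) = T (tau (i - 1 + j) w)"
  using step2 T_tau[of "tau j w" "i - 1"] T_tau[of w "i - 1 + j"] by (simp add: algebra_simps)
 then show ?case
  using step2.prems by (metis Tinv_T tau_space)
qed

lemma T_measurable [measurable]: "T \<in> measurable P P"
 and Tinv_measurable [measurable]: "inv_into (space P) T \<in> measurable P P"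
 and T_distr: "distr P P T = P"
 using T by (auto simp: preserving_bijection_def)

lemma tau_measurable [measurable]: "tau i \<in> measurable P P"
 by (simp add: int_iterate_def measurable_compose_n)

lemma Tinv_distr: "distr P P (inv_into (space P) T) = P"
proof -
 have "distr P P (inv_into (space P) T) = distr (distr P P T) P (inv_into (space P) T)"
  by (simp add: T_distr)
 also have "... = distr P P (inv_into (space P) T \<circ> T)"
  by (rule distr_distr) measurable
 also have "... = distr P P (%w. w)"
  by (rule distr_cong) (auto simp: Tinv_T)
 finally show ?thesis by (simp add: distr_id2)
qed

lemma distr_pow:
 assumes [measurable]: "S \<in> measurable P P" and "distr P P S = P"
 shows "distr P P (S ^^ n) = P"
proof (induction n)
 case 0
 then show ?case by (simp add: distr_id2 id_def)
next
 case (Suc n)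
 have [measurable]: "S ^^ n \<in> measurable P P" by (rule measurable_compose_n) fact
 have "distr P P (S \<circ> S ^^ n) = distr (distr P P (S ^^ n)) P S"
  by (rule distr_distr[symmetric]) measurable
 then show ?case using Suc assms(2) by (simp add: comp_def)
qed

lemma tau_distr: "distr P P (tau i) = P"
 using distr_pow[OF T_measurable T_distr] distr_pow[OF Tinv_measurable Tinv_distr]
 by (simp add: int_iterate_def)

lemma integral_tau: "f \<in> borel_measurable P ==> (LINT w|P. f (tau i w)) = (LINT w|P. f w)"
 for f :: "'w => 'b::{banach, second_countable_topology}"
 using integral_distr[OF tau_measurable[of i], where f = f] by (simp add: tau_distr)

lemma integrable_tau: "integrable P f ==> integrable P (%w. f (tau i w))"
 for f :: "'w => 'b::{banach, second_countable_topology}"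
 using integrable_distr[OF tau_measurable[of i], where f = f] by (simp add: tau_distr)

lemma AE_tau: "AE w in P. Q w ==> AE w in P. Q (tau i w)"
 using AE_distrD[OF tau_measurable[of i], of Q] unfolding tau_distr by blast

lemma L2fun_tau: "L2fun P f ==> L2fun P (%w. f (tau i w))"
 using integrable_tau[of "%w. (f w)\<^sup>2" i] by (simp add: L2fun_def measurable_compose[OF tau_measurable])

lemma nrm_tau: "f \<in> borel_measurable P ==> nrm P (%w. f (tau i w)) = nrm P f"
 using integral_tau[of "%w. (f w)\<^sup>2" i] by (simp add: nrm_def)

lemma norm2_tau:
 assumes [measurable]: "bmeas P f"
 shows "norm2 P (%w. f (tau i w)) = norm2 P f"
proof (cases "L2fun P f")
 case True
 then show ?thesis by (simp add: norm2_L2 L2fun_tau nrm_tau)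
next
 case False
 have "\<not> L2fun P (%w. f (tau i w))"
 proof
  assume "L2fun P (%w. f (tau i w))"
  from L2fun_tau[OF this, of "- i"] have "L2fun P (%w. f (tau i (tau (- i) w)))" .
  then have "L2fun P f"
   by (rule L2fun_cong_AE[rotated]) (auto simp: tau_add intro!: AE_I2)
  with False show False by contradiction
 qed
 with False show ?thesis by (simp add: norm2_not_L2)
qed

lemma space_F0: "space F0 = space P"
 using F0 by (simp add: subalgebra_def)

lemma sets_F0: "A \<in> sets F0 ==> A \<in> sets P"
 using F0 by (auto simp: subalgebra_def)

lemma space_Fil [simp]: "space (Fil i) = space P"
 by (simp add: filt_def)

lemma sets_Fil: "sets (Fil i) = {tau i -` A \<inter> space P | A. A \<in> sets F0}"
 unfolding filt_def by (rule sets_vimage_algebra2) (simp add: space_F0)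

lemma Fil_subalgebra: "subalgebra P (Fil i)"
 using measurable_sets[OF tau_measurable sets_F0] by (auto simp: subalgebra_def sets_Fil)

lemma sets_Fil_0: "sets (Fil 0) = sets F0"
proof -
 have *: "tau 0 -` A \<inter> space P = A" if "A \<in> sets F0" for A
  using sets.sets_into_space[OF that] space_F0 by auto
 show ?thesis
 proof (intro set_eqI iffI)
  fix B assume "B \<in> sets (Fil 0)"
  then obtain A where "A \<in> sets F0" "B = tau 0 -` A \<inter> space P" unfolding sets_Fil by blast
  then show "B \<in> sets F0" using * by simp
 next
  fix B assume B: "B \<in> sets F0"
  show "B \<in> sets (Fil 0)" unfolding sets_Fil using *[OF B, symmetric] B by blast
 qed
qed

lemma Fil_Suc: "sets (Fil i) \<subseteq> sets (Fil (i + 1))"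
proof
 fix B assume "B \<in> sets (Fil i)"
 then obtain A where A: "A \<in> sets F0" "B = tau i -` A \<inter> space P" by (auto simp: sets_Fil)
 then obtain C where C: "C \<in> sets F0" "A = T -` C \<inter> space P" using filtration by blast
 have "B = tau (i + 1) -` C \<inter> space P"
  using A(2) C(2) by (auto simp: T_tau)
 then show "B \<in> sets (Fil (i + 1))" using C(1) by (auto simp: sets_Fil)
qed

lemma Fil_mono: "i \<le> j ==> sets (Fil i) \<subseteq> sets (Fil j)"
 by (induction j rule: int_ge_induct) (use Fil_Suc in auto)

lemma Fil_subalgebra_mono: "i \<le> j ==> subalgebra (Fil j) (Fil i)"
 by (simp add: subalgebra_def Fil_mono)

lemma measurable_Fil_mono: "f \<in> measurable (Fil i) N ==> i \<le> j ==> f \<in> measurable (Fil j) N"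
 using measurable_from_subalg[OF Fil_subalgebra_mono] .

lemma measurable_Fil: "f \<in> measurable (Fil i) N ==> f \<in> measurable P N"
 by (rule measurable_from_subalg[OF Fil_subalgebra])

lemma measurable_F0: "f \<in> measurable F0 N ==> f \<in> measurable P N"
 by (rule measurable_from_subalg[OF F0])

lemma measurable_F0_Fil: "f \<in> measurable F0 N \<longleftrightarrow> f \<in> measurable (Fil 0) N"
 by (rule measurable_cong_sets[THEN arg_cong[where f = "%S. f \<in> S"]]) (simp_all add: sets_Fil_0)

lemma sets_Fil_tau: "sets (Fil (i + j)) = {tau i -` B \<inter> space P | B. B \<in> sets (Fil j)}"
proof -
 have "tau (i + j) -` A \<inter> space P = tau i -` (tau j -` A \<inter> space P) \<inter> space P" for A
  by (auto simp: tau_add add.commute)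
 then have "{tau (i + j) -` A \<inter> space P | A. A \<in> sets F0}
   = {tau i -` (tau j -` A \<inter> space P) \<inter> space P | A. A \<in> sets F0}" by simp
 also have "... = {tau i -` B \<inter> space P | B. B \<in> {tau j -` A \<inter> space P | A. A \<in> sets F0}}" by blast
 finally show ?thesis by (simp only: sets_Fil)
qed

lemma tau_measurable_Fil: "tau i \<in> measurable (Fil (i + j)) (Fil j)"
 by (rule measurableI) (auto simp: sets_Fil_tau[of i j])

lemma measurable_Fil_tau: "f \<in> measurable (Fil j) N ==> (%w. f (tau i w)) \<in> measurable (Fil (i + j)) N"
 by (rule measurable_compose[OF tau_measurable_Fil])

lemma measurable_F0_tau: "f \<in> measurable F0 N ==> (%w. f (tau i w)) \<in> measurable (Fil i) N"
 using measurable_Fil_tau[of f 0 N i] by (simp add: measurable_F0_Fil)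

lemma sfs_Fil: "sigma_finite_subalgebra P (Fil i)"
 using Fil_subalgebra finite_measure_axioms
 by (intro finite_measure_subalgebra_is_sigma_finite finite_measure_subalgebra.intro
   finite_measure_subalgebra_axioms.intro)

lemma sfs_F0: "sigma_finite_subalgebra P F0"
 using F0 finite_measure_axioms
 by (intro finite_measure_subalgebra_is_sigma_finite finite_measure_subalgebra.intro
   finite_measure_subalgebra_axioms.intro)

text \<open>The preimage under the i-th iterate identifies the sets of \<open>Fil j\<close> with
  those of \<open>Fil (i + j)\<close>, and preservation of P carries the defining identity of the
  conditional expectation from the former to the latter.\<close>

lemma cond_exp_tau:
 assumes Y: "integrable P Y"
 shows "AE w in P. real_cond_exp P (Fil (i + j)) (%w. Y (tau i w)) w = real_cond_exp P (Fil j) Y (tau i w)"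
proof -
 interpret A: sigma_finite_subalgebra P "Fil (i + j)" by (rule sfs_Fil)
 interpret B: sigma_finite_subalgebra P "Fil j" by (rule sfs_Fil)
 have [measurable]: "bmeas P Y" using Y by auto
 show ?thesis
 proof (rule A.real_cond_exp_charact)
  show "integrable P (%w. Y (tau i w))" by (rule integrable_tau[OF Y])
  show "integrable P (%w. real_cond_exp P (Fil j) Y (tau i w))"
   by (rule integrable_tau[OF B.real_cond_exp_int(1)[OF Y]])
  show "bmeas (Fil (i + j)) (%w. real_cond_exp P (Fil j) Y (tau i w))"
   by (rule measurable_Fil_tau) simp
  fix A assume "A \<in> sets (Fil (i + j))"
  then obtain B where B: "B \<in> sets (Fil j)" and A: "A = tau i -` B \<inter> space P"
   by (auto simp: sets_Fil_tau)
  have [measurable]: "B \<in> sets P" using B Fil_subalgebra by (auto simp: subalgebra_def)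
  have *: "(\<integral>w\<in>A. f (tau i w) \<partial>P) = (\<integral>w\<in>B. f w \<partial>P)" if [measurable]: "bmeas P f" for f :: "'w => real"
  proof -
   have "(\<integral>w\<in>A. f (tau i w) \<partial>P) = (LINT w|P. (%w. indicator B w *\<^sub>R f w) (tau i w))"
    unfolding set_lebesgue_integral_def
    by (rule Bintegral_cong) (auto simp: A indicator_def)
   also have "... = (LINT w|P. indicator B w *\<^sub>R f w)" by (rule integral_tau) measurable
   finally show ?thesis by (simp add: set_lebesgue_integral_def)
  qed
  show "(\<integral>w\<in>A. Y (tau i w) \<partial>P) = (\<integral>w\<in>A. real_cond_exp P (Fil j) Y (tau i w) \<partial>P)"
   using B.real_cond_exp_intA[OF Y B] by (simp add: *)
 qed
qed

section \<open>Martingale differences\<close>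

text \<open>The increment at time 0 of a stationary martingale difference sequence: its shifts by
  \<open>tau i\<close> are the other increments. Vanishing of the conditional expectation is
  expressed through integrals over past events, so that no version has to be chosen.\<close>

definition mds :: "('w => real) => bool" where
 "mds q \<longleftrightarrow> L2fun P q \<and> q \<in> borel_measurable F0 \<and>
  (\<forall>A\<in>sets (Fil (- 1)). (LINT w|P. indicator A w * q w) = 0)"

lemma mds_L2: "mds q ==> L2fun P q"
 by (simp add: mds_def)

text \<open>After a shift by -i the factor \<open>W\<close> is measurable with respect to
  \<open>Fil (- 1)\<close> and can be taken out of the conditional expectation of \<open>q\<close>,
  which is 0.\<close>

lemma mds_integral_zero:
 assumes q: "mds q" and W: "bmeas (Fil (i - 1)) W"
  and int: "integrable P (%w. W w * q (tau i w))"
 shows "(LINT w|P. W w * q (tau i w)) = 0"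
proof -
 interpret B: sigma_finite_subalgebra P "Fil (- 1)" by (rule sfs_Fil)
 have qi: "integrable P q" and [measurable]: "bmeas P q"
  using L2fun_integrable[OF mds_L2[OF q]] mds_L2[OF q] by (auto dest: L2fun_measurable)
 have [measurable]: "bmeas P W" using measurable_Fil[OF W] .
 let ?W = "%w. W (tau (- i) w)"
 have Wm: "bmeas (Fil (- 1)) ?W"
  using measurable_Fil_tau[OF W, of "- i"] by simp
 have eq: "W w * q (tau i w) = (%w. ?W w * q w) (tau i w)" if "w \<in> space P" for w
  using that by (simp add: tau_add)
 have int': "integrable P (%w. ?W w * q w)"
  using integrable_tau[OF int, of "- i"] by (simp add: tau_add cong: Bintegrable_cong)
 have "AE w in P. real_cond_exp P (Fil (- 1)) q w = 0"
  by (rule B.real_cond_exp_charact) (use q qi in \<open>auto simp: mds_def set_lebesgue_integral_def\<close>)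
 then have "(LINT w|P. ?W w * real_cond_exp P (Fil (- 1)) q w) = (LINT w|P. 0)"
  by (intro integral_cong_AE) auto
 then have "(LINT w|P. ?W w * q w) = 0"
  using B.real_cond_exp_intg(2)[OF int' Wm] by simp
 moreover have "(LINT w|P. W w * q (tau i w)) = (LINT w|P. (%w. ?W w * q w) (tau i w))"
  by (rule Bintegral_cong) (simp_all add: eq)
 ultimately show ?thesis using integral_tau[of "%w. ?W w * q w" i] by simp
qed

lemma mds_integral_zero_complex:
 assumes q: "mds q" and W: "bmeas (Fil (i - 1)) W"
  and int: "integrable P (%w. W w * complex_of_real (q (tau i w)))"
 shows "(LINT w|P. W w * complex_of_real (q (tau i w))) = 0"
proof -
 have "Re (LINT w|P. W w * complex_of_real (q (tau i w))) = (LINT w|P. Re (W w) * q (tau i w))"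
  using integral_Re[OF int] by simp
 also have "... = 0"
  by (rule mds_integral_zero[OF q]) (use W integrable_Re[OF int] in auto)
 finally have "Re (LINT w|P. W w * complex_of_real (q (tau i w))) = 0" .
 moreover have "Im (LINT w|P. W w * complex_of_real (q (tau i w))) = (LINT w|P. Im (W w) * q (tau i w))"
  using integral_Im[OF int] by simp
 moreover have "... = 0"
  by (rule mds_integral_zero[OF q]) (use W integrable_Im[OF int] in auto)
 ultimately show ?thesis by (simp add: complex_eq_iff)
qed

lemma mds_orthogonal:
 assumes "mds q" "mds r" "i \<noteq> j"
 shows "(LINT w|P. q (tau i w) * r (tau j w)) = 0"
proof -
 have *: "(LINT w|P. q (tau i w) * r (tau j w)) = 0" if "mds q" "mds r" "i < j" for q r i j
 proof (rule mds_integral_zero[OF that(2)])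
  show "bmeas (Fil (j - 1)) (%w. q (tau i w))"
   using that by (intro measurable_Fil_mono[OF measurable_F0_tau]) (auto simp: mds_def)
  show "integrable P (%w. q (tau i w) * r (tau j w))"
   using that by (intro L2fun_mult_integrable L2fun_tau mds_L2)
 qed
 show ?thesis
  using *[OF assms(1,2)] *[OF assms(2,1)] assms(3) by (cases "i < j") (simp_all add: mult.commute)
qed

lemma mds_nrm_sum:
 assumes "mds q" "finite I"
 shows "nrm P (%w. \<Sum>i\<in>I. q (tau i w)) = sqrt (card I) * nrm P q"
proof -
 have "(nrm P (%w. \<Sum>i\<in>I. q (tau i w)))\<^sup>2 = card I * (nrm P q)\<^sup>2"
  using assms(2)
 proof (induction I rule: finite_induct)
  case (insert j I)
  have L: "L2fun P (%w. q (tau i w))" for i by (intro L2fun_tau mds_L2 assms(1))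
  have "(LINT w|P. q (tau j w) * (\<Sum>i\<in>I. q (tau i w))) = (LINT w|P. (\<Sum>i\<in>I. q (tau j w) * q (tau i w)))"
   by (simp add: sum_distrib_left)
  also have "... = (\<Sum>i\<in>I. \<integral>w. q (tau j w) * q (tau i w) \<partial>P)"
   by (rule Bintegral_sum) (intro L2fun_mult_integrable L)
  also have "... = 0"
   using insert by (intro sum.neutral ballI mds_orthogonal assms(1)) auto
  finally have "(nrm P (%w. q (tau j w) + (\<Sum>i\<in>I. q (tau i w))))\<^sup>2 = (nrm P q)\<^sup>2 + card I * (nrm P q)\<^sup>2"
   using insert L2fun_measurable[OF mds_L2[OF assms(1)]]
   by (subst nrm_power2_add) (auto intro!: L L2fun_sum simp: nrm_tau)
  then show ?case using insert by (simp add: algebra_simps)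
 qed simp
 then have "nrm P (%w. \<Sum>i\<in>I. q (tau i w)) = sqrt (card I * (nrm P q)\<^sup>2)"
  by (metis nrm_nonneg real_sqrt_abs abs_of_nonneg)
 then show ?thesis by (simp add: real_sqrt_mult)
qed

text \<open>Common indices of the two blocks cancel. Each remaining block has at most min(n,|k|)
  indices, and orthogonality turns their number into its square root.\<close>

lemma mds_nrm_sum_diff:
 assumes q: "mds q"
 shows "nrm P (%w. (\<Sum>i=1..n. q (tau (int i - k) w)) - (\<Sum>i=1..n. q (tau (int i) w)))
  \<le> 2 * sqrt (min (real n) \<bar>real_of_int k\<bar>) * nrm P q"
proof -
 let ?A = "{1 - k..int n - k}" and ?B = "{1..int n}"
 have L: "L2fun P (%w. q (tau i w))" for i by (intro L2fun_tau mds_L2 assms(1))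
 have sA: "(\<Sum>i=1..n. q (tau (int i - k) w)) = (\<Sum>i\<in>?A. q (tau i w))" for w
  by (rule sum.reindex_bij_witness[of _ "%i. nat (i + k)" "%i. int i - k"]) auto
 have sB: "(\<Sum>i=1..n. q (tau (int i) w)) = (\<Sum>i\<in>?B. q (tau i w))" for w
  by (rule sum.reindex_bij_witness[of _ nat int]) auto
 have "(\<Sum>i\<in>?A. q (tau i w)) - (\<Sum>i\<in>?B. q (tau i w))
   = (\<Sum>i\<in>?A - ?B. q (tau i w)) - (\<Sum>i\<in>?B - ?A. q (tau i w))" for w
  using sum.Int_Diff[of ?A "%i. q (tau i w)" ?B] sum.Int_Diff[of ?B "%i. q (tau i w)" ?A]
  by (simp add: Int_commute)
 then have "nrm P (%w. (\<Sum>i\<in>?A. q (tau i w)) - (\<Sum>i\<in>?B. q (tau i w)))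
   \<le> nrm P (%w. \<Sum>i\<in>?A - ?B. q (tau i w)) + nrm P (%w. \<Sum>i\<in>?B - ?A. q (tau i w))"
  using nrm_triangle_diff[OF L2fun_sum[OF L] L2fun_sum[OF L]] by simp
 also have "... = sqrt (card (?A - ?B)) * nrm P q + sqrt (card (?B - ?A)) * nrm P q"
  by (simp add: mds_nrm_sum[OF q])
 also have "... \<le> sqrt (min (real n) \<bar>real_of_int k\<bar>) * nrm P q + sqrt (min (real n) \<bar>real_of_int k\<bar>) * nrm P q"
 proof -
  have cA: "card ?A = n" and cB: "card ?B = n" by auto
  have 1: "card (?A - ?B) \<le> n" "card (?B - ?A) \<le> n"
   using card_mono[of ?A "?A - ?B"] card_mono[of ?B "?B - ?A"] cA cB by auto
  have sub: "?A - ?B \<subseteq> (if k \<ge> 0 then {1 - k..0} else {int n + 1..int n - k})"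
   "?B - ?A \<subseteq> (if k \<ge> 0 then {int n - k + 1..int n} else {1..- k})" by auto
  have 2: "card (?A - ?B) \<le> nat \<bar>k\<bar>" "card (?B - ?A) \<le> nat \<bar>k\<bar>"
   using card_mono[OF _ sub(1)] card_mono[OF _ sub(2)] by (cases "k \<ge> 0"; simp)+
  have "real (card (?A - ?B)) \<le> min (real n) \<bar>real_of_int k\<bar>" "real (card (?B - ?A)) \<le> min (real n) \<bar>real_of_int k\<bar>"
   using 1 2 by linarith+
  then show ?thesis by (intro add_mono mult_right_mono real_sqrt_le_mono) auto
 qed
 also have "... = 2 * sqrt (min (real n) \<bar>real_of_int k\<bar>) * nrm P q" by simp
 finally show ?thesis unfolding sA sB .
qed

lemma mds_cmult: "mds q ==> mds (%w. c * q w)"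
 by (auto simp: mds_def L2fun_cmult mult.left_commute[of _ c])

lemma indicator_mult_integrable: "A \<in> sets P ==> integrable P f ==> integrable P (%w. indicator A w * f w :: real)"
 using integrable_mult_indicator[of A P f] by simp

lemma sets_Fil_P: "A \<in> sets (Fil i) ==> A \<in> sets P"
 using Fil_subalgebra[of i] by (auto simp: subalgebra_def)

lemma mds_add: "mds q ==> mds r ==> mds (%w. q w + r w)"
 by (auto simp: mds_def L2fun_add distrib_left indicator_mult_integrable sets_Fil_P L2fun_integrable)

lemma mds_zero: "mds (%w. 0)"
 by (simp add: mds_def)

lemma mds_sum: "(\<And>i. i \<in> I ==> mds (q i)) ==> mds (%w. \<Sum>i\<in>I. q i w)"
 by (induction I rule: infinite_finite_induct) (auto intro: mds_add mds_zero)

lemma mds_diff: "mds q ==> mds r ==> mds (%w. q w - r w)"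
 using mds_add[OF _ mds_cmult[of r "-1"]] by simp

text \<open>Pairing with the indicator of a past event is continuous in L2, with norm at most 1, so
  vanishing of these pairings survives the limit.\<close>

lemma mds_limit:
 assumes q: "\<And>eps. eps > 0 ==> \<exists>r. mds r \<and> nrm P (%w. q w - r w) \<le> eps"
  and L: "L2fun P q" and m: "bmeas F0 q"
 shows "mds q"
 unfolding mds_def
proof (intro conjI L m ballI)
 fix A assume A: "A \<in> sets (Fil (- 1))"
 have [measurable]: "A \<in> sets P" using A by (rule sets_Fil_P)
 have LA: "L2fun P (indicator A)"
  by (rule L2fun_bound[OF L2fun_const[of 1]]) (auto simp: indicator_def)
 have nA: "nrm P (indicator A) \<le> 1"
  using nrm_mono[OF L2fun_const[of 1], of "indicator A"] by (auto simp: indicator_def nrm_def[of P "%_. 1"] prob_space)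
 have "\<bar>\<integral>w. indicator A w * q w \<partial>P\<bar> \<le> 0 + eps" if eps: "eps > 0" for eps
 proof -
  obtain r where r: "mds r" "nrm P (%w. q w - r w) \<le> eps" using q[OF eps] by blast
  have "(LINT w|P. indicator A w * (q w - r w)) = (LINT w|P. indicator A w * q w) - (LINT w|P. indicator A w * r w)"
   using L2fun_mult_integrable[OF LA L] L2fun_mult_integrable[OF LA mds_L2[OF r(1)]]
   by (simp add: right_diff_distrib)
  then have "(LINT w|P. indicator A w * q w) = (LINT w|P. indicator A w * (q w - r w))"
   using r(1) A by (simp add: mds_def)
  also have "\<bar>...\<bar> \<le> nrm P (indicator A) * nrm P (%w. q w - r w)"
   by (intro L2fun_CS LA L2fun_diff L mds_L2 r(1))
  also have "... \<le> 1 * eps" by (intro mult_mono nA r(2)) auto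
  finally show ?thesis by simp
 qed
 then have "\<bar>\<integral>w. indicator A w * q w \<partial>P\<bar> \<le> 0" by (rule field_le_epsilon)
 then show "(LINT w|P. indicator A w * q w) = 0" by simp
qed

end

section \<open>Convergence of martingales in quadratic mean\<close>

text \<open>Serves measurability: a limit can be computed from any tail, hence along decreasing
  sigma-fields it is measurable for each of them.\<close>

lemma lim_ignore_initial_segment: "lim (%n. X (n + N)) = lim (X :: nat => real)"
proof -
 have "(%n. X (n + N)) \<longlonglongrightarrow> L \<longleftrightarrow> X \<longlonglongrightarrow> L" for L
  using LIMSEQ_ignore_initial_segment[of X L N] LIMSEQ_offset[of X N L] by blast
 then show ?thesis by (simp add: lim_def)
qed

text \<open>Completeness of L2, with the limit given as the pointwise \<open>lim\<close> of an
  explicit subsequence. In this form its measurability with respect to smaller sigma-fields can be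
  read off from the members of the subsequence.\<close>

lemma (in prob_space) L2_Cauchy_limit:
 fixes f :: "nat => 'a => real"
 assumes L: "\<And>n. L2fun M (f n)"
  and Cauchy: "\<And>eps. eps > 0 ==> \<exists>N. \<forall>m\<ge>N. \<forall>n\<ge>N. nrm M (%x. f m x - f n x) \<le> eps"
 shows "\<exists>r. strict_mono r \<and> L2fun M (%x. lim (%n. f (r n) x)) \<and>
  (%n. nrm M (%x. f n x - lim (%n. f (r n) x))) \<longlonglongrightarrow> 0"
proof -
 have fm [measurable]: "bmeas M (f n)" for n using L by (auto dest: L2fun_measurable)
 have "\<forall>k. \<exists>N. \<forall>m\<ge>N. \<forall>n\<ge>N. nrm M (%x. f m x - f n x) \<le> (1 / 2) ^ k"
  using Cauchy by simp
 then obtain N where N: "\<And>k m n. N k \<le> m ==> N k \<le> n ==> nrm M (%x. f m x - f n x) \<le> (1 / 2) ^ k"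
  by metis
 \<comment> \<open>The subsequence stays beyond \<open>N k\<close>, which makes consecutive
   distances at most (1/2)^k and hence summable; the other argument of the maximum makes it strictly
   increasing.\<close>
 define r where "r = rec_nat (N 0) (%k x. max (Suc x) (N (Suc k)))"
 have r_Suc: "r (Suc k) = max (Suc (r k)) (N (Suc k))" for k by (simp add: r_def)
 have rN: "N k \<le> r k" for k by (cases k) (auto simp: r_def)
 have r: "strict_mono r" by (simp add: strict_mono_Suc_iff r_Suc less_max_iff_disj)
 let ?d = "%k x. f (r (Suc k)) x - f (r k) x"
 have dn: "nrm M (?d k) \<le> (1 / 2) ^ k" for k
  using rN[of k] strict_monoD[OF r, of k "Suc k"] by (intro N) auto
 have "(\<integral>\<^sup>+x. (\<Sum>k. ennreal \<bar>?d k x\<bar>) \<partial>M) = (\<Sum>k. \<integral>\<^sup>+x. ennreal \<bar>?d k x\<bar> \<partial>M)"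
  by (rule nn_integral_suminf) measurable
 also have "... \<le> (\<Sum>k. ennreal ((1 / 2) ^ k))"
 proof (intro suminf_le allI)
  fix k
  have "(\<integral>\<^sup>+x. ennreal \<bar>?d k x\<bar> \<partial>M) \<le> norm2 M (?d k)"
   by (rule norm1_le_norm2) measurable
  also have "... = ennreal (nrm M (?d k))" by (intro norm2_L2 L2fun_diff L)
  finally show "(\<integral>\<^sup>+x. ennreal \<bar>?d k x\<bar> \<partial>M) \<le> ennreal ((1 / 2) ^ k)"
   using dn[of k] ennreal_leI order_trans by blast
 qed auto
 also have "... = ennreal (\<Sum>k. (1 / 2) ^ k)"
  by (rule suminf_ennreal2) (auto simp: summable_geometric)
 also have "... < \<infinity>" by simp
 finally have "AE x in M. (\<Sum>k. ennreal \<bar>?d k x\<bar>) \<noteq> \<infinity>"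
  by (intro nn_integral_PInf_AE) auto
 then have conv: "AE x in M. (%n. f (r n) x) \<longlonglongrightarrow> lim (%n. f (r n) x)"
 proof eventually_elim
  case (elim x)
  then have "summable (%k. \<bar>?d k x\<bar>)"
   by (intro summable_suminf_not_top) auto
  then have "summable (%k. ?d k x)" by (rule summable_rabs_cancel)
  then have "convergent (%n. \<Sum>k<n. ?d k x)" by (simp add: summable_iff_convergent)
  moreover have "(\<Sum>k<n. ?d k x) = f (r n) x - f (r 0) x" for n
   by (rule sum_lessThan_telescope)
  ultimately have "convergent (%n. f (r n) x - f (r 0) x)" by (simp only:)
  then have "convergent (%n. f (r n) x)"
   using convergent_add[OF _ convergent_const[of "f (r 0) x"]] by force
  then show ?case by (simp add: convergent_LIMSEQ_iff)
 qed
 let ?Z = "%x. lim (%n. f (r n) x)"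
 have Zm [measurable]: "bmeas M ?Z" by (rule borel_measurable_lim_metric) measurable
 \<comment> \<open>Fatou's lemma along the subsequence turns the Cauchy estimate into an estimate of
   the distance to the limit, and gives square integrability of the limit on the way.\<close>
 have bound: "(\<integral>\<^sup>+x. ennreal ((f m x - ?Z x)\<^sup>2) \<partial>M) \<le> ennreal (((1 / 2) ^ k)\<^sup>2)" if "m \<ge> N k" for m k
 proof -
  have "(\<integral>\<^sup>+x. ennreal ((f m x - ?Z x)\<^sup>2) \<partial>M)
    = (\<integral>\<^sup>+x. liminf (%n. ennreal ((f m x - f (r n) x)\<^sup>2)) \<partial>M)"
  proof (rule nn_integral_cong_AE, use conv in eventually_elim)
   case (elim x)
   then have "(%n. ennreal ((f m x - f (r n) x)\<^sup>2)) \<longlonglongrightarrow> ennreal ((f m x - ?Z x)\<^sup>2)"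
    by (intro tendsto_ennrealI tendsto_intros)
   then show ?case using lim_imp_Liminf[of sequentially] by (metis trivial_limit_sequentially)
  qed
  also have "... \<le> liminf (%n. \<integral>\<^sup>+x. ennreal ((f m x - f (r n) x)\<^sup>2) \<partial>M)"
   by (rule nn_integral_liminf) measurable
  also have "... \<le> liminf (%n. ennreal (((1 / 2) ^ k)\<^sup>2))"
  proof (rule Liminf_mono, rule eventually_sequentiallyI[of k])
   fix n assume "k \<le> n"
   then have "N k \<le> r n" using rN[of k] strict_mono_leD[OF r, of k n] by linarith
   then have "nrm M (%x. f m x - f (r n) x) \<le> (1 / 2) ^ k" using that by (intro N) auto
   then show "(\<integral>\<^sup>+x. ennreal ((f m x - f (r n) x)\<^sup>2) \<partial>M) \<le> ennreal (((1 / 2) ^ k)\<^sup>2)"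
    by (subst nrm_ennreal[OF L2fun_diff[OF L L]]) (intro ennreal_leI power_mono, auto)
  qed
  also have "... = ennreal (((1 / 2) ^ k)\<^sup>2)" by (simp add: Liminf_const)
  finally show ?thesis .
 qed
 have LZd: "L2fun M (%x. f m x - ?Z x)" if "m \<ge> N k" for m k
  using bound[OF that] by (subst nn_integral_power2_finite_iff) (measurable, auto intro: le_less_trans)
 have LZ: "L2fun M ?Z"
  using L2fun_diff[OF L LZd[of 0 "N 0"], of "N 0"] by simp
 have "null_seq (%n. nrm M (%x. f n x - ?Z x))"
 proof (rule LIMSEQ_I)
  fix eps :: real assume "eps > 0"
  then obtain k where k: "(1 / 2) ^ k < eps" using real_arch_pow_inv[of eps "1/2"] by auto
  have "nrm M (%x. f n x - ?Z x) < eps" if n: "n \<ge> N k" for n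
  proof -
   have "ennreal ((nrm M (%x. f n x - ?Z x))\<^sup>2) \<le> ennreal (((1 / 2) ^ k)\<^sup>2)"
    using bound[OF n] nrm_ennreal[OF LZd[OF n]] by simp
   then have "(nrm M (%x. f n x - ?Z x))\<^sup>2 \<le> ((1 / 2) ^ k)\<^sup>2" by simp
   then have "nrm M (%x. f n x - ?Z x) \<le> (1 / 2) ^ k" by (rule power2_le_imp_le) simp
   with k show ?thesis by simp
  qed
  then show "\<exists>no. \<forall>n\<ge>no. norm (nrm M (%x. f n x - ?Z x) - 0) < eps" by auto
 qed
 with r LZ show ?thesis by blast
qed

context shift
begin

lemma cond_exp_L2:
 assumes "sigma_finite_subalgebra P F" and Y: "L2fun P Y"
 shows "L2fun P (real_cond_exp P F Y)"
  and "\<And>Z. L2fun P Z ==> Z \<in> borel_measurable F ==>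
   (LINT w|P. real_cond_exp P F Y w * Z w) = (LINT w|P. Y w * Z w)"
proof -
 interpret sigma_finite_subalgebra P F by fact
 have "integrable P (%x. (real_cond_exp P F Y x)\<^sup>2)"
  by (rule integrable_convex_cond_exp[where I = UNIV])
   (use Y L2fun_integrable[OF Y] in \<open>auto simp: L2fun_square convex_power2\<close>)
 then show "L2fun P (real_cond_exp P F Y)" by (simp add: L2fun_def)
 fix Z assume Z: "L2fun P Z" "bmeas F Z"
 show "(LINT w|P. real_cond_exp P F Y w * Z w) = (LINT w|P. Y w * Z w)"
  using real_cond_exp_intg(2)[OF L2fun_mult_integrable[OF Z(1) Y] Z(2)] L2fun_measurable[OF Y]
  by (simp add: mult.commute)
qed

abbreviation "ce i Y \<equiv> real_cond_exp P (Fil i) Y"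

lemmas ce_L2 = cond_exp_L2(1)[OF sfs_Fil]
lemmas ce_inner = cond_exp_L2(2)[OF sfs_Fil]

lemma ce_inner2:
 assumes "L2fun P Y" "i \<le> j"
 shows "(LINT w|P. ce j Y w * ce i Y w) = (nrm P (ce i Y))\<^sup>2"
proof -
 have "bmeas (Fil j) (ce i Y)"
  by (rule measurable_Fil_mono[OF borel_measurable_cond_exp assms(2)])
 then have "(LINT w|P. ce j Y w * ce i Y w) = (LINT w|P. Y w * ce i Y w)"
  by (intro ce_inner ce_L2 assms)
 also have "... = (LINT w|P. ce i Y w * ce i Y w)"
  by (intro ce_inner[symmetric] ce_L2 assms) auto
 finally show ?thesis by (simp add: nrm_power2) (simp add: power2_eq_square)
qed

lemma ce_nrm_diff:
 assumes "L2fun P Y" "i \<le> j"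
 shows "(nrm P (%w. ce j Y w - ce i Y w))\<^sup>2 = (nrm P (ce j Y))\<^sup>2 - (nrm P (ce i Y))\<^sup>2"
 by (simp add: nrm_power2_diff ce_L2 assms ce_inner2)

lemma ce_nrm_diff_self:
 assumes "L2fun P Y"
 shows "(nrm P (%w. Y w - ce i Y w))\<^sup>2 = (nrm P Y)\<^sup>2 - (nrm P (ce i Y))\<^sup>2"
proof -
 have "(LINT w|P. Y w * ce i Y w) = (nrm P (ce i Y))\<^sup>2"
  using ce_inner[OF assms ce_L2[OF assms], of i i] by (simp add: nrm_power2) (simp add: power2_eq_square)
 then show ?thesis by (simp add: nrm_power2_diff ce_L2 assms)
qed

lemma ce_nrm_le:
 assumes "L2fun P Y" shows "nrm P (ce i Y) \<le> nrm P Y"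
proof (rule power2_le_imp_le)
 show "(nrm P (ce i Y))\<^sup>2 \<le> (nrm P Y)\<^sup>2"
  using ce_nrm_diff_self[OF assms, of i] zero_le_power2[of "nrm P (%w. Y w - ce i Y w)"] by linarith
qed simp

lemma ce_nrm_diff_self_le:
 assumes "L2fun P Y" shows "nrm P (%w. Y w - ce i Y w) \<le> nrm P Y"
proof (rule power2_le_imp_le)
 show "(nrm P (%w. Y w - ce i Y w))\<^sup>2 \<le> (nrm P Y)\<^sup>2"
  using ce_nrm_diff_self[OF assms, of i] zero_le_power2[of "nrm P (ce i Y)"] by linarith
qed simp

lemma ce_nrm_mono: "L2fun P Y ==> i \<le> j ==> (nrm P (ce i Y))\<^sup>2 \<le> (nrm P (ce j Y))\<^sup>2"
 using ce_nrm_diff[of Y i j] zero_le_power2[of "nrm P (%w. ce j Y w - ce i Y w)"] by linarith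

text \<open>The squared norms of the conditional expectations are monotone and bounded, hence
  Cauchy; by Pythagoras their differences are the squared norms of the differences. The same
  argument serves the index running to either end.\<close>

lemma ce_Cauchy:
 assumes Y: "L2fun P Y" and s: "s = (%n. int n) \<or> s = (%n. - int n)" and "eps > 0"
 shows "\<exists>N. \<forall>m\<ge>N. \<forall>n\<ge>N. nrm P (%w. ce (s m) Y w - ce (s n) Y w) \<le> eps"
proof -
 let ?a = "%n. (nrm P (ce (s n) Y))\<^sup>2"
 have b: "?a n \<le> (nrm P Y)\<^sup>2" for n by (intro power_mono ce_nrm_le Y) auto
 have "Bseq ?a" by (rule BseqI'[of _ "(nrm P Y)\<^sup>2"]) (use b in auto)
 moreover have "monoseq ?a"
  unfolding monoseq_def
 proof (rule disjE[OF s])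
  assume s: "s = (%n. int n)"
  have "?a m \<le> ?a n" if "m \<le> n" for m n unfolding s by (rule ce_nrm_mono[OF Y]) (use that in simp)
  then show "(\<forall>m n. m \<le> n \<longrightarrow> ?a m \<le> ?a n) \<or> (\<forall>m n. m \<le> n \<longrightarrow> ?a n \<le> ?a m)" by blast
 next
  assume s: "s = (%n. - int n)"
  have "?a n \<le> ?a m" if "m \<le> n" for m n unfolding s by (rule ce_nrm_mono[OF Y]) (use that in simp)
  then show "(\<forall>m n. m \<le> n \<longrightarrow> ?a m \<le> ?a n) \<or> (\<forall>m n. m \<le> n \<longrightarrow> ?a n \<le> ?a m)" by blast
 qed
 ultimately have "Cauchy ?a" by (intro convergent_Cauchy Bseq_monoseq_convergent)
 then obtain N where N: "\<And>m n. m \<ge> N ==> n \<ge> N ==> \<bar>?a m - ?a n\<bar> < eps\<^sup>2"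
  using assms(3) unfolding Cauchy_def dist_real_def by (meson zero_less_power)
 have "nrm P (%w. ce (s m) Y w - ce (s n) Y w) \<le> eps" if "m \<ge> N" "n \<ge> N" for m n
 proof -
  have "(nrm P (%w. ce (s m) Y w - ce (s n) Y w))\<^sup>2 \<le> \<bar>?a m - ?a n\<bar>"
  proof (cases "s m \<le> s n")
   case True
   then show ?thesis using ce_nrm_diff[OF Y True] by (simp add: nrm_commute[of P "ce (s m) Y"])
  next
   case False
   then show ?thesis using ce_nrm_diff[OF Y, of "s n" "s m"] by simp
  qed
  also have "... \<le> eps\<^sup>2" using N[OF that] by simp
  finally show ?thesis by (rule power2_le_imp_le) (use assms(3) in simp)
 qed
 then show ?thesis by blast
qed

lemma indicator_L2: "A \<in> sets P ==> L2fun P (indicator A)"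
 by (rule L2fun_bound[OF L2fun_const[of 1]]) (auto simp: indicator_def)

lemma inner_tendsto:
 assumes "\<And>n. L2fun P (f n)" "L2fun P Z" "L2fun P V" "null_seq (%n. nrm P (%w. f n w - Z w))"
 shows "(%n. \<integral>w. V w * f n w \<partial>P) \<longlonglongrightarrow> (LINT w|P. V w * Z w)"
proof -
 have z: "null_seq (%n. nrm P V * nrm P (%w. f n w - Z w))"
  using tendsto_mult_right_zero[OF assms(4)] by simp
 have b: "norm ((LINT w|P. V w * f n w) - (LINT w|P. V w * Z w)) \<le> nrm P V * nrm P (%w. f n w - Z w)" for n
 proof -
  have "(LINT w|P. V w * f n w) - (LINT w|P. V w * Z w) = (LINT w|P. V w * (f n w - Z w))"
   using L2fun_mult_integrable[OF assms(3,1)] L2fun_mult_integrable[OF assms(3,2)]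
   by (simp add: right_diff_distrib)
  then show ?thesis using L2fun_CS[OF assms(3) L2fun_diff[OF assms(1,2)]] by simp
 qed
 have "null_seq (%n. (LINT w|P. V w * f n w) - (LINT w|P. V w * Z w))"
  by (rule Lim_null_comparison[OF always_eventually[OF allI[OF b]] z])
 then show ?thesis by (rule LIM_zero_cancel)
qed

lemma ce_set_integral:
 assumes "L2fun P Y" "A \<in> sets (Fil i)"
 shows "(LINT w|P. indicator A w * ce i Y w) = (LINT w|P. indicator A w * Y w)"
 using ce_inner[OF assms(1) indicator_L2[OF sets_Fil_P[OF assms(2)]], of i] assms(2)
 by (simp add: mult.commute)

text \<open>The intersection of the sigma-fields is itself a sigma-field.\<close>

lemma sets_filt_minf: "A \<in> sets (filt_minf P T F0) \<longleftrightarrow> (\<forall>i. A \<in> sets (Fil i))"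
proof
 have sub: "(\<Inter>i. sets (Fil i)) \<subseteq> Pow (space P)"
  using sets.sets_into_space[of _ "Fil 0"] by auto
 have eq: "sets (filt_minf P T F0) = sigma_sets (space P) (\<Inter>i. sets (Fil i))"
  unfolding filt_minf_def by (rule sets_measure_of[OF sub])
 show "A \<in> sets (filt_minf P T F0)" if "\<forall>i. A \<in> sets (Fil i)"
  using that by (auto simp: eq)
 assume A: "A \<in> sets (filt_minf P T F0)"
 show "\<forall>i. A \<in> sets (Fil i)"
 proof
  fix i
  have "sigma_sets (space (Fil i)) (\<Inter>i. sets (Fil i)) \<subseteq> sets (Fil i)"
   by (rule sets.sigma_sets_subset) auto
  then show "A \<in> sets (Fil i)" using A by (auto simp: eq)
 qed
qed

lemma space_filt_minf [simp]: "space (filt_minf P T F0) = space P"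
 by (simp add: filt_minf_def space_measure_of_conv)

lemma space_filt_inf [simp]: "space (filt_inf P T F0) = space P"
 by (simp add: filt_inf_def space_measure_of_conv)

lemma sets_filt_inf: "sets (filt_inf P T F0) = sigma_sets (space P) (\<Union>i. sets (Fil i))"
 unfolding filt_inf_def
 by (rule sets_measure_of) (use sets.sets_into_space[of _ "Fil _"] in auto)

lemma sfs_filt_minf: "sigma_finite_subalgebra P (filt_minf P T F0)"
proof -
 have "subalgebra P (filt_minf P T F0)"
  using sets_Fil_P by (auto simp: subalgebra_def sets_filt_minf)
 then show ?thesis using finite_measure_axioms
  by (intro finite_measure_subalgebra_is_sigma_finite finite_measure_subalgebra.intro
   finite_measure_subalgebra_axioms.intro)
qed

lemma sfs_filt_inf: "sigma_finite_subalgebra P (filt_inf P T F0)"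
proof -
 have "sets (filt_inf P T F0) \<subseteq> sets P"
  unfolding sets_filt_inf by (rule sets.sigma_sets_subset) (auto intro: sets_Fil_P)
 then have "subalgebra P (filt_inf P T F0)" by (simp add: subalgebra_def)
 then show ?thesis using finite_measure_axioms
  by (intro finite_measure_subalgebra_is_sigma_finite finite_measure_subalgebra.intro
   finite_measure_subalgebra_axioms.intro)
qed

text \<open>Backward martingale convergence: the L2 limit is measurable for every
  \<open>Fil i\<close>, hence for their intersection, and has the integrals of \<open>Y\<close> over
  its sets. So it is the conditional expectation of \<open>Y\<close>, which vanishes by
  assumption.\<close>

lemma ce_minf_tendsto:
 assumes Y: "L2fun P Y" and zero: "AE w in P. real_cond_exp P (filt_minf P T F0) Y w = 0"
 shows "null_seq (%n. nrm P (ce (- int n) Y))"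
proof -
 interpret G: sigma_finite_subalgebra P "filt_minf P T F0" by (rule sfs_filt_minf)
 let ?f = "%n. ce (- int n) Y"
 obtain r where r: "strict_mono r" and LZ: "L2fun P (%w. lim (%n. ?f (r n) w))"
  and conv: "null_seq (%n. nrm P (%w. ?f n w - lim (%n. ?f (r n) w)))"
  using L2_Cauchy_limit[OF ce_L2[OF Y] ce_Cauchy[OF Y], of "%n. - int n"] by auto
 define Z where "Z w = lim (%n. ?f (r n) w)" for w
 have Zi: "bmeas (Fil i) Z" for i
 proof -
  have "Z = (%w. lim (%n. ?f (r (n + nat (- i))) w))"
   by (rule ext) (simp only: Z_def lim_ignore_initial_segment[of "%n. ?f (r n) _"])
  moreover have "bmeas (Fil i) (%w. lim (%n. ?f (r (n + nat (- i))) w))"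
  proof (rule borel_measurable_lim_metric)
   fix n
   \<comment> \<open>A strictly increasing \<open>r\<close> satisfies m \<le> r m; after
     \<open>nat (- i)\<close> terms are dropped, all indices of the sigma-fields are therefore at
     most i.\<close>
   have "n + nat (- i) \<le> r (n + nat (- i))" by (rule strict_mono_imp_increasing[OF r])
   then show "bmeas (Fil i) (%w. ?f (r (n + nat (- i))) w)"
    by (intro measurable_Fil_mono[OF borel_measurable_cond_exp]) linarith
  qed
  ultimately show ?thesis by (simp only:)
 qed
 have Zm: "bmeas (filt_minf P T F0) Z"
  by (rule measurableI) (use measurable_sets[OF Zi] in \<open>auto simp: sets_filt_minf\<close>)
 have LZ: "L2fun P Z" using LZ by (simp add: Z_def[abs_def])
 have conv: "null_seq (%n. nrm P (%w. ?f n w - Z w))" using conv by (simp add: Z_def)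
 have "AE w in P. real_cond_exp P (filt_minf P T F0) Y w = Z w"
 proof (rule G.real_cond_exp_charact)
  fix A assume A: "A \<in> sets (filt_minf P T F0)"
  then have Ai: "A \<in> sets (Fil i)" for i by (simp add: sets_filt_minf)
  have "(%n. \<integral>w. indicator A w * ?f n w \<partial>P) \<longlonglongrightarrow> (LINT w|P. indicator A w * Z w)"
   by (rule inner_tendsto[OF ce_L2[OF Y] LZ indicator_L2[OF sets_Fil_P[OF Ai]] conv])
  then have "(LINT w|P. indicator A w * Y w) = (LINT w|P. indicator A w * Z w)"
   unfolding ce_set_integral[OF Y Ai] by (rule LIMSEQ_unique[OF tendsto_const])
  then show "(\<integral>w\<in>A. Y w \<partial>P) = (\<integral>w\<in>A. Z w \<partial>P)" by (simp add: set_lebesgue_integral_def)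
 qed (use L2fun_integrable Y LZ Zm in auto)
 with zero have "AE w in P. Z w = 0" by eventually_elim simp
 then have "nrm P (%w. ?f n w - Z w) = nrm P (?f n)" for n
  using L2fun_measurable[OF LZ] by (intro nrm_cong_AE) auto
 with conv show ?thesis by simp
qed

text \<open>Forward martingale convergence: the L2 limit and \<open>Y\<close> have equal integrals
  over every set of every \<open>Fil i\<close>. The union of the \<open>Fil i\<close> is closed
  under intersection, so equality extends to the sigma-field it generates, and both are conditional
  expectations of \<open>Y\<close> there.\<close>

lemma ce_inf_tendsto:
 assumes Y: "L2fun P Y" and eq: "AE w in P. real_cond_exp P (filt_inf P T F0) Y w = Y w"
 shows "null_seq (%n. nrm P (%w. Y w - ce (int n) Y w))"
proof -
 interpret G: sigma_finite_subalgebra P "filt_inf P T F0" by (rule sfs_filt_inf)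
 let ?f = "%n. ce (int n) Y"
 obtain r where r: "strict_mono r" and LZ: "L2fun P (%w. lim (%n. ?f (r n) w))"
  and conv: "null_seq (%n. nrm P (%w. ?f n w - lim (%n. ?f (r n) w)))"
  using L2_Cauchy_limit[OF ce_L2[OF Y] ce_Cauchy[OF Y], of "%n. int n"] by auto
 define Z where "Z w = lim (%n. ?f (r n) w)" for w
 have sub: "subalgebra (filt_inf P T F0) (Fil i)" for i
  by (auto simp: subalgebra_def sets_filt_inf)
 have Zm: "bmeas (filt_inf P T F0) Z"
  unfolding Z_def[abs_def]
  by (intro borel_measurable_lim_metric measurable_from_subalg[OF sub borel_measurable_cond_exp])
 have LZ: "L2fun P Z" using LZ by (simp add: Z_def[abs_def])
 have conv: "null_seq (%n. nrm P (%w. ?f n w - Z w))" using conv by (simp add: Z_def)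
 have Yi: "integrable P Y" and Zi: "integrable P Z" by (simp_all add: L2fun_integrable Y LZ)
 have basic: "(\<integral>w\<in>A. Y w \<partial>P) = (\<integral>w\<in>A. Z w \<partial>P)" if A: "A \<in> sets (Fil i)" for A i
 proof -
  have "(%n. \<integral>w. indicator A w * ?f n w \<partial>P) \<longlonglongrightarrow> (LINT w|P. indicator A w * Z w)"
   by (rule inner_tendsto[OF ce_L2[OF Y] LZ indicator_L2[OF sets_Fil_P[OF A]] conv])
  moreover have "(%n. \<integral>w. indicator A w * ?f n w \<partial>P) \<longlonglongrightarrow> (LINT w|P. indicator A w * Y w)"
  proof (rule tendsto_eventually, rule eventually_sequentiallyI[of "nat i"])
   fix n assume "nat i \<le> n"
   then have "i \<le> int n" by linarith
   then have "A \<in> sets (Fil (int n))" using A Fil_mono[of i "int n"] by auto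
   then show "(LINT w|P. indicator A w * ?f n w) = (LINT w|P. indicator A w * Y w)"
    by (rule ce_set_integral[OF Y])
  qed
  ultimately have "(LINT w|P. indicator A w * Y w) = (LINT w|P. indicator A w * Z w)"
   by (rule LIMSEQ_unique[rotated])
  then show ?thesis by (simp add: set_lebesgue_integral_def)
 qed
 have si: "set_integrable P A Y" "set_integrable P A Z" if "A \<in> sets P" for A
  using integrable_mult_indicator[OF that Yi] integrable_mult_indicator[OF that Zi]
  by (auto simp: set_integrable_def)
 have "AE w in P. real_cond_exp P (filt_inf P T F0) Y w = Z w"
 proof (rule G.real_cond_exp_charact[OF _ Yi Zi Zm])
  fix A assume "A \<in> sets (filt_inf P T F0)"
  then have A: "A \<in> sigma_sets (space P) (\<Union>i. sets (Fil i))" by (simp add: sets_filt_inf)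
  have sP: "B \<in> sets P" if "B \<in> sigma_sets (space P) (\<Union>i. sets (Fil i))" for B
   using that G.subalg by (auto simp: subalgebra_def sets_filt_inf)
  have Is: "Int_stable (\<Union>i. sets (Fil i))"
  proof (rule Int_stableI)
   fix B C assume "B \<in> (\<Union>i. sets (Fil i))" "C \<in> (\<Union>i. sets (Fil i))"
   then obtain i j where "B \<in> sets (Fil i)" "C \<in> sets (Fil j)" by auto
   then have "B \<inter> C \<in> sets (Fil (max i j))"
    using Fil_mono[of i "max i j"] Fil_mono[of j "max i j"] by auto
   then show "B \<inter> C \<in> (\<Union>i. sets (Fil i))" by blast
  qed
  have Pw: "(\<Union>i. sets (Fil i)) \<subseteq> Pow (space P)"
   using sets.sets_into_space[of _ "Fil _"] by auto
  show "(\<integral>w\<in>A. Y w \<partial>P) = (\<integral>w\<in>A. Z w \<partial>P)"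
   using Is Pw A
  proof (induction rule: sigma_sets_induct_disjoint)
   case (basic A)
   then show ?case using \<open>\<And>A i. A \<in> sets (Fil i) ==> (\<integral>w\<in>A. Y w \<partial>P) = (\<integral>w\<in>A. Z w \<partial>P)\<close> by blast
  next
   case empty
   show ?case by (simp add: set_lebesgue_integral_def)
  next
   case (compl A)
   have AP: "A \<in> sets P" using compl(1) by (rule sP)
   have *: "(\<integral>w\<in>space P - A. f w \<partial>P) = (LINT w|P. f w) - (\<integral>w\<in>A. f w \<partial>P)"
    if f: "integrable P f" for f :: "'w => real"
   proof -
    have "(\<integral>w\<in>space P - A. f w \<partial>P) = (LINT w|P. f w - indicator A w *\<^sub>R f w)"
     unfolding set_lebesgue_integral_def
     by (rule Bintegral_cong) (auto simp: indicator_def)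
    then show ?thesis
     using f integrable_mult_indicator[OF AP f] by (simp add: set_lebesgue_integral_def)
   qed
   have "(\<integral>w\<in>space P. Y w \<partial>P) = (\<integral>w\<in>space P. Z w \<partial>P)"
    by (rule basic[of _ 0]) (metis sets.top space_Fil)
   then have "(LINT w|P. Y w) = (LINT w|P. Z w)" by (simp add: set_integral_space Yi Zi)
   then show ?case using compl by (simp add: * Yi Zi)
  next
   case (union A)
   have AP: "A i \<in> sets P" for i using union(2) sP by auto
   have dis: "i \<noteq> j ==> A i \<inter> A j = {}" for i j using union(1) by (auto simp: disjoint_family_on_def)
   have U: "(\<Union>i. A i) \<in> sets P" using AP by auto
   show ?case
    using lebesgue_integral_countable_add[OF AP dis si(1)[OF U]]
     lebesgue_integral_countable_add[OF AP dis si(2)[OF U]] union.IH by simp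
  qed
 qed
 with eq have "AE w in P. Z w = Y w" by eventually_elim simp
 then have "nrm P (%w. ?f n w - Z w) = nrm P (%w. ?f n w - Y w)" for n
  using L2fun_measurable[OF LZ] L2fun_measurable[OF Y] by (intro nrm_cong_AE) auto
 with conv show ?thesis by (simp add: nrm_commute[of P Y])
qed

text \<open>\<open>F0\<close> and \<open>Fil 0\<close> have the same sets but may differ as
  measures; the conditional expectation reads only the space and the sets of its second
  argument.\<close>

lemma real_cond_exp_F0: "real_cond_exp P F0 Y = ce 0 Y"
proof -
 have "restr_to_subalg M F0 = restr_to_subalg M (Fil 0)" for M :: "'w measure"
  by (simp add: restr_to_subalg_def sets_Fil_0)
 moreover have "subalgebra P F0 \<longleftrightarrow> subalgebra P (Fil 0)"
  using F0 Fil_subalgebra by simp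
 ultimately have "nn_cond_exp P F0 f = nn_cond_exp P (Fil 0) f" for f
  by (simp add: nn_cond_exp_def)
 then show ?thesis by (simp add: real_cond_exp_def)
qed

section \<open>Expansion of a random variable into martingale increments\<close>

lemma P0_eq: "P0 P T F0 Y = (%w. ce 0 Y w - ce (- 1) Y w)"
 by (simp add: P0_def[abs_def] real_cond_exp_F0)

lemma mds_P0:
 assumes "L2fun P Y" shows "mds (P0 P T F0 Y)"
 unfolding mds_def P0_eq
proof (intro conjI ballI)
 show "L2fun P (%w. ce 0 Y w - ce (- 1) Y w)" by (intro L2fun_diff ce_L2 assms)
 show "bmeas F0 (%w. ce 0 Y w - ce (- 1) Y w)"
  unfolding measurable_F0_Fil
  by (intro borel_measurable_diff measurable_Fil_mono[OF borel_measurable_cond_exp]) auto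
 fix A assume A: "A \<in> sets (Fil (- 1))"
 have A0: "A \<in> sets (Fil 0)" using A Fil_mono[of "-1" 0] by auto
 have "(LINT w|P. indicator A w * (ce 0 Y w - ce (- 1) Y w))
   = (LINT w|P. indicator A w * ce 0 Y w) - (LINT w|P. indicator A w * ce (- 1) Y w)"
  using L2fun_integrable[OF ce_L2[OF assms]] sets_Fil_P[OF A]
  by (simp add: right_diff_distrib indicator_mult_integrable)
 also have "... = 0" by (simp only: ce_set_integral[OF assms A] ce_set_integral[OF assms A0])
 finally show "(LINT w|P. indicator A w * (ce 0 Y w - ce (- 1) Y w)) = 0" .
qed

lemma mds_cong_AE:
 assumes "mds q" "AE w in P. r w = q w" "bmeas F0 r"
 shows "mds r"
 unfolding mds_def
proof (intro conjI ballI assms(3))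
 have rm: "bmeas P r" using measurable_F0[OF assms(3)] .
 show "L2fun P r" by (rule L2fun_cong_AE[OF _ mds_L2[OF assms(1)] rm]) (use assms(2) in auto)
 fix A assume A: "A \<in> sets (Fil (- 1))"
 have "(LINT w|P. indicator A w * r w) = (LINT w|P. indicator A w * q w)"
  using rm L2fun_measurable[OF mds_L2[OF assms(1)]] sets_Fil_P[OF A]
  by (intro integral_cong_AE) (use assms(2) in auto)
 then show "(LINT w|P. indicator A w * r w) = 0" using assms(1) A by (simp add: mds_def)
qed

text \<open>Shifted back by k, the projection of the k-th translate becomes E(Y | F_{-k}) - E(Y |
  F_{-k-1}), so the sum over a symmetric window telescopes.\<close>

lemma P0_tau_telescope:
 assumes Y: "L2fun P Y"
 shows "AE w in P. (\<Sum>k\<in>{- int K..int K}. P0 P T F0 (%w. Y (tau k w)) (tau (- k) w))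
  = ce (int K) Y w - ce (- int K - 1) Y w"
proof -
 have Yi: "integrable P Y" by (rule L2fun_integrable[OF Y])
 have *: "AE w in P. P0 P T F0 (%w. Y (tau k w)) (tau (- k) w) = ce (- k) Y w - ce (- k - 1) Y w" for k
 proof -
  have "AE w in P. ce (- k + j) Y w = ce j (%w. Y (tau k w)) (tau (- k) w)" for j
  proof -
   have "ce (- k + j) (%w. Y (tau k (tau (- k) w))) = ce (- k + j) (%w. Y (tau k (tau (- k) w)))" ..
   have "AE w in P. ce (- k + j) (%w. Y (tau k (tau (- k) w))) w = ce j (%w. Y (tau k w)) (tau (- k) w)"
    using cond_exp_tau[OF integrable_tau[OF Yi, of k], of "- k" j] by simp
   moreover have "AE w in P. ce (- k + j) (%w. Y (tau k (tau (- k) w))) w = ce (- k + j) Y w"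
    by (rule sigma_finite_subalgebra.real_cond_exp_cong[OF sfs_Fil])
     (use Yi L2fun_measurable[OF Y] in \<open>auto simp: tau_add intro!: AE_I2\<close>)
   ultimately show ?thesis by eventually_elim simp
  qed
  from this[of 0] this[of "- 1"] show ?thesis by eventually_elim (simp add: P0_eq)
 qed
 have "AE w in P. \<forall>k. P0 P T F0 (%w. Y (tau k w)) (tau (- k) w) = ce (- k) Y w - ce (- k - 1) Y w"
  using * by (simp add: AE_all_countable)
 then show ?thesis
 proof eventually_elim
  case (elim w)
  have "(\<Sum>k\<in>{- int K..int K}. ce (- k) Y w - ce (- k - 1) Y w) = ce (int K) Y w - ce (- int K - 1) Y w"
  proof (induction K)
   case (Suc K)
   have s: "{- int (Suc K)..int (Suc K)} = insert (- int (Suc K)) (insert (int (Suc K)) {- int K..int K})"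
    by auto
   have e: "1 + int K = int K + 1" "- 1 - int K = - int K - 1" by auto
   have "(\<Sum>k\<in>{- int (Suc K)..int (Suc K)}. ce (- k) Y w - ce (- k - 1) Y w)
     = (ce (int (Suc K)) Y w - ce (int K) Y w) + (ce (- int K - 1) Y w - ce (- int (Suc K) - 1) Y w)
      + (\<Sum>k\<in>{- int K..int K}. ce (- k) Y w - ce (- k - 1) Y w)"
    unfolding s by (simp, simp only: e)
   then show ?case unfolding Suc.IH by simp
  qed simp
  then show ?case using elim by simp
 qed
qed

text \<open>The remainder is the sum of Y - E(Y | F_K) and E(Y | F_{-K-1}). Both vanish in the limit
  by the two convergence theorems; the bound by twice the norm of \<open>Y\<close> later serves as
  the dominating function in t.\<close>

lemma P0_tau_decomposition:
 assumes Y: "L2fun P Y"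
  and "AE w in P. real_cond_exp P (filt_minf P T F0) Y w = 0"
  and "AE w in P. real_cond_exp P (filt_inf P T F0) Y w = Y w"
 defines "R \<equiv> %K w. Y w - (\<Sum>k\<in>{- int K..int K}. P0 P T F0 (%w. Y (tau k w)) (tau (- k) w))"
 shows "null_seq (%K. nrm P (R K))" and "nrm P (R K) \<le> 2 * nrm P Y" and "L2fun P (R K)"
proof -
 have L: "L2fun P (R K)" for K
  unfolding R_def by (intro L2fun_diff Y L2fun_sum L2fun_tau mds_L2 mds_P0)
 have "nrm P (R K) = nrm P (%w. (Y w - ce (int K) Y w) + ce (- int K - 1) Y w)" for K
  using L2fun_measurable[OF Y] L2fun_measurable[OF L[of K]]
  by (intro nrm_cong_AE) (use P0_tau_telescope[OF Y, of K] in \<open>auto simp: R_def\<close>)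
 moreover have "nrm P (%w. (Y w - ce (int K) Y w) + ce (- int K - 1) Y w)
   \<le> nrm P (%w. Y w - ce (int K) Y w) + nrm P (ce (- int K - 1) Y)" for K
  by (intro nrm_triangle L2fun_diff ce_L2 Y)
 ultimately have le: "nrm P (R K) \<le> nrm P (%w. Y w - ce (int K) Y w) + nrm P (ce (- int K - 1) Y)" for K
  by simp
 have "null_seq (%K. nrm P (ce (- int (Suc K)) Y))"
  using ce_minf_tendsto[OF assms(1,2)] by (rule LIMSEQ_Suc)
 moreover have "- int (Suc K) = - int K - 1" for K by simp
 ultimately have "null_seq (%K. nrm P (ce (- int K - 1) Y))" by (simp only:)
 from tendsto_add[OF ce_inf_tendsto[OF assms(1,3)] this]
 have "null_seq (%K. nrm P (%w. Y w - ce (int K) Y w) + nrm P (ce (- int K - 1) Y))" by simp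
 then show "null_seq (%K. nrm P (R K))"
  by (rule tendsto_sandwich[OF _ _ tendsto_const, rotated 2]) (use le in auto)
 show "nrm P (R K) \<le> 2 * nrm P Y"
  using le[of K] ce_nrm_diff_self_le[OF Y, of "int K"] ce_nrm_le[OF Y, of "- int K - 1"] by linarith
 show "L2fun P (R K)" by (rule L)
qed

end

section \<open>Sums of stationary random functions in the mixed norm\<close>

lemma norm2_measurable_P:
 assumes "prob_space P" "joint_meas P mu Y"
 shows "bmeas mu (%t. norm2 P (%x. Y x t))"
proof -
 interpret prob_space P by fact
 show ?thesis by (rule norm2_measurable[OF assms(2)])
qed

lemma joint_section:
 assumes "joint_meas P mu Y" "t \<in> space mu"
 shows "bmeas P (%w. Y w t)"
 using measurable_compose[OF measurable_Pair2'[OF assms(2), of P] assms(1)] by simp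

lemma joint_section1:
 assumes "joint_meas P mu Y" "w \<in> space P"
 shows "bmeas mu (%t. Y w t)"
 using measurable_compose[OF measurable_Pair1'[OF assms(2), of mu] assms(1)] by simp

lemma mixn_triangle:
 assumes "prob_space P" and Y: "joint_meas P mu Y"
  and Z: "joint_meas P mu Z"
 shows "mixn P mu (%w t. Y w t + Z w t) \<le> mixn P mu Y + mixn P mu Z"
proof -
 have "mixn P mu (%w t. Y w t + Z w t) \<le> (\<integral>\<^sup>+t. norm2 P (%w. Y w t) + norm2 P (%w. Z w t) \<partial>mu)"
  unfolding mixn_def by (intro nn_integral_mono norm2_triangle joint_section[OF Y] joint_section[OF Z])
 then show ?thesis
  unfolding mixn_def using norm2_measurable_P[OF assms(1) Y] norm2_measurable_P[OF assms(1) Z]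
  by (simp add: nn_integral_add)
qed

lemma mixn_cmult:
 assumes "prob_space P" and Y: "joint_meas P mu Y"
 shows "mixn P mu (%w t. c * Y w t) = ennreal \<bar>c\<bar> * mixn P mu Y"
proof -
 have "mixn P mu (%w t. c * Y w t) = (\<integral>\<^sup>+t. ennreal \<bar>c\<bar> * norm2 P (%w. Y w t) \<partial>mu)"
  unfolding mixn_def by (intro nn_integral_cong norm2_cmult joint_section[OF Y])
 then show ?thesis
  unfolding mixn_def using norm2_measurable_P[OF assms(1) Y] by (simp add: nn_integral_cmult)
qed

lemma mixn_uminus: "mixn P mu (%w t. - Y w t) = mixn P mu Y"
 by (simp add: mixn_def)

lemma mixn_commute: "mixn P mu (%w t. Y w t - Z w t) = mixn P mu (%w t. Z w t - Y w t)"
 using mixn_uminus[of P mu "%w t. Y w t - Z w t"] by simp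

lemma mixn_triangle_diff:
 assumes "prob_space P" and Y: "joint_meas P mu Y"
  and [measurable]: "joint_meas P mu Z"
 shows "mixn P mu (%w t. Y w t - Z w t) \<le> mixn P mu Y + mixn P mu Z"
 using mixn_triangle[OF assms(1) Y, of "%w t. - Z w t"] by (simp add: mixn_uminus)

lemma mixn_triangle3:
 assumes "prob_space P" and [measurable]: "joint_meas P mu X"
  "joint_meas P mu Y" "joint_meas P mu Z"
 shows "mixn P mu (%w t. X w t - Z w t) \<le> mixn P mu (%w t. X w t - Y w t) + mixn P mu (%w t. Y w t - Z w t)"
 using mixn_triangle[OF assms(1), of "%w t. X w t - Y w t" mu "%w t. Y w t - Z w t"] by simp

lemma mixn_sum:
 assumes "prob_space P" and Y: "\<And>i. i \<in> I ==> joint_meas P mu (Y i)"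
 shows "mixn P mu (%w t. \<Sum>i\<in>I. Y i w t) \<le> (\<Sum>i\<in>I. mixn P mu (Y i))"
proof -
 have "mixn P mu (%w t. \<Sum>i\<in>I. Y i w t) \<le> (\<integral>\<^sup>+t. (\<Sum>i\<in>I. norm2 P (%w. Y i w t)) \<partial>mu)"
  unfolding mixn_def by (intro nn_integral_mono norm2_sum_le joint_section[OF Y])
 then show ?thesis
  unfolding mixn_def using norm2_measurable_P[OF assms(1) Y] by (simp add: nn_integral_sum)
qed

lemma mixn_cong:
 assumes "\<And>t. t \<in> space mu ==> AE w in P. Y w t = Z w t"
  and Y: "joint_meas P mu Y"
  and Z: "joint_meas P mu Z"
 shows "mixn P mu Y = mixn P mu Z"
 unfolding mixn_def
 by (intro nn_integral_cong norm2_cong_AE assms joint_section[OF Y] joint_section[OF Z])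

lemma mixn_L2_AE:
 assumes "prob_space P" and Y: "joint_meas P mu Y"
  and "mixn P mu Y < \<infinity>"
 shows "AE t in mu. L2fun P (%w. Y w t)"
proof -
 have "AE t in mu. norm2 P (%w. Y w t) \<noteq> \<infinity>"
  using nn_integral_PInf_AE[OF norm2_measurable_P[OF assms(1) Y]] assms(3) by (simp add: mixn_def less_top)
 moreover have "AE t in mu. (%w. Y w t) \<in> borel_measurable P"
  using joint_section[OF Y] by (intro AE_I2)
 ultimately show ?thesis
  by eventually_elim (simp add: norm2_finite_iff[symmetric] less_top)
qed

locale shift_mu = shift P T F0 for P :: "'w measure" and T F0 +
 fixes mu :: "'t measure"
 assumes mu: "sigma_finite_measure mu"
begin

sublocale mu: sigma_finite_measure mu by (rule mu)
sublocale Pmu: pair_sigma_finite P mu ..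

lemmas P = prob_space_axioms

lemma joint_F0: "f \<in> measurable (F0 \<Otimes>\<^sub>M mu) N ==> f \<in> measurable (P \<Otimes>\<^sub>M mu) N"
 by (rule measurable_pair_subalgebra[OF F0])

lemma joint_tau:
 assumes "joint_meas P mu Y"
 shows "joint_meas P mu (%w t. Y (tau i w) t)"
proof -
 have "(%(w, t). (tau i w, t)) \<in> measurable (P \<Otimes>\<^sub>M mu) (P \<Otimes>\<^sub>M mu)" by measurable
 from measurable_compose[OF this assms] show ?thesis by (simp add: case_prod_unfold)
qed

lemma joint_tau_sum:
 fixes Y :: "'w => 't => real"
 assumes "joint_meas P mu Y"
 shows "joint_meas P mu (%w t. \<Sum>i\<in>I. Y (tau (g i) w) t)"
proof -
 have "bmeas (P \<Otimes>\<^sub>M mu) (%x. \<Sum>i\<in>I. (%(w, t). Y (tau (g i) w) t) x)"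
  by (rule borel_measurable_sum) (rule joint_tau[OF assms])
 then show ?thesis by (simp add: case_prod_unfold)
qed

lemma mixn_tau:
 assumes "joint_meas P mu Y"
 shows "mixn P mu (%w t. Y (tau i w) t) = mixn P mu Y"
 unfolding mixn_def by (intro nn_integral_cong norm2_tau joint_section[OF assms])

lemma mixn_sum_tau_le:
 assumes Y: "joint_meas P mu Y"
 shows "mixn P mu (%w t. \<Sum>i=1..n. Y (tau (int i) w) t) \<le> of_nat n * mixn P mu Y"
proof -
 have "mixn P mu (%w t. \<Sum>i=1..n. Y (tau (int i) w) t) \<le> (\<Sum>i=1..n. mixn P mu (%w t. Y (tau (int i) w) t))"
  by (intro mixn_sum P joint_tau Y)
 then show ?thesis by (simp add: mixn_tau[OF Y])
qed

lemma mixn_mds_sum: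
 assumes Y: "joint_meas P mu Y" and m: "AE t in mu. mds (%w. Y w t)"
 shows "mixn P mu (%w t. \<Sum>i=1..n. Y (tau (int i) w) t) = ennreal (sqrt n) * mixn P mu Y"
proof -
 have "mixn P mu (%w t. \<Sum>i=1..n. Y (tau (int i) w) t) = (\<integral>\<^sup>+t. ennreal (sqrt n) * norm2 P (%w. Y w t) \<partial>mu)"
  unfolding mixn_def
 proof (rule nn_integral_cong_AE, use m in eventually_elim)
  case (elim t)
  have e: "(\<Sum>i=1..n. Y (tau (int i) w) t) = (\<Sum>i\<in>int ` {1..n}. Y (tau i w) t)" for w
   by (simp add: sum.reindex)
  have c: "card (int ` {1..n}) = n" by (simp add: card_image)
  have "nrm P (%w. \<Sum>i=1..n. Y (tau (int i) w) t) = sqrt n * nrm P (%w. Y w t)"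
   unfolding e using mds_nrm_sum[OF elim, of "int ` {1..n}"] unfolding c by simp
  moreover have "L2fun P (%w. \<Sum>i=1..n. Y (tau (int i) w) t)"
   by (intro L2fun_sum L2fun_tau[of "%w. Y w t"] mds_L2 elim)
  ultimately show ?case using mds_L2[OF elim] by (simp add: norm2_L2 ennreal_mult)
 qed
 then show ?thesis
  using norm2_measurable_P[OF P Y] by (simp add: mixn_def nn_integral_cmult)
qed

lemma mixn_mds_sum_diff:
 assumes Y: "joint_meas P mu Y" and m: "AE t in mu. mds (%w. Y w t)"
 shows "mixn P mu (%w t. (\<Sum>i=1..n. Y (tau (int i - k) w) t) - (\<Sum>i=1..n. Y (tau (int i) w) t))
  \<le> ennreal (2 * sqrt (min (real n) \<bar>real_of_int k\<bar>)) * mixn P mu Y"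
proof -
 have "mixn P mu (%w t. (\<Sum>i=1..n. Y (tau (int i - k) w) t) - (\<Sum>i=1..n. Y (tau (int i) w) t))
   \<le> (\<integral>\<^sup>+t. ennreal (2 * sqrt (min (real n) \<bar>real_of_int k\<bar>)) * norm2 P (%w. Y w t) \<partial>mu)"
  unfolding mixn_def
 proof (rule nn_integral_mono_AE, use m in eventually_elim)
  case (elim t)
  have "L2fun P (%w. (\<Sum>i=1..n. Y (tau (int i - k) w) t) - (\<Sum>i=1..n. Y (tau (int i) w) t))"
   by (intro L2fun_diff L2fun_sum L2fun_tau[of "%w. Y w t"] mds_L2 elim)
  then show ?case
   using mds_nrm_sum_diff[OF elim, where n = n and k = k] mds_L2[OF elim]
   by (simp add: norm2_L2 ennreal_mult[symmetric] ennreal_leI)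
 qed
 then show ?thesis
  using norm2_measurable_P[OF P Y] by (simp add: mixn_def nn_integral_cmult)
qed

text \<open>By Fatou's lemma, convergence in the mixed norm makes the lower limit of the distances
  vanish for almost every t. That is enough, since closedness of the martingale differences asks for
  only one good approximant per tolerance.\<close>

lemma mds_mixn_limit:
 fixes Z :: "'w => 't => real" and W :: "nat => 'w => 't => real"
 assumes Z: "joint_meas F0 mu Z" and Zf: "mixn P mu Z < \<infinity>"
  and W: "\<And>n. joint_meas P mu (W n)"
  and Wm: "\<And>n. AE t in mu. mds (%w. W n w t)"
  and lim: "null_seq (%n. mixn P mu (%w t. Z w t - W n w t))"
 shows "AE t in mu. mds (%w. Z w t)"
proof -
 note ZP = joint_F0[OF Z]
 note [measurable] = ZP W
 have ZW: "joint_meas P mu (%w t. Z w t - W n w t)" for n by measurable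
 note nm = norm2_measurable_P[OF P ZW]
 have "(\<integral>\<^sup>+t. liminf (%n. norm2 P (%w. Z w t - W n w t)) \<partial>mu) \<le> liminf (%n. mixn P mu (%w t. Z w t - W n w t))"
  unfolding mixn_def by (rule nn_integral_liminf[OF nm])
 also have "... = 0" using lim_imp_Liminf[OF _ lim] by simp
 finally have "(\<integral>\<^sup>+t. liminf (%n. norm2 P (%w. Z w t - W n w t)) \<partial>mu) = 0" by simp
 then have "AE t in mu. liminf (%n. norm2 P (%w. Z w t - W n w t)) = 0"
  using nm by (subst (asm) nn_integral_0_iff_AE) auto
 moreover have "AE t in mu. \<forall>n. mds (%w. W n w t)" using Wm by (simp add: AE_all_countable)
 moreover have "AE t in mu. L2fun P (%w. Z w t)" by (rule mixn_L2_AE[OF P ZP Zf])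
 moreover have "AE t in mu. (%w. Z w t) \<in> borel_measurable F0"
  using joint_section[OF Z] by (intro AE_I2)
 ultimately show ?thesis
 proof eventually_elim
  case (elim t)
  show ?case
  proof (rule mds_limit[OF _ elim(3,4)])
   fix eps :: real assume "eps > 0"
   have "\<exists>n. norm2 P (%w. Z w t - W n w t) < ennreal eps"
   proof (rule ccontr)
    assume "\<not> ?thesis"
    then have "\<And>n. ennreal eps \<le> norm2 P (%w. Z w t - W n w t)" by (simp add: not_less)
    then have "ennreal eps \<le> liminf (%n. norm2 P (%w. Z w t - W n w t))"
     by (intro Liminf_bounded always_eventually) auto
    with elim(1) \<open>eps > 0\<close> show False by simp
   qed
   then obtain n where n: "norm2 P (%w. Z w t - W n w t) < ennreal eps" ..
   have "mds (%w. W n w t)" using elim(2) by simp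
   moreover have "nrm P (%w. Z w t - W n w t) \<le> eps"
    using n \<open>eps > 0\<close> norm2_L2[OF L2fun_diff[OF elim(3) mds_L2[OF \<open>mds (%w. W n w t)\<close>]]]
    by (simp add: ennreal_less_iff)
   ultimately show "\<exists>r. mds r \<and> nrm P (%w. Z w t - r w) \<le> eps" by blast
  qed
 qed
qed

section \<open>Bounded functionals of random functions\<close>

lemma Linfty_bound:
 assumes "f \<in> Linfty mu"
 obtains C where "0 \<le> C" "AE t in mu. \<bar>f t\<bar> \<le> C"
proof -
 obtain C where "AE t in mu. \<bar>f t\<bar> \<le> C" using assms by (auto simp: Linfty_def)
 then have "AE t in mu. \<bar>f t\<bar> \<le> max 0 C" by eventually_elim simp
 then show thesis by (intro that[of "max 0 C"]) auto
qed

lemma Linfty_mult_integrable: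
 assumes "f \<in> Linfty mu" "integrable mu x"
 shows "integrable mu (%t. f t * x t)"
proof -
 obtain C where C: "0 \<le> C" "AE t in mu. \<bar>f t\<bar> \<le> C" using Linfty_bound[OF assms(1)] .
 have [measurable]: "bmeas mu f" "bmeas mu x" using assms by (auto simp: Linfty_def)
 show ?thesis
 proof (rule Bintegrable_bound[of _ "%t. C * x t"])
  show "AE t in mu. norm (f t * x t) \<le> norm (C * x t)"
   using C(2) by eventually_elim (simp add: abs_mult mult_right_mono C(1))
 qed (use assms(2) in auto)
qed

lemma L1_pair_measurable:
 assumes f: "f \<in> Linfty mu" and Y: "joint_meas M mu Y"
 shows "bmeas M (%w. L1_pair mu f (Y w))"
proof -
 have [measurable]: "bmeas mu f" using f by (simp add: Linfty_def)
 note [measurable] = Y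
 show ?thesis unfolding L1_pair_def by measurable
qed

text \<open>Minkowski's integral inequality makes a bounded functional continuous from the mixed
  norm to L2; this is how functionals inherit the approximations made in the mixed norm.\<close>

lemma norm2_L1_pair:
 assumes Q: "prob_space Q" and f: "f \<in> Linfty mu" and C: "0 \<le> C" "AE t in mu. \<bar>f t\<bar> \<le> C"
  and Y: "joint_meas Q mu Y"
 shows "norm2 Q (%w. L1_pair mu f (Y w)) \<le> ennreal C * mixn Q mu Y"
proof -
 interpret Q: prob_space Q by fact
 have [measurable]: "bmeas mu f" using f by (simp add: Linfty_def)
 note [measurable] = Y
 have "norm2 Q (%w. L1_pair mu f (Y w)) \<le> (\<integral>\<^sup>+t. norm2 Q (%w. f t * Y w t) \<partial>mu)"
  unfolding L1_pair_def by (rule norm2_integral_le[OF Q.sigma_finite_measure_axioms mu]) measurable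
 also have "... \<le> (\<integral>\<^sup>+t. ennreal C * norm2 Q (%w. Y w t) \<partial>mu)"
 proof (rule nn_integral_mono_AE)
  have "AE t in mu. t \<in> space mu" by simp
  with C(2) show "AE t in mu. norm2 Q (%w. f t * Y w t) \<le> ennreal C * norm2 Q (%w. Y w t)"
   by eventually_elim (simp add: norm2_cmult joint_section[OF Y] mult_right_mono ennreal_leI)
 qed
 also have "... = ennreal C * mixn Q mu Y"
  unfolding mixn_def by (rule nn_integral_cmult[OF norm2_measurable_P[OF Q Y]])
 finally show ?thesis .
qed

lemma L1_pair_L2:
 assumes Q: "prob_space Q" and f: "f \<in> Linfty mu"
  and Y: "joint_meas Q mu Y" and Yf: "mixn Q mu Y < \<infinity>"
 shows "L2fun Q (%w. L1_pair mu f (Y w))"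
proof -
 obtain C where C: "0 \<le> C" "AE t in mu. \<bar>f t\<bar> \<le> C" using Linfty_bound[OF f] .
 have "norm2 Q (%w. L1_pair mu f (Y w)) < \<infinity>"
  using norm2_L1_pair[OF Q f C Y] Yf by (auto simp: ennreal_mult_less_top intro: le_less_trans)
 then show ?thesis using norm2_finite_iff[OF L1_pair_measurable[OF f Y]] by simp
qed

text \<open>Fubini's theorem exchanges the functional with integration over a past event, where the
  integral vanishes for almost every t. The finite mixed norm provides integrability on the
  product.\<close>

lemma mds_L1_pair:
 assumes f: "f \<in> Linfty mu" and Z: "joint_meas F0 mu Z"
  and Zf: "mixn P mu Z < \<infinity>" and m: "AE t in mu. mds (%w. Z w t)"
 shows "mds (%w. L1_pair mu f (Z w))"
 unfolding mds_def
proof (intro conjI ballI)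
 note ZP = joint_F0[OF Z]
 note [measurable] = ZP
 have fm [measurable]: "bmeas mu f" using f by (simp add: Linfty_def)
 obtain C where C: "0 \<le> C" "AE t in mu. \<bar>f t\<bar> \<le> C" using Linfty_bound[OF f] .
 show "L2fun P (%w. L1_pair mu f (Z w))" by (rule L1_pair_L2[OF P f ZP Zf])
 show "bmeas F0 (%w. L1_pair mu f (Z w))" by (rule L1_pair_measurable[OF f Z])
 fix A assume A: "A \<in> sets (Fil (- 1))"
 have [measurable]: "A \<in> sets P" by (rule sets_Fil_P[OF A])
 have fin: "(\<integral>\<^sup>+t. \<integral>\<^sup>+w. ennreal \<bar>indicator A w * (f t * Z w t)\<bar> \<partial>P \<partial>mu) < \<infinity>"
 proof -
  have "(\<integral>\<^sup>+t. \<integral>\<^sup>+w. ennreal \<bar>indicator A w * (f t * Z w t)\<bar> \<partial>P \<partial>mu)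
    \<le> (\<integral>\<^sup>+t. ennreal C * norm2 P (%w. Z w t) \<partial>mu)"
  proof (rule nn_integral_mono_AE)
   have "AE t in mu. t \<in> space mu" by simp
   with C(2) show "AE t in mu. (\<integral>\<^sup>+w. ennreal \<bar>indicator A w * (f t * Z w t)\<bar> \<partial>P) \<le> ennreal C * norm2 P (%w. Z w t)"
   proof eventually_elim
    case (elim t)
    note [measurable] = joint_section[OF ZP elim(2)]
    have "(\<integral>\<^sup>+w. ennreal \<bar>indicator A w * (f t * Z w t)\<bar> \<partial>P) \<le> (\<integral>\<^sup>+w. ennreal C * ennreal \<bar>Z w t\<bar> \<partial>P)"
    proof (rule nn_integral_mono)
     fix w
     have "\<bar>indicator A w * (f t * Z w t)\<bar> \<le> \<bar>f t\<bar> * \<bar>Z w t\<bar>" by (auto simp: indicator_def abs_mult)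
     also have "... \<le> C * \<bar>Z w t\<bar>" using elim(1) by (intro mult_right_mono) auto
     finally show "ennreal \<bar>indicator A w * (f t * Z w t)\<bar> \<le> ennreal C * ennreal \<bar>Z w t\<bar>"
      using C(1) by (simp add: ennreal_mult[symmetric] ennreal_leI)
    qed
    also have "... = ennreal C * (\<integral>\<^sup>+w. ennreal \<bar>Z w t\<bar> \<partial>P)" by (rule nn_integral_cmult) measurable
    also have "... \<le> ennreal C * norm2 P (%w. Z w t)"
     by (intro mult_left_mono norm1_le_norm2) auto
    finally show ?case .
   qed
  qed
  also have "... = ennreal C * mixn P mu Z"
   unfolding mixn_def by (rule nn_integral_cmult[OF norm2_measurable_P[OF P ZP]])
  also have "... < \<infinity>" using Zf by (simp add: ennreal_mult_less_top)
  finally show ?thesis .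
 qed
 have int: "integrable (P \<Otimes>\<^sub>M mu) (%(w, t). indicator A w * (f t * Z w t))"
 proof (rule integrableI_bounded)
  show m1: "joint_meas P mu (%w t. indicator A w * (f t * Z w t))" by measurable
  have m2: "bmeas (P \<Otimes>\<^sub>M mu) (%x. ennreal (norm ((%(w, t). indicator A w * (f t * Z w t)) x)))"
   by (rule measurable_compose[OF m1]) measurable
  have "(\<integral>\<^sup>+x. ennreal (norm ((%(w, t). indicator A w * (f t * Z w t)) x)) \<partial>(P \<Otimes>\<^sub>M mu))
    = (\<integral>\<^sup>+t. \<integral>\<^sup>+w. ennreal \<bar>indicator A w * (f t * Z w t)\<bar> \<partial>P \<partial>mu)"
   using Pmu.nn_integral_snd[OF m2] by simp
  then show "(\<integral>\<^sup>+x. ennreal (norm ((%(w, t). indicator A w * (f t * Z w t)) x)) \<partial>(P \<Otimes>\<^sub>M mu)) < \<infinity>"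
   using fin by simp
 qed
 have "(LINT w|P. indicator A w * L1_pair mu f (Z w)) = (LINT w|P. \<integral>t. indicator A w * (f t * Z w t) \<partial>mu)"
  by (simp add: L1_pair_def)
 also have "... = (LINT t|mu. \<integral>w. indicator A w * (f t * Z w t) \<partial>P)"
  by (rule Pmu.Fubini_integral[OF int, symmetric])
 also have "... = (LINT t|mu. 0)"
 proof (rule integral_cong_AE)
  show "AE t in mu. (LINT w|P. indicator A w * (f t * Z w t)) = 0"
   using m
  proof eventually_elim
   case (elim t)
   have "(LINT w|P. indicator A w * (f t * Z w t)) = f t * (LINT w|P. indicator A w * Z w t)"
    by (simp add: mult.left_commute[of _ "f t"])
   also have "(LINT w|P. indicator A w * Z w t) = 0" using elim A by (simp add: mds_def)
   finally show ?case by simp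
  qed
  show "bmeas mu (%t. \<integral>w. indicator A w * (f t * Z w t) \<partial>P)"
  proof -
   have "joint_meas mu P (%t w. indicator A w * (f t * Z w t))"
    using measurable_pair_swap[of "%(w, t). indicator A w * (f t * Z w t)" P mu borel] int
    by (simp add: case_prod_unfold)
   then show ?thesis by (rule borel_measurable_lebesgue_integral)
  qed
 qed simp
 finally show "(LINT w|P. indicator A w * L1_pair mu f (Z w)) = 0" by simp
qed

end

section \<open>Martingale approximation and the covariance series\<close>

lemma filterlim_finite_subsets_at_topI:
 fixes A :: "'n => 'x set"
 assumes "\<And>n. finite (A n)" "\<And>x. \<forall>\<^sub>F n in F. x \<in> A n"
 shows "filterlim A (finite_subsets_at_top UNIV) F"
 unfolding filterlim_finite_subsets_at_top
proof (intro allI impI)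
 fix X :: "'x set" assume "finite X \<and> X \<subseteq> UNIV"
 then have "\<forall>\<^sub>F n in F. \<forall>x\<in>X. x \<in> A n" using assms(2) by (simp add: eventually_ball_finite_distrib)
 then show "\<forall>\<^sub>F n in F. finite (A n) \<and> X \<subseteq> A n \<and> A n \<subseteq> UNIV"
  by eventually_elim (use assms(1) in auto)
qed

lemma eventually_int_symmetric: "\<forall>\<^sub>F K in sequentially. x \<in> {- int K..int K}"
 by (rule eventually_sequentiallyI[of "nat \<bar>x\<bar>"]) auto

lemma filterlim_int_symmetric:
 "filterlim (%K. {- int K..int K}) (finite_subsets_at_top UNIV) sequentially"
 by (rule filterlim_finite_subsets_at_topI) (simp, rule eventually_int_symmetric)

context shift
begin

lemma inner_tendsto2:
 assumes f: "\<And>n. L2fun P (f n)" and Z: "L2fun P Z" and g: "\<And>n. L2fun P (g n)" and W: "L2fun P W"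
  and fZ: "null_seq (%n. nrm P (%w. Z w - f n w))" and gW: "null_seq (%n. nrm P (%w. W w - g n w))"
 shows "(%n. \<integral>w. f n w * g n w \<partial>P) \<longlonglongrightarrow> (LINT w|P. Z w * W w)"
proof -
 let ?e = "%n. nrm P (%w. Z w - f n w) * (nrm P W + nrm P (%w. W w - g n w)) + nrm P Z * nrm P (%w. W w - g n w)"
 have "?e \<longlonglongrightarrow> 0 * (nrm P W + 0) + nrm P Z * 0"
  by (intro tendsto_intros fZ gW)
 then have e: "?e \<longlonglongrightarrow> 0" by simp
 have b: "norm ((LINT w|P. Z w * W w) - (LINT w|P. f n w * g n w)) \<le> ?e n" for n
 proof -
  have "(LINT w|P. Z w * W w) - (LINT w|P. f n w * g n w)
    = (LINT w|P. (Z w - f n w) * g n w + Z w * (W w - g n w))"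
   by (subst Bintegral_diff[symmetric])
    (auto intro!: L2fun_mult_integrable f g Z W Bintegral_cong simp: algebra_simps)
  also have "... = (LINT w|P. (Z w - f n w) * g n w) + (LINT w|P. Z w * (W w - g n w))"
   by (intro Bintegral_add L2fun_mult_integrable L2fun_diff f g Z W)
  finally have "norm ((LINT w|P. Z w * W w) - (LINT w|P. f n w * g n w))
    \<le> \<bar>\<integral>w. (Z w - f n w) * g n w \<partial>P\<bar> + \<bar>\<integral>w. Z w * (W w - g n w) \<partial>P\<bar>" by simp
  also have "... \<le> nrm P (%w. Z w - f n w) * nrm P (g n) + nrm P Z * nrm P (%w. W w - g n w)"
   by (intro add_mono L2fun_CS L2fun_diff f g Z W)
  also have "... \<le> ?e n"
   using nrm_abs_diff_le[OF W g, of n] by (intro add_mono mult_left_mono) auto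
  finally show ?thesis .
 qed
 have "null_seq (%n. (LINT w|P. Z w * W w) - (LINT w|P. f n w * g n w))"
  by (rule Lim_null_comparison[OF always_eventually[OF allI[OF b]] e])
 from tendsto_diff[OF tendsto_const[of "\<integral>w. Z w * W w \<partial>P"] this] show ?thesis by simp
qed

lemma mds_inner_tau:
 assumes "mds q" "mds r"
 shows "(LINT w|P. q (tau i w) * r (tau j w)) = (if i = j then \<integral>w. q w * r w \<partial>P else 0)"
proof (cases "i = j")
 case True
 have [measurable]: "bmeas P q" "bmeas P r"
  using assms mds_L2 L2fun_measurable by auto
 show ?thesis using integral_tau[of "%w. q w * r w" i] True by simp
qed (simp add: mds_orthogonal[OF assms])

text \<open>With g(j,k) = E(q_j q_k), the second moment of d is the sum of all g(j,k), and
  orthogonality at different times makes E(y y(tau_k)) the sum of g(j,j+k) over j. The family g is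
  absolutely summable because |g(j,k)| is at most the product of the norms, so it may be summed
  along diagonals.\<close>

lemma covariance_has_sum:
 fixes q :: "int => 'w => real"
 assumes q: "\<And>k. mds (q k)" and sq: "(%k. nrm P (q k)) summable_on UNIV"
  and y: "L2fun P y" and d: "L2fun P d"
  and yq: "null_seq (%K. nrm P (%w. y w - (\<Sum>k\<in>{- int K..int K}. q k (tau (- k) w))))"
  and dq: "null_seq (%K. nrm P (%w. d w - (\<Sum>k\<in>{- int K..int K}. q k w)))"
 shows "((%k. \<integral>w. y w * y (tau k w) \<partial>P) has_sum (nrm P d)\<^sup>2) UNIV"
proof -
 let ?I = "%K. {- int K..int K}"
 define g where "g = (%(j, k). \<integral>w. q j w * q k w \<partial>P)"
 let ?r = "%k. nrm P (q k)"
 note qL = mds_L2[OF q]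
 have inner: "integrable P (%w. q j w * q k w)" for j k by (intro L2fun_mult_integrable qL)
 have gb: "norm (g (j, k)) \<le> ?r j * ?r k" for j k
  using L2fun_CS[OF qL qL, of j k] by (simp add: g_def)
 have rr: "(%(j, k). ?r j * ?r k) summable_on UNIV"
 proof (rule nonneg_bdd_above_summable_on)
  show "bdd_above (sum (%(j, k). ?r j * ?r k) ` {F. F \<subseteq> UNIV \<and> finite F})"
  proof (rule bdd_aboveI2)
   fix F :: "(int \<times> int) set" assume "F \<in> {F. F \<subseteq> UNIV \<and> finite F}"
   then have F: "finite F" by simp
   have "sum (%(j, k). ?r j * ?r k) F \<le> sum (%(j, k). ?r j * ?r k) (fst ` F \<times> snd ` F)"
    by (rule sum_mono2) (use F subset_fst_snd in \<open>auto split: prod.split\<close>)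
   also have "... = sum ?r (fst ` F) * sum ?r (snd ` F)"
    by (simp add: sum_product sum.cartesian_product)
   also have "... \<le> infsum ?r UNIV * infsum ?r UNIV"
    using F by (intro mult_mono finite_sum_le_infsum sq infsum_nonneg sum_nonneg) auto
   finally show "sum (%(j, k). ?r j * ?r k) F \<le> infsum ?r UNIV * infsum ?r UNIV" .
  qed
 qed auto
 have "(%x. norm (g x)) summable_on UNIV"
  by (rule Infinite_Sum.abs_summable_on_comparison_test'[OF rr]) (use gb in auto)
 then have gs: "g summable_on UNIV" by (rule abs_summable_summable)
 have sq_lim: "filterlim (%K. ?I K \<times> ?I K) (finite_subsets_at_top UNIV) sequentially"
 proof (rule filterlim_finite_subsets_at_topI)
  fix x :: "int \<times> int"
  show "\<forall>\<^sub>F K in sequentially. x \<in> ?I K \<times> ?I K"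
   using eventually_int_symmetric[of "fst x"] eventually_int_symmetric[of "snd x"]
   by eventually_elim (auto simp: mem_Times_iff)
 qed simp
 have "(%K. sum g (?I K \<times> ?I K)) \<longlonglongrightarrow> infsum g UNIV"
  using filterlim_compose[OF has_sum_infsum[OF gs, unfolded has_sum_def] sq_lim] .
 moreover have "sum g (?I K \<times> ?I K) = (LINT w|P. (\<Sum>k\<in>?I K. q k w) * (\<Sum>k\<in>?I K. q k w))" for K
 proof -
  have "(LINT w|P. (\<Sum>k\<in>?I K. q k w) * (\<Sum>k\<in>?I K. q k w)) = (LINT w|P. (\<Sum>j\<in>?I K. \<Sum>k\<in>?I K. q j w * q k w))"
   by (simp add: sum_product)
  also have "... = (\<Sum>j\<in>?I K. \<Sum>k\<in>?I K. g (j, k))"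
   by (simp add: g_def inner)
  finally show ?thesis by (simp add: sum.cartesian_product)
 qed
 moreover have "(%K. \<integral>w. (\<Sum>k\<in>?I K. q k w) * (\<Sum>k\<in>?I K. q k w) \<partial>P) \<longlonglongrightarrow> (LINT w|P. d w * d w)"
  by (intro inner_tendsto2 d L2fun_sum qL dq)
 ultimately have "infsum g UNIV = (LINT w|P. d w * d w)"
  using LIMSEQ_unique by force
 then have g_sum: "(g has_sum (nrm P d)\<^sup>2) UNIV"
  using has_sum_infsum[OF gs] by (simp add: nrm_power2 power2_eq_square[of "d _"])
 define h where "h = (%(k, j). g (j, j + k))"
 have h_sum: "(h has_sum (nrm P d)\<^sup>2) (Sigma UNIV (%_. UNIV))"
  using g_sum
  by (subst has_sum_reindex_bij_witness[where T = UNIV and h = g and j = "%(k, j). (j, j + k)" and i = "%(j, k). (k - j, j)"])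
   (auto simp: h_def)
 have "((%j. h (k, j)) has_sum (LINT w|P. y w * y (tau k w))) UNIV" for k
 proof -
  have hs: "(%j. h (k, j)) summable_on UNIV"
   using summable_on_SigmaD1[of "%k j. h (k, j)" UNIV "%_. UNIV" k] h_sum
   by (auto simp: summable_on_def)
  let ?J = "%K. {j \<in> ?I K. j + k \<in> ?I K}"
  have J: "filterlim ?J (finite_subsets_at_top UNIV) sequentially"
  proof (rule filterlim_finite_subsets_at_topI)
   fix x show "\<forall>\<^sub>F K in sequentially. x \<in> ?J K"
    using eventually_int_symmetric[of x] eventually_int_symmetric[of "x + k"]
    by eventually_elim simp
  next
   fix K show "finite (?J K)" by (rule finite_subset[of _ "?I K"]) auto
  qed
  have "(%K. sum (%j. h (k, j)) (?J K)) \<longlonglongrightarrow> infsum (%j. h (k, j)) UNIV"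
   using filterlim_compose[OF has_sum_infsum[OF hs, unfolded has_sum_def] J] .
  moreover have "sum (%j. h (k, j)) (?J K)
    = (LINT w|P. (\<Sum>i\<in>?I K. q i (tau (- i) w)) * (\<Sum>j\<in>?I K. q j (tau (k - j) w)))" for K
  proof -
   have int: "integrable P (%w. q i (tau a w) * q j (tau b w))" for i j a b
    by (intro L2fun_mult_integrable L2fun_tau qL)
   have "(LINT w|P. (\<Sum>i\<in>?I K. q i (tau (- i) w)) * (\<Sum>j\<in>?I K. q j (tau (k - j) w)))
     = (LINT w|P. (\<Sum>i\<in>?I K. \<Sum>j\<in>?I K. q i (tau (- i) w) * q j (tau (k - j) w)))"
    by (simp add: sum_product)
   also have "... = (\<Sum>i\<in>?I K. \<Sum>j\<in>?I K. \<integral>w. q i (tau (- i) w) * q j (tau (k - j) w) \<partial>P)"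
    by (simp add: int)
   \<comment> \<open>Only equal times survive: -i = k - j means j = i + k.\<close>
   also have "... = (\<Sum>i\<in>?I K. \<Sum>j\<in>?I K. if j = i + k then g (i, j) else 0)"
    by (intro sum.cong refl) (auto simp: mds_inner_tau[OF q q] g_def)
   also have "... = (\<Sum>i\<in>?I K. if i + k \<in> ?I K then g (i, i + k) else 0)"
    by (intro sum.cong refl) (simp add: sum.delta')
   also have "... = sum (%j. h (k, j)) (?J K)"
    by (simp add: h_def sum.inter_filter[symmetric])
   finally show ?thesis ..
  qed
  moreover have "(%K. \<integral>w. (\<Sum>i\<in>?I K. q i (tau (- i) w)) * (\<Sum>j\<in>?I K. q j (tau (k - j) w)) \<partial>P)
    \<longlonglongrightarrow> (LINT w|P. y w * y (tau k w))"
  proof (intro inner_tendsto2 y L2fun_tau L2fun_sum qL yq)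
   have "nrm P (%w. y (tau k w) - (\<Sum>j\<in>?I K. q j (tau (k - j) w)))
     = nrm P (%w. (%w. y w - (\<Sum>j\<in>?I K. q j (tau (- j) w))) (tau k w))" for K
    unfolding nrm_def
    by (intro arg_cong[where f = sqrt] Bintegral_cong) (simp_all add: tau_add)
   also have "... K = nrm P (%w. y w - (\<Sum>j\<in>?I K. q j (tau (- j) w)))" for K
    by (rule nrm_tau) (intro L2fun_measurable L2fun_diff y L2fun_sum L2fun_tau qL)
   finally show "null_seq (%K. nrm P (%w. y (tau k w) - (\<Sum>j\<in>?I K. q j (tau (k - j) w))))"
    using yq by simp
  qed
  ultimately have "infsum (%j. h (k, j)) UNIV = (LINT w|P. y w * y (tau k w))"
   using LIMSEQ_unique by force
  then show ?thesis using has_sum_infsum[OF hs] by simp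
 qed
 then show ?thesis by (rule has_sum_SigmaD[OF h_sum])
qed

end

section \<open>Joint versions of the projections and of their sum\<close>

locale hannan = shift_mu P T F0 mu for P :: "'w measure" and T F0 and mu :: "'t measure" +
 fixes X0 :: "'w => 't => real"
 assumes X0: "L1_random_variable P mu X0"
  and X0_minf: "\<And>t. t \<in> space mu ==>
   AE w in P. real_cond_exp P (filt_minf P T F0) (%w. X0 w t) w = 0"
  and X0_inf: "\<And>t. t \<in> space mu ==>
   AE w in P. real_cond_exp P (filt_inf P T F0) (%w. X0 w t) w = X0 w t"
  and X0_fin: "(\<integral>\<^sup>+t. norm2 P (%w. X0 w t) \<partial>mu) < \<infinity>"
  and P0_fin: "(\<Sum>\<^sub>\<infinity>k::int. \<integral>\<^sup>+t. norm2 P (P0 P T F0 (%w. X0 (tau k w) t)) \<partial>mu) < \<infinity>"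
begin

lemma X0_joint: "joint_meas P mu X0"
 and X0_integrable: "w \<in> space P ==> integrable mu (X0 w)"
 using X0 by (auto simp: L1_random_variable_def)

lemma mixn_X0: "mixn P mu X0 < \<infinity>"
 using X0_fin by (simp add: mixn_def)

text \<open>A joint version for the sigma-field at time -1 is also measurable at time 0, so the
  difference of the two versions is jointly measurable over \<open>F0\<close>. Its mixed norm is one
  term of the sum assumed finite, which makes almost every section integrable.\<close>

lemma P0_version_exists:
 "\<exists>Z. joint_meas F0 mu Z \<and> L1_random_variable P mu Z \<and>
  (\<forall>t\<in>space mu. AE w in P. Z w t = P0 P T F0 (%w. X0 (tau k w) t) w)"
proof -
 have Xk: "joint_meas P mu (%w t. X0 (tau k w) t)" by (rule joint_tau[OF X0_joint])
 obtain U where U: "joint_meas F0 mu U"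
  "\<And>t. t \<in> space mu ==> AE w in P. U w t = real_cond_exp P F0 (%w. X0 (tau k w) t) w"
  using joint_real_cond_exp[OF sfs_F0 Xk] by blast
 obtain V where V: "bmeas (Fil (- 1) \<Otimes>\<^sub>M mu) (%(w, t). V w t)"
  "\<And>t. t \<in> space mu ==> AE w in P. V w t = real_cond_exp P (Fil (- 1)) (%w. X0 (tau k w) t) w"
  using joint_real_cond_exp[OF sfs_Fil Xk] by blast
 have "subalgebra F0 (Fil (- 1))"
  using Fil_mono[of "- 1" 0] by (simp add: subalgebra_def sets_Fil_0 space_F0)
 note V' = measurable_pair_subalgebra[OF this V(1)]
 let ?Y = "%w t. U w t - V w t"
 have Y: "joint_meas F0 mu ?Y"
  using borel_measurable_diff[OF U(1) V'] by (simp add: case_prod_unfold)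
 note YP = joint_F0[OF Y]
 have Ya: "joint_meas P mu (%w t. ennreal \<bar>?Y w t\<bar>)"
  using measurable_compose[OF YP, of "%y. ennreal \<bar>y\<bar>" borel] by (simp add: case_prod_unfold)
 have Yeq: "AE w in P. ?Y w t = P0 P T F0 (%w. X0 (tau k w) t) w" if "t \<in> space mu" for t
  using U(2)[OF that] V(2)[OF that] by eventually_elim (simp add: P0_def)
 have "(\<Sum>\<^sub>\<infinity>k::int. \<integral>\<^sup>+t. norm2 P (P0 P T F0 (%w. X0 (tau k w) t)) \<partial>mu) \<ge>
   (\<integral>\<^sup>+t. norm2 P (P0 P T F0 (%w. X0 (tau k w) t)) \<partial>mu)"
  using nonneg_infsum_complete[of UNIV "%k. \<integral>\<^sup>+t. norm2 P (P0 P T F0 (%w. X0 (tau k w) t)) \<partial>mu"]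
   SUP_upper[of "{k}" "{F. finite F \<and> F \<subseteq> UNIV}" "sum (%k. \<integral>\<^sup>+t. norm2 P (P0 P T F0 (%w. X0 (tau k w) t)) \<partial>mu)"]
  by simp
 then have "(\<integral>\<^sup>+t. norm2 P (P0 P T F0 (%w. X0 (tau k w) t)) \<partial>mu) < \<infinity>"
  using P0_fin by (rule le_less_trans)
 moreover have "mixn P mu ?Y = (\<integral>\<^sup>+t. norm2 P (P0 P T F0 (%w. X0 (tau k w) t)) \<partial>mu)"
  unfolding mixn_def
 proof (intro nn_integral_cong norm2_cong_AE Yeq joint_section[OF YP])
  show "P0 P T F0 (%w. X0 (tau k w) t) \<in> borel_measurable P" for t
   unfolding P0_eq by measurable
 qed
 ultimately have fin: "mixn P mu ?Y < \<infinity>" by simp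
 have "(\<integral>\<^sup>+w. \<integral>\<^sup>+t. ennreal \<bar>?Y w t\<bar> \<partial>mu \<partial>P) = (\<integral>\<^sup>+t. \<integral>\<^sup>+w. ennreal \<bar>?Y w t\<bar> \<partial>P \<partial>mu)"
  by (rule Pmu.Fubini'[OF Ya, symmetric])
 also have "... \<le> mixn P mu ?Y"
  unfolding mixn_def by (intro nn_integral_mono norm1_le_norm2 joint_section[OF YP])
 finally have "(\<integral>\<^sup>+w. \<integral>\<^sup>+t. ennreal \<bar>?Y w t\<bar> \<partial>mu \<partial>P) < \<infinity>" using fin by (rule le_less_trans)
 then have "AE w in P. (\<integral>\<^sup>+t. ennreal \<bar>?Y w t\<bar> \<partial>mu) \<noteq> \<infinity>"
  using mu.borel_measurable_nn_integral[OF Ya] by (intro nn_integral_PInf_AE) (auto simp: less_top)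
 then have "AE w in P. (\<integral>\<^sup>+t. ennreal \<bar>?Y w t\<bar> \<partial>mu) < \<infinity>" by eventually_elim (simp add: less_top)
 from L1_modification[OF F0 mu Y this] obtain Z where
  Z: "joint_meas F0 mu Z" "L1_random_variable P mu Z" "AE w in P. \<forall>t. Z w t = ?Y w t"
  by blast
 have "AE w in P. Z w t = P0 P T F0 (%w. X0 (tau k w) t) w" if "t \<in> space mu" for t
  using Z(3) Yeq[OF that] by eventually_elim simp
 with Z show ?thesis by blast
qed

definition D :: "int => 'w => 't => real" where
 "D k = (SOME Z. joint_meas F0 mu Z \<and> L1_random_variable P mu Z \<and>
  (\<forall>t\<in>space mu. AE w in P. Z w t = P0 P T F0 (%w. X0 (tau k w) t) w))"

lemma D_F0: "joint_meas F0 mu (D k)"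
 and D_L1: "L1_random_variable P mu (D k)"
 and D_P0: "t \<in> space mu ==> AE w in P. D k w t = P0 P T F0 (%w. X0 (tau k w) t) w"
 using someI_ex[OF P0_version_exists[of k]] unfolding D_def by blast+

lemma D_joint: "joint_meas P mu (D k)"
 by (rule joint_F0[OF D_F0])

lemma mixn_D: "mixn P mu (D k) = (\<integral>\<^sup>+t. norm2 P (P0 P T F0 (%w. X0 (tau k w) t)) \<partial>mu)"
 unfolding mixn_def
proof (intro nn_integral_cong norm2_cong_AE D_P0 joint_section[OF D_joint])
 show "P0 P T F0 (%w. X0 (tau k w) t) \<in> borel_measurable P" for t
  unfolding P0_eq by measurable
qed

lemma D_fin: "(\<integral>\<^sup>+k. mixn P mu (D k) \<partial>counting) < \<infinity>"
 using infsum_ennreal_finite_imp_count_space[OF P0_fin] by (simp add: mixn_D)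

lemma mixn_D_fin: "mixn P mu (D k) < \<infinity>"
 using nn_integral_ge_point[of k UNIV "%k. mixn P mu (D k)"] D_fin by (simp add: le_less_trans)

lemma X0_L2: "AE t in mu. L2fun P (%w. X0 w t)"
 by (rule mixn_L2_AE[OF P X0_joint mixn_X0])

text \<open>Stated for almost every t, because square integrability of \<open>X0\<close> at t
  follows from the finite mixed norm only outside a null set.\<close>

lemma D_mds: "AE t in mu. mds (%w. D k w t)"
proof -
 have "AE t in mu. t \<in> space mu" by simp
 with X0_L2 show ?thesis
 proof eventually_elim
  case (elim t)
  show ?case
   by (rule mds_cong_AE[OF mds_P0 D_P0[OF elim(2)]])
    (intro L2fun_tau[of "%w. X0 w t"] elim(1), rule joint_section[OF D_F0 elim(2)])
 qed
qed

definition S :: "'w => 't => real" where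
 "S = (SOME Z. joint_meas F0 mu Z \<and> L1_random_variable P mu Z \<and>
  (AE w in P. \<forall>t. Z w t = serfun D w t))"

lemma S_F0: "joint_meas F0 mu S"
 and S_L1: "L1_random_variable P mu S"
 and S_serfun: "AE w in P. \<forall>t. S w t = serfun D w t"
proof -
 have "joint_meas F0 mu (serfun D)"
  by (rule serfun_measurable[OF D_F0])
 from L1_modification[OF F0 mu this serfun_L1_has_sum(2)[OF P mu D_joint D_fin]]
 have "\<exists>Z. joint_meas F0 mu Z \<and> L1_random_variable P mu Z \<and>
  (AE w in P. \<forall>t. Z w t = serfun D w t)" .
 from someI_ex[OF this]
 show "joint_meas F0 mu S" "L1_random_variable P mu S"
  "AE w in P. \<forall>t. S w t = serfun D w t"
  unfolding S_def by blast+
qed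

lemma S_joint: "joint_meas P mu S"
 by (rule joint_F0[OF S_F0])

lemma S_has_sum: "AE w in P. L1_has_sum mu (%k. D k w) (S w)"
 using serfun_L1_has_sum(1)[OF P mu D_joint D_fin] S_serfun
proof eventually_elim
 case (elim w)
 then have "S w = serfun D w" by auto
 then show ?case using elim(1) by simp
qed

lemma D_sum_joint: "joint_meas P mu (%w t. \<Sum>k\<in>K. D k w t)"
proof -
 have "bmeas (P \<Otimes>\<^sub>M mu) (%x. \<Sum>k\<in>K. (%(w, t). D k w t) x)"
  by (rule borel_measurable_sum) (rule D_joint)
 then show ?thesis by (simp add: case_prod_unfold)
qed

lemma S_D_joint: "joint_meas P mu (%w t. S w t - (\<Sum>k\<in>K. D k w t))"
proof -
 note [measurable] = S_joint D_sum_joint[of K]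
 show ?thesis by measurable
qed

lemma mixn_S_tendsto:
 "null_seq (%K. mixn P mu (%w t. S w t - (\<Sum>k\<in>{- int K..int K}. D k w t)))"
proof -
 have sm: "joint_meas P mu (serfun D)"
  by (rule serfun_measurable[OF D_joint])
 have sdm: "joint_meas P mu (%w t. serfun D w t - (\<Sum>k\<in>K. D k w t))" for K
 proof -
  note [measurable] = sm D_sum_joint[of K]
  show ?thesis by measurable
 qed
 have "mixn P mu (%w t. S w t - (\<Sum>k\<in>K. D k w t)) = mixn P mu (%w t. serfun D w t - (\<Sum>k\<in>K. D k w t))" for K
 proof (rule mixn_cong[OF _ S_D_joint sdm])
  show "AE w in P. S w t - (\<Sum>k\<in>K. D k w t) = serfun D w t - (\<Sum>k\<in>K. D k w t)" for t
   using S_serfun by eventually_elim simp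
 qed
 then show ?thesis
  using filterlim_compose[OF mixn_serfun_tendsto[OF P mu D_joint D_fin] filterlim_int_symmetric] by simp
qed

lemma D_sum_mds: "AE t in mu. mds (%w. \<Sum>k\<in>K. D k w t)"
proof -
 have "AE t in mu. \<forall>k. mds (%w. D k w t)" using D_mds by (simp add: AE_all_countable)
 then show ?thesis by eventually_elim (intro mds_sum, simp)
qed

lemma mixn_S: "mixn P mu S < \<infinity>"
proof -
 obtain K where "mixn P mu (%w t. S w t - (\<Sum>k\<in>{- int K..int K}. D k w t)) < 1"
  using order_tendstoD(2)[OF mixn_S_tendsto, of 1] by (auto simp: eventually_sequentially)
 then have 1: "mixn P mu (%w t. S w t - (\<Sum>k\<in>{- int K..int K}. D k w t)) < \<infinity>"
  by (rule less_trans) simp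
 have "mixn P mu (%w t. \<Sum>k\<in>{- int K..int K}. D k w t) \<le> (\<Sum>k\<in>{- int K..int K}. mixn P mu (D k))"
  by (intro mixn_sum P D_joint)
 also have "... < \<infinity>" using mixn_D_fin by (simp add: less_top[symmetric])
 finally have 2: "mixn P mu (%w t. \<Sum>k\<in>{- int K..int K}. D k w t) < \<infinity>" .
 have "mixn P mu (%w t. (S w t - (\<Sum>k\<in>{- int K..int K}. D k w t)) + (\<Sum>k\<in>{- int K..int K}. D k w t))
   \<le> mixn P mu (%w t. S w t - (\<Sum>k\<in>{- int K..int K}. D k w t)) + mixn P mu (%w t. \<Sum>k\<in>{- int K..int K}. D k w t)"
  by (rule mixn_triangle[OF P S_D_joint D_sum_joint])
 also have "... < \<infinity>" using 1 2 by simp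
 finally show ?thesis by simp
qed

lemma S_mds: "AE t in mu. mds (%w. S w t)"
 by (rule mds_mixn_limit[OF S_F0 mixn_S D_sum_joint D_sum_mds mixn_S_tendsto])

text \<open>The error of truncating the expansion of \<open>X0\<close> into martingale increments at
  |k| \<le> K.\<close>

definition R :: "nat => 'w => 't => real" where
 "R K w t = X0 w t - (\<Sum>k\<in>{- int K..int K}. D k (tau (- k) w) t)"

lemma R_joint: "joint_meas P mu (R K)"
proof -
 have "bmeas (P \<Otimes>\<^sub>M mu) (%x. \<Sum>k\<in>{- int K..int K}. (%(w, t). D k (tau (- k) w) t) x)"
  by (rule borel_measurable_sum) (rule joint_tau[OF D_joint])
 then have "bmeas (P \<Otimes>\<^sub>M mu) (%x. (%(w, t). X0 w t) x - (\<Sum>k\<in>{- int K..int K}. (%(w, t). D k (tau (- k) w) t) x))"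
  by (rule borel_measurable_diff[OF X0_joint])
 then show ?thesis by (simp add: R_def case_prod_unfold)
qed

text \<open>For almost every t the truncation error tends to 0 in L2 and is at most twice the L2
  norm of \<open>X0\<close> at t. The latter is integrable in t, so dominated convergence
  applies.\<close>

lemma mixn_R_tendsto: "null_seq (%K. mixn P mu (R K))"
proof -
 have X0n: "bmeas mu (%t. norm2 P (%w. X0 w t))" by (rule norm2_measurable_P[OF P X0_joint])
 have main: "AE t in mu. (\<forall>K. norm2 P (%w. R K w t) \<le> 2 * norm2 P (%w. X0 w t)) \<and>
   (%K. norm2 P (%w. R K w t)) \<longlonglongrightarrow> 0"
 proof -
  have "AE t in mu. t \<in> space mu" by simp
  with X0_L2 show ?thesis
  proof eventually_elim
   case (elim t)
   let ?R = "%K w. X0 w t - (\<Sum>k\<in>{- int K..int K}. P0 P T F0 (%w. X0 (tau k w) t) (tau (- k) w))"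
   note dec = P0_tau_decomposition[OF elim(1) X0_minf[OF elim(2)] X0_inf[OF elim(2)]]
   have n: "norm2 P (%w. R K w t) = ennreal (nrm P (?R K))" for K
   proof -
    have "AE w in P. \<forall>k. D k (tau (- k) w) t = P0 P T F0 (%w. X0 (tau k w) t) (tau (- k) w)"
     using AE_tau[OF D_P0[OF elim(2)]] by (simp add: AE_all_countable)
    then have "AE w in P. R K w t = ?R K w" by eventually_elim (simp add: R_def)
    then have "norm2 P (%w. R K w t) = norm2 P (?R K)"
     by (rule norm2_cong_AE[OF _ L2fun_measurable[OF dec(3)] joint_section[OF R_joint elim(2)]])
    then show ?thesis using dec(3) by (simp add: norm2_L2)
   qed
   have "ennreal (nrm P (?R K)) \<le> 2 * norm2 P (%w. X0 w t)" for K
    using dec(2)[of K] by (simp add: norm2_L2[OF elim(1)] ennreal_leI numeral_mult_ennreal)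
   moreover have "(%K. ennreal (nrm P (?R K))) \<longlonglongrightarrow> ennreal 0"
    by (intro tendsto_ennrealI dec(1))
   ultimately show ?case by (simp add: n)
  qed
 qed
 have "(%K. \<integral>\<^sup>+t. norm2 P (%w. R K w t) \<partial>mu) \<longlonglongrightarrow> (\<integral>\<^sup>+t. 0 \<partial>mu)"
 proof (rule nn_integral_dominated_convergence[where w = "%t. 2 * norm2 P (%w. X0 w t)"])
  show "(\<integral>\<^sup>+t. 2 * norm2 P (%w. X0 w t) \<partial>mu) < \<infinity>"
   using X0_fin X0n by (simp add: nn_integral_cmult ennreal_mult_less_top)
  show "AE t in mu. norm2 P (%w. R K w t) \<le> 2 * norm2 P (%w. X0 w t)" for K
   using main by eventually_elim simp
  show "AE t in mu. (%K. norm2 P (%w. R K w t)) \<longlonglongrightarrow> 0"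
   using main by eventually_elim simp
 qed (use X0n norm2_measurable_P[OF P R_joint] in auto)
 then show ?thesis by (simp add: mixn_def)
qed

text \<open>Both \<open>X0\<close> and \<open>S\<close> are truncated at |k| \<le> K. The truncation
  errors are summed crudely, with a factor n, which is harmless because n is fixed while K tends to
  infinity. For each k in the window, the sums of \<open>D k\<close> at the times i - k and i are
  compared by orthogonality.\<close>

lemma mixn_sum_diff_le:
 "mixn P mu (%w t. (\<Sum>i=1..n. X0 (tau (int i) w) t) - (\<Sum>i=1..n. S (tau (int i) w) t))
  \<le> (\<integral>\<^sup>+k. ennreal (2 * sqrt (min (real n) \<bar>real_of_int k\<bar>)) * mixn P mu (D k) \<partial>counting)"
  (is "?L \<le> ?B")
proof -
 let ?I = "%K. {- int K..int K}"
 let ?Q = "%K w t. S w t - (\<Sum>k\<in>?I K. D k w t)"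
 let ?U = "%k w t. (\<Sum>i=1..n. D k (tau (int i - k) w) t) - (\<Sum>i=1..n. D k (tau (int i) w) t)"
 have Um: "joint_meas P mu (?U k)" for k
  using borel_measurable_diff[OF joint_tau_sum[OF D_joint[of k], where I = "{1..n}" and g = "%i. int i - k"]
    joint_tau_sum[OF D_joint[of k], where I = "{1..n}" and g = int]]
  by (simp add: case_prod_unfold)
 have UUm: "joint_meas P mu (%w t. \<Sum>k\<in>?I K. ?U k w t)" for K
 proof -
  have "bmeas (P \<Otimes>\<^sub>M mu) (%x. \<Sum>k\<in>?I K. (%(w, t). ?U k w t) x)"
   by (rule borel_measurable_sum) (rule Um)
  then show ?thesis by (simp add: case_prod_unfold)
 qed
 have Rm: "joint_meas P mu (%w t. \<Sum>i=1..n. R K (tau (int i) w) t)" for K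
  by (rule joint_tau_sum[OF R_joint])
 have Qm: "joint_meas P mu (%w t. \<Sum>i=1..n. ?Q K (tau (int i) w) t)" for K
  by (rule joint_tau_sum[OF S_D_joint])
 have RUm: "joint_meas P mu (%w t. (\<Sum>i=1..n. R K (tau (int i) w) t) + (\<Sum>k\<in>?I K. ?U k w t))" for K
  using borel_measurable_add[OF Rm[of K] UUm[of K]] by (simp add: case_prod_unfold)
 have bound: "?L \<le> (of_nat n * mixn P mu (R K) + of_nat n * mixn P mu (?Q K)) + ?B" for K
 proof -
  have e: "(\<Sum>i=1..n. X0 (tau (int i) w) t) - (\<Sum>i=1..n. S (tau (int i) w) t)
    = ((\<Sum>i=1..n. R K (tau (int i) w) t) + (\<Sum>k\<in>?I K. ?U k w t)) - (\<Sum>i=1..n. ?Q K (tau (int i) w) t)"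
   if w: "w \<in> space P" for w t
  proof -
   have "(\<Sum>k\<in>?I K. ?U k w t) = (\<Sum>i=1..n. \<Sum>k\<in>?I K. D k (tau (int i - k) w) t) - (\<Sum>i=1..n. \<Sum>k\<in>?I K. D k (tau (int i) w) t)"
    by (simp only: sum_subtractf sum.swap[of _ "{1..n}" "?I K"])
   moreover have "(\<Sum>i=1..n. R K (tau (int i) w) t)
     = (\<Sum>i=1..n. X0 (tau (int i) w) t) - (\<Sum>i=1..n. \<Sum>k\<in>?I K. D k (tau (int i - k) w) t)"
    using w by (simp add: R_def sum_subtractf tau_add)
   moreover have "(\<Sum>i=1..n. ?Q K (tau (int i) w) t)
     = (\<Sum>i=1..n. S (tau (int i) w) t) - (\<Sum>i=1..n. \<Sum>k\<in>?I K. D k (tau (int i) w) t)"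
    by (simp add: sum_subtractf)
   ultimately show ?thesis by simp
  qed
  have "?L = mixn P mu (%w t. ((\<Sum>i=1..n. R K (tau (int i) w) t) + (\<Sum>k\<in>?I K. ?U k w t)) - (\<Sum>i=1..n. ?Q K (tau (int i) w) t))"
  proof (rule mixn_cong)
   show "joint_meas P mu (%w t. (\<Sum>i=1..n. X0 (tau (int i) w) t) - (\<Sum>i=1..n. S (tau (int i) w) t))"
    using borel_measurable_diff[OF joint_tau_sum[OF X0_joint, where I = "{1..n}" and g = int] joint_tau_sum[OF S_joint, where I = "{1..n}" and g = int]]
    by (simp add: case_prod_unfold)
   show "joint_meas P mu (%w t. ((\<Sum>i=1..n. R K (tau (int i) w) t) + (\<Sum>k\<in>?I K. ?U k w t)) - (\<Sum>i=1..n. ?Q K (tau (int i) w) t))"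
    using borel_measurable_diff[OF RUm[of K] Qm[of K]] by (simp add: case_prod_unfold)
  qed (use e in \<open>auto intro!: AE_I2\<close>)
  also have "... \<le> mixn P mu (%w t. (\<Sum>i=1..n. R K (tau (int i) w) t) + (\<Sum>k\<in>?I K. ?U k w t))
    + mixn P mu (%w t. \<Sum>i=1..n. ?Q K (tau (int i) w) t)"
   by (rule mixn_triangle_diff[OF P RUm Qm])
  also have "... \<le> (mixn P mu (%w t. \<Sum>i=1..n. R K (tau (int i) w) t) + mixn P mu (%w t. \<Sum>k\<in>?I K. ?U k w t))
    + mixn P mu (%w t. \<Sum>i=1..n. ?Q K (tau (int i) w) t)"
   by (intro add_right_mono mixn_triangle[OF P Rm UUm])
  also have "... \<le> (of_nat n * mixn P mu (R K) + ?B) + of_nat n * mixn P mu (?Q K)"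
  proof (intro add_mono mixn_sum_tau_le R_joint S_D_joint)
   have "mixn P mu (%w t. \<Sum>k\<in>?I K. ?U k w t) \<le> (\<Sum>k\<in>?I K. mixn P mu (?U k))"
    by (rule mixn_sum[OF P Um])
   also have "... \<le> (\<Sum>k\<in>?I K. ennreal (2 * sqrt (min (real n) \<bar>real_of_int k\<bar>)) * mixn P mu (D k))"
    by (intro sum_mono mixn_mds_sum_diff D_joint D_mds)
   also have "... = (\<integral>\<^sup>+k. ennreal (2 * sqrt (min (real n) \<bar>real_of_int k\<bar>)) * mixn P mu (D k) \<partial>count_space (?I K))"
    by (simp add: nn_integral_count_space_finite)
   also have "... \<le> ?B"
    by (subst nn_integral_count_space_indicator) (auto intro!: nn_integral_mono simp: indicator_def)
   finally show "mixn P mu (%w t. \<Sum>k\<in>?I K. ?U k w t) \<le> ?B" .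
  qed
  finally show ?thesis by (simp add: ac_simps)
 qed
 have fn: "of_nat n < (top :: ennreal)" by (simp add: of_nat_less_top)
 have "(%K. (of_nat n * mixn P mu (R K) + of_nat n * mixn P mu (?Q K)) + ?B)
   \<longlonglongrightarrow> (of_nat n * 0 + of_nat n * 0) + ?B"
  by (intro tendsto_add tendsto_const ennreal_tendsto_cmult fn mixn_R_tendsto mixn_S_tendsto)
 then have "?L \<le> (of_nat n * 0 + of_nat n * 0) + ?B"
  by (rule LIMSEQ_le_const) (use bound in auto)
 then show ?thesis by simp
qed

text \<open>Division by sqrt n leaves in front of the mixed norm of \<open>D k\<close> a weight that
  is at most 2 and tends to 0 for every fixed k; dominated convergence over k concludes.\<close>

lemma martingale_approximation:
 "null_seq (%n. mixn P mu (%w t. (1 / sqrt (real n)) *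
   ((\<Sum>i=1..n. X0 (tau (int i) w) t) - (\<Sum>i=1..n. S (tau (int i) w) t))))"
proof -
 let ?m = "%n k. 2 * sqrt (min (real n) \<bar>real_of_int k\<bar>) / sqrt (real n)"
 let ?B = "%n. \<integral>\<^sup>+k. ennreal (?m n k) * mixn P mu (D k) \<partial>counting"
 have le: "mixn P mu (%w t. (1 / sqrt (real n)) *
   ((\<Sum>i=1..n. X0 (tau (int i) w) t) - (\<Sum>i=1..n. S (tau (int i) w) t))) \<le> ?B n" for n
 proof -
  have m: "joint_meas P mu (%w t. (\<Sum>i=1..n. X0 (tau (int i) w) t) - (\<Sum>i=1..n. S (tau (int i) w) t))"
   using borel_measurable_diff[OF joint_tau_sum[OF X0_joint, where I = "{1..n}" and g = int] joint_tau_sum[OF S_joint, where I = "{1..n}" and g = int]]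
   by (simp add: case_prod_unfold)
  have "mixn P mu (%w t. (1 / sqrt (real n)) *
   ((\<Sum>i=1..n. X0 (tau (int i) w) t) - (\<Sum>i=1..n. S (tau (int i) w) t)))
   = ennreal \<bar>1 / sqrt (real n)\<bar> * mixn P mu (%w t. (\<Sum>i=1..n. X0 (tau (int i) w) t) - (\<Sum>i=1..n. S (tau (int i) w) t))"
   by (rule mixn_cmult[OF P m])
  also have "... \<le> ennreal \<bar>1 / sqrt (real n)\<bar> *
    (\<integral>\<^sup>+k. ennreal (2 * sqrt (min (real n) \<bar>real_of_int k\<bar>)) * mixn P mu (D k) \<partial>counting)"
   by (intro mult_left_mono mixn_sum_diff_le) simp
  also have "... = (\<integral>\<^sup>+k. ennreal \<bar>1 / sqrt (real n)\<bar> * (ennreal (2 * sqrt (min (real n) \<bar>real_of_int k\<bar>)) * mixn P mu (D k)) \<partial>counting)"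
   by (rule nn_integral_cmult[symmetric]) simp
  also have "... = ?B n"
   by (intro nn_integral_cong) (simp add: mult.assoc[symmetric] ennreal_mult[symmetric])
  finally show ?thesis .
 qed
 have "?B \<longlonglongrightarrow> (\<integral>\<^sup>+k. 0 \<partial>count_space (UNIV :: int set))"
 proof (rule nn_integral_dominated_convergence[where w = "%k. 2 * mixn P mu (D k)"])
  show "(\<integral>\<^sup>+k. 2 * mixn P mu (D k) \<partial>counting) < \<infinity>"
   using D_fin by (simp add: nn_integral_cmult ennreal_mult_less_top)
  have r2: "?m n k \<le> 2" for n k
   by (cases "n = 0") (auto simp: divide_le_eq)
  have "ennreal (?m n k) \<le> 2" for n k
   using ennreal_leI[OF r2[of n k]] by simp
  then show "AE k in counting. ennreal (?m n k) * mixn P mu (D k) \<le> 2 * mixn P mu (D k)" for n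
   by (intro AE_I2 mult_right_mono) auto
  show "AE k in counting. (%n. ennreal (?m n k) * mixn P mu (D k)) \<longlonglongrightarrow> 0"
  proof (rule AE_I2)
   fix k :: int
   obtain m where m: "mixn P mu (D k) = ennreal m" "0 \<le> m"
    using mixn_D_fin[of k] by (cases "mixn P mu (D k)") auto
   have "(%n. 2 * sqrt \<bar>real_of_int k\<bar> / sqrt (real n) * m) \<longlonglongrightarrow> 0 * m"
    by (intro tendsto_mult tendsto_const tendsto_divide_0[OF tendsto_const]
      filterlim_at_top_imp_at_infinity filterlim_compose[OF sqrt_at_top filterlim_real_sequentially])
   then have lim: "null_seq (%n. 2 * sqrt \<bar>real_of_int k\<bar> / sqrt (real n) * m)" by simp
   have "norm (?m n k * m) \<le> 2 * sqrt \<bar>real_of_int k\<bar> / sqrt (real n) * m" for n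
    using m(2) by (auto simp: abs_mult intro!: mult_right_mono divide_right_mono)
   then have "null_seq (%n. ?m n k * m)"
    by (intro Lim_null_comparison[OF always_eventually lim]) blast
   then have lim': "(%n. ennreal (?m n k * m)) \<longlonglongrightarrow> ennreal 0"
    by (rule tendsto_ennrealI)
   have "ennreal (?m n k * m)
     = ennreal (?m n k) * mixn P mu (D k)" for n
    unfolding m(1) by (rule ennreal_mult) (use m(2) in auto)
   with lim' show "null_seq (%n. ennreal (?m n k) * mixn P mu (D k))"
    by (simp only: ennreal_0)
  qed
 qed auto
 then have "?B \<longlonglongrightarrow> 0" by simp
 then show ?thesis
  by (rule tendsto_sandwich[OF _ _ tendsto_const, rotated 2]) (use le in auto)
qed

end

section \<open>Ergodic averages\<close>

text \<open>The maximum of 0 and the first \<open>N\<close> partial sums of \<open>g\<close> along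
  the orbit under \<open>U\<close>, in recursive form.\<close>

primrec garsia :: "('w => 'w) => ('w => real) => nat => 'w => real" where
 "garsia U g 0 w = 0"
| "garsia U g (Suc N) w = max 0 (g w + garsia U g N (U w))"

lemma garsia_nonneg: "0 \<le> garsia U g N w"
 by (cases N) auto

lemma garsia_mono: "garsia U g N w \<le> garsia U g (Suc N) w"
 by (induction N arbitrary: w) (auto simp: max.coboundedI2)

text \<open>Shifting the sequence changes the partial sums by the single term a 0 and their length
  by one. For large n this bounded error is absorbed by half of the margin 1/(m+1), which is the
  margin belonging to 2m+1.\<close>

lemma exceeds_infinitely_often_shift:
 fixes a :: "nat => real"
 assumes b: "\<And>j. b j = a (Suc j)"
 shows "(\<exists>m::nat. \<forall>N. \<exists>n\<ge>N. (\<Sum>j<n. a j) > (\<alpha> + 1 / real (Suc m)) * real n) \<longleftrightarrow>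
  (\<exists>m::nat. \<forall>N. \<exists>n\<ge>N. (\<Sum>j<n. b j) > (\<alpha> + 1 / real (Suc m)) * real n)"
proof -
 have sum: "(\<Sum>j<n. b j) = (\<Sum>j<Suc n. a j) - a 0" for n
  by (simp only: sum.lessThan_Suc_shift b add_diff_cancel_left')
 have half: "1 / real (Suc (2 * m + 1)) = (1 / real (Suc m)) / 2" for m by (simp add: field_simps)
 show ?thesis
 proof (intro iffI; elim exE)
  fix m :: nat assume m: "\<forall>N. \<exists>n\<ge>N. (\<Sum>j<n. a j) > (\<alpha> + 1 / real (Suc m)) * real n"
  define \<delta> where "\<delta> = 1 / real (Suc m) / 2"
  have \<delta>: "\<delta> > 0" and d2: "2 * \<delta> = 1 / real (Suc m)" by (simp_all add: \<delta>_def del: of_nat_Suc)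
  show "\<exists>m::nat. \<forall>N. \<exists>n\<ge>N. (\<Sum>j<n. b j) > (\<alpha> + 1 / real (Suc m)) * real n"
  proof (rule exI[of _ "2 * m + 1"], rule allI)
   fix N
   obtain N0 :: nat where N0: "real N0 * \<delta> > \<bar>\<alpha>\<bar> + \<bar>a 0\<bar>"
    using reals_Archimedean3[OF \<delta>] by blast
   obtain n where n: "n \<ge> Suc (max N N0)" "(\<Sum>j<n. a j) > (\<alpha> + 1 / real (Suc m)) * real n"
    using m by blast
   then obtain k where k: "n = Suc k" "k \<ge> N" "k \<ge> N0" by (cases n) auto
   have "real k * \<delta> > \<bar>\<alpha>\<bar> + \<bar>a 0\<bar>"
    using N0 k(3) \<delta> by (meson less_le_trans mult_right_mono of_nat_le_iff less_imp_le)
   moreover have "(\<Sum>j<k. b j) > (\<alpha> + 2 * \<delta>) * real (Suc k) - a 0"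
    using n(2) unfolding k(1) d2 sum by linarith
   moreover have "(\<alpha> + 2 * \<delta>) * real (Suc k) = (\<alpha> + \<delta>) * real k + real k * \<delta> + \<alpha> + 2 * \<delta>"
    by (simp add: algebra_simps)
   ultimately have "(\<Sum>j<k. b j) > (\<alpha> + \<delta>) * real k" using \<delta> by linarith
   then show "\<exists>n\<ge>N. (\<Sum>j<n. b j) > (\<alpha> + 1 / real (Suc (2 * m + 1))) * real n"
    using k(2) unfolding half \<delta>_def by blast
  qed
 next
  fix m :: nat assume m: "\<forall>N. \<exists>n\<ge>N. (\<Sum>j<n. b j) > (\<alpha> + 1 / real (Suc m)) * real n"
  define \<delta> where "\<delta> = 1 / real (Suc m) / 2"
  have \<delta>: "\<delta> > 0" and d2: "2 * \<delta> = 1 / real (Suc m)" by (simp_all add: \<delta>_def del: of_nat_Suc)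
  show "\<exists>m::nat. \<forall>N. \<exists>n\<ge>N. (\<Sum>j<n. a j) > (\<alpha> + 1 / real (Suc m)) * real n"
  proof (rule exI[of _ "2 * m + 1"], rule allI)
   fix N
   obtain N0 :: nat where N0: "real N0 * \<delta> > \<bar>\<alpha>\<bar> + \<bar>a 0\<bar> + \<delta>"
    using reals_Archimedean3[OF \<delta>] by blast
   obtain k where k: "k \<ge> max N N0" "(\<Sum>j<k. b j) > (\<alpha> + 1 / real (Suc m)) * real k"
    using m by blast
   have "real k * \<delta> > \<bar>\<alpha>\<bar> + \<bar>a 0\<bar> + \<delta>"
    using N0 k(1) \<delta> by (meson less_le_trans mult_right_mono of_nat_le_iff less_imp_le max.boundedE)
   moreover have "(\<Sum>j<Suc k. a j) > (\<alpha> + 2 * \<delta>) * real k + a 0"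
    using k(2) unfolding d2 sum by linarith
   moreover have "(\<alpha> + 2 * \<delta>) * real k = (\<alpha> + \<delta>) * real (Suc k) + real k * \<delta> - \<alpha> - \<delta>"
    by (simp add: algebra_simps)
   ultimately have "(\<Sum>j<Suc k. a j) > (\<alpha> + \<delta>) * real (Suc k)" by linarith
   then show "\<exists>n\<ge>N. (\<Sum>j<n. a j) > (\<alpha> + 1 / real (Suc (2 * m + 1))) * real n"
    using k(1) unfolding half \<delta>_def by (intro exI[of _ "Suc k"]) auto
  qed
 qed
qed

context shift
begin

text \<open>Garsia's proof of the maximal ergodic inequality.\<close>

lemma maximal_ergodic:
 fixes g :: "'w => real"
 assumes g: "integrable P g" and pos: "AE w in P. \<exists>n. 0 < (\<Sum>j<n. g (tau (int j) w))"
 shows "0 \<le> (LINT w|P. g w)"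
proof -
 let ?m = "garsia (tau 1) g"
 have mi: "integrable P (?m N)" for N
 proof (induction N)
  case (Suc N)
  then have "integrable P (%w. max 0 (g w + ?m N (tau 1 w)))"
   by (intro integrable_max Bintegrable_add g integrable_tau[of "?m N"]) auto
  then show ?case by (simp add: garsia.simps(2)[abs_def])
 qed (simp add: garsia.simps(1)[abs_def])
 have mm [measurable]: "bmeas P (?m N)" for N using mi[of N] by auto
 have ge: "w \<in> space P ==> (\<Sum>j<n. g (tau (int j) w)) \<le> ?m n w" for n w
 proof (induction n arbitrary: w)
  case (Suc n)
  have "(\<Sum>j<Suc n. g (tau (int j) w)) = g w + (\<Sum>j<n. g (tau (int j) (tau 1 w)))"
   using Suc.prems by (simp add: sum.lessThan_Suc_shift tau_add add.commute del: sum.lessThan_Suc)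
  also have "... \<le> g w + ?m n (tau 1 w)" using Suc by simp
  finally show ?case by simp
 qed simp
 let ?E = "%N. {w \<in> space P. 0 < ?m N w}"
 have Em [measurable]: "?E N \<in> sets P" for N by measurable
 have step: "0 \<le> (LINT w|P. indicator (?E (Suc N)) w * g w)" for N
 proof -
  have i1: "integrable P (%w. ?m (Suc N) w - ?m (Suc N) (tau 1 w))"
   by (intro Bintegrable_diff mi integrable_tau)
  \<comment> \<open>The maximum and its shift have equal expectations. Where the maximum is positive
    it is at most g plus its shift; elsewhere it is 0 and its shift is nonnegative.\<close>
  have "0 = (LINT w|P. ?m (Suc N) w - ?m (Suc N) (tau 1 w))"
   using integral_tau[OF mm, of "Suc N" 1]
   by (subst Bintegral_diff[OF mi integrable_tau[OF mi]]) (simp del: garsia.simps)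
  also have "... \<le> (LINT w|P. indicator (?E (Suc N)) w * g w)"
  proof (rule integral_mono[OF i1 indicator_mult_integrable[OF Em g]])
   fix w assume w: "w \<in> space P"
   show "?m (Suc N) w - ?m (Suc N) (tau 1 w) \<le> indicator (?E (Suc N)) w * g w"
   proof (cases "0 < ?m (Suc N) w")
    case True
    then have "?m (Suc N) w = g w + ?m N (tau 1 w)" by (auto simp: max_def split: if_splits)
    then show ?thesis using garsia_mono[of "tau 1" g N "tau 1 w"] True w
     by (simp del: garsia.simps)
   next
    case False
    then have "?m (Suc N) w = 0" using garsia_nonneg[of "tau 1" g "Suc N" w] by linarith
    then show ?thesis using garsia_nonneg[of "tau 1" g "Suc N" "tau 1 w"] False
     by (simp del: garsia.simps)
   qed
  qed
  finally show ?thesis .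
 qed
 \<comment> \<open>The events increase with \<open>N\<close> and, by \<open>pos\<close>, exhaust the
   space up to a null set.\<close>
 have "(%N. \<integral>w. indicator (?E (Suc N)) w * g w \<partial>P) \<longlonglongrightarrow> (LINT w|P. g w)"
 proof (rule integral_dominated_convergence[where w = "%w. \<bar>g w\<bar>"])
  have "AE w in P. w \<in> space P" by simp
  with pos show "AE w in P. (%N. indicator (?E (Suc N)) w * g w) \<longlonglongrightarrow> g w"
  proof eventually_elim
   case (elim w)
   then obtain n where "0 < (\<Sum>j<n. g (tau (int j) w))" by blast
   with ge[OF elim(2), of n] have n: "0 < ?m n w" by linarith
   have "0 < ?m (Suc N) w" if "N \<ge> n" for N
   proof -
    have "?m n w \<le> ?m (Suc N) w"
     by (rule lift_Suc_mono_le[of "%N. ?m N w"]) (use garsia_mono that in auto)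
    with n show ?thesis by linarith
   qed
   then have "\<forall>\<^sub>F N in sequentially. indicator (?E (Suc N)) w * g w = g w"
    using elim(2) by (intro eventually_sequentiallyI[of n]) (simp del: garsia.simps)
   then show ?case by (rule tendsto_eventually)
  qed
  show "bmeas P (%w. indicator (?E (Suc N)) w * g w)" for N
   using g by measurable
 qed (use g in \<open>auto simp: indicator_def\<close>)
 then show ?thesis by (rule LIMSEQ_le_const) (use step in auto)
qed

text \<open>The event that the upper ergodic average is larger than \<open>\<alpha>\<close>. Quantifying over \<open>m\<close> makes it
 invariant under the shift exactly, not only up to a null set, as the definition of ergodicity requires.\<close>

definition exceeds :: "('w => real) => real => 'w set" where
 "exceeds z \<alpha> = {w \<in> space P. \<exists>m::nat. \<forall>N. \<exists>n\<ge>N.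
  (\<Sum>j<n. z (tau (int j) w)) > (\<alpha> + 1 / real (Suc m)) * real n}"

text \<open>If the event had probability one, the partial sums of z - \<alpha> would almost surely
  become positive and the maximal inequality would give \<alpha> \<le> E z. So it is a null event
  for \<alpha> > E z. The level E z + 1/(k+1) together with the margin 1/(k+1) inside
  \<open>exceeds\<close> yields the 2/(k+1).\<close>

lemma exceeds_upper:
 assumes z: "integrable P z" and erg: "\<And>\<alpha>. prob (exceeds z \<alpha>) \<in> {0, 1}"
 shows "AE w in P. \<forall>k::nat. \<forall>\<^sub>F n in sequentially.
  (\<Sum>j<n. z (tau (int j) w)) \<le> ((LINT w|P. z w) + 2 / real (Suc k)) * real n"
proof -
 have [measurable]: "bmeas P z" using z by auto
 have m [measurable]: "exceeds z \<alpha> \<in> sets P" for \<alpha> unfolding exceeds_def by measurable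
 have zero: "AE w in P. w \<notin> exceeds z \<alpha>" if \<alpha>: "\<alpha> > (LINT w|P. z w)" for \<alpha>
 proof -
  have "prob (exceeds z \<alpha>) \<noteq> 1"
  proof
   assume "prob (exceeds z \<alpha>) = 1"
   then have "AE w in P. w \<in> exceeds z \<alpha>" by (simp add: prob_eq_1)
   then have "AE w in P. \<exists>n. 0 < (\<Sum>j<n. z (tau (int j) w) - \<alpha>)"
   proof eventually_elim
    case (elim w)
    then obtain k :: nat where "\<forall>N. \<exists>n\<ge>N. (\<Sum>j<n. z (tau (int j) w)) > (\<alpha> + 1 / real (Suc k)) * real n"
     by (auto simp: exceeds_def)
    then obtain n where n: "n \<ge> 1" "(\<Sum>j<n. z (tau (int j) w)) > (\<alpha> + 1 / real (Suc k)) * real n" by blast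
    have "(\<alpha> + 1 / real (Suc k)) * real n \<ge> \<alpha> * real n" by (intro mult_right_mono) auto
    with n(2) have "(\<Sum>j<n. z (tau (int j) w)) > \<alpha> * real n" by linarith
    then show ?case by (intro exI[of _ n]) (simp add: sum_subtractf mult.commute)
   qed
   from maximal_ergodic[OF _ this] have "0 \<le> (LINT w|P. z w - \<alpha>)" using z by simp
   with \<alpha> z show False by (simp add: prob_space)
  qed
  with erg[of \<alpha>] have "prob (exceeds z \<alpha>) = 0" by auto
  then show ?thesis by (simp add: prob_eq_0)
 qed
 have "AE w in P. \<forall>k::nat. w \<notin> exceeds z ((LINT w|P. z w) + 1 / real (Suc k))"
  using zero by (simp add: AE_all_countable)
 moreover have "AE w in P. w \<in> space P" by simp
 ultimately show ?thesis
 proof eventually_elim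
  case (elim w)
  show ?case
  proof
   fix k :: nat
   have "w \<notin> exceeds z ((LINT w|P. z w) + 1 / real (Suc k))" using elim(1) by blast
   then have "\<not> (\<forall>N. \<exists>n\<ge>N. (\<Sum>j<n. z (tau (int j) w))
     > ((LINT w|P. z w) + 1 / real (Suc k) + 1 / real (Suc k)) * real n)"
    using elim(2) unfolding exceeds_def by blast
   then obtain N where N: "\<And>n. n \<ge> N ==>
     (\<Sum>j<n. z (tau (int j) w)) \<le> ((LINT w|P. z w) + 1 / real (Suc k) + 1 / real (Suc k)) * real n"
    by (meson not_less)
   then show "\<forall>\<^sub>F n in sequentially. (\<Sum>j<n. z (tau (int j) w)) \<le> ((LINT w|P. z w) + 2 / real (Suc k)) * real n"
    by (intro eventually_sequentiallyI[of N]) (simp add: add.assoc add_divide_distrib[symmetric])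
  qed
 qed
qed

lemma ergodic_average_AE:
 assumes z: "integrable P z" and erg: "\<And>\<alpha>. prob (exceeds z \<alpha>) \<in> {0, 1}"
  "\<And>\<alpha>. prob (exceeds (%w. - z w) \<alpha>) \<in> {0, 1}"
 shows "AE w in P. (%n. (1 / real n) * (\<Sum>j<n. z (tau (int j) w))) \<longlonglongrightarrow> (LINT w|P. z w)"
 using exceeds_upper[OF z erg(1)] exceeds_upper[OF Bochner_Integration.integrable_minus[OF z] erg(2)]
proof eventually_elim
 case (elim w)
 let ?c = "\<integral>w. z w \<partial>P"
 show ?case
 proof (rule LIMSEQ_I)
  fix eps :: real assume "eps > 0"
  then obtain k :: nat where k: "2 / real (Suc k) < eps"
   using reals_Archimedean[of "eps / 2"] by (auto simp: field_simps inverse_eq_divide)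
  have "\<forall>\<^sub>F n in sequentially. n \<ge> 1 \<and> (\<Sum>j<n. z (tau (int j) w)) \<le> (?c + 2 / real (Suc k)) * real n
    \<and> (\<Sum>j<n. - z (tau (int j) w)) \<le> (- ?c + 2 / real (Suc k)) * real n"
   using elim(1)[rule_format, of k] elim(2)[rule_format, of k] eventually_ge_at_top[of 1]
   by eventually_elim simp
  then have "\<forall>\<^sub>F n in sequentially. norm ((1 / real n) * (\<Sum>j<n. z (tau (int j) w)) - ?c) < eps"
  proof eventually_elim
   case (elim n)
   let ?s = "\<Sum>j<n. z (tau (int j) w)"
   have n: "real n > 0" using elim by simp
   have "?s / n \<le> ?c + 2 / real (Suc k)"
    using elim by (simp only: pos_divide_le_eq[OF n])
   moreover have "(- ?s) / n \<le> - ?c + 2 / real (Suc k)"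
    using elim by (simp only: pos_divide_le_eq[OF n] sum_negf)
   ultimately have "\<bar>?s / n - ?c\<bar> \<le> 2 / real (Suc k)" by (simp add: abs_le_iff del: of_nat_Suc)
   with k show ?case by simp
  qed
  then show "\<exists>no. \<forall>n\<ge>no. norm ((1 / real n) * (\<Sum>j<n. z (tau (int j) w)) - ?c) < eps"
   by (simp add: eventually_sequentially)
 qed
qed

text \<open>Scheffe's argument: for n \<ge> 1 the average has the mean c of z, so its L1 distance to
  c is twice the mean of the positive part of c minus the average. As the averages are nonnegative,
  that part lies between 0 and c, and bounded convergence applies.\<close>

lemma ergodic_average_L1:
 assumes z: "integrable P z" and z0: "\<And>w. 0 \<le> z w" and erg: "\<And>\<alpha>. prob (exceeds z \<alpha>) \<in> {0, 1}"
  "\<And>\<alpha>. prob (exceeds (%w. - z w) \<alpha>) \<in> {0, 1}"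
 shows "null_seq (%n. \<integral>w. \<bar>(1 / real n) * (\<Sum>j<n. z (tau (int j) w)) - (LINT w|P. z w)\<bar> \<partial>P)"
proof -
 let ?c = "\<integral>w. z w \<partial>P" and ?a = "%n w. (1 / real n) * (\<Sum>j<n. z (tau (int j) w))"
 have c0: "0 \<le> ?c" by (intro integral_nonneg_AE) (simp add: z0)
 have ai: "integrable P (?a n)" for n by (intro integrable_mult_right Bintegrable_sum integrable_tau z)
 have zm: "bmeas P z" using z by auto
 have am [measurable]: "bmeas P (?a n)" for n using ai[of n] by auto
 have pi: "integrable P (%w. max 0 (?c - ?a n w))" for n
  by (intro integrable_max Bintegrable_diff ai) auto
 have "(%n. \<integral>w. max 0 (?c - ?a n w) \<partial>P) \<longlonglongrightarrow> (LINT w|P. 0)"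
 proof (rule integral_dominated_convergence[where w = "%w. ?c"])
  show "AE w in P. (%n. max 0 (?c - ?a n w)) \<longlonglongrightarrow> 0"
   using ergodic_average_AE[OF z erg]
  proof eventually_elim
   case (elim w)
   have "(%n. max 0 (?c - ?a n w)) \<longlonglongrightarrow> max 0 (?c - ?c)"
    by (intro tendsto_max tendsto_const tendsto_diff elim)
   then show ?case by simp
  qed
  have "0 \<le> ?a n w" for n w by (intro mult_nonneg_nonneg sum_nonneg z0) auto
  then show "AE w in P. norm (max 0 (?c - ?a n w)) \<le> ?c" for n
   using c0 by (intro AE_I2) (simp add: max_def)
  show "bmeas P (%w. max 0 (?c - ?a n w))" for n
   by (rule borel_measurable_integrable[OF pi])
 qed auto
 then have "(%n. 2 * (LINT w|P. max 0 (?c - ?a n w))) \<longlonglongrightarrow> 2 * 0" by (intro tendsto_mult) auto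
 moreover have "\<forall>\<^sub>F n in sequentially. 2 * (LINT w|P. max 0 (?c - ?a n w)) = (LINT w|P. \<bar>?a n w - ?c\<bar>)"
 proof (rule eventually_sequentiallyI[of 1])
  fix n :: nat assume n: "1 \<le> n"
  have "(LINT w|P. ?a n w) = (1 / real n) * (\<Sum>j<n. \<integral>w. z (tau (int j) w) \<partial>P)"
   by (subst integral_mult_right_zero) (simp add: integrable_tau z)
  also have "... = ?c" using n by (simp add: integral_tau[OF zm])
  finally have ea: "(LINT w|P. ?a n w) = ?c" .
  have "(LINT w|P. \<bar>?a n w - ?c\<bar>) = (LINT w|P. 2 * max 0 (?c - ?a n w) + (?a n w - ?c))"
   by (intro Bintegral_cong) (auto simp: max_def)
  also have "... = 2 * (LINT w|P. max 0 (?c - ?a n w)) + ((LINT w|P. ?a n w) - ?c)"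
   using ai[of n] pi[of n] by (simp add: prob_space)
  finally show "2 * (LINT w|P. max 0 (?c - ?a n w)) = (LINT w|P. \<bar>?a n w - ?c\<bar>)" using ea by simp
 qed
 ultimately show ?thesis using Lim_transform_eventually by fastforce
qed

end

section \<open>Functionals on classes and events of the path space\<close>

lemma L1_dist_pair_le:
 assumes "0 \<le> C" "AE t in mu. \<bar>f t\<bar> \<le> C" "bmeas mu f" "integrable mu x" "integrable mu y"
 shows "\<bar>L1_pair mu f x - L1_pair mu f y\<bar> \<le> C * (dL1 mu x y)"
proof -
 have [measurable]: "bmeas mu f" "bmeas mu x" "bmeas mu y"
  using assms by auto
 have int: "integrable mu (%t. f t * g t)" if "integrable mu g" for g
 proof (rule Bintegrable_bound[of _ "%t. C * g t"])
  show "AE t in mu. norm (f t * g t) \<le> norm (C * g t)"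
   using assms(2) by eventually_elim (simp add: abs_mult mult_right_mono assms(1))
  show "bmeas mu (%t. f t * g t)" using that by measurable
 qed (use that in auto)
 have "L1_pair mu f x - L1_pair mu f y = (LINT t|mu. f t * (x t - y t))"
  unfolding L1_pair_def using int[OF assms(4)] int[OF assms(5)] by (simp add: right_diff_distrib)
 also have "\<bar>...\<bar> \<le> (LINT t|mu. \<bar>f t * (x t - y t)\<bar>)" by (rule integral_abs_bound)
 also have "... \<le> (LINT t|mu. C * \<bar>x t - y t\<bar>)"
 proof (rule integral_mono_AE)
  show "AE t in mu. \<bar>f t * (x t - y t)\<bar> \<le> C * \<bar>x t - y t\<bar>"
   using assms(2) by eventually_elim (simp add: abs_mult mult_right_mono)
 qed (use assms int[of "%t. x t - y t"] in auto)
 finally show ?thesis by simp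
qed

text \<open>The functional on the quotient, evaluated at a chosen representative. It is needed
  because ergodicity speaks of paths of classes.\<close>

definition class_pair :: "'t measure => ('t => real) => ('t => real) set => real" where
 "class_pair mu f A = L1_pair mu f (SOME x. x \<in> A)"

lemma class_pair_L1_class:
 assumes f: "bmeas mu f" and x: "integrable mu x"
 shows "class_pair mu f (L1_class mu x) = L1_pair mu f x"
proof -
 have "(SOME y. y \<in> L1_class mu x) \<in> L1_class mu x" by (rule someI[of "%y. y \<in> L1_class mu x", OF L1_class_self[OF x]])
 then have "integrable mu (SOME y. y \<in> L1_class mu x)" "AE t in mu. (SOME y. y \<in> L1_class mu x) t = x t"
  by (auto simp: L1_class_def)
 then show ?thesis
  unfolding class_pair_def L1_pair_def using f x by (intro integral_cong_AE) auto
qed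

text \<open>A bounded functional is Lipschitz for the L1 distance, so preimages of open sets are
  open and belong to the generator of \<open>L1_borel\<close>.\<close>

lemma class_pair_measurable:
 assumes f: "f \<in> Linfty mu"
 shows "bmeas (L1_borel mu) (class_pair mu f)"
proof -
 have fm: "bmeas mu f" using f by (simp add: Linfty_def)
 obtain C0 where C0: "AE t in mu. \<bar>f t\<bar> \<le> C0" using f by (auto simp: Linfty_def)
 define C where "C = max C0 1"
 have C: "0 \<le> C" "AE t in mu. \<bar>f t\<bar> \<le> C" using C0 by (auto simp: C_def elim!: eventually_mono)
 have "Lipschitz_continuous_map (L1_space mu) euclidean_metric (class_pair mu f)"
  unfolding Lipschitz_continuous_map_def
 proof (intro conjI exI[of _ C] ballI)
  fix A B assume "A \<in> mspace (L1_space mu)" "B \<in> mspace (L1_space mu)"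
  then obtain x y where "integrable mu x" "A = L1_class mu x" "integrable mu y" "B = L1_class mu y"
   by (auto simp: mspace_L1_space L1_carrier_def)
  then show "mdist euclidean_metric (class_pair mu f A) (class_pair mu f B) \<le> C * mdist (L1_space mu) A B"
   using L1_dist_pair_le[OF C fm] by (simp add: mdist_L1_space L1_dist_class class_pair_L1_class[OF fm] dist_real_def)
 qed auto
 then have cont: "continuous_map (mtopology_of (L1_space mu)) euclideanreal (class_pair mu f)"
  using Lipschitz_continuous_imp_continuous_map by (metis mtopology_of_euclidean)
 have sp: "topspace (mtopology_of (L1_space mu)) = mspace (L1_space mu)" by simp
 have pw: "{U. openin (mtopology_of (L1_space mu)) U} \<subseteq> Pow (mspace (L1_space mu))"
  using openin_subset[of "mtopology_of (L1_space mu)"] by (auto simp: sp)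
 have space: "space (L1_borel mu) = mspace (L1_space mu)"
  unfolding L1_borel_def by (rule space_measure_of[OF pw])
 show ?thesis
 proof (rule borel_measurableI)
  fix U :: "real set" assume "open U"
  then have "openin (mtopology_of (L1_space mu)) {x \<in> topspace (mtopology_of (L1_space mu)). class_pair mu f x \<in> U}"
   using openin_continuous_map_preimage[OF cont] by simp
  then have "openin (mtopology_of (L1_space mu)) (class_pair mu f -` U \<inter> space (L1_borel mu))"
   by (simp add: space vimage_def Int_def conj_commute)
  then show "class_pair mu f -` U \<inter> space (L1_borel mu) \<in> sets (L1_borel mu)"
   unfolding L1_borel_def using pw by (simp add: sets_measure_of)
 qed
qed

lemma space_L1_borel: "space (L1_borel mu) = L1_carrier mu"
proof -
 have pw: "{U. openin (mtopology_of (L1_space mu)) U} \<subseteq> Pow (mspace (L1_space mu))"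
  using openin_subset[of "mtopology_of (L1_space mu)"] by auto
 show ?thesis unfolding L1_borel_def using space_measure_of[OF pw] by (simp add: mspace_L1_space)
qed

locale ergodic_hannan = hannan P T F0 mu X0 for P :: "'w measure" and T F0 and mu :: "'t measure" and X0 +
 assumes erg: "L1_ergodic_sequence P mu (translates P T X0)"
begin

text \<open>The event is the preimage, under the path of classes, of a measurable set of paths that
  is exactly invariant under the shift. The factor s will be 1 and -1, for the upper and the lower
  ergodic averages.\<close>

lemma exceeds_zero_one:
 assumes f: "f \<in> Linfty mu"
 shows "prob (exceeds (%w. s * (\<Sum>i=1..r. L1_pair mu f (X0 (tau (int i) w)))\<^sup>2) \<alpha>) \<in> {0, 1}"
proof -
 let ?path = "Pi\<^sub>M (UNIV :: int set) (%_. L1_borel mu)"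
 let ?Z = "%p j. s * (\<Sum>i=1..r. class_pair mu f (p (int i + int j)))\<^sup>2"
 have fm: "bmeas mu f" using f by (simp add: Linfty_def)
 note [measurable] = class_pair_measurable[OF f]
 define A where "A = {p \<in> space ?path. \<exists>m::nat. \<forall>N. \<exists>n\<ge>N. (\<Sum>j<n. ?Z p j) > (\<alpha> + 1 / real (Suc m)) * real n}"
 have "A \<in> sets ?path" unfolding A_def by measurable
 moreover have "{y \<in> space ?path. (%i. y (i + 1)) \<in> A} = A"
 proof -
  have "(%i. y (i + 1)) \<in> A \<longleftrightarrow> y \<in> A" if y: "y \<in> space ?path" for y
  proof -
   have "(%i. y (i + 1)) \<in> space ?path" using y by (auto simp: space_PiM)
   moreover have "?Z (%i. y (i + 1)) j = ?Z y (Suc j)" for j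
   proof -
    have "int i + int j + 1 = int i + int (Suc j)" for i by simp
    then show ?thesis by (simp only:)
   qed
   note exceeds_infinitely_often_shift[of "%j. ?Z (%i. y (i + 1)) j" "%j. ?Z y j", OF this]
   ultimately show ?thesis using y by (simp add: A_def)
  qed
  moreover have "A \<subseteq> space ?path" by (auto simp: A_def)
  ultimately show ?thesis by blast
 qed
 ultimately have "measure P {w \<in> space P. (%i. L1_class mu (translates P T X0 i w)) \<in> A} \<in> {0, 1}"
  using erg unfolding L1_ergodic_sequence_def Let_def by blast
 moreover have "{w \<in> space P. (%i. L1_class mu (translates P T X0 i w)) \<in> A}
   = exceeds (%w. s * (\<Sum>i=1..r. L1_pair mu f (X0 (tau (int i) w)))\<^sup>2) \<alpha>"
 proof -
  have "(%i. L1_class mu (translates P T X0 i w)) \<in> space ?path" if w: "w \<in> space P" for w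
   using X0_integrable w by (auto simp: space_PiM space_L1_borel L1_carrier_def translates_def)
  moreover have "class_pair mu f (L1_class mu (translates P T X0 (int i + int j) w))
    = L1_pair mu f (X0 (tau (int i) (tau (int j) w)))" if w: "w \<in> space P" for w i j
   using class_pair_L1_class[OF fm X0_integrable] w by (simp add: translates_def tau_add)
  ultimately show ?thesis
   unfolding exceeds_def by (intro Collect_cong conj_cong refl) (simp add: A_def)
 qed
 ultimately show ?thesis by simp
qed

end

section \<open>The central limit theorem for real martingale differences\<close>

lemma norm_integral_le:
 fixes f :: "'a => 'b::{banach, second_countable_topology}"
 assumes "integrable M f" "integrable M g" "\<And>x. x \<in> space M ==> norm (f x) \<le> g x"
 shows "norm (LINT x|M. f x) \<le> (LINT x|M. g x)"
 by (rule order_trans[OF integral_norm_bound integral_mono]) (use assms in auto)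

lemma iexp_minus_1_le: "cmod (iexp x - 1) \<le> \<bar>x\<bar>" "cmod (iexp x - 1) \<le> 2"
 using iexp_approx1[of x 0] iexp_approx2[of x 0] by simp_all

lemma iexp_quadratic:
 "cmod (iexp x - 1 - \<i> * x + of_real (x\<^sup>2 / 2)) \<le> min (x\<^sup>2) (\<bar>x\<bar> ^ 3)"
proof -
 have s: "(\<Sum>k\<le>2. (\<i> * complex_of_real x) ^ k / fact k) = 1 + \<i> * x - of_real (x\<^sup>2 / 2)"
  by (simp add: eval_nat_numeral fact_numeral power_mult_distrib)
 have eq: "iexp x - (1 + \<i> * x - of_real (x\<^sup>2 / 2)) = iexp x - 1 - \<i> * x + of_real (x\<^sup>2 / 2)"
  by simp
 have "cmod (iexp x - 1 - \<i> * x + of_real (x\<^sup>2 / 2)) \<le> \<bar>x\<bar> ^ 3 / 6"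
  using iexp_approx1[of x 2] unfolding s eq by (simp add: eval_nat_numeral fact_numeral)
 moreover have "\<bar>x\<bar> ^ 3 / 6 \<le> \<bar>x\<bar> ^ 3" by simp
 moreover have "cmod (iexp x - 1 - \<i> * x + of_real (x\<^sup>2 / 2)) \<le> x\<^sup>2"
  using iexp_approx2[of x 2] unfolding s eq by (simp add: eval_nat_numeral fact_numeral)
 ultimately show ?thesis by (intro min.boundedI) linarith+
qed

text \<open>Second-order expansion of one compensated factor. In its use x is the normalised
  increment and a = \<sigma>^2/(2n): the term linear in x has conditional mean 0, and a - x^2/2 is
  left for the averaging argument.\<close>

lemma compensated_iexp:
 assumes a: "0 \<le> a" "a \<le> 1"
 shows "cmod (of_real (exp a) * iexp x - 1 - (\<i> * x + of_real (a - x\<^sup>2 / 2)))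
  \<le> min (x\<^sup>2) (\<bar>x\<bar> ^ 3) + a\<^sup>2 + 2 * a * \<bar>x\<bar>"
proof -
 have e1: "\<bar>exp a - 1 - a\<bar> \<le> a\<^sup>2" using exp_bound[OF a] exp_ge_add_one_self[of a] zero_le_power2[of a]
  unfolding abs_le_iff by (intro conjI) linarith+
 have "a\<^sup>2 \<le> a" using a by (simp add: power2_eq_square mult_left_le)
 then have e2: "\<bar>exp a - 1\<bar> \<le> 2 * a" using e1 a by linarith
 have "of_real (exp a) * iexp x - 1 - (\<i> * x + of_real (a - x\<^sup>2 / 2))
   = (iexp x - 1 - \<i> * x + of_real (x\<^sup>2 / 2)) + of_real (exp a - 1 - a) + of_real (exp a - 1) * (iexp x - 1)"
  by (simp add: algebra_simps)
 also have "cmod ... \<le> cmod (iexp x - 1 - \<i> * x + of_real (x\<^sup>2 / 2)) + cmod (of_real (exp a - 1 - a))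
   + cmod (of_real (exp a - 1) * (iexp x - 1))"
  by (intro order_trans[OF norm_triangle_ineq] add_mono order_refl norm_triangle_ineq)
 also have "... \<le> min (x\<^sup>2) (\<bar>x\<bar> ^ 3) + a\<^sup>2 + 2 * a * \<bar>x\<bar>"
  unfolding norm_mult norm_of_real
  by (intro add_mono iexp_quadratic e1 mult_mono e2 iexp_minus_1_le) (use a in auto)
 finally show ?thesis .
qed

context shift
begin

definition psum :: "('w => real) => nat => 'w => real" where
 "psum d n w = (\<Sum>i=1..n. d (tau (int i) w))"

text \<open>The factor \<open>exp (j \<sigma>\<^sup>2 / (2 n))\<close> compensates the decay of the characteristic function of the first
 \<open>j\<close> steps, so that the expectation of \<open>Wf d n j\<close> changes from \<open>j\<close> to \<open>j + 1\<close> only by the deviation of the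
 conditional variance from \<open>\<sigma>\<^sup>2\<close>. \<open>Lam d n Z\<close> averages \<open>Z\<close> along the orbit with these weights; it is almost
 invariant under shifting \<open>Z\<close>, and this lets the ergodic theorem for block sums of \<open>y\<close> replace the ergodicity of \<open>d\<close>, which is
 not part of the hypotheses.\<close>

definition Wf :: "('w => real) => nat => nat => 'w => complex" where
 "Wf d n j w = of_real (exp (real j * ((nrm P d)\<^sup>2 / (2 * real n)))) * iexp (psum d j w / sqrt (real n))"

definition Lam :: "('w => real) => nat => ('w => real) => complex" where
 "Lam d n Z = (\<Sum>j<n. \<integral>w. Wf d n j w * of_real (Z (tau (int j + 1) w)) \<partial>P) / of_nat n"

lemma psum_L2: "L2fun P d ==> L2fun P (psum d n)"
 unfolding psum_def[abs_def] by (intro L2fun_sum L2fun_tau)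

context
 fixes d :: "'w => real"
 assumes d: "mds d"
begin

lemma d_L2: "L2fun P d" by (rule mds_L2[OF d])

lemma d_measurable [measurable]: "bmeas P d" by (rule L2fun_measurable[OF d_L2])

lemma psum_Fil: "bmeas (Fil (int j)) (psum d j)"
 unfolding psum_def[abs_def]
 by (intro borel_measurable_sum measurable_Fil_mono[OF measurable_F0_tau]) (use d in \<open>auto simp: mds_def\<close>)

lemma Wf_Fil: "bmeas (Fil (int j)) (Wf d n j)"
proof -
 note [measurable] = psum_Fil[of j]
 show ?thesis unfolding Wf_def[abs_def] by measurable
qed

lemma Wf_measurable [measurable]: "bmeas P (Wf d n j)"
 by (rule measurable_Fil[OF Wf_Fil])

abbreviation "CW \<equiv> exp ((nrm P d)\<^sup>2 / 2)"

lemma Wf_bound: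
 assumes "j \<le> n" shows "cmod (Wf d n j w) \<le> CW"
proof -
 have "real j * ((nrm P d)\<^sup>2 / (2 * real n)) \<le> (nrm P d)\<^sup>2 / 2"
 proof (cases "n = 0")
  case False
  then have "real j * ((nrm P d)\<^sup>2 / (2 * real n)) = (real j / real n) * ((nrm P d)\<^sup>2 / 2)" by simp
  also have "... \<le> 1 * ((nrm P d)\<^sup>2 / 2)"
   using assms False by (intro mult_right_mono) (auto simp: divide_le_eq)
  finally show ?thesis by simp
 qed simp
 then show ?thesis by (simp add: Wf_def norm_mult)
qed

lemma Wf_mult_integrable:
 fixes Z :: "'w => real"
 assumes "j \<le> n" "integrable P Z" shows "integrable P (%w. Wf d n j w * of_real (Z w))"
proof (rule Bintegrable_bound[of _ "%w. CW * \<bar>Z w\<bar>"])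
 show "bmeas P (%w. Wf d n j w * of_real (Z w))"
  using assms(2) by measurable
 show "AE w in P. cmod (Wf d n j w * of_real (Z w)) \<le> norm (CW * \<bar>Z w\<bar>)"
  using Wf_bound[OF assms(1)] by (auto simp: norm_mult intro!: mult_right_mono)
qed (use assms(2) in auto)

lemma Wf_integral_bound:
 fixes Z :: "'w => real"
 assumes "j \<le> n" "integrable P Z"
 shows "cmod (LINT w|P. Wf d n j w * of_real (Z (tau k w))) \<le> CW * (LINT w|P. \<bar>Z w\<bar>)"
proof -
 have Zk: "integrable P (%w. Z (tau k w))" by (rule integrable_tau[OF assms(2)])
 have "cmod (LINT w|P. Wf d n j w * of_real (Z (tau k w))) \<le> (LINT w|P. CW * \<bar>Z (tau k w)\<bar>)"
  by (rule norm_integral_le[OF Wf_mult_integrable[OF assms(1) Zk]])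
   (use Zk Wf_bound[OF assms(1)] in \<open>auto simp: norm_mult intro!: mult_right_mono\<close>)
 also have "... = CW * (LINT w|P. \<bar>Z w\<bar>)"
  using integral_tau[of "%w. \<bar>Z w\<bar>" k] assms(2) by simp
 finally show ?thesis .
qed

lemma Lam_bound:
 assumes "integrable P Z" shows "cmod (Lam d n Z) \<le> CW * (LINT w|P. \<bar>Z w\<bar>)"
proof (cases "n = 0")
 case True
 then show ?thesis by (simp add: Lam_def)
next
 case False
 have "cmod (\<Sum>j<n. \<integral>w. Wf d n j w * of_real (Z (tau (int j + 1) w)) \<partial>P) \<le> (\<Sum>j<n. CW * (LINT w|P. \<bar>Z w\<bar>))"
  by (intro sum_norm_le Wf_integral_bound assms) auto
 then show ?thesis using False by (simp add: Lam_def norm_divide divide_le_eq mult.commute)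
qed

lemma Lam_add:
 assumes "integrable P Y" "integrable P Z"
 shows "Lam d n (%w. Y w + Z w) = Lam d n Y + Lam d n Z"
 unfolding Lam_def add_divide_distrib[symmetric] sum.distrib[symmetric]
 by (intro arg_cong2[where f = "(/)"] refl sum.cong)
  (auto simp: distrib_left intro!: Bintegral_add Wf_mult_integrable integrable_tau[OF assms(1)] integrable_tau[OF assms(2)])

lemma Lam_cmult: "Lam d n (%w. c * Z w) = of_real c * Lam d n Z"
 by (simp add: Lam_def sum_distrib_left mult.left_commute[of _ "complex_of_real c"])

lemma Lam_diff:
 assumes "integrable P Y" "integrable P Z"
 shows "Lam d n (%w. Y w - Z w) = Lam d n Y - Lam d n Z"
 using Lam_add[OF assms(1) integrable_mult_right[OF assms(2), of "-1"]] Lam_cmult[of n "-1" Z] by simp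

lemma Lam_sum:
 assumes "finite I" "\<And>i. i \<in> I ==> integrable P (Y i)"
 shows "Lam d n (%w. \<Sum>i\<in>I. Y i w) = (\<Sum>i\<in>I. Lam d n (Y i))"
 using assms by (induction I rule: finite_induct) (simp add: Lam_def, simp add: Lam_add)

lemma Wf_Suc: "Wf d n (Suc j) w
  = Wf d n j w * (of_real (exp ((nrm P d)\<^sup>2 / (2 * real n))) * iexp (d (tau (int j + 1) w) / sqrt (real n)))"
proof -
 have p: "psum d (Suc j) w / sqrt (real n) = psum d j w / sqrt (real n) + d (tau (int j + 1) w) / sqrt (real n)"
  by (simp add: psum_def add_divide_distrib add.commute)
 have e: "exp (real (Suc j) * x) = exp (real j * x) * exp x" for x :: real
  by (simp add: exp_add[symmetric] algebra_simps)
 have i: "iexp (x + y) = iexp x * iexp y" for x y :: real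
  by (simp add: distrib_left exp_add)
 show ?thesis unfolding Wf_def p e i by simp
qed

text \<open>Summation by parts moves the shift from \<open>Z\<close> to the weights. Two consecutive
  weights differ by the factor 1 minus one compensated exponential, which tends to 0 in mean against
  |Z|, and the two boundary terms are divided by n.\<close>

lemma Lam_shift:
 assumes Z: "integrable P Z"
 shows "null_seq (%n. Lam d n (%w. Z (tau 1 w)) - Lam d n Z)"
proof -
 have Zm [measurable]: "bmeas P Z" using Z by auto
 let ?a = "%n. (nrm P d)\<^sup>2 / (2 * real n)"
 \<comment> \<open>Bounds |1 - exp(a) exp(ix)| |Z| for the normalised increment x. The minimum with
   2 keeps a multiple of |Z| as dominating function, since no more than integrability of
   \<open>Z\<close> is at hand.\<close>
 let ?h = "%n w. (exp (?a n) * min 2 \<bar>d w / sqrt (real n)\<bar> + (exp (?a n) - 1)) * \<bar>Z (tau 1 w)\<bar>"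
 let ?\<beta> = "%n. \<integral>w. ?h n w \<partial>P"
 have Z1: "integrable P (%w. Z (tau 1 w))" by (rule integrable_tau[OF Z])
 have ea: "exp (?a n) \<le> CW" if "n \<ge> 1" for n
  using that by (auto simp: divide_le_eq mult_le_cancel_left1 intro!: divide_left_mono)
 have hb: "\<bar>?h n w\<bar> \<le> 3 * CW * \<bar>Z (tau 1 w)\<bar>" if "n \<ge> 1" for n w
 proof -
  have 0: "0 \<le> exp (?a n) - 1" by simp
  have "exp (?a n) * min 2 \<bar>d w / sqrt (real n)\<bar> \<le> CW * 2"
   using ea[OF that] by (intro mult_mono) auto
  then have "exp (?a n) * min 2 \<bar>d w / sqrt (real n)\<bar> + (exp (?a n) - 1) \<le> 3 * CW"
   using ea[OF that] by linarith
  moreover have "0 \<le> exp (?a n) * min 2 \<bar>d w / sqrt (real n)\<bar> + (exp (?a n) - 1)" using 0 by simp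
  ultimately show ?thesis by (simp add: abs_mult mult_right_mono)
 qed
 have hm: "bmeas P (?h n)" for n by measurable
 have hi: "integrable P (?h n)" if "n \<ge> 1" for n
  by (rule Bintegrable_bound[of _ "%w. 3 * CW * \<bar>Z (tau 1 w)\<bar>"])
   (use Z1 hm hb[OF that] in \<open>auto intro!: AE_I2\<close>)
 have sq: "filterlim (%n. sqrt (real n)) at_infinity sequentially"
  by (intro filterlim_at_top_imp_at_infinity filterlim_compose[OF sqrt_at_top filterlim_real_sequentially])
 have rn: "filterlim (%n. 2 * real n) at_infinity sequentially"
  by (intro filterlim_at_top_imp_at_infinity filterlim_tendsto_pos_mult_at_top[OF tendsto_const] filterlim_real_sequentially) simp
 have alim: "?a \<longlonglongrightarrow> 0" by (rule tendsto_divide_0[OF tendsto_const rn])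
 \<comment> \<open>The index is moved by one because the bound \<open>hb\<close> starts at n =
   1.\<close>
 have "(%n. ?\<beta> (Suc n)) \<longlonglongrightarrow> (LINT w|P. 0)"
 proof (rule integral_dominated_convergence[where w = "%w. 3 * CW * \<bar>Z (tau 1 w)\<bar>"])
  show "AE w in P. (%n. ?h (Suc n) w) \<longlonglongrightarrow> 0"
  proof (rule AE_I2)
   fix w
   have "(%n. ?h n w) \<longlonglongrightarrow> (exp 0 * min 2 \<bar>0\<bar> + (exp 0 - 1)) * \<bar>Z (tau 1 w)\<bar>"
    by (intro tendsto_intros alim tendsto_min tendsto_rabs tendsto_divide_0[OF tendsto_const sq])
   then show "null_seq (%n. ?h (Suc n) w)" using LIMSEQ_Suc by force
  qed
  show "AE w in P. norm (?h (Suc n) w) \<le> 3 * CW * \<bar>Z (tau 1 w)\<bar>" for n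
   using hb[of "Suc n"] by (intro AE_I2) (simp del: of_nat_Suc)
 qed (use hm Z1 in auto)
 then have "null_seq (%n. ?\<beta> (Suc n))" by simp
 then have \<beta>: "?\<beta> \<longlonglongrightarrow> 0" by (rule LIMSEQ_imp_Suc)
 have "null_seq (%n. 2 * CW * (LINT w|P. \<bar>Z w\<bar>) / real n)"
  by (intro tendsto_divide_0[OF tendsto_const] filterlim_at_top_imp_at_infinity filterlim_real_sequentially)
 from tendsto_add[OF tendsto_mult[OF tendsto_const \<beta>, of CW] this]
 have lim: "null_seq (%n. CW * ?\<beta> n + 2 * CW * (LINT w|P. \<bar>Z w\<bar>) / real n)" by simp
 have bound: "cmod (Lam d n (%w. Z (tau 1 w)) - Lam d n Z) \<le> CW * ?\<beta> n + 2 * CW * (LINT w|P. \<bar>Z w\<bar>) / real n"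
  if n: "n \<ge> 1" for n
 proof -
  let ?D = "%j. \<integral>w. Wf d n j w * of_real (Z (tau (int j + 2) w)) \<partial>P"
  let ?E = "%j. \<integral>w. Wf d n j w * of_real (Z (tau (int j + 1) w)) \<partial>P"
  have DE: "cmod (?D j - ?E (Suc j)) \<le> CW * ?\<beta> n" if j: "j < n" for j
  proof -
   have i1: "integrable P (%w. Wf d n j w * of_real (Z (tau (int j + 2) w)))"
    using j by (intro Wf_mult_integrable integrable_tau[OF Z]) auto
   have i2: "integrable P (%w. Wf d n (Suc j) w * of_real (Z (tau (int j + 2) w)))"
    using j by (intro Wf_mult_integrable integrable_tau[OF Z]) auto
   have eqD: "?D j - ?E (Suc j) = (LINT w|P. Wf d n j w * of_real (Z (tau (int j + 2) w)) - Wf d n (Suc j) w * of_real (Z (tau (int j + 2) w)))"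
    using i1 i2 by (simp add: algebra_simps)
   define H where "H = ?h n"
   have H: "H w = ?h n w" for w by (simp add: H_def)
   have Hi: "integrable P H" unfolding H_def by (rule hi[OF n])
   have b1: "cmod (LINT w|P. Wf d n j w * of_real (Z (tau (int j + 2) w)) - Wf d n (Suc j) w * of_real (Z (tau (int j + 2) w)))
     \<le> (LINT w|P. CW * H (tau (int j + 1) w))"
   proof (rule norm_integral_le)
    show "integrable P (%w. Wf d n j w * of_real (Z (tau (int j + 2) w)) - Wf d n (Suc j) w * of_real (Z (tau (int j + 2) w)))"
     by (rule Bintegrable_diff[OF i1 i2])
    show "integrable P (%w. CW * H (tau (int j + 1) w))"
     by (intro integrable_mult_right integrable_tau[OF Hi])
    fix w assume w: "w \<in> space P"
    let ?x = "d (tau (int j + 1) w) / sqrt (real n)"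
    have "of_real (exp (?a n)) * iexp ?x - 1 = of_real (exp (?a n)) * (iexp ?x - 1) + of_real (exp (?a n) - 1)"
     by (simp add: algebra_simps)
    then have "cmod (of_real (exp (?a n)) * iexp ?x - 1) \<le> exp (?a n) * cmod (iexp ?x - 1) + (exp (?a n) - 1)"
     using norm_triangle_ineq[of "of_real (exp (?a n)) * (iexp ?x - 1)" "complex_of_real (exp (?a n) - 1)"]
     by (simp add: norm_mult del: of_real_diff)
    also have "... \<le> exp (?a n) * min 2 \<bar>?x\<bar> + (exp (?a n) - 1)"
     using iexp_minus_1_le[of ?x] by (intro add_right_mono mult_left_mono) auto
    finally have e: "cmod (1 - of_real (exp (?a n)) * iexp ?x) \<le> exp (?a n) * min 2 \<bar>?x\<bar> + (exp (?a n) - 1)"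
     by (simp add: norm_minus_commute)
    have "Wf d n j w * of_real (Z (tau (int j + 2) w)) - Wf d n (Suc j) w * of_real (Z (tau (int j + 2) w))
      = Wf d n j w * ((1 - of_real (exp (?a n)) * iexp ?x) * of_real (Z (tau 1 (tau (int j + 1) w))))"
     using w by (simp add: Wf_Suc tau_add algebra_simps)
    also have "cmod ... \<le> CW * ((exp (?a n) * min 2 \<bar>?x\<bar> + (exp (?a n) - 1)) * \<bar>Z (tau 1 (tau (int j + 1) w))\<bar>)"
     unfolding norm_mult norm_of_real
     using Wf_bound[of j n w] j by (intro mult_mono e order_refl) auto
    finally show "cmod (Wf d n j w * of_real (Z (tau (int j + 2) w)) - Wf d n (Suc j) w * of_real (Z (tau (int j + 2) w)))
      \<le> CW * H (tau (int j + 1) w)" unfolding H .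
   qed
   have b2: "(LINT w|P. CW * H (tau (int j + 1) w)) = CW * (LINT w|P. H w)"
    using integral_tau[OF borel_measurable_integrable[OF Hi], of "int j + 1"] by simp
   show ?thesis using order_trans[OF b1 eq_refl[OF b2]] unfolding eqD H_def .
  qed
  have "Lam d n (%w. Z (tau 1 w)) = (\<Sum>j<n. ?D j) / of_nat n"
   unfolding Lam_def
   by (intro arg_cong2[where f = "(/)"] sum.cong refl Bintegral_cong) (simp_all add: tau_add add.commute)
  then have "Lam d n (%w. Z (tau 1 w)) - Lam d n Z = ((\<Sum>j<n. ?D j) - (\<Sum>j<n. ?E j)) / of_nat n"
   by (simp add: Lam_def diff_divide_distrib)
  also have "(\<Sum>j<n. ?D j) - (\<Sum>j<n. ?E j) = (\<Sum>j<n. ?D j - ?E (Suc j)) + (?E n - ?E 0)"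
   using sum_lessThan_telescope[of ?E n] by (simp only: sum_subtractf) (simp add: algebra_simps)
  finally have "cmod (Lam d n (%w. Z (tau 1 w)) - Lam d n Z)
    = cmod ((\<Sum>j<n. ?D j - ?E (Suc j)) + (?E n - ?E 0)) / real n"
   by (simp only: norm_divide norm_of_nat)
  also have "... \<le> (real n * (CW * ?\<beta> n) + 2 * CW * (LINT w|P. \<bar>Z w\<bar>)) / real n"
  proof (intro divide_right_mono)
   have "cmod (\<Sum>j<n. ?D j - ?E (Suc j)) \<le> (\<Sum>j<n. CW * ?\<beta> n)"
    by (intro sum_norm_le DE) simp
   moreover have "cmod (?E n - ?E 0) \<le> cmod (?E n) + cmod (?E 0)" by (rule norm_triangle_ineq4)
   moreover have "cmod (?E n) \<le> CW * (LINT w|P. \<bar>Z w\<bar>)" "cmod (?E 0) \<le> CW * (LINT w|P. \<bar>Z w\<bar>)"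
    by (intro Wf_integral_bound Z; simp)+
   moreover have "cmod ((\<Sum>j<n. ?D j - ?E (Suc j)) + (?E n - ?E 0)) \<le> cmod (\<Sum>j<n. ?D j - ?E (Suc j)) + cmod (?E n - ?E 0)"
    by (rule norm_triangle_ineq)
   ultimately show "cmod ((\<Sum>j<n. ?D j - ?E (Suc j)) + (?E n - ?E 0)) \<le> real n * (CW * ?\<beta> n) + 2 * CW * (LINT w|P. \<bar>Z w\<bar>)"
    by (simp only: sum_constant card_lessThan)
  qed simp
  also have "... = CW * ?\<beta> n + 2 * CW * (LINT w|P. \<bar>Z w\<bar>) / real n"
   using n by (simp add: add_divide_distrib)
  finally show ?thesis .
 qed
 show ?thesis
  by (rule Lim_null_comparison[OF eventually_sequentiallyI[of 1] lim]) (rule bound)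
qed

lemma Lam_cong:
 assumes "\<And>w. w \<in> space P ==> Y w = Z w" shows "Lam d n Y = Lam d n Z"
 unfolding Lam_def
 by (intro arg_cong2[where f = "(/)"] sum.cong refl Bintegral_cong) (simp add: assms)

lemma Lam_shift_n:
 assumes Z: "integrable P Z"
 shows "null_seq (%n. Lam d n (%w. Z (tau (int l) w)) - Lam d n Z)"
proof (induction l)
 case (Suc l)
 have "Lam d n (%w. Z (tau (int (Suc l)) w)) = Lam d n (%w. (%w. Z (tau (int l) w)) (tau 1 w))" for n
  by (rule Lam_cong) (simp add: tau_add add.commute)
 with tendsto_add[OF Lam_shift[OF integrable_tau[OF Z, of "int l"]] Suc] show ?case by simp
qed simp

lemma Lam_average:
 assumes Z: "integrable P Z" and L: "L \<ge> 1"
 shows "null_seq (%n. Lam d n (%w. (1 / real L) * (\<Sum>l<L. Z (tau (int l + k) w))) - Lam d n (%w. Z (tau k w)))"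
proof -
 have Zk: "integrable P (%w. Z (tau k w))" by (rule integrable_tau[OF Z])
 have "Lam d n (%w. (1 / real L) * (\<Sum>l<L. Z (tau (int l + k) w))) - Lam d n (%w. Z (tau k w))
   = of_real (1 / real L) * (\<Sum>l<L. Lam d n (%w. Z (tau k (tau (int l) w))) - Lam d n (%w. Z (tau k w)))" for n
 proof -
  have "Lam d n (%w. (1 / real L) * (\<Sum>l<L. Z (tau (int l + k) w)))
    = of_real (1 / real L) * (\<Sum>l<L. Lam d n (%w. Z (tau (int l + k) w)))"
   unfolding Lam_cmult by (subst Lam_sum) (auto intro: integrable_tau Z)
  also have "(\<Sum>l<L. Lam d n (%w. Z (tau (int l + k) w))) = (\<Sum>l<L. Lam d n (%w. Z (tau k (tau (int l) w))))"
   by (intro sum.cong refl Lam_cong) (simp add: tau_add add.commute)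
  finally show ?thesis using L by (simp add: sum_subtractf algebra_simps)
 qed
 moreover have "(%n. of_real (1 / real L) * (\<Sum>l<L. Lam d n (%w. Z (tau k (tau (int l) w))) - Lam d n (%w. Z (tau k w)))) \<longlonglongrightarrow> of_real (1 / real L) * (\<Sum>l<L. 0)"
  by (intro tendsto_mult tendsto_const tendsto_sum Lam_shift_n[OF Zk])
 ultimately show ?thesis by simp
qed

text \<open>\<open>Z\<close> is replaced by its average over L consecutive shifts, which changes
  \<open>Lam\<close> by a null sequence. The average is close to its mean in L1, and
  \<open>Lam\<close> is bounded by the L1 norm uniformly in n, so L can be fixed before n tends to
  infinity.\<close>

lemma Lam_ergodic:
 assumes Z: "integrable P Z"
  and erg: "null_seq (%L. \<integral>w. \<bar>(1 / real L) * (\<Sum>l<L. Z (tau (int l) w)) - (LINT w|P. Z w)\<bar> \<partial>P)"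
 shows "null_seq (%n. Lam d n Z - of_real (LINT w|P. Z w) * Lam d n (%_. 1))"
proof (rule LIMSEQ_I)
 fix eps :: real assume eps: "eps > 0"
 let ?c = "\<integral>w. Z w \<partial>P"
 let ?A = "%L w. (1 / real L) * (\<Sum>l<L. Z (tau (int l) w))"
 have C: "CW > 0" by simp
 have "eps / (2 * CW) > 0" using eps by simp
 from order_tendstoD(2)[OF erg this] obtain L where L: "L \<ge> 1" "(LINT w|P. \<bar>?A L w - ?c\<bar>) < eps / (2 * CW)"
  by (metis (mono_tags, lifting) eventually_sequentially le_add1 le_add2)
 have Ai: "integrable P (?A L)"
  by (intro integrable_mult_right Bintegrable_sum integrable_tau[OF Z])
 have Zc: "Lam d n (%w. ?A L w - ?c) = Lam d n (?A L) - of_real ?c * Lam d n (%_. 1)" for n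
 proof -
  have "Lam d n (%w. ?A L w - ?c) = Lam d n (?A L) - Lam d n (%_. ?c)" by (rule Lam_diff[OF Ai integrable_const])
  moreover have "Lam d n (%_. ?c) = of_real ?c * Lam d n (%_. 1)" using Lam_cmult[of n ?c "%_. 1"] by simp
  ultimately show ?thesis by (simp only:)
 qed
 have "null_seq (%n. Lam d n (?A L) - Lam d n Z)"
  using Lam_average[OF Z L(1), of 0] by simp
 from LIMSEQ_D[OF this, of "eps / 2"] eps obtain N where N: "\<And>n. n \<ge> N ==> cmod (Lam d n (?A L) - Lam d n Z) < eps / 2"
  by auto
 have "cmod (Lam d n Z - of_real ?c * Lam d n (%_. 1)) < eps" if n: "n \<ge> N" for n
 proof -
  have eq: "Lam d n Z - of_real ?c * Lam d n (%_. 1) = Lam d n (%w. ?A L w - ?c) - (Lam d n (?A L) - Lam d n Z)"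
   unfolding Zc by simp
  have "cmod (Lam d n (%w. ?A L w - ?c)) \<le> CW * (LINT w|P. \<bar>?A L w - ?c\<bar>)"
   by (rule Lam_bound[OF Bintegrable_diff[OF Ai integrable_const]])
  moreover have "CW * (LINT w|P. \<bar>?A L w - ?c\<bar>) \<le> eps / 2"
   using mult_strict_left_mono[OF L(2) C] by simp
  moreover have "cmod (Lam d n Z - of_real ?c * Lam d n (%_. 1))
    \<le> cmod (Lam d n (%w. ?A L w - ?c)) + cmod (Lam d n (?A L) - Lam d n Z)"
   unfolding eq by (rule norm_triangle_ineq4)
  ultimately show ?thesis using N[OF n] by linarith
 qed
 then show "\<exists>no. \<forall>n\<ge>no. cmod (Lam d n Z - of_real ?c * Lam d n (%_. 1) - 0) < eps" by auto
qed

lemma square_diff_L1: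
 assumes "L2fun P X" "L2fun P Y"
 shows "(LINT w|P. \<bar>(X w)\<^sup>2 - (Y w)\<^sup>2\<bar>) \<le> nrm P (%w. X w - Y w) * (2 * nrm P X + nrm P (%w. X w - Y w))"
proof -
 have "(LINT w|P. \<bar>(X w)\<^sup>2 - (Y w)\<^sup>2\<bar>) = (LINT w|P. \<bar>(X w - Y w) * (X w + Y w)\<bar>)"
  by (intro Bintegral_cong refl) (simp add: power2_eq_square algebra_simps)
 also have "... \<le> nrm P (%w. X w - Y w) * nrm P (%w. X w + Y w)"
  by (intro L2fun_CS_abs L2fun_diff L2fun_add assms)
 also have "... \<le> nrm P (%w. X w - Y w) * (2 * nrm P X + nrm P (%w. X w - Y w))"
  using nrm_triangle[OF assms] nrm_abs_diff_le[OF assms] by (intro mult_left_mono) auto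
 finally show ?thesis .
qed

lemma psum_nrm: "nrm P (psum d r) = sqrt (real r) * nrm P d"
proof -
 have e: "(\<Sum>i=1..r. d (tau (int i) w)) = (\<Sum>i\<in>int ` {1..r}. d (tau i w))" for w
  by (simp add: sum.reindex)
 have c: "card (int ` {1..r}) = r" by (simp add: card_image)
 show ?thesis unfolding psum_def[abs_def] e using mds_nrm_sum[OF d, of "int ` {1..r}"] unfolding c by simp
qed

text \<open>Cross terms vanish exactly: the weight and the earlier of the two increments are
  measurable before the later increment, whose conditional mean is 0.\<close>

lemma Lam_psum_square:
 "Lam d n (%w. (psum d r w)\<^sup>2) = Lam d n (%w. \<Sum>i=1..r. (d (tau (int i) w))\<^sup>2)"
proof -
 have int2: "integrable P (%w. d (tau i w) * d (tau k w))" for i k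
  by (intro L2fun_mult_integrable L2fun_tau d_L2)
 have zero: "(LINT w|P. Wf d n j w * of_real (d (tau (int j + 1 + i) w) * d (tau (int j + 1 + k) w))) = 0"
  if "i < k" "0 \<le> i" "j < n" for i k :: int and j
 proof -
  have "bmeas (Fil (int j + 1 + k - 1)) (%w. d (tau (int j + 1 + i) w))"
   using that d by (intro measurable_Fil_mono[OF measurable_F0_tau]) (auto simp: mds_def)
  moreover have "bmeas (Fil (int j + 1 + k - 1)) (Wf d n j)"
   using that by (intro measurable_Fil_mono[OF Wf_Fil]) auto
  ultimately have "bmeas (Fil (int j + 1 + k - 1)) (%w. Wf d n j w * of_real (d (tau (int j + 1 + i) w)))"
   by measurable
  from mds_integral_zero_complex[OF d this]
   Wf_mult_integrable[OF less_imp_le[OF that(3)] int2[of "int j + 1 + i" "int j + 1 + k"]]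
  show ?thesis by (simp add: mult.assoc)
 qed
 have cross: "Lam d n (%w. d (tau (int i) w) * d (tau (int k) w)) = 0" if "i \<noteq> k" for i k
 proof -
  have "(LINT w|P. Wf d n j w * of_real (d (tau (int i) (tau (int j + 1) w)) * d (tau (int k) (tau (int j + 1) w)))) = 0"
   if j: "j < n" for j
  proof -
   have "(LINT w|P. Wf d n j w * of_real (d (tau (int i) (tau (int j + 1) w)) * d (tau (int k) (tau (int j + 1) w))))
     = (LINT w|P. Wf d n j w * of_real (d (tau (int j + 1 + int i) w) * d (tau (int j + 1 + int k) w)))"
    by (intro Bintegral_cong refl) (simp add: tau_add add.commute)
   also have "... = 0"
   proof (cases "i < k")
    case True
    then show ?thesis using zero[of "int i" "int k" j] j by simp
   next
    case False
    with \<open>i \<noteq> k\<close> show ?thesis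
     using zero[of "int k" "int i" j] j by (simp add: mult.commute[of "d _" "d _"] mult.commute[of "complex_of_real (d _)" "complex_of_real (d _)"])
   qed
   finally show ?thesis .
  qed
  then show ?thesis by (simp add: Lam_def)
 qed
 have "Lam d n (%w. (psum d r w)\<^sup>2) = Lam d n (%w. \<Sum>i=1..r. \<Sum>k=1..r. d (tau (int i) w) * d (tau (int k) w))"
  by (simp only: psum_def power2_eq_square sum_product)
 also have "... = (\<Sum>i=1..r. \<Sum>k=1..r. Lam d n (%w. d (tau (int i) w) * d (tau (int k) w)))"
  by (subst Lam_sum, simp, intro Bintegrable_sum int2)
   (intro sum.cong refl Lam_sum finite_atLeastAtMost int2)
 also have "... = (\<Sum>i=1..r. \<Sum>k=1..r. if k = i then Lam d n (%w. (d (tau (int i) w))\<^sup>2) else 0)"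
  by (intro sum.cong refl) (auto simp: cross power2_eq_square)
 also have "... = (\<Sum>i=1..r. Lam d n (%w. (d (tau (int i) w))\<^sup>2))"
  by (intro sum.cong refl) (simp add: sum.delta)
 also have "... = Lam d n (%w. \<Sum>i=1..r. (d (tau (int i) w))\<^sup>2)"
  by (rule Lam_sum[symmetric]) (auto intro!: L2fun_square L2fun_tau d_L2)
 finally show ?thesis .
qed

text \<open>For a block length r, \<open>Lam\<close> of the squared block sum of \<open>d\<close> is
  r times \<open>Lam\<close> of an average of shifts of d^2. That block sum is within o(sqrt r) in
  L2 of the block sum of \<open>y\<close>, whose square obeys the ergodic theorem. After division by
  r the replacement costs little for large r, uniformly in n; r is fixed before n tends to
  infinity.\<close>

lemma Lam_variance:
 assumes y: "L2fun P y"
  and eta: "null_seq (%n. nrm P (%w. psum y n w - psum d n w) / sqrt (real n))"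
  and erg: "\<And>r. (%L. \<integral>w. \<bar>(1 / real L) * (\<Sum>l<L. (psum y r (tau (int l) w))\<^sup>2) - (LINT w|P. (psum y r w)\<^sup>2)\<bar> \<partial>P) \<longlonglongrightarrow> 0"
 shows "null_seq (%n. Lam d n (%w. (d w)\<^sup>2) - of_real ((nrm P d)\<^sup>2) * Lam d n (%_. 1))"
proof (rule LIMSEQ_I)
 fix eps :: real assume eps: "eps > 0"
 let ?\<sigma> = "nrm P d"
 let ?\<eta> = "%r. nrm P (%w. psum d r w - psum y r w) / sqrt (real r)"
 have eta': "?\<eta> \<longlonglongrightarrow> 0" using eta by (simp add: nrm_commute[of P "psum d _"])
 \<comment> \<open>The factor 2 covers the two uses of the replacement error: once inside
   \<open>Lam\<close>, once in comparing \<sigma>^2 with the normalised second moment of the block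
   sum of \<open>y\<close>.\<close>
 have "(%r. 2 * CW * (?\<eta> r * (2 * ?\<sigma> + ?\<eta> r))) \<longlonglongrightarrow> 2 * CW * (0 * (2 * ?\<sigma> + 0))"
  by (intro tendsto_intros eta')
 then have "null_seq (%r. 2 * CW * (?\<eta> r * (2 * ?\<sigma> + ?\<eta> r)))" by simp
 from order_tendstoD(2)[OF this, of "eps / 2"] eps obtain r0 where
  r0: "\<And>r. r \<ge> r0 ==> 2 * CW * (?\<eta> r * (2 * ?\<sigma> + ?\<eta> r)) < eps / 2"
  unfolding eventually_sequentially by auto
 define r where "r = Suc r0"
 have r: "r \<ge> 1" "2 * CW * (?\<eta> r * (2 * ?\<sigma> + ?\<eta> r)) < eps / 2"
  by (simp add: r_def, rule r0, simp add: r_def)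
 have rr: "sqrt (real r) > 0" "real r > 0" using r(1) by auto
 let ?Y = "%w. (psum y r w)\<^sup>2" and ?M = "%w. (psum d r w)\<^sup>2"
 let ?c = "\<integral>w. ?Y w \<partial>P"
 have Yi: "integrable P ?Y" and Mi: "integrable P ?M" by (intro L2fun_square psum_L2 y d_L2)+
 have d2: "integrable P (%w. (d w)\<^sup>2)" by (rule L2fun_square[OF d_L2])
 have diff: "(LINT w|P. \<bar>?M w - ?Y w\<bar>) \<le> real r * (?\<eta> r * (2 * ?\<sigma> + ?\<eta> r))"
 proof -
  define e where "e = ?\<eta> r"
  have n\<eta>: "nrm P (%w. psum d r w - psum y r w) = sqrt (real r) * e" using rr by (simp add: e_def)
  have "(LINT w|P. \<bar>?M w - ?Y w\<bar>) \<le> (sqrt (real r) * e) * (2 * (sqrt (real r) * ?\<sigma>) + sqrt (real r) * e)"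
   using square_diff_L1[OF psum_L2[OF d_L2] psum_L2[OF y], of r r] unfolding psum_nrm n\<eta> .
  also have "... = (sqrt (real r) * sqrt (real r)) * (e * (2 * ?\<sigma> + e))" by (simp only: algebra_simps)
  finally have "(LINT w|P. \<bar>?M w - ?Y w\<bar>) \<le> real r * (e * (2 * ?\<sigma> + e))" by simp
  then show ?thesis unfolding e_def .
 qed
 have cs: "\<bar>?\<sigma>\<^sup>2 - ?c / real r\<bar> \<le> ?\<eta> r * (2 * ?\<sigma> + ?\<eta> r)"
 proof -
  have "(LINT w|P. ?M w) = real r * ?\<sigma>\<^sup>2" using nrm_power2[of P "psum d r"] psum_nrm[of r] by (simp add: power_mult_distrib)
  then have "\<bar>real r * ?\<sigma>\<^sup>2 - ?c\<bar> = \<bar>\<integral>w. ?M w - ?Y w \<partial>P\<bar>" using Mi Yi by simp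
  also have "... \<le> (LINT w|P. \<bar>?M w - ?Y w\<bar>)" by (rule integral_abs_bound)
  finally have "\<bar>real r * ?\<sigma>\<^sup>2 - ?c\<bar> \<le> real r * (?\<eta> r * (2 * ?\<sigma> + ?\<eta> r))" using diff by linarith
  moreover have "\<bar>real r * ?\<sigma>\<^sup>2 - ?c\<bar> = real r * \<bar>?\<sigma>\<^sup>2 - ?c / real r\<bar>"
   using rr by (subst abs_of_pos[OF rr(2), symmetric], subst abs_mult[symmetric]) (simp add: algebra_simps)
  ultimately have "real r * \<bar>?\<sigma>\<^sup>2 - ?c / real r\<bar> \<le> real r * (?\<eta> r * (2 * ?\<sigma> + ?\<eta> r))"
   by (simp only:)
  then show ?thesis by (rule mult_left_le_imp_le[OF _ rr(2)])
 qed
 let ?A = "%w. (1 / real r) * (\<Sum>l<r. (d (tau (int l + 1) w))\<^sup>2)"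
 have A: "Lam d n ?A = of_real (1 / real r) * Lam d n ?M" for n
 proof -
  have "(\<Sum>l<r. (d (tau (int l + 1) w))\<^sup>2) = (\<Sum>i=1..r. (d (tau (int i) w))\<^sup>2)" for w
   by (rule sum.reindex_bij_witness[of _ "%i. i - 1" Suc]) (auto simp: add.commute)
  then show ?thesis unfolding Lam_cmult Lam_psum_square by simp
 qed
 have lim1: "null_seq (%n. Lam d n ?A - Lam d n (%w. (d (tau 1 w))\<^sup>2))"
  by (rule Lam_average[OF d2 r(1)])
 have lim2: "null_seq (%n. Lam d n (%w. (d (tau 1 w))\<^sup>2) - Lam d n (%w. (d w)\<^sup>2))"
  by (rule Lam_shift[OF d2])
 have lim3: "null_seq (%n. Lam d n ?Y - of_real ?c * Lam d n (%_. 1))"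
  by (rule Lam_ergodic[OF Yi erg])
 let ?e = "%n. - ((Lam d n ?A - Lam d n (%w. (d (tau 1 w))\<^sup>2)) + (Lam d n (%w. (d (tau 1 w))\<^sup>2) - Lam d n (%w. (d w)\<^sup>2)))
   + of_real (1 / real r) * (Lam d n ?Y - of_real ?c * Lam d n (%_. 1))"
 have "?e \<longlonglongrightarrow> - (0 + 0) + of_real (1 / real r) * 0" by (intro tendsto_intros lim1 lim2 lim3)
 then have "?e \<longlonglongrightarrow> 0" by simp
 from LIMSEQ_D[OF this, of "eps / 2"] eps obtain N where N: "\<And>n. n \<ge> N ==> cmod (?e n) < eps / 2" by auto
 have "cmod (Lam d n (%w. (d w)\<^sup>2) - of_real (?\<sigma>\<^sup>2) * Lam d n (%_. 1)) < eps" if n: "n \<ge> N" for n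
 proof -
  have eq: "Lam d n (%w. (d w)\<^sup>2) - of_real (?\<sigma>\<^sup>2) * Lam d n (%_. 1)
    = ?e n + of_real (1 / real r) * (Lam d n ?M - Lam d n ?Y) - of_real (?\<sigma>\<^sup>2 - ?c / real r) * Lam d n (%_. 1)"
   unfolding A using rr by (simp add: field_simps)
  have tri: "cmod (a + b - c) \<le> cmod a + cmod b + cmod c" for a b c
   by (intro order_trans[OF norm_triangle_ineq4] add_right_mono norm_triangle_ineq)
  have b1: "cmod (of_real (1 / real r) * (Lam d n ?M - Lam d n ?Y)) \<le> CW * (?\<eta> r * (2 * ?\<sigma> + ?\<eta> r))"
  proof -
   have "cmod (Lam d n ?M - Lam d n ?Y) \<le> CW * (LINT w|P. \<bar>?M w - ?Y w\<bar>)"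
    using Lam_bound[OF Bintegrable_diff[OF Mi Yi], of n] unfolding Lam_diff[OF Mi Yi] .
   moreover have "CW * (LINT w|P. \<bar>?M w - ?Y w\<bar>) \<le> CW * (real r * (?\<eta> r * (2 * ?\<sigma> + ?\<eta> r)))"
    by (intro mult_left_mono diff) simp
   ultimately have "cmod (Lam d n ?M - Lam d n ?Y) \<le> CW * (?\<eta> r * (2 * ?\<sigma> + ?\<eta> r)) * real r"
    by (simp only: ac_simps)
   then have "cmod (Lam d n ?M - Lam d n ?Y) / real r \<le> CW * (?\<eta> r * (2 * ?\<sigma> + ?\<eta> r))"
    by (simp only: pos_divide_le_eq[OF rr(2)])
   then show ?thesis using rr by (simp add: norm_mult norm_divide)
  qed
  have b2: "cmod (of_real (?\<sigma>\<^sup>2 - ?c / real r) * Lam d n (%_. 1)) \<le> (?\<eta> r * (2 * ?\<sigma> + ?\<eta> r)) * CW"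
   unfolding norm_mult norm_of_real using Lam_bound[of "%_. 1" n] cs
   by (intro mult_mono cs) (auto simp: prob_space intro: order_trans[OF abs_ge_zero cs])
  define q where "q = CW * (?\<eta> r * (2 * ?\<sigma> + ?\<eta> r))"
  have r2: "2 * q < eps / 2" using r(2) unfolding q_def mult.assoc .
  have b2': "cmod (of_real (?\<sigma>\<^sup>2 - ?c / real r) * Lam d n (%_. 1)) \<le> q"
   using b2 unfolding q_def by (simp only: mult.commute)
  note b1' = b1[folded q_def]
  define e where "e = ?e n"
  have Ne: "cmod e < eps / 2" unfolding e_def by (rule N[OF n])
  show ?thesis
   using tri[of e "of_real (1 / real r) * (Lam d n ?M - Lam d n ?Y)" "of_real (?\<sigma>\<^sup>2 - ?c / real r) * Lam d n (%_. 1)"]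
    Ne r2 b1' b2' unfolding eq[folded e_def] by linarith
 qed
 then show "\<exists>no. \<forall>n\<ge>no. cmod (Lam d n (%w. (d w)\<^sup>2) - of_real ((nrm P d)\<^sup>2) * Lam d n (%_. 1) - 0) < eps" by auto
qed

text \<open>The expectation of the compensated exponential starts at 1 and is followed step by step.
  Linear terms vanish by the martingale property, quadratic terms add up to half of the difference
  treated by \<open>Lam_variance\<close>, and the remainders total at most a constant times n
  E(r_n), which tends to 0. Hence the final expectation tends to 1, and removing the compensator
  gives the Gaussian limit.\<close>

theorem martingale_clt:
 assumes y: "L2fun P y"
  and eta: "null_seq (%n. nrm P (%w. psum y n w - psum d n w) / sqrt (real n))"
  and erg: "\<And>r. (%L. \<integral>w. \<bar>(1 / real L) * (\<Sum>l<L. (psum y r (tau (int l) w))\<^sup>2) - (LINT w|P. (psum y r w)\<^sup>2)\<bar> \<partial>P) \<longlonglongrightarrow> 0"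
 shows "(%n. \<integral>w. iexp (psum d n w / sqrt (real n)) \<partial>P) \<longlonglongrightarrow> of_real (exp (- (nrm P d)\<^sup>2 / 2))"
proof -
 let ?\<sigma> = "nrm P d"
 let ?a = "%n. ?\<sigma>\<^sup>2 / (2 * real n)"
 let ?x = "%n w. d w / sqrt (real n)"
 let ?r = "%n w. min ((?x n w)\<^sup>2) (\<bar>?x n w\<bar> ^ 3) + (?a n)\<^sup>2 + 2 * ?a n * \<bar>?x n w\<bar>"
 have di: "integrable P d" by (rule L2fun_integrable[OF d_L2])
 have d2: "integrable P (%w. (d w)\<^sup>2)" by (rule L2fun_square[OF d_L2])
 have x2: "integrable P (%w. (?x n w)\<^sup>2)" for n using d2 by (simp add: power_divide)
 have mi: "integrable P (%w. min ((?x n w)\<^sup>2) (\<bar>?x n w\<bar> ^ 3))" for n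
  by (rule Bintegrable_bound[OF x2[of n]]) (auto intro!: AE_I2)
 have ri: "integrable P (?r n)" for n
  using mi[of n] di by (intro Bintegrable_add integrable_mult_right) auto
 have sq: "filterlim (%n. sqrt (real n)) at_infinity sequentially"
  by (intro filterlim_at_top_imp_at_infinity filterlim_compose[OF sqrt_at_top filterlim_real_sequentially])
 have rho: "null_seq (%n. real n * (LINT w|P. ?r n w))"
 proof -
  \<comment> \<open>Multiplication by n turns the cubic remainder into min(d^2, |d|^3 / sqrt n),
    which tends to 0 pointwise and is dominated by d^2; second moments therefore suffice.\<close>
  have "(%n. \<integral>w. min ((d w)\<^sup>2) (\<bar>d w\<bar> ^ 3 / sqrt (real n)) \<partial>P) \<longlonglongrightarrow> (LINT w|P. 0)"
  proof (rule integral_dominated_convergence[where w = "%w. (d w)\<^sup>2"])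
   show "AE w in P. (%n. min ((d w)\<^sup>2) (\<bar>d w\<bar> ^ 3 / sqrt (real n))) \<longlonglongrightarrow> 0"
   proof (rule AE_I2)
    fix w
    have "(%n. min ((d w)\<^sup>2) (\<bar>d w\<bar> ^ 3 / sqrt (real n))) \<longlonglongrightarrow> min ((d w)\<^sup>2) 0"
     by (intro tendsto_min tendsto_const tendsto_divide_0[OF tendsto_const sq])
    moreover have "min ((d w)\<^sup>2) 0 = 0" by (simp add: min_absorb2)
    ultimately show "null_seq (%n. min ((d w)\<^sup>2) (\<bar>d w\<bar> ^ 3 / sqrt (real n)))" by (simp only:)
   qed
  qed (use d2 in \<open>auto intro!: AE_I2\<close>)
  then have 1: "null_seq (%n. \<integral>w. min ((d w)\<^sup>2) (\<bar>d w\<bar> ^ 3 / sqrt (real n)) \<partial>P)" by simp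
  have 2: "null_seq (%n. (?\<sigma>\<^sup>2)\<^sup>2 / 4 / real n)"
   by (intro tendsto_divide_0[OF tendsto_const] filterlim_at_top_imp_at_infinity filterlim_real_sequentially)
  have 3: "null_seq (%n. ?\<sigma>\<^sup>2 * (LINT w|P. \<bar>d w\<bar>) / sqrt (real n))"
   by (rule tendsto_divide_0[OF tendsto_const sq])
  have "null_seq (%n. (LINT w|P. min ((d w)\<^sup>2) (\<bar>d w\<bar> ^ 3 / sqrt (real n))) + (?\<sigma>\<^sup>2)\<^sup>2 / 4 / real n + ?\<sigma>\<^sup>2 * (LINT w|P. \<bar>d w\<bar>) / sqrt (real n))"
   using tendsto_add[OF tendsto_add[OF 1 2] 3] by simp
  moreover have "\<forall>\<^sub>F n in sequentially. (LINT w|P. min ((d w)\<^sup>2) (\<bar>d w\<bar> ^ 3 / sqrt (real n))) + (?\<sigma>\<^sup>2)\<^sup>2 / 4 / real n + ?\<sigma>\<^sup>2 * (LINT w|P. \<bar>d w\<bar>) / sqrt (real n)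
    = real n * (LINT w|P. ?r n w)"
  proof (rule eventually_sequentiallyI[of 1])
   fix n :: nat assume n: "1 \<le> n"
   have s0: "sqrt (real n) > 0" using n by simp
   have ss: "sqrt (real n) ^ 2 = real n" by simp
   have s3: "sqrt (real n) ^ 3 = real n * sqrt (real n)" by (simp add: power3_eq_cube)
   have m: "min ((d w)\<^sup>2) (\<bar>d w\<bar> ^ 3 / sqrt (real n)) = real n * min ((?x n w)\<^sup>2) (\<bar>?x n w\<bar> ^ 3)" for w
    using n by (simp add: min_mult_distrib_left power_divide ss s3 abs_divide)
   have "real n * (LINT w|P. ?r n w) = real n * (LINT w|P. min ((?x n w)\<^sup>2) (\<bar>?x n w\<bar> ^ 3)) + real n * (?a n)\<^sup>2 + real n * (2 * ?a n * (LINT w|P. \<bar>?x n w\<bar>))"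
    using mi[of n] di by (simp add: prob_space distrib_left)
   also have "real n * (?a n)\<^sup>2 = (?\<sigma>\<^sup>2)\<^sup>2 / 4 / real n"
    using n by (simp add: power2_eq_square field_simps)
   also have "real n * (2 * ?a n * (LINT w|P. \<bar>?x n w\<bar>)) = ?\<sigma>\<^sup>2 * (LINT w|P. \<bar>d w\<bar>) / sqrt (real n)"
    using n by (simp add: abs_divide)
   finally show "(LINT w|P. min ((d w)\<^sup>2) (\<bar>d w\<bar> ^ 3 / sqrt (real n))) + (?\<sigma>\<^sup>2)\<^sup>2 / 4 / real n + ?\<sigma>\<^sup>2 * (LINT w|P. \<bar>d w\<bar>) / sqrt (real n)
    = real n * (LINT w|P. ?r n w)" by (simp only: m integral_mult_right_zero)
  qed
  ultimately show ?thesis by (rule Lim_transform_eventually)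
 qed
 \<comment> \<open>From n \<ge> \<sigma>^2 on, the exponent \<sigma>^2/(2n) is at most 1, as
   \<open>compensated_iexp\<close> requires.\<close>
 obtain n1 :: nat where n1: "?\<sigma>\<^sup>2 \<le> real n1" using real_arch_simple by blast
 define n0 where "n0 = Suc n1"
 have n0: "real n0 \<ge> ?\<sigma>\<^sup>2" "n0 \<ge> 1" using n1 by (simp_all add: n0_def)
 have step: "cmod ((LINT w|P. Wf d n n w) - 1 + of_real (1/2) * (Lam d n (%w. (d w)\<^sup>2) - of_real (?\<sigma>\<^sup>2) * Lam d n (%_. 1)))
   \<le> CW * (real n * (LINT w|P. ?r n w))" if n: "n \<ge> n0" for n
 proof -
  have n1: "n \<ge> 1" using n n0(2) by simp
  have nn: "?\<sigma>\<^sup>2 \<le> real n" using n n0(1) by linarith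
  have a: "0 \<le> ?a n" "?a n \<le> 1"
  proof -
   show "0 \<le> ?a n" by simp
   show "?a n \<le> 1" using n1 nn by (simp add: divide_le_eq)
  qed
  have inc: "cmod ((LINT w|P. Wf d n (Suc j) w) - (LINT w|P. Wf d n j w)
    - (LINT w|P. Wf d n j w * of_real (?a n - (?x n (tau (int j + 1) w))\<^sup>2 / 2))) \<le> CW * (LINT w|P. ?r n w)"
   if j: "j < n" for j
  proof -
   let ?X = "%w. ?x n (tau (int j + 1) w)"
   have jn: "j \<le> n" "Suc j \<le> n" using j by auto
   have Xi: "integrable P ?X" using integrable_tau[OF di, of "int j + 1"] by simp
   have qi: "integrable P (%w. ?a n - (?X w)\<^sup>2 / 2)" using integrable_tau[OF x2[of n], of "int j + 1"] by simp
   have iS: "integrable P (Wf d n (Suc j))" using Wf_mult_integrable[OF jn(2), of "%_. 1"] by simp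
   have i0: "integrable P (Wf d n j)" using Wf_mult_integrable[OF jn(1), of "%_. 1"] by simp
   have i1: "integrable P (%w. Wf d n j w * of_real (?X w))" by (rule Wf_mult_integrable[OF jn(1) Xi])
   have i2: "integrable P (%w. Wf d n j w * of_real (?a n - (?X w)\<^sup>2 / 2))" by (rule Wf_mult_integrable[OF jn(1) qi])
   have "(LINT w|P. Wf d n j w * of_real (d (tau (int j + 1) w))) = 0"
    by (rule mds_integral_zero_complex[OF d]) (use Wf_Fil[of n j] Wf_mult_integrable[OF jn(1) integrable_tau[OF di, of "int j + 1"]] in auto)
   then have z: "(LINT w|P. Wf d n j w * of_real (?X w)) = 0"
    by simp
   let ?V = "%w. Wf d n j w * (of_real (exp (?a n)) * iexp (?X w) - 1 - (\<i> * ?X w + of_real (?a n - (?X w)\<^sup>2 / 2)))"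
   have V: "Wf d n (Suc j) w - Wf d n j w - \<i> * (Wf d n j w * of_real (?X w)) - Wf d n j w * of_real (?a n - (?X w)\<^sup>2 / 2) = ?V w" for w
    by (simp only: Wf_Suc algebra_simps mult_1_left)
   have iV: "integrable P (%w. Wf d n (Suc j) w - Wf d n j w - \<i> * (Wf d n j w * of_real (?X w)) - Wf d n j w * of_real (?a n - (?X w)\<^sup>2 / 2))"
    by (intro Bintegrable_diff integrable_mult_right iS i0 i1 i2)
   have "(LINT w|P. ?V w) = (LINT w|P. Wf d n (Suc j) w) - (LINT w|P. Wf d n j w) - \<i> * (LINT w|P. Wf d n j w * of_real (?X w))
     - (LINT w|P. Wf d n j w * of_real (?a n - (?X w)\<^sup>2 / 2))"
    unfolding V[symmetric]
    by (simp only: Bintegral_diff iS i0 i1 i2 Bintegrable_diff integrable_mult_right integral_mult_right_zero)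
   then have eq: "(LINT w|P. Wf d n (Suc j) w) - (LINT w|P. Wf d n j w) - (LINT w|P. Wf d n j w * of_real (?a n - (?X w)\<^sup>2 / 2)) = (LINT w|P. ?V w)"
    unfolding z by (simp only: mult_zero_right diff_zero)
   define H where "H = ?r n"
   have Hi: "integrable P H" unfolding H_def by (rule ri)
   have b1: "cmod (LINT w|P. ?V w) \<le> (LINT w|P. CW * H (tau (int j + 1) w))"
   proof (rule norm_integral_le)
    show "integrable P ?V" using iV unfolding V .
    show "integrable P (%w. CW * H (tau (int j + 1) w))"
     by (intro integrable_mult_right integrable_tau[OF Hi])
    fix w
    show "cmod (?V w) \<le> CW * H (tau (int j + 1) w)"
     unfolding norm_mult H_def by (intro mult_mono Wf_bound jn compensated_iexp a) auto
   qed
   have b2: "(LINT w|P. CW * H (tau (int j + 1) w)) = CW * (LINT w|P. H w)"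
    using integral_tau[OF borel_measurable_integrable[OF Hi], of "int j + 1"] by simp
   show ?thesis using order_trans[OF b1 eq_refl[OF b2]] unfolding eq H_def .
  qed
  have Wf0: "Wf d n 0 w = 1" for w by (simp add: Wf_def psum_def)
  have tele: "(\<Sum>j<n. (LINT w|P. Wf d n (Suc j) w) - (LINT w|P. Wf d n j w)) = (LINT w|P. Wf d n n w) - 1"
   using sum_lessThan_telescope[of "%j. \<integral>w. Wf d n j w \<partial>P" n] by (simp add: Wf0 prob_space)
  have lam: "(\<Sum>j<n. \<integral>w. Wf d n j w * of_real (?a n - (?x n (tau (int j + 1) w))\<^sup>2 / 2) \<partial>P)
    = - of_real (1/2) * (Lam d n (%w. (d w)\<^sup>2) - of_real (?\<sigma>\<^sup>2) * Lam d n (%_. 1))"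
  proof -
   have "(\<Sum>j<n. \<integral>w. Wf d n j w * of_real (?a n - (?x n (tau (int j + 1) w))\<^sup>2 / 2) \<partial>P)
     = of_nat n * Lam d n (%w. ?a n - (?x n w)\<^sup>2 / 2)"
    using n1 by (simp add: Lam_def)
   also have "Lam d n (%w. ?a n - (?x n w)\<^sup>2 / 2) = Lam d n (%w. ?a n * 1 - (1 / (2 * real n)) * (d w)\<^sup>2)"
    by (rule Lam_cong) (simp add: power_divide)
   also have "... = of_real (?a n) * Lam d n (%_. 1) - of_real (1 / (2 * real n)) * Lam d n (%w. (d w)\<^sup>2)"
    by (subst Lam_diff) (use d2 in \<open>auto simp only: Lam_cmult integrable_mult_right integrable_const\<close>)
   finally show ?thesis
   proof (rule trans)
    show "of_nat n * (of_real (?a n) * x - of_real (1 / (2 * real n)) * z) = - of_real (1/2) * (z - of_real (?\<sigma>\<^sup>2) * x)"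
     for x z :: complex using n1 by (simp add: field_simps)
   qed
  qed
  have eq: "(LINT w|P. Wf d n n w) - 1 + of_real (1/2) * (Lam d n (%w. (d w)\<^sup>2) - of_real (?\<sigma>\<^sup>2) * Lam d n (%_. 1))
    = (\<Sum>j<n. ((LINT w|P. Wf d n (Suc j) w) - (LINT w|P. Wf d n j w))
      - (LINT w|P. Wf d n j w * of_real (?a n - (?x n (tau (int j + 1) w))\<^sup>2 / 2)))"
   unfolding sum_subtractf[of "%j. (LINT w|P. Wf d n (Suc j) w) - (LINT w|P. Wf d n j w)"] tele lam by simp
  define c where "c = CW * (LINT w|P. ?r n w)"
  note inc' = inc[folded c_def]
  have "cmod (\<Sum>j<n. ((LINT w|P. Wf d n (Suc j) w) - (LINT w|P. Wf d n j w))
      - (LINT w|P. Wf d n j w * of_real (?a n - (?x n (tau (int j + 1) w))\<^sup>2 / 2))) \<le> (\<Sum>j<n. c)"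
   by (rule sum_norm_le) (rule inc', simp)
  then have "cmod (\<Sum>j<n. ((LINT w|P. Wf d n (Suc j) w) - (LINT w|P. Wf d n j w))
      - (LINT w|P. Wf d n j w * of_real (?a n - (?x n (tau (int j + 1) w))\<^sup>2 / 2))) \<le> real n * c"
   by (simp only: sum_constant card_lessThan)
  then show ?thesis unfolding eq c_def by (simp only: mult.left_commute)
 qed
 have "null_seq (%n. (LINT w|P. Wf d n n w) - 1 + of_real (1/2) * (Lam d n (%w. (d w)\<^sup>2) - of_real (?\<sigma>\<^sup>2) * Lam d n (%_. 1)))"
 proof (rule Lim_null_comparison[OF eventually_sequentiallyI[of n0]])
  show "null_seq (%n. CW * (real n * (LINT w|P. ?r n w)))"
   using tendsto_mult[OF tendsto_const rho, of CW] by simp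
 qed (rule step)
 from tendsto_diff[OF this tendsto_mult[OF tendsto_const Lam_variance[OF y eta erg], of "of_real (1/2)"]]
 have "null_seq (%n. (LINT w|P. Wf d n n w) - 1)" by simp
 from tendsto_add[OF this tendsto_const[of 1]]
 have "(%n. \<integral>w. Wf d n n w \<partial>P) \<longlonglongrightarrow> 1" by simp
 from tendsto_mult[OF tendsto_const[of "of_real (exp (- ?\<sigma>\<^sup>2 / 2))"] this]
 have lim: "(%n. of_real (exp (- ?\<sigma>\<^sup>2 / 2)) * (LINT w|P. Wf d n n w)) \<longlonglongrightarrow> of_real (exp (- ?\<sigma>\<^sup>2 / 2))" by simp
 have "\<forall>\<^sub>F n in sequentially. of_real (exp (- ?\<sigma>\<^sup>2 / 2)) * (LINT w|P. Wf d n n w) = (LINT w|P. iexp (psum d n w / sqrt (real n)))"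
 proof (rule eventually_sequentiallyI[of 1])
  fix n :: nat assume n: "1 \<le> n"
  have "real n * ?a n = ?\<sigma>\<^sup>2 / 2" using n by simp
  then have "(LINT w|P. Wf d n n w) = of_real (exp (?\<sigma>\<^sup>2 / 2)) * (LINT w|P. iexp (psum d n w / sqrt (real n)))"
   by (simp add: Wf_def)
  moreover have "exp (- ?\<sigma>\<^sup>2 / 2) * exp (?\<sigma>\<^sup>2 / 2) = (1 :: real)" by (simp add: exp_add[symmetric])
  ultimately show "of_real (exp (- ?\<sigma>\<^sup>2 / 2)) * (LINT w|P. Wf d n n w) = (LINT w|P. iexp (psum d n w / sqrt (real n)))"
   by (simp only: mult.assoc[symmetric] of_real_mult[symmetric]) simp
 qed
 with lim show ?thesis by (rule Lim_transform_eventually)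
qed

end

end

section \<open>Separability of the range of a jointly measurable function\<close>

definition sect_dist :: "'t measure => ('w \<times> 't) set => 'w => 't set => real" where
 "sect_dist mu E w K = (LINT t|mu. \<bar>indicator E (w, t) - indicator K t\<bar>)"

context
 fixes mu :: "'t measure" and P :: "'w measure"
 assumes fin: "finite_measure mu"
begin

interpretation mu: finite_measure mu by (rule fin)

lemma indicator_section_measurable:
 assumes "E \<in> sets (P \<Otimes>\<^sub>M mu)" "w \<in> space P"
 shows "bmeas mu (%t. indicator E (w, t) :: real)"
 using measurable_compose[OF measurable_Pair1'[OF assms(2), of mu], of "indicator E" borel] assms(1) by simp

lemma bounded_integrable:
 fixes f :: "'t => real"
 assumes "bmeas mu f" "\<And>t. t \<in> space mu ==> \<bar>f t\<bar> \<le> B"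
 shows "integrable mu f"
 by (rule mu.integrable_const_bound[of _ B]) (use assms in auto)

lemma indicator_diff_integrable:
 assumes "E \<in> sets (P \<Otimes>\<^sub>M mu)" "w \<in> space P" "K \<in> sets mu"
 shows "integrable mu (%t. \<bar>indicator E (w, t) - indicator K t\<bar> :: real)"
proof (rule bounded_integrable[of _ 1])
 show "bmeas mu (%t. \<bar>indicator E (w, t) - indicator K t\<bar> :: real)"
  using indicator_section_measurable[OF assms(1,2)] assms(3) by measurable
qed (auto simp: indicator_def)

text \<open>Dynkin class argument over E, producing one countable family for all w. A rectangle
  needs only its base and the empty set; complements are approximated by complements; a disjoint
  union is approximated by finite unions of approximants of its members.\<close>

lemma separable_sections_set:
 assumes "E \<in> sets (P \<Otimes>\<^sub>M mu)"
 shows "\<exists>K :: nat => 't set. (\<forall>k. K k \<in> sets mu) \<and>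
  (\<forall>w\<in>space P. \<forall>eps>0. \<exists>k. sect_dist mu E w (K k) < eps)"
proof -
 have E: "E \<in> sigma_sets (space P \<times> space mu) {a \<times> b |a b. a \<in> sets P \<and> b \<in> sets mu}"
  using assms by (simp add: sets_pair_measure)
 show ?thesis
  using Int_stable_pair_measure_generator[of P mu] pair_measure_closed[of P mu] E
 proof (induction rule: sigma_sets_induct_disjoint)
  case (basic E)
  then obtain A B where E: "E = A \<times> B" "A \<in> sets P" "B \<in> sets mu" by auto
  show ?case
  proof (rule exI[of _ "%k. if k = 0 then B else {}"], intro conjI allI ballI impI)
   fix w and eps :: real assume "eps > 0"
   show "\<exists>k. sect_dist mu E w (if k = (0::nat) then B else {}) < eps"
   proof (rule exI[of _ "if w \<in> A then 0 else 1"])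
    show "sect_dist mu E w (if (if w \<in> A then 0 else 1) = (0::nat) then B else {}) < eps"
     using \<open>eps > 0\<close> by (simp add: sect_dist_def E(1) indicator_def)
   qed
  qed (use E(3) in auto)
 next
  case empty
  show ?case
   by (rule exI[of _ "%_. {}"]) (simp add: sect_dist_def)
 next
  case (compl E)
  then obtain K :: "nat => 't set" where K: "\<And>k. K k \<in> sets mu"
   "\<And>w eps. w \<in> space P ==> eps > 0 ==> \<exists>k. sect_dist mu E w (K k) < eps" by blast
  show ?case
  proof (rule exI[of _ "%k. space mu - K k"], intro conjI allI ballI impI)
   fix w and eps :: real assume w: "w \<in> space P" and "eps > 0"
   then obtain k where k: "sect_dist mu E w (K k) < eps" using K(2) by blast
   have "sect_dist mu (space P \<times> space mu - E) w (space mu - K k) = sect_dist mu E w (K k)"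
    unfolding sect_dist_def
    by (intro Bintegral_cong refl) (auto simp: indicator_def w)
   then show "\<exists>k. sect_dist mu (space P \<times> space mu - E) w (space mu - K k) < eps"
    using k by (intro exI[of _ k]) simp
  qed (use K(1) in auto)
 next
  case (union A)
  have A: "A i \<in> sets (P \<Otimes>\<^sub>M mu)" for i using union(2) by (auto simp: sets_pair_measure)
  have "\<exists>K. \<forall>i. (\<forall>k. K i k \<in> sets mu) \<and> (\<forall>w\<in>space P. \<forall>eps>0. \<exists>k::nat. sect_dist mu (A i) w (K i k) < eps)"
   by (rule choice) (use union.IH in blast)
  then obtain K :: "nat => nat => 't set" where K: "\<And>i k. K i k \<in> sets mu"
   "\<And>i w eps. w \<in> space P ==> eps > 0 ==> \<exists>k. sect_dist mu (A i) w (K i k) < eps" by blast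
  \<comment> \<open>A coded list: its length is the number of members of the union that are used,
    its i-th entry selects the approximant of the i-th one. Lists of naturals are countable, so the
    family remains a sequence.\<close>
  let ?L = "%n. let xs = from_nat n :: nat list in \<Union>i<length xs. K i (xs ! i)"
  show ?case
  proof (rule exI[of _ ?L], intro conjI allI ballI impI)
   show "?L n \<in> sets mu" for n using K(1) by (auto simp: Let_def)
   fix w and eps :: real assume w: "w \<in> space P" and eps: "eps > 0"
   let ?a = "%n t. \<bar>indicator (\<Union>i. A i) (w, t) - indicator (\<Union>i<n. A i) (w, t)\<bar> :: real"
   have Aw: "bmeas mu (%t. indicator (A i) (w, t) :: real)" for i
    by (rule indicator_section_measurable[OF A w])
   have U: "(\<Union>i. A i) \<in> sets (P \<Otimes>\<^sub>M mu)" using A by auto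
   have Uw: "bmeas mu (%t. indicator (\<Union>i. A i) (w, t) :: real)"
    by (rule indicator_section_measurable[OF U w])
   have Vw: "bmeas mu (%t. indicator (\<Union>i<n. A i) (w, t) :: real)" for n
    by (rule indicator_section_measurable[OF _ w]) (use A in auto)
   have "(%n. \<integral>t. (?a n t :: real) \<partial>mu) \<longlonglongrightarrow> (LINT t|mu. 0)"
   proof (rule integral_dominated_convergence[where w = "%_. 1"])
    show "AE t in mu. (%n. ?a n t :: real) \<longlonglongrightarrow> 0"
    proof (rule AE_I2)
     fix t
     show "null_seq (%n. ?a n t :: real)"
     proof (cases "(w, t) \<in> (\<Union>i. A i)")
      case True
      then obtain i where i: "(w, t) \<in> A i" by blast
      show ?thesis
       by (rule tendsto_eventually, rule eventually_sequentiallyI[of "Suc i"])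
        (use i in \<open>auto simp: indicator_def\<close>)
     next
      case False
      then have "(%n. ?a n t :: real) = (%n. 0)"
       by (auto simp: indicator_def)
      then show ?thesis by simp
     qed
    qed
    show "bmeas mu (%t. ?a n t :: real)" for n
     using Uw Vw[of n] by measurable
   qed (auto simp: indicator_def)
   then have "null_seq (%n. \<integral>t. (?a n t :: real) \<partial>mu)" by simp
   from order_tendstoD(2)[OF this, of "eps / 2"] eps obtain n where
    n: "(LINT t|mu. (?a n t :: real)) < eps / 2"
    by (auto simp: eventually_sequentially)
   have "\<forall>i. \<exists>k. sect_dist mu (A i) w (K i k) < eps / (2 * real (Suc n))"
    using K(2)[OF w] eps by simp
   then obtain c where c: "\<And>i. sect_dist mu (A i) w (K i (c i)) < eps / (2 * real (Suc n))" by metis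
   define xs where "xs = map c [0..<n]"
   have L: "?L (to_nat xs) = (\<Union>i<n. K i (c i))" by (simp add: Let_def xs_def)
   have ie: "integrable mu (%t. ?a n t :: real)"
    by (rule bounded_integrable[of _ 1]) (use Uw Vw[of n] in \<open>auto simp: indicator_def\<close>)
   have ii: "integrable mu (%t. \<bar>indicator (A i) (w, t) - indicator (K i (c i)) t\<bar> :: real)" for i
    by (rule indicator_diff_integrable[OF A w K(1)])
   have pt: "\<bar>indicator (\<Union>i. A i) (w, t) - indicator (\<Union>i<n. K i (c i)) t\<bar>
     \<le> ?a n t
      + (\<Sum>i<n. \<bar>indicator (A i) (w, t) - indicator (K i (c i)) t\<bar> :: real)" for t
   proof -
    have "\<bar>indicator (\<Union>i<n. A i) (w, t) - indicator (\<Union>i<n. K i (c i)) t\<bar>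
     \<le> (\<Sum>i<n. \<bar>indicator (A i) (w, t) - indicator (K i (c i)) t\<bar> :: real)"
    proof (cases "\<exists>i<n. ((w, t) \<in> A i) \<noteq> (t \<in> K i (c i))")
     case True
     then obtain i where i: "i < n" "((w, t) \<in> A i) \<noteq> (t \<in> K i (c i))" by blast
     have "\<bar>indicator (\<Union>i<n. A i) (w, t) - indicator (\<Union>i<n. K i (c i)) t\<bar> \<le> (1::real)"
      by (auto simp: indicator_def)
     also have "1 = \<bar>indicator (A i) (w, t) - indicator (K i (c i)) t :: real\<bar>"
      using i(2) by (auto simp: indicator_def)
     also have "... \<le> (\<Sum>i<n. \<bar>indicator (A i) (w, t) - indicator (K i (c i)) t\<bar> :: real)"
      by (rule member_le_sum) (use i(1) in auto)
     finally show ?thesis .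
    next
     case False
     then have "(w, t) \<in> (\<Union>i<n. A i) \<longleftrightarrow> t \<in> (\<Union>i<n. K i (c i))" by auto
     then have "\<bar>indicator (\<Union>i<n. A i) (w, t) - indicator (\<Union>i<n. K i (c i)) t\<bar> = (0::real)"
      by (simp add: indicator_def)
     then show ?thesis by (simp add: sum_nonneg)
    qed
    then show ?thesis by linarith
   qed
   have "sect_dist mu (\<Union>i. A i) w (\<Union>i<n. K i (c i))
     \<le> (LINT t|mu. ?a n t
      + (\<Sum>i<n. \<bar>indicator (A i) (w, t) - indicator (K i (c i)) t\<bar>))"
    unfolding sect_dist_def
    by (rule integral_mono[OF indicator_diff_integrable[OF U w]])
     (use K(1) ie ii pt in auto)
   also have "... = (LINT t|mu. ?a n t)
      + (\<Sum>i<n. sect_dist mu (A i) w (K i (c i)))"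
    unfolding sect_dist_def
    by (subst Bintegral_add[OF ie Bintegrable_sum[OF ii]]) (simp add: ii)
   also have "... \<le> (LINT t|mu. ?a n t)
      + (\<Sum>i<n. eps / (2 * real (Suc n)))"
    by (intro add_left_mono sum_mono less_imp_le c)
   also have "(\<Sum>i<n. eps / (2 * real (Suc n))) \<le> eps / 2"
    using eps by (simp add: field_simps)
   finally have "sect_dist mu (\<Union>i. A i) w (?L (to_nat xs)) < eps" unfolding L using n by linarith
   then show "\<exists>k. sect_dist mu (\<Union>i. A i) w (?L k) < eps" by blast
  qed
 qed
qed

text \<open>\<open>Z\<close> is rounded down to multiples of 1/(m+1), and each of the finitely many
  level sets is approximated by the family for sets. Clipping to [-B, B] keeps the approximants
  uniformly bounded and never increases the distance to \<open>Z\<close>.\<close>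

lemma separable_sections_bounded:
 fixes Z :: "'w => 't => real"
 assumes Z: "joint_meas P mu Z" and B: "\<And>w t. \<bar>Z w t\<bar> \<le> real B"
 shows "\<exists>X :: nat => 't => real. (\<forall>k. X k \<in> borel_measurable mu) \<and> (\<forall>k t. \<bar>X k t\<bar> \<le> real B) \<and>
  (\<forall>w\<in>space P. \<forall>eps>0. \<exists>k. (dL1 mu (Z w) (X k)) < eps)"
proof -
 define E where "E m i = {x \<in> space (P \<Otimes>\<^sub>M mu). \<lfloor>real (Suc m) * (case x of (w, t) => Z w t)\<rfloor> = i}" for m and i :: int
 have Em: "E m i \<in> sets (P \<Otimes>\<^sub>M mu)" for m i
 proof -
  note [measurable] = Z
  show ?thesis unfolding E_def by measurable
 qed
 have "\<exists>K. \<forall>mi. (\<forall>k. K mi k \<in> sets mu) \<and>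
   (\<forall>w\<in>space P. \<forall>eps>0. \<exists>k::nat. sect_dist mu (E (fst mi) (snd mi)) w (K mi k) < eps)"
  by (rule choice) (use separable_sections_set[OF Em] in blast)
 then obtain K where K: "\<And>mi k. K mi k \<in> sets mu"
  "\<And>mi w eps. w \<in> space P ==> eps > 0 ==> \<exists>k::nat. sect_dist mu (E (fst mi) (snd mi)) w (K mi k) < eps" by blast
 define N where "N m = int (Suc m * B)" for m
 \<comment> \<open>The level i, between -N m and N m, is stored at the list position i + N
   m.\<close>
 define X0 where "X0 mx t = (case mx of (m, xs) =>
   (\<Sum>i\<in>{- N m..N m}. (of_int i / real (Suc m)) * indicator (K (m, i) (xs ! nat (i + N m))) t))"
  for mx :: "nat \<times> nat list" and t
 define X where "X k t = max (- real B) (min (real B) (X0 (from_nat k) t))" for k t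
 have X0m: "bmeas mu (X0 mx)" for mx
 proof (cases mx)
  case (Pair m xs)
  note [measurable] = K(1)
  show ?thesis unfolding X0_def[abs_def] Pair prod.case by measurable
 qed
 have Xm: "bmeas mu (X k)" for k
  unfolding X_def[abs_def] using X0m[of "from_nat k"] by measurable
 have XB: "\<bar>X k t\<bar> \<le> real B" for k t by (simp add: X_def abs_le_iff)
 have "\<exists>k. (dL1 mu (Z w) (X k)) < eps" if w: "w \<in> space P" and eps: "eps > 0" for w eps
 proof -
  obtain m :: nat where m: "measure mu (space mu) / real (Suc m) < eps / 2"
  proof -
   obtain m :: nat where "measure mu (space mu) < real m * (eps / 2)"
    using reals_Archimedean3[of "eps / 2"] eps by auto
   moreover have "real m * (eps / 2) \<le> real (Suc m) * (eps / 2)" using eps by (intro mult_right_mono) auto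
   ultimately have "measure mu (space mu) < real (Suc m) * (eps / 2)" by linarith
   then show thesis by (intro that[of m]) (simp add: pos_divide_less_eq mult.commute del: of_nat_Suc)
  qed
  let ?I = "{- N m..N m}"
  \<comment> \<open>One such error per level, each weighted by B, adds up to at most eps/2; the
    added ones keep the denominator positive when B = 0.\<close>
  define \<eta> where "\<eta> = eps / (2 * (real B + 1) * (real (card ?I) + 1))"
  have \<eta>: "\<eta> > 0" using eps by (simp add: \<eta>_def)
  have "\<forall>i. \<exists>k. sect_dist mu (E m i) w (K (m, i) k) < \<eta>"
   using K(2)[OF w \<eta>, of "(m, _)"] by simp
  then obtain c where c: "\<And>i. sect_dist mu (E m i) w (K (m, i) (c i)) < \<eta>" by metis
  let ?e = "%i t. indicator (E m i) (w, t) - indicator (K (m, i) (c i)) t :: real"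
  define xs where "xs = map (%j. c (int j - N m)) [0..<nat (2 * N m + 1)]"
  have xs: "xs ! nat (i + N m) = c i" if "i \<in> ?I" for i
  proof -
   have "nat (i + N m) < nat (2 * N m + 1)" using that by auto
   then show ?thesis using that by (simp add: xs_def)
  qed
  have X0e: "X0 (m, xs) t = (\<Sum>i\<in>?I. (of_int i / real (Suc m)) * indicator (K (m, i) (c i)) t)" for t
   unfolding X0_def prod.case by (intro sum.cong refl) (simp add: xs)
  define Y where "Y t = (\<Sum>i\<in>?I. (of_int i / real (Suc m)) * indicator (E m i) (w, t))" for t
  have YZ: "\<bar>Z w t - Y t\<bar> \<le> 1 / real (Suc m)" if t: "t \<in> space mu" for t
  proof -
   let ?j = "\<lfloor>real (Suc m) * Z w t\<rfloor>"
   have "\<bar>real (Suc m) * Z w t\<bar> \<le> real (Suc m) * real B"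
    using B[of w t] by (simp add: abs_mult mult_left_mono del: of_nat_Suc)
   moreover have "of_int (N m) = real (Suc m) * real B" by (simp add: N_def algebra_simps)
   ultimately have "\<bar>real (Suc m) * Z w t\<bar> \<le> of_int (N m)" by (simp only:)
   then have j: "?j \<in> ?I" by (auto simp: le_floor_iff floor_le_iff abs_le_iff)
   have "Y t = (\<Sum>i\<in>?I. if i = ?j then of_int i / real (Suc m) else 0)"
    unfolding Y_def by (intro sum.cong refl) (use w t in \<open>auto simp: indicator_def E_def space_pair_measure\<close>)
   also have "... = of_int ?j / real (Suc m)" using j by (simp add: sum.delta)
   finally have "Z w t - Y t = (real (Suc m) * Z w t - of_int ?j) / real (Suc m)"
    by (simp add: diff_divide_distrib del: of_nat_Suc)
   moreover have "0 \<le> real (Suc m) * Z w t - of_int ?j" "real (Suc m) * Z w t - of_int ?j \<le> 1"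
    by linarith+
   ultimately show ?thesis by (simp add: divide_right_mono del: of_nat_Suc)
  qed
  have clip: "\<bar>Z w t - max (- real B) (min (real B) x)\<bar> \<le> \<bar>Z w t - x\<bar>" for t x
   using B[of w t] by (auto simp: abs_le_iff max_def min_def)
  have pt: "\<bar>Z w t - X (to_nat (m, xs)) t\<bar> \<le> 1 / real (Suc m)
    + (\<Sum>i\<in>?I. real B * \<bar>?e i t\<bar>)" if t: "t \<in> space mu" for t
  proof -
   have "\<bar>Z w t - X (to_nat (m, xs)) t\<bar> \<le> \<bar>Z w t - X0 (m, xs) t\<bar>" unfolding X_def using clip by simp
   also have "... \<le> \<bar>Z w t - Y t\<bar> + \<bar>Y t - X0 (m, xs) t\<bar>" by linarith
   also have "\<bar>Y t - X0 (m, xs) t\<bar> = \<bar>\<Sum>i\<in>?I. (of_int i / real (Suc m)) * ?e i t\<bar>"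
    unfolding Y_def X0e by (simp only: sum_subtractf right_diff_distrib)
   also have "... \<le> (\<Sum>i\<in>?I. \<bar>(of_int i / real (Suc m)) * ?e i t\<bar>)"
    by (rule sum_abs)
   also have "... \<le> (\<Sum>i\<in>?I. real B * \<bar>?e i t\<bar>)"
   proof (rule sum_mono)
    fix i assume "i \<in> ?I"
    then have "\<bar>i\<bar> \<le> N m" by auto
    then have "real_of_int \<bar>i\<bar> \<le> real_of_int (N m)" by (simp only: of_int_le_iff)
    then have "\<bar>of_int i / real (Suc m)\<bar> \<le> real B"
     by (simp add: N_def abs_divide divide_le_eq algebra_simps)
    then show "\<bar>(of_int i / real (Suc m)) * ?e i t\<bar>
      \<le> real B * \<bar>?e i t\<bar>"
     unfolding abs_mult by (rule mult_right_mono) simp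
   qed
   finally show ?thesis using YZ[OF t] by linarith
  qed
  have si: "integrable mu (%t. \<Sum>i\<in>?I. real B * \<bar>?e i t\<bar>)"
   by (intro Bintegrable_sum integrable_mult_right indicator_diff_integrable Em w K(1))
  have Zw: "bmeas mu (Z w)" by (rule joint_section1[OF Z w])
  have li: "integrable mu (%t. \<bar>Z w t - X (to_nat (m, xs)) t\<bar>)"
  proof (rule bounded_integrable[of _ "2 * real B"])
   show "bmeas mu (%t. \<bar>Z w t - X (to_nat (m, xs)) t\<bar>)" using Zw Xm by measurable
   show "\<bar>\<bar>Z w t - X (to_nat (m, xs)) t\<bar>\<bar> \<le> 2 * real B" for t
    using B[of w t] XB[of "to_nat (m, xs)" t] by (simp add: abs_le_iff)
  qed
  have "(LINT t|mu. \<bar>Z w t - X (to_nat (m, xs)) t\<bar>)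
    \<le> (LINT t|mu. 1 / real (Suc m) + (\<Sum>i\<in>?I. real B * \<bar>?e i t\<bar>))"
   by (rule integral_mono[OF li Bintegrable_add[OF _ si]]) (simp, rule pt)
  also have "... = measure mu (space mu) / real (Suc m) + (LINT t|mu. (\<Sum>i\<in>?I. real B * \<bar>?e i t\<bar>))"
   by (subst Bintegral_add[OF _ si]) simp_all
  also have "(LINT t|mu. (\<Sum>i\<in>?I. real B * \<bar>?e i t\<bar>))
    = (\<Sum>i\<in>?I. real B * sect_dist mu (E m i) w (K (m, i) (c i)))"
   unfolding sect_dist_def
   by (subst Bintegral_sum) (simp_all add: indicator_diff_integrable Em w K(1))
  finally have "(LINT t|mu. \<bar>Z w t - X (to_nat (m, xs)) t\<bar>)
    \<le> measure mu (space mu) / real (Suc m) + (\<Sum>i\<in>?I. real B * sect_dist mu (E m i) w (K (m, i) (c i)))" .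
  moreover have "(\<Sum>i\<in>?I. real B * sect_dist mu (E m i) w (K (m, i) (c i))) \<le> (\<Sum>i\<in>?I. real B * \<eta>)"
   by (intro sum_mono mult_left_mono less_imp_le[OF c]) simp
  moreover have "(\<Sum>i\<in>?I. real B * \<eta>) \<le> eps / 2"
  proof -
   have "(\<Sum>i\<in>?I. real B * \<eta>) = real (card ?I) * (real B * \<eta>)" by simp
   also have "... \<le> (real (card ?I) + 1) * ((real B + 1) * \<eta>)"
    using \<eta> by (intro mult_mono) auto
   also have "... = eps / 2"
   proof -
    have "c * (b * (eps / (2 * b * c))) = eps / 2" if "b \<noteq> 0" "c \<noteq> 0" for b c :: real
     using that by (simp add: field_simps)
    from this[of "real B + 1" "real (card ?I) + 1"] show ?thesis unfolding \<eta>_def by simp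
   qed
   finally show ?thesis .
  qed
  ultimately have "(LINT t|mu. \<bar>Z w t - X (to_nat (m, xs)) t\<bar>) < eps" using m by linarith
  then show ?thesis by blast
 qed
 then show ?thesis using Xm XB by blast
qed

lemma power_add_le: "0 \<le> a ==> 0 \<le> b ==> (a + b) ^ p \<le> 2 ^ p * (a ^ p + b ^ p)" for a b :: real
proof -
 assume ab: "0 \<le> a" "0 \<le> b"
 have "(a + b) ^ p \<le> (2 * max a b) ^ p" using ab by (intro power_mono) auto
 also have "... = 2 ^ p * max a b ^ p" by (rule power_mult_distrib)
 also have "max a b ^ p \<le> a ^ p + b ^ p" using ab by (auto simp: max_def)
 finally show ?thesis by simp
qed

text \<open>Truncation at level B reduces to the bounded case. There the L1 distance controls the
  p-th power, because differences are at most 2B+1 and a factor (2B+1)^(p-1) can be split off. The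
  exponents used are 1 and 2.\<close>

lemma separable_sections:
 fixes Z :: "'w => 't => real"
 assumes Z: "joint_meas P mu Z" and p: "p \<ge> 1"
 shows "\<exists>X :: nat => 't => real. (\<forall>k. X k \<in> borel_measurable mu) \<and> (\<forall>k. \<exists>B. \<forall>t. \<bar>X k t\<bar> \<le> B) \<and>
  (\<forall>w\<in>space P. integrable mu (%t. \<bar>Z w t\<bar> ^ p) \<longrightarrow> (\<forall>eps>0. \<exists>k. (LINT t|mu. \<bar>Z w t - X k t\<bar> ^ p) < eps))"
proof -
 let ?Z = "%B w t. max (- real B) (min (real B) (Z w t))"
 have ZB: "joint_meas P mu (?Z B)" for B
 proof -
  note [measurable] = Z
  show ?thesis by measurable
 qed
 have bd: "\<bar>?Z B w t\<bar> \<le> real B" for B w t by (simp add: abs_le_iff)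
 have "\<exists>X. \<forall>B. (\<forall>k. X B k \<in> borel_measurable mu) \<and> (\<forall>k t. \<bar>X B k t\<bar> \<le> real B) \<and>
  (\<forall>w\<in>space P. \<forall>eps>0. \<exists>k::nat. (LINT t|mu. \<bar>?Z B w t - X B k t\<bar>) < eps)"
  by (rule choice) (use separable_sections_bounded[OF ZB bd] in blast)
 then obtain X where X: "\<And>B k. X B k \<in> borel_measurable mu" "\<And>B k t. \<bar>X B k t\<bar> \<le> real B"
  "\<And>B w eps. w \<in> space P ==> eps > 0 ==> \<exists>k::nat. (LINT t|mu. \<bar>?Z B w t - X B k t\<bar>) < eps" by blast
 let ?X = "%n::nat. X (fst (from_nat n :: nat \<times> nat)) (snd (from_nat n :: nat \<times> nat))"
 have "\<exists>k. (LINT t|mu. \<bar>Z w t - ?X k t\<bar> ^ p) < eps"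
  if w: "w \<in> space P" and int: "integrable mu (%t. \<bar>Z w t\<bar> ^ p)" and eps: "eps > 0" for w eps
 proof -
  have Zw: "bmeas mu (Z w)" by (rule joint_section1[OF Z w])
  have cl: "\<bar>Z w t - ?Z B w t\<bar> \<le> \<bar>Z w t\<bar>" for B t by (auto simp: max_def min_def abs_le_iff)
  have m1: "bmeas mu (%t. \<bar>Z w t - ?Z B w t\<bar> ^ p)" for B using Zw by measurable
  have "(%B. \<integral>t. \<bar>Z w t - ?Z B w t\<bar> ^ p \<partial>mu) \<longlonglongrightarrow> (LINT t|mu. 0)"
  proof (rule integral_dominated_convergence[where w = "%t. \<bar>Z w t\<bar> ^ p"])
   show "AE t in mu. (%B. \<bar>Z w t - ?Z B w t\<bar> ^ p) \<longlonglongrightarrow> 0"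
   proof (rule AE_I2)
    fix t
    obtain B0 :: nat where B0: "\<bar>Z w t\<bar> \<le> real B0" using real_arch_simple by blast
    show "null_seq (%B. \<bar>Z w t - ?Z B w t\<bar> ^ p)"
    proof (rule tendsto_eventually, rule eventually_sequentiallyI[of B0])
     fix B assume "B0 \<le> B"
     then have "\<bar>Z w t\<bar> \<le> real B" using B0 by linarith
     then have "?Z B w t = Z w t" by (auto simp: max_def min_def abs_le_iff)
     then show "\<bar>Z w t - ?Z B w t\<bar> ^ p = 0" using p by simp
    qed
   qed
   show "AE t in mu. norm (\<bar>Z w t - ?Z B w t\<bar> ^ p) \<le> \<bar>Z w t\<bar> ^ p" for B
    using cl by (intro AE_I2) (simp add: power_mono)
  qed (simp, rule m1, rule int)
  then have "null_seq (%B. \<integral>t. \<bar>Z w t - ?Z B w t\<bar> ^ p \<partial>mu)" by simp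
  from order_tendstoD(2)[OF this, of "eps / (2 * 2 ^ p)"] eps obtain B where
   B: "(LINT t|mu. \<bar>Z w t - ?Z B w t\<bar> ^ p) < eps / (2 * 2 ^ p)"
   by (auto simp: eventually_sequentially)
  define M where "M = (2 * real B + 1) ^ (p - 1)"
  have M: "M > 0" by (simp add: M_def)
  obtain k where k: "(LINT t|mu. \<bar>?Z B w t - X B k t\<bar>) < eps / (2 * 2 ^ p * M)"
   using X(3)[OF w, of "eps / (2 * 2 ^ p * M)" B] eps M by auto
  have e: "\<bar>?Z B w t - X B k t\<bar> \<le> 2 * real B + 1" for t
   using bd[of B w t] X(2)[of B k t] by linarith
  have pw: "\<bar>?Z B w t - X B k t\<bar> ^ p \<le> M * \<bar>?Z B w t - X B k t\<bar>" for t
  proof -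
   have "\<bar>?Z B w t - X B k t\<bar> ^ p = \<bar>?Z B w t - X B k t\<bar> ^ (p - 1) * \<bar>?Z B w t - X B k t\<bar>"
    using p by (metis Suc_diff_1 less_eq_Suc_le mult.commute power_Suc One_nat_def)
   also have "... \<le> M * \<bar>?Z B w t - X B k t\<bar>"
    unfolding M_def by (intro mult_right_mono power_mono e) auto
   finally show ?thesis .
  qed
  have pt: "\<bar>Z w t - X B k t\<bar> ^ p \<le> 2 ^ p * (\<bar>Z w t - ?Z B w t\<bar> ^ p + M * \<bar>?Z B w t - X B k t\<bar>)" for t
  proof -
   have "\<bar>Z w t - X B k t\<bar> ^ p \<le> (\<bar>Z w t - ?Z B w t\<bar> + \<bar>?Z B w t - X B k t\<bar>) ^ p"
    by (intro power_mono) linarith+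
   also have "... \<le> 2 ^ p * (\<bar>Z w t - ?Z B w t\<bar> ^ p + \<bar>?Z B w t - X B k t\<bar> ^ p)"
    by (rule power_add_le) auto
   finally show ?thesis using pw[of t] by (smt (verit) mult_left_mono zero_le_power)
  qed
  have i1: "integrable mu (%t. \<bar>Z w t - ?Z B w t\<bar> ^ p)"
   by (rule Bintegrable_bound[OF int m1]) (use cl in \<open>simp add: power_mono\<close>)
  have i2: "integrable mu (%t. \<bar>?Z B w t - X B k t\<bar>)"
   by (rule bounded_integrable[of _ "2 * real B + 1"]) (use Zw X(1)[of B k] e in simp_all)
  have i3: "integrable mu (%t. 2 ^ p * (\<bar>Z w t - ?Z B w t\<bar> ^ p + M * \<bar>?Z B w t - X B k t\<bar>))"
   by (intro integrable_mult_right Bintegrable_add i1 i2)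
  have i4: "integrable mu (%t. \<bar>Z w t - X B k t\<bar> ^ p)"
  proof (rule Bintegrable_bound[OF i3])
   show "bmeas mu (%t. \<bar>Z w t - X B k t\<bar> ^ p)" using Zw X(1)[of B k] by measurable
   show "AE t in mu. norm (\<bar>Z w t - X B k t\<bar> ^ p) \<le> norm (2 ^ p * (\<bar>Z w t - ?Z B w t\<bar> ^ p + M * \<bar>?Z B w t - X B k t\<bar>))"
    using pt by (intro AE_I2) (simp add: order_trans[OF _ abs_ge_self])
  qed
  have "(LINT t|mu. \<bar>Z w t - X B k t\<bar> ^ p) \<le> (LINT t|mu. 2 ^ p * (\<bar>Z w t - ?Z B w t\<bar> ^ p + M * \<bar>?Z B w t - X B k t\<bar>))"
   by (rule integral_mono[OF i4 i3]) (rule pt)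
  also have "... = 2 ^ p * ((LINT t|mu. \<bar>Z w t - ?Z B w t\<bar> ^ p) + M * (LINT t|mu. \<bar>?Z B w t - X B k t\<bar>))"
   using i1 i2 by simp
  also have "... < 2 ^ p * (eps / (2 * 2 ^ p) + M * (eps / (2 * 2 ^ p * M)))"
   using M by (intro mult_strict_left_mono add_strict_mono B k) auto
  also have "... = eps" using M by (simp add: field_simps)
  finally have "(LINT t|mu. \<bar>Z w t - ?X (to_nat (B, k)) t\<bar> ^ p) < eps" by simp
  then show ?thesis by blast
 qed
 then show ?thesis
  by (intro exI[of _ ?X]) (use X(1,2) in blast)
qed

end

text \<open>A strictly positive integrable density v turns mu into a finite measure. Multiplication
  by v carries L1 of that measure isometrically onto L1(mu), so the approximants of Z/v give those
  of Z.\<close>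

lemma separable_L1_sections:
 fixes Z :: "'w => 't => real"
 assumes "sigma_finite_measure mu" and Z: "joint_meas P mu Z"
 shows "\<exists>X :: nat => 't => real. (\<forall>k. integrable mu (X k)) \<and>
  (\<forall>w\<in>space P. integrable mu (Z w) \<longrightarrow> (\<forall>eps>0. \<exists>k. (dL1 mu (Z w) (X k)) < eps))"
proof -
 interpret mu: sigma_finite_measure mu by fact
 obtain h where h: "bmeas mu h" "integral\<^sup>N mu h \<noteq> \<infinity>" "\<And>t. t \<in> space mu ==> 0 < h t \<and> h t < \<infinity>"
  using mu.Ex_finite_integrable_function by blast
 define v where "v t = enn2real (h t)" for t
 have v: "t \<in> space mu ==> v t > 0" "t \<in> space mu ==> h t = ennreal (v t)" for t
  using h(3)[of t] by (auto simp: v_def enn2real_positive_iff)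
 have vm [measurable]: "bmeas mu v" using h(1) by (simp add: v_def[abs_def])
 have v0: "0 \<le> v t" for t by (simp add: v_def)
 have vi: "integrable mu v"
 proof (rule integrableI_bounded[OF vm])
  have "(\<integral>\<^sup>+t. ennreal (norm (v t)) \<partial>mu) = integral\<^sup>N mu h"
   by (intro nn_integral_cong) (simp add: v(2) v0)
  then show "(\<integral>\<^sup>+t. ennreal (norm (v t)) \<partial>mu) < \<infinity>" using h(2) by (simp add: less_top)
 qed
 define \<nu> where "\<nu> = density mu (%t. ennreal (v t))"
 have s\<nu> [measurable_cong]: "sets \<nu> = sets mu" and sp\<nu>: "space \<nu> = space mu" by (simp_all add: \<nu>_def)
 have f\<nu>: "finite_measure \<nu>"
 proof
  have "emeasure \<nu> (space \<nu>) = (\<integral>\<^sup>+t. ennreal (v t) \<partial>mu)"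
   unfolding \<nu>_def by (simp add: emeasure_density nn_integral_set_ennreal cong: nn_integral_cong)
  also have "... < \<infinity>" using integrableD(2)[OF vi] v0 by (simp add: less_top)
  finally show "emeasure \<nu> (space \<nu>) \<noteq> \<infinity>" by simp
 qed
 have sPm: "sets (P \<Otimes>\<^sub>M \<nu>) = sets (P \<Otimes>\<^sub>M mu)" by (rule sets_pair_measure_cong) (simp_all add: s\<nu>)
 have Zv: "bmeas (P \<Otimes>\<^sub>M \<nu>) (%(w, t). Z w t / v t)"
 proof -
  note [measurable] = Z
  have "joint_meas P mu (%w t. Z w t / v t)" by measurable
  then show ?thesis by (simp add: measurable_cong_sets[OF sPm refl])
 qed
 obtain X :: "nat => 't => real" where X: "\<And>k. X k \<in> borel_measurable \<nu>" "\<And>k. \<exists>B. \<forall>t. \<bar>X k t\<bar> \<le> B"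
  "\<And>w eps. w \<in> space P ==> integrable \<nu> (%t. \<bar>Z w t / v t\<bar>) ==> eps > 0 ==> \<exists>k. (\<integral>t. \<bar>Z w t / v t - X k t\<bar> \<partial>\<nu>) < eps"
  using separable_sections[OF f\<nu> Zv, of 1, unfolded power_one_right] by blast
 have Xm [measurable]: "bmeas mu (X k)" for k using X(1)[of k] by (simp add: measurable_cong_sets[OF s\<nu> refl])
 have "integrable mu (%t. v t * X k t)" for k
 proof -
  obtain B where B: "\<And>t. \<bar>X k t\<bar> \<le> B" using X(2)[of k] by blast
  show ?thesis
  proof (rule Bintegrable_bound[OF integrable_mult_left[OF vi, of B]])
   have "0 \<le> B" using B[of undefined] by linarith
   then show "AE t in mu. norm (v t * X k t) \<le> norm (v t * B)"
    using B v0 by (intro AE_I2) (simp add: abs_mult mult_left_mono)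
  qed measurable
 qed
 moreover have "\<exists>k. (LINT t|mu. \<bar>Z w t - v t * X k t\<bar>) < eps"
  if w: "w \<in> space P" and int: "integrable mu (Z w)" and eps: "eps > 0" for w eps
 proof -
  have Zm [measurable]: "bmeas mu (Z w)" using int by auto
  have "integrable \<nu> (%t. \<bar>Z w t / v t\<bar>)"
   unfolding \<nu>_def
  proof (subst integrable_density)
   show "integrable mu (%t. v t *\<^sub>R \<bar>Z w t / v t\<bar>)"
    by (rule Bintegrable_cong[THEN iffD2, OF refl _ integrable_abs[OF int]])
     (auto simp: abs_divide abs_of_pos[OF v(1)] less_imp_neq[OF v(1), symmetric])
  qed (auto simp: v0)
  then obtain k where k: "(\<integral>t. \<bar>Z w t / v t - X k t\<bar> \<partial>\<nu>) < eps" using X(3)[OF w _ eps] by auto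
  have "(\<integral>t. \<bar>Z w t / v t - X k t\<bar> \<partial>\<nu>) = (LINT t|mu. v t *\<^sub>R \<bar>Z w t / v t - X k t\<bar>)"
   unfolding \<nu>_def by (rule integral_density) (auto simp: v0)
  also have "... = (LINT t|mu. \<bar>Z w t - v t * X k t\<bar>)"
  proof (rule Bintegral_cong[OF refl])
   fix t assume t: "t \<in> space mu"
   have "v t *\<^sub>R \<bar>Z w t / v t - X k t\<bar> = \<bar>v t * (Z w t / v t - X k t)\<bar>" using v0[of t] by (simp add: abs_mult)
   also have "v t * (Z w t / v t - X k t) = Z w t - v t * X k t" using v(1)[OF t] by (simp add: right_diff_distrib)
   finally show "v t *\<^sub>R \<bar>Z w t / v t - X k t\<bar> = \<bar>Z w t - v t * X k t\<bar>" .
  qed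
  finally show ?thesis using k by auto
 qed
 ultimately show ?thesis by (intro exI[of _ "%k t. v t * X k t"]) blast
qed

text \<open>\<open>Z\<close> is approximated by functions with countably many values: each outcome
  picks the first \<open>X k\<close> within 1/(n+1). A functional of such a function is measurable
  whatever \<open>H\<close> is, and continuity gives pointwise convergence.\<close>

lemma L1_continuous_functional_measurable:
 fixes H :: "('t => real) => real" and Z :: "'w => 't => real"
 assumes "sigma_finite_measure mu" and Z: "L1_random_variable P mu Z"
  and H: "\<And>x eps. integrable mu x ==> eps > 0 ==>
   \<exists>\<delta>>0. \<forall>y. integrable mu y \<longrightarrow> (dL1 mu x y) < \<delta> \<longrightarrow> \<bar>H x - H y\<bar> < eps"
 shows "bmeas P (%w. H (Z w))"
proof -
 interpret mu: sigma_finite_measure mu by fact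
 have Zj: "joint_meas P mu Z" and Zi: "\<And>w. w \<in> space P ==> integrable mu (Z w)"
  using Z by (auto simp: L1_random_variable_def)
 obtain X :: "nat => 't => real" where X: "\<And>k. integrable mu (X k)"
  "\<And>w eps. w \<in> space P ==> eps > 0 ==> \<exists>k. (dL1 mu (Z w) (X k)) < eps"
  using separable_L1_sections[OF assms(1) Zj] Zi by metis
 define J where "J n w = (LEAST k. (dL1 mu (Z w) (X k)) < 1 / real (Suc n))" for n w
 have J: "(LINT t|mu. \<bar>Z w t - X (J n w) t\<bar>) < 1 / real (Suc n)" if "w \<in> space P" for n w
  unfolding J_def by (rule LeastI_ex) (use X(2)[OF that, of "1 / real (Suc n)"] in simp)
 have dm [measurable]: "bmeas P (%w. \<integral>t. \<bar>Z w t - X k t\<bar> \<partial>mu)" for k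
 proof -
  have [measurable]: "bmeas mu (X k)" using X(1)[of k] by auto
  note [measurable] = Zj
  show ?thesis by measurable
 qed
 have Jm [measurable]: "J n \<in> measurable P counting" for n
  unfolding J_def[abs_def] by measurable
 have HJ: "bmeas P (%w. H (X (J n w)))" for n
  by (rule measurable_compose[OF Jm]) simp
 show ?thesis
 proof (rule borel_measurable_LIMSEQ_real[OF _ HJ])
  fix w assume w: "w \<in> space P"
  show "(%n. H (X (J n w))) \<longlonglongrightarrow> H (Z w)"
  proof (rule LIMSEQ_I)
   fix eps :: real assume "eps > 0"
   then obtain \<delta> where \<delta>: "\<delta> > 0" "\<And>y. integrable mu y ==> (dL1 mu (Z w) y) < \<delta> ==> \<bar>H (Z w) - H y\<bar> < eps"
    using H[OF Zi[OF w]] by blast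
   obtain N :: nat where N: "1 / real (Suc N) < \<delta>"
    using reals_Archimedean[OF \<delta>(1)] by (auto simp: inverse_eq_divide)
   have "norm (H (X (J n w)) - H (Z w)) < eps" if n: "n \<ge> N" for n
   proof -
    have "1 / real (Suc n) \<le> 1 / real (Suc N)" using n by (simp add: frac_le)
    then have "(LINT t|mu. \<bar>Z w t - X (J n w) t\<bar>) < \<delta>" using J[OF w, of n] N by linarith
    from \<delta>(2)[OF X(1) this] show ?thesis by (simp add: abs_minus_commute)
   qed
   then show "\<exists>no. \<forall>n\<ge>no. norm (H (X (J n w)) - H (Z w)) < eps" by blast
  qed
 qed
qed

section \<open>Orthonormal systems generated by bounded functionals\<close>

context shift_mu begin

text \<open>With the roles of w and t exchanged, separability gives countably many X_k approximating
  all Y(t) in L2(P). Let C be a set of finite measure on which Y(t) is within 1/(m+1) of X_k.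
  Averaging over C is a bounded functional, its value at Y is within 1/(m+1) of X_k by Minkowski's
  inequality, hence within 2/(m+1) of Y(t) for t in C.\<close>

lemma dense_functionals:
 fixes Y :: "'w => 't => real"
 assumes rv: "L1_random_variable P mu Y"
  and fin: "mixn P mu Y < \<infinity>"
 shows "\<exists>F :: nat => 't => real. (\<forall>j. F j \<in> Linfty mu) \<and>
  (AE t in mu. \<forall>eps>0. \<exists>j. norm2 P (%w. Y w t - L1_pair mu (F j) (Y w)) < ennreal eps)"
proof -
 have Y: "joint_meas P mu Y" and Yi: "\<And>w. w \<in> space P ==> integrable mu (Y w)"
  using rv by (auto simp: L1_random_variable_def)
 note [measurable] = Y
 have Ysw: "joint_meas mu P (%t w. Y w t)"
  by measurable
 obtain X :: "nat => 'w => real" where X: "\<And>k. X k \<in> borel_measurable P" "\<And>k. \<exists>B. \<forall>w. \<bar>X k w\<bar> \<le> B"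
  "\<And>t eps. t \<in> space mu ==> integrable P (%w. \<bar>Y w t\<bar> ^ 2) ==> eps > 0 ==> \<exists>k. (LINT w|P. \<bar>Y w t - X k w\<bar> ^ 2) < eps"
  using separable_sections[OF finite_measure_axioms Ysw, of 2, OF one_le_numeral] by blast
 note [measurable] = X(1)
 have XL: "L2fun P (X k)" for k
 proof -
  obtain B where B: "\<And>w. \<bar>X k w\<bar> \<le> B" using X(2)[of k] by blast
  have "\<bar>X k w\<bar> \<le> \<bar>B\<bar>" for w using B[of w] by linarith
  then show ?thesis by (intro L2fun_bound[OF L2fun_const[of B]] X(1)) auto
 qed
 have YX: "joint_meas P mu (%w t. Y w t - X k w)" for k
  by measurable
 define B where "B k m = {t \<in> space mu. norm2 P (%w. Y w t - X k w) < ennreal (1 / real (Suc m))}" for k m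
 have Bm [measurable]: "B k m \<in> sets mu" for k m
  unfolding B_def using norm2_measurable[OF YX, of k] by measurable
 obtain A :: "nat => 't set" where A: "range A \<subseteq> sets mu" "(\<Union>i. A i) = space mu" "\<And>i. emeasure mu (A i) \<noteq> \<infinity>"
  using mu.sigma_finite by blast
 have Am [measurable]: "A l \<in> sets mu" for l using A(1) by blast
 define C where "C k m l = B k m \<inter> A l" for k m l
 have Cm [measurable]: "C k m l \<in> sets mu" for k m l by (simp add: C_def)
 have Cf: "emeasure mu (C k m l) \<noteq> \<infinity>" for k m l
 proof -
  have "emeasure mu (C k m l) \<le> emeasure mu (A l)" by (rule emeasure_mono) (auto simp: C_def)
  then show ?thesis using A(3)[of l] by (metis infinity_ennreal_def neq_top_trans)
 qed
 \<comment> \<open>If C has measure 0, division by zero makes this the zero functional; the t in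
   such sets are discarded below as a null set.\<close>
 define f where "f k m l t = indicator (C k m l) t / measure mu (C k m l)" for k m l t
 have fL: "f k m l \<in> Linfty mu" for k m l
  unfolding Linfty_def
 proof (intro CollectI conjI exI[of _ "1 / measure mu (C k m l)"] AE_I2)
  show "bmeas mu (f k m l)" unfolding f_def[abs_def] by measurable
  show "\<bar>f k m l t\<bar> \<le> 1 / measure mu (C k m l)" for t by (auto simp: f_def indicator_def)
 qed
 define F where "F n = (let (k, m, l) = from_nat n in f k m l)" for n :: nat
 have FL: "F j \<in> Linfty mu" for j by (simp add: F_def split_beta Let_def fL)
 have Ff: "F (to_nat (k, m, l)) = f k m l" for k m l by (simp add: F_def)
 have "AE t in mu. \<not> (t \<in> C k m l \<and> measure mu (C k m l) = 0)" for k m l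
 proof (cases "measure mu (C k m l) = 0")
  case True
  then have "emeasure mu (C k m l) = 0" using Cf[of k m l] by (simp add: emeasure_eq_ennreal_measure)
  then have "C k m l \<in> null_sets mu" by (auto simp: null_sets_def)
  then show ?thesis by (rule AE_not_in[THEN eventually_mono]) simp
 qed simp
 then have "AE t in mu. \<forall>k m l. \<not> (t \<in> C k m l \<and> measure mu (C k m l) = 0)"
  by (simp only: AE_all_countable) blast
 moreover have "AE t in mu. t \<in> space mu" by simp
 moreover note mixn_L2_AE[OF P Y fin]
 ultimately have "AE t in mu. \<forall>eps>0. \<exists>j. norm2 P (%w. Y w t - L1_pair mu (F j) (Y w)) < ennreal eps"
 proof eventually_elim
  case (elim t)
  show ?case
  proof (intro allI impI)
   fix eps :: real assume eps: "eps > 0"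
   obtain m where m: "1 / real (Suc m) < eps / 2"
    using reals_Archimedean[of "eps / 2"] eps by (auto simp: inverse_eq_divide)
   let ?\<delta> = "1 / real (Suc m)"
   have "integrable P (%w. \<bar>Y w t\<bar> ^ 2)" using elim(3) by (simp add: L2fun_def)
   from X(3)[OF elim(2) this, of "?\<delta>\<^sup>2"] obtain k where k: "(LINT w|P. \<bar>Y w t - X k w\<bar> ^ 2) < ?\<delta>\<^sup>2" by auto
   have YXL: "L2fun P (%w. Y w t - X k w)" by (rule L2fun_diff[OF elim(3) XL])
   have "(nrm P (%w. Y w t - X k w))\<^sup>2 < ?\<delta>\<^sup>2" using k by (simp add: nrm_power2 del: of_nat_Suc)
   then have "nrm P (%w. Y w t - X k w) < ?\<delta>" by (rule power2_less_imp_less) simp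
   then have n1: "norm2 P (%w. Y w t - X k w) < ennreal ?\<delta>"
    unfolding norm2_L2[OF YXL] by (rule ennreal_lessI[rotated]) simp
   obtain l where "t \<in> A l" using A(2) elim(2) by blast
   then have tC: "t \<in> C k m l" using n1 elim(2) by (simp add: C_def B_def del: of_nat_Suc)
   define c where "c = measure mu (C k m l)"
   have c: "c > 0" using elim(1) tC by (metis c_def measure_nonneg order_le_less)
   have fi: "integrable mu (f k m l)"
    unfolding f_def[abs_def] using Cf[of k m l] by (simp add: less_top)
   have f1: "(LINT s|mu. f k m l s) = 1"
    unfolding f_def[abs_def] using c by (simp add: c_def)
   have fs [measurable]: "bmeas mu (f k m l)" using fi by auto
   have eq: "(LINT s|mu. f k m l s * (Y w s - X k w)) = L1_pair mu (f k m l) (Y w) - X k w" if w: "w \<in> space P" for w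
   proof -
    have "(LINT s|mu. f k m l s * (Y w s - X k w)) = (LINT s|mu. f k m l s * Y w s - f k m l s * X k w)"
     by (simp add: right_diff_distrib)
    also have "... = L1_pair mu (f k m l) (Y w) - (LINT s|mu. f k m l s * X k w)"
     unfolding L1_pair_def
     by (rule Bintegral_diff[OF Linfty_mult_integrable[OF fL Yi[OF w]] integrable_mult_left[OF fi]])
    also have "(LINT s|mu. f k m l s * X k w) = X k w" by (simp add: f1)
    finally show ?thesis .
   qed
   have Lm [measurable]: "bmeas P (%w. L1_pair mu (f k m l) (Y w))"
    by (rule L1_pair_measurable[OF fL Y])
   have YXs [measurable]: "bmeas P (%w. Y w s - X k w)" if "s \<in> space mu" for s
    by (rule joint_section[OF YX that])
   have "norm2 P (%w. L1_pair mu (f k m l) (Y w) - X k w) = norm2 P (%w. \<integral>s. f k m l s * (Y w s - X k w) \<partial>mu)"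
    by (rule norm2_cong_AE) (auto simp: eq)
   also have "... \<le> (\<integral>\<^sup>+s. norm2 P (%w. f k m l s * (Y w s - X k w)) \<partial>mu)"
    by (rule norm2_integral_le[OF sigma_finite_measure_axioms mu]) measurable
   also have "... \<le> (\<integral>\<^sup>+s. ennreal ?\<delta> * ennreal (f k m l s) \<partial>mu)"
   proof (rule nn_integral_mono)
    fix s assume s: "s \<in> space mu"
    have f0: "0 \<le> f k m l s" by (simp add: f_def)
    have "norm2 P (%w. f k m l s * (Y w s - X k w)) = ennreal (f k m l s) * norm2 P (%w. Y w s - X k w)"
     using norm2_cmult[OF YXs[OF s], of "f k m l s"] f0 by simp
    also have "... \<le> ennreal (f k m l s) * ennreal ?\<delta>"
    proof (cases "s \<in> C k m l")
     case True
     then show ?thesis by (intro mult_left_mono) (auto simp: C_def B_def simp del: of_nat_Suc)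
    next
     case False
     then show ?thesis by (simp add: f_def)
    qed
    finally show "norm2 P (%w. f k m l s * (Y w s - X k w)) \<le> ennreal ?\<delta> * ennreal (f k m l s)"
     by (simp add: mult.commute)
   qed
   also have "... = ennreal ?\<delta> * ennreal 1"
    using nn_integral_eq_integral[OF fi] f1 by (subst nn_integral_cmult) (auto simp: f_def)
   finally have n2: "norm2 P (%w. L1_pair mu (f k m l) (Y w) - X k w) \<le> ennreal ?\<delta>" by simp
   have "norm2 P (%w. Y w t - L1_pair mu (f k m l) (Y w))
     = norm2 P (%w. (Y w t - X k w) - (L1_pair mu (f k m l) (Y w) - X k w))" by simp
   also have "... \<le> norm2 P (%w. Y w t - X k w) + norm2 P (%w. L1_pair mu (f k m l) (Y w) - X k w)"
    by (rule norm2_triangle_diff) (use elim(2) in measurable)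
   also have "... \<le> ennreal ?\<delta> + ennreal ?\<delta>" using n1 n2 by (intro add_mono) auto
   also have "... = ennreal (?\<delta> + ?\<delta>)" by (rule ennreal_plus[symmetric]) auto
   also have "... < ennreal eps" using m by (intro ennreal_lessI eps) (simp del: of_nat_Suc)
   finally show "\<exists>j. norm2 P (%w. Y w t - L1_pair mu (F j) (Y w)) < ennreal eps"
    by (intro exI[of _ "to_nat (k, m, l)"]) (simp add: Ff)
  qed
 qed
 then show ?thesis using FL by blast
qed

end

section \<open>Projections and Gram-Schmidt\<close>

definition inner2 :: "'a measure => ('a => real) => ('a => real) => real" where
 "inner2 M Y Z = (LINT x|M. Y x * Z x)"

lemma inner2_commute: "inner2 M Y Z = inner2 M Z Y"
 by (simp add: inner2_def mult.commute)

lemma inner2_diff_left: "L2fun M X ==> L2fun M Y ==> L2fun M Z ==>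
  inner2 M (%x. X x - Y x) Z = inner2 M X Z - inner2 M Y Z"
 unfolding inner2_def left_diff_distrib by (intro Bintegral_diff L2fun_mult_integrable)

lemma inner2_cmult_left: "inner2 M (%x. c * Y x) Z = c * inner2 M Y Z"
 by (simp add: inner2_def mult.assoc)

lemma inner2_sum_left:
 assumes "\<And>i. i \<in> I ==> L2fun M (Y i)" "L2fun M Z"
 shows "inner2 M (%x. \<Sum>i\<in>I. Y i x) Z = (\<Sum>i\<in>I. inner2 M (Y i) Z)"
 unfolding inner2_def sum_distrib_right by (intro Bintegral_sum L2fun_mult_integrable assms)

lemma inner2_self: "inner2 M Y Y = (nrm M Y)\<^sup>2"
 by (simp only: inner2_def nrm_power2 flip: power2_eq_square)

lemma inner2_zero_AE:
 assumes "L2fun M Z" "nrm M Z = 0" shows "inner2 M Y Z = 0"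
proof -
 have "AE x in M. Y x * Z x = 0" using nrm_eq_0_AE[OF assms] by eventually_elim simp
 then show ?thesis unfolding inner2_def by (rule integral_eq_zero_AE)
qed

text \<open>Vanishing vectors are allowed so that the Gram-Schmidt process never has to skip an index.\<close>

definition orthonormal0 :: "'a measure => (nat => 'a => real) => bool" where
 "orthonormal0 M e \<longleftrightarrow> (\<forall>i. L2fun M (e i)) \<and> (\<forall>i. nrm M (e i) \<in> {0, 1}) \<and>
   (\<forall>i j. i \<noteq> j \<longrightarrow> inner2 M (e i) (e j) = 0)"

lemma inner2_residual:
 assumes L: "\<And>i. L2fun M (e i)" "L2fun M Y" and k: "k < (m::nat)" and n: "nrm M (e k) \<in> {0, 1}"
  and o: "\<And>i. i < m ==> i \<noteq> k ==> inner2 M (e i) (e k) = 0"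
 shows "inner2 M (%x. Y x - (\<Sum>i<m. inner2 M Y (e i) * e i x)) (e k) = 0"
proof -
 have "inner2 M (%x. Y x - (\<Sum>i<m. inner2 M Y (e i) * e i x)) (e k)
   = inner2 M Y (e k) - (\<Sum>i<m. inner2 M Y (e i) * inner2 M (e i) (e k))"
  by (simp add: inner2_diff_left inner2_sum_left inner2_cmult_left L L2fun_cmult L2fun_sum)
 also have "(\<Sum>i<m. inner2 M Y (e i) * inner2 M (e i) (e k)) = (\<Sum>i<m. if i = k then inner2 M Y (e k) * inner2 M (e k) (e k) else 0)"
  by (rule sum.cong) (auto simp: o)
 also have "... = inner2 M Y (e k) * inner2 M (e k) (e k)" using k by (simp add: sum.delta)
 also have "... = inner2 M Y (e k)"
  using n inner2_zero_AE[OF L(1), of k Y] by (auto simp: inner2_self)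
 finally show ?thesis by simp
qed

lemma best_approximation:
 assumes e: "orthonormal0 M e" and Y: "L2fun M Y"
 shows "nrm M (%x. Y x - (\<Sum>i<m. inner2 M Y (e i) * e i x)) \<le> nrm M (%x. Y x - (\<Sum>i<m. b i * e i x))"
proof -
 have L: "L2fun M (e i)" for i using e by (simp add: orthonormal0_def)
 let ?R = "%x. Y x - (\<Sum>i<m. inner2 M Y (e i) * e i x)"
 let ?D = "%x. \<Sum>i<m. (inner2 M Y (e i) - b i) * e i x"
 have R: "L2fun M ?R" and D: "L2fun M ?D"
  by (intro L2fun_diff L2fun_sum L2fun_cmult L Y)+
 have "inner2 M ?D ?R = (\<Sum>i<m. (inner2 M Y (e i) - b i) * inner2 M ?R (e i))"
  using R by (simp add: inner2_sum_left inner2_cmult_left L2fun_cmult L inner2_commute[of M ?R])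
 also have "... = 0"
 proof (rule sum.neutral, rule ballI)
  fix i assume "i \<in> {..<m}"
  then have "inner2 M ?R (e i) = 0"
   using e by (intro inner2_residual L Y) (auto simp: orthonormal0_def)
  then show "(inner2 M Y (e i) - b i) * inner2 M ?R (e i) = 0" by simp
 qed
 finally have 0: "(LINT x|M. ?R x * ?D x) = 0" by (simp add: inner2_def mult.commute)
 have "(nrm M (%x. ?R x + ?D x))\<^sup>2 = (nrm M ?R)\<^sup>2 + (nrm M ?D)\<^sup>2"
  using nrm_power2_add[OF R D] 0 by simp
 then have "(nrm M ?R)\<^sup>2 \<le> (nrm M (%x. ?R x + ?D x))\<^sup>2" by simp
 then have "nrm M ?R \<le> nrm M (%x. ?R x + ?D x)" by (rule power2_le_imp_le) simp
 moreover have "(%x. ?R x + ?D x) = (%x. Y x - (\<Sum>i<m. b i * e i x))"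
  by (simp add: fun_eq_iff left_diff_distrib sum_subtractf)
 ultimately show ?thesis by simp
qed

context shift_mu begin

lemma L1_pair_add: "f \<in> Linfty mu ==> g \<in> Linfty mu ==> integrable mu x ==>
  L1_pair mu (%t. f t + g t) x = L1_pair mu f x + L1_pair mu g x"
 unfolding L1_pair_def distrib_right by (intro Bintegral_add Linfty_mult_integrable)

lemma L1_pair_cmult: "L1_pair mu (%t. c * f t) x = c * L1_pair mu f x"
 by (simp add: L1_pair_def mult.assoc)

lemma Linfty_add: "f \<in> Linfty mu ==> g \<in> Linfty mu ==> (%t. f t + g t) \<in> Linfty mu"
proof -
 assume f: "f \<in> Linfty mu" and g: "g \<in> Linfty mu"
 obtain C where C: "AE t in mu. \<bar>f t\<bar> \<le> C" using f by (auto simp: Linfty_def)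
 obtain C' where C': "AE t in mu. \<bar>g t\<bar> \<le> C'" using g by (auto simp: Linfty_def)
 have "AE t in mu. \<bar>f t + g t\<bar> \<le> C + C'" using C C' by eventually_elim linarith
 then show ?thesis using f g by (auto simp: Linfty_def)
qed

lemma Linfty_cmult: "f \<in> Linfty mu ==> (%t. c * f t) \<in> Linfty mu"
proof -
 assume f: "f \<in> Linfty mu"
 obtain C where C: "AE t in mu. \<bar>f t\<bar> \<le> C" using f by (auto simp: Linfty_def)
 then have "AE t in mu. \<bar>c * f t\<bar> \<le> \<bar>c\<bar> * C" by eventually_elim (simp add: abs_mult mult_left_mono)
 then show ?thesis using f by (auto simp: Linfty_def)
qed

lemma Linfty_zero: "(%t. 0) \<in> Linfty mu"
 by (auto simp: Linfty_def intro!: exI[of _ 0])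

lemma Linfty_sum: "(\<And>i. i \<in> I ==> f i \<in> Linfty mu) ==> (%t. \<Sum>i\<in>I. f i t) \<in> Linfty mu"
 by (induction I rule: infinite_finite_induct) (auto simp: Linfty_zero Linfty_add)

lemma L1_pair_zero: "L1_pair mu (%t. 0) x = 0"
 by (simp add: L1_pair_def)

lemma L1_pair_sum:
 assumes "\<And>i. i \<in> I ==> f i \<in> Linfty mu" "integrable mu x"
 shows "L1_pair mu (%t. \<Sum>i\<in>I. f i t) x = (\<Sum>i\<in>I. L1_pair mu (f i) x)"
 using assms
 by (induction I rule: infinite_finite_induct) (auto simp: L1_pair_zero L1_pair_add Linfty_sum)

text \<open>The process runs on the functionals, not on the random variables: each step forms a
  linear combination of bounded functionals, so every orthonormal vector is again the value of a
  bounded functional at \<open>Y\<close>. Normalisation by \<open>inverse\<close> turns a vanishing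
  remainder into a zero vector.\<close>

lemma gram_schmidt:
 fixes Y :: "'w => 't => real" and F :: "nat => 't => real"
 assumes F: "\<And>j. F j \<in> Linfty mu" and Yi: "\<And>w. w \<in> space P ==> integrable mu (Y w)"
  and L: "\<And>f. f \<in> Linfty mu ==> L2fun P (%w. L1_pair mu f (Y w))"
 shows "\<exists>f :: nat => 't => real. (\<forall>j. f j \<in> Linfty mu) \<and>
  orthonormal0 P (%j w. L1_pair mu (f j) (Y w)) \<and>
  (\<forall>j. \<exists>b. AE w in P. L1_pair mu (F j) (Y w) = (\<Sum>i<Suc j. b i * L1_pair mu (f i) (Y w)))"
proof -
 let ?\<Lambda> = "%f w. L1_pair mu f (Y w)"
 define g where "g f n = (%t. F n t + (\<Sum>i<n. - inner2 P (?\<Lambda> (F n)) (?\<Lambda> (f i)) * f i t))"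
  for f :: "nat => 't => real" and n :: nat
 \<comment> \<open>The recursion for f n refers to all earlier f i, hence well-founded
   choice.\<close>
 have "\<exists>f. \<forall>n. f n = (%t. inverse (nrm P (?\<Lambda> (g f n))) * g f n t)"
 proof (rule dependent_wf_choice[OF wf_less])
  fix f h :: "nat => 't => real" and n r assume "\<And>z. (z, n) \<in> {(x, y). x < y} ==> f z = h z"
  then have "g f n = g h n" unfolding g_def by (intro ext arg_cong2[where f = "(+)"] refl sum.cong) auto
  then show "(r = (%t. inverse (nrm P (?\<Lambda> (g f n))) * g f n t)) = (r = (%t. inverse (nrm P (?\<Lambda> (g h n))) * g h n t))"
   by simp
 qed blast
 then obtain f where f: "\<And>n. f n = (%t. inverse (nrm P (?\<Lambda> (g f n))) * g f n t)" by blast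
 have fL: "f n \<in> Linfty mu" for n
 proof (induction n rule: less_induct)
  case (less n)
  have "g f n \<in> Linfty mu"
   unfolding g_def by (intro Linfty_add F Linfty_sum Linfty_cmult less) simp
  then show ?case by (subst f) (rule Linfty_cmult)
 qed
 have gL: "g f n \<in> Linfty mu" for n
  unfolding g_def by (intro Linfty_add F Linfty_sum Linfty_cmult fL)
 define e where "e n w = ?\<Lambda> (f n) w" for n w
 define h where "h n w = ?\<Lambda> (g f n) w" for n w
 define N where "N n = nrm P (h n)" for n
 have eL: "L2fun P (e n)" for n unfolding e_def by (rule L[OF fL])
 have hL: "L2fun P (h n)" for n unfolding h_def by (rule L[OF gL])
 have eh: "e n w = inverse (N n) * h n w" for n w
  unfolding e_def h_def N_def by (subst f) (simp only: L1_pair_cmult)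
 define x where "x n w = ?\<Lambda> (F n) w" for n w
 have xL: "L2fun P (x n)" for n unfolding x_def by (rule L[OF F])
 have hx: "h n w = x n w - (\<Sum>i<n. inner2 P (x n) (e i) * e i w)" if w: "w \<in> space P" for n w
 proof -
  have "h n w = x n w + (\<Sum>i<n. ?\<Lambda> (%t. - inner2 P (?\<Lambda> (F n)) (?\<Lambda> (f i)) * f i t) w)"
   unfolding h_def g_def x_def
   by (subst L1_pair_add[OF F Linfty_sum Yi[OF w]], intro Linfty_cmult fL,
     subst L1_pair_sum[OF _ Yi[OF w]], intro Linfty_cmult fL, rule refl)
  then show ?thesis unfolding L1_pair_cmult by (simp add: x_def[abs_def] e_def[abs_def] sum_negf)
 qed
 have nrme: "nrm P (e n) \<in> {0, 1}" for n
  unfolding eh nrm_cmult by (cases "N n = 0") (auto simp: N_def)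
 have orth: "inner2 P (e n) (e k) = 0" if "k < n" for n k
  using that
 proof (induction n arbitrary: k rule: less_induct)
  case (less n)
  have "inner2 P (h n) (e k) = inner2 P (%w. x n w - (\<Sum>i<n. inner2 P (x n) (e i) * e i w)) (e k)"
   unfolding inner2_def by (rule Bintegral_cong) (simp_all add: hx inner2_def)
  also have "... = 0"
  proof (rule inner2_residual[OF eL xL less(2) nrme])
   fix i assume "i < n" "i \<noteq> k"
   then show "inner2 P (e i) (e k) = 0"
    using less.IH[of i k] less.IH[of k i] less.prems inner2_commute[of P "e i" "e k"]
    by (cases "i < k") auto
  qed
  finally show ?case unfolding eh[of n] inner2_cmult_left by simp
 qed
 have "orthonormal0 P e"
  unfolding orthonormal0_def
 proof (intro conjI allI impI eL nrme)
  fix i j :: nat assume "i \<noteq> j"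
  then show "inner2 P (e i) (e j) = 0" using orth[of i j] orth[of j i] inner2_commute[of P "e i" "e j"]
   by (cases "i < j") auto
 qed
 moreover have "\<exists>b. AE w in P. x j w = (\<Sum>i<Suc j. b i * e i w)" for j
 proof (intro exI[of _ "%i. if i = j then N j else inner2 P (x j) (e i)"])
  \<comment> \<open>This also holds for N j = 0, where the remainder \<open>h j\<close> is almost
    surely 0.\<close>
  have "AE w in P. h j w = N j * e j w"
  proof (cases "N j = 0")
   case True
   then show ?thesis using nrm_eq_0_AE[OF hL, of j] by (simp add: N_def)
  qed (simp add: eh)
  moreover have "AE w in P. w \<in> space P" by simp
  ultimately show "AE w in P. x j w = (\<Sum>i<Suc j. (if i = j then N j else inner2 P (x j) (e i)) * e i w)"
  proof eventually_elim
   case (elim w)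
   have "(\<Sum>i<j. (if i = j then N j else inner2 P (x j) (e i)) * e i w) = (\<Sum>i<j. inner2 P (x j) (e i) * e i w)"
    by (rule sum.cong) auto
   then show ?case using hx[OF elim(2), of j] elim(1) by simp
  qed
 qed
 ultimately show ?thesis
  by (intro exI[of _ f]) (use fL in \<open>simp add: e_def[abs_def] x_def\<close>)
qed

end

section \<open>Convergence of characteristic functions in several variables\<close>

text \<open>The Gaussian is, up to scaling, its own Fourier transform; this writes the smoothing
  kernel as an average of exponentials.\<close>

lemma normal_density_char:
 assumes "eps > 0"
 shows "complex_of_real (normal_density v eps y)
  = of_real (1 / sqrt (2 * pi * eps\<^sup>2)) * (LINT u|std_normal_distribution. iexp ((y - v) / eps * u))"
proof -
 have "(LINT u|std_normal_distribution. iexp ((y - v) / eps * u)) = of_real (exp (- (((y - v) / eps)\<^sup>2) / 2))"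
  using fun_cong[OF char_std_normal_distribution, of "(y - v) / eps"] unfolding char_def by simp
 moreover have "- (((y - v) / eps)\<^sup>2) / 2 = - (y - v)\<^sup>2 / (2 * eps\<^sup>2)"
  by (simp add: power_divide)
 ultimately show ?thesis unfolding normal_density_def by (simp only: of_real_mult)
qed

definition gauss_kernel :: "nat => real => (nat => real) => (nat => real) => real" where
 "gauss_kernel m eps v y = (\<Prod>j<m. normal_density (v j) eps (y j))"

lemma gauss_kernel_nonneg: "0 \<le> gauss_kernel m eps v y"
 unfolding gauss_kernel_def by (intro prod_nonneg) simp

abbreviation lborel_pi :: "nat => (nat => real) measure" where
 "lborel_pi m \<equiv> Pi\<^sub>M {..<m} (%_. lborel)"

abbreviation normal_pi :: "nat => (nat => real) measure" where
 "normal_pi m \<equiv> Pi\<^sub>M {..<m} (%_. std_normal_distribution)"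

lemma psf_lborel: "product_sigma_finite (%_::nat. lborel :: real measure)"
 by (simp add: product_sigma_finite_def lborel.sigma_finite_measure_axioms)

lemma prob_normal: "prob_space std_normal_distribution"
 by (rule prob_space_normal_density) simp

lemma psf_normal: "product_sigma_finite (%_::nat. std_normal_distribution)"
 unfolding product_sigma_finite_def using prob_normal by (auto intro: prob_space_imp_sigma_finite)

lemma prob_normal_pi: "prob_space (normal_pi m)"
 by (rule prob_space_PiM) (rule prob_normal)

lemma sf_lborel_pi: "sigma_finite_measure (lborel_pi m)"
 using product_sigma_finite.sigma_finite[OF psf_lborel, of "{..<m}"] by simp

lemma gauss_kernel_measurable [measurable]:
 assumes "\<And>j. j < m ==> (%x. v x j) \<in> borel_measurable M" "\<And>j. j < m ==> (%x. y x j) \<in> borel_measurable M"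
 shows "bmeas M (%x. gauss_kernel m eps (v x) (y x))"
 unfolding gauss_kernel_def normal_density_def
proof (rule borel_measurable_prod)
 fix j assume "j \<in> {..<m}"
 then have [measurable]: "bmeas M (%x. v x j)" "bmeas M (%x. y x j)"
  using assms by auto
 show "bmeas M (%x. 1 / sqrt (2 * pi * eps\<^sup>2) * exp (- (y x j - v x j)\<^sup>2 / (2 * eps\<^sup>2)))" by measurable
qed

lemma coordinate_measurable: "j < m ==> (%y. y j) \<in> borel_measurable (lborel_pi m)"
 using measurable_component_singleton[of j "{..<m}" "%_. lborel :: real measure"] by simp

lemma coordinate_measurable': "j < m ==> (%y. y j) \<in> borel_measurable (normal_pi m)"
 using measurable_component_singleton[of j "{..<m}" "%_. std_normal_distribution"]
 by simp

lemma gauss_kernel_integral: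
 assumes "eps > 0"
 shows "integrable (lborel_pi m) (gauss_kernel m eps v)" "(LINT y|lborel_pi m. gauss_kernel m eps v y) = 1"
  and "(\<integral>\<^sup>+y. ennreal (gauss_kernel m eps v y) \<partial>lborel_pi m) = 1"
proof -
 interpret L: product_sigma_finite "%_::nat. lborel :: real measure" by (rule psf_lborel)
 show 1: "integrable (lborel_pi m) (gauss_kernel m eps v)"
  unfolding gauss_kernel_def[abs_def] using assms by (intro L.product_integrable_prod) auto
 show 2: "(LINT y|lborel_pi m. gauss_kernel m eps v y) = 1"
  unfolding gauss_kernel_def using assms by (subst L.product_integral_prod) auto
 show "(\<integral>\<^sup>+y. ennreal (gauss_kernel m eps v y) \<partial>lborel_pi m) = 1"
  using nn_integral_eq_integral[OF 1] 2 by (simp add: gauss_kernel_nonneg)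
qed

text \<open>The mean absolute deviation of a one-dimensional normal law is eps * sqrt (2 / pi); the
  remaining coordinates integrate to 1.\<close>

lemma gauss_kernel_moment:
 assumes eps: "eps > 0" and k: "k < m"
 shows "integrable (lborel_pi m) (%y. gauss_kernel m eps v y * \<bar>y k - v k\<bar>)"
  "(LINT y|lborel_pi m. gauss_kernel m eps v y * \<bar>y k - v k\<bar>) \<le> eps"
proof -
 interpret L: product_sigma_finite "%_::nat. lborel :: real measure" by (rule psf_lborel)
 let ?f = "%j x. normal_density (v j) eps x * (if j = k then \<bar>x - v k\<bar> else 1)"
 have eq: "gauss_kernel m eps v y * \<bar>y k - v k\<bar> = (\<Prod>j<m. ?f j (y j))" for y
  using k by (simp add: gauss_kernel_def prod.distrib prod.delta)
 have i: "integrable lborel (?f j)" for j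
  using integrable_normal_moment_abs[OF eps, of "v j" 1] eps by (cases "j = k") auto
 show "integrable (lborel_pi m) (%y. gauss_kernel m eps v y * \<bar>y k - v k\<bar>)"
  unfolding eq by (intro L.product_integrable_prod i) simp
 have ik: "integral\<^sup>L lborel (?f k) = eps * sqrt (2 / pi)"
  using integral_normal_moment_abs_odd[OF eps, of "v k" 0] by simp
 have "(LINT y|lborel_pi m. gauss_kernel m eps v y * \<bar>y k - v k\<bar>) = (\<Prod>j<m. integral\<^sup>L lborel (?f j))"
  unfolding eq by (intro L.product_integral_prod i) simp
 also have "... = (\<Prod>j<m. if j = k then eps * sqrt (2 / pi) else 1)"
  by (rule prod.cong) (use ik eps in auto)
 also have "... = eps * sqrt (2 / pi)" using k by (simp add: prod.delta)
 also have "... \<le> eps * 1"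
  using eps pi_gt3 by (intro mult_left_mono) (auto simp: real_sqrt_le_1_iff)
 finally show "(LINT y|lborel_pi m. gauss_kernel m eps v y * \<bar>y k - v k\<bar>) \<le> eps" by simp
qed

text \<open>The kernel has mass 1, so the error is the kernel average of g y - g v; the Lipschitz
  bound leaves m first moments of size at most eps.\<close>

lemma gauss_smoothing_error:
 assumes eps: "eps > 0" and g: "bmeas (lborel_pi m) g" and B: "\<And>v. \<bar>g v\<bar> \<le> B"
  and K: "\<And>v v'. \<bar>g v - g v'\<bar> \<le> K * (\<Sum>j<m. \<bar>v j - v' j\<bar>)" and K0: "0 \<le> K"
 shows "\<bar>(LINT y|lborel_pi m. g y * gauss_kernel m eps v y) - g v\<bar> \<le> K * real m * eps"
proof -
 note gk = gauss_kernel_integral[OF eps, of m v]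
 have m1: "bmeas (lborel_pi m) (gauss_kernel m eps v)" using gk(1) by auto
 have gi: "integrable (lborel_pi m) (%y. g y * gauss_kernel m eps v y)"
 proof (rule Bintegrable_bound[OF integrable_mult_right[OF gk(1), of B]])
  show "bmeas (lborel_pi m) (%y. g y * gauss_kernel m eps v y)" using g m1 by measurable
  have "0 \<le> B" using B[of undefined] by linarith
  then show "AE y in lborel_pi m. norm (g y * gauss_kernel m eps v y) \<le> norm (B * gauss_kernel m eps v y)"
   using B gauss_kernel_nonneg[of m eps v] by (intro AE_I2) (simp add: abs_mult mult_right_mono)
 qed
 have "(LINT y|lborel_pi m. g y * gauss_kernel m eps v y) - g v
   = (LINT y|lborel_pi m. g y * gauss_kernel m eps v y) - (LINT y|lborel_pi m. g v * gauss_kernel m eps v y)"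
  using gk(2) by simp
 also have "... = (LINT y|lborel_pi m. g y * gauss_kernel m eps v y - g v * gauss_kernel m eps v y)"
  by (rule Bintegral_diff[OF gi integrable_mult_right[OF gk(1)], symmetric])
 finally have eq: "(LINT y|lborel_pi m. g y * gauss_kernel m eps v y) - g v
   = (LINT y|lborel_pi m. g y * gauss_kernel m eps v y - g v * gauss_kernel m eps v y)" .
 have pt: "\<bar>g y * gauss_kernel m eps v y - g v * gauss_kernel m eps v y\<bar>
   \<le> (\<Sum>j<m. K * (gauss_kernel m eps v y * \<bar>y j - v j\<bar>))" for y
 proof -
  have "\<bar>g y * gauss_kernel m eps v y - g v * gauss_kernel m eps v y\<bar> = \<bar>g y - g v\<bar> * gauss_kernel m eps v y"
   using gauss_kernel_nonneg[of m eps v y] by (simp add: abs_mult flip: left_diff_distrib)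
  also have "... \<le> (K * (\<Sum>j<m. \<bar>y j - v j\<bar>)) * gauss_kernel m eps v y"
   by (rule mult_right_mono[OF K gauss_kernel_nonneg])
  also have "... = (\<Sum>j<m. K * (gauss_kernel m eps v y * \<bar>y j - v j\<bar>))"
   by (simp add: sum_distrib_left sum_distrib_right mult_ac)
  finally show ?thesis .
 qed
 have si: "integrable (lborel_pi m) (%y. \<Sum>j<m. K * (gauss_kernel m eps v y * \<bar>y j - v j\<bar>))"
  by (intro Bintegrable_sum integrable_mult_right gauss_kernel_moment eps) simp
 have "\<bar>\<integral>y. g y * gauss_kernel m eps v y - g v * gauss_kernel m eps v y \<partial>lborel_pi m\<bar>
   \<le> (LINT y|lborel_pi m. \<bar>g y * gauss_kernel m eps v y - g v * gauss_kernel m eps v y\<bar>)"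
  by (rule integral_abs_bound)
 also have "... \<le> (LINT y|lborel_pi m. (\<Sum>j<m. K * (gauss_kernel m eps v y * \<bar>y j - v j\<bar>)))"
  using pt by (intro integral_mono integrable_abs Bintegrable_diff gi integrable_mult_right gk si) auto
 also have "... = (\<Sum>j<m. K * (LINT y|lborel_pi m. gauss_kernel m eps v y * \<bar>y j - v j\<bar>))"
  by (subst Bintegral_sum) (auto intro!: integrable_mult_right gauss_kernel_moment eps)
 also have "... \<le> (\<Sum>j<m. K * eps)"
  by (intro sum_mono mult_left_mono gauss_kernel_moment eps K0) simp
 finally show ?thesis unfolding eq by (simp add: mult_ac)
qed

text \<open>The density of \<open>V\<close> plus an independent Gaussian vector whose coordinates
  are independent, centered and of standard deviation eps.\<close>

definition smooth_density :: "nat => real => 'a measure => ('a => nat => real) => (nat => real) => real" where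
 "smooth_density m eps P V y = (LINT w|P. gauss_kernel m eps (V w) y)"

lemma smooth_density_facts:
 assumes "prob_space P" and V: "\<And>j. j < m ==> (%w. V w j) \<in> borel_measurable P" and eps: "eps > 0"
  and g: "bmeas (lborel_pi m) g" and B: "\<And>v. \<bar>g v\<bar> \<le> B"
 shows "integrable (lborel_pi m) (%y. g y * smooth_density m eps P V y)"
  and "integrable P (%w. \<integral>y. g y * gauss_kernel m eps (V w) y \<partial>lborel_pi m)"
  and "(LINT y|lborel_pi m. g y * smooth_density m eps P V y) = (LINT w|P. (LINT y|lborel_pi m. g y * gauss_kernel m eps (V w) y))"
proof -
 interpret P: prob_space P by fact
 interpret L: sigma_finite_measure "lborel_pi m" by (rule sf_lborel_pi)
 interpret PL: pair_sigma_finite P "lborel_pi m" ..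
 have m1 [measurable]: "bmeas (P \<Otimes>\<^sub>M lborel_pi m) (%x. gauss_kernel m eps (V (fst x)) (snd x))"
  by (rule gauss_kernel_measurable)
   (use measurable_compose[OF measurable_fst V] measurable_compose[OF measurable_snd coordinate_measurable] in auto)
 note [measurable] = g
 let ?h = "%w y. g y * gauss_kernel m eps (V w) y"
 have hm: "bmeas (P \<Otimes>\<^sub>M lborel_pi m) (%(w, y). ?h w y)"
  unfolding case_prod_unfold by measurable
 have B0: "0 \<le> B" using B[of undefined] by linarith
 have int: "integrable (P \<Otimes>\<^sub>M lborel_pi m) (%(w, y). ?h w y)"
 proof (rule integrableI_bounded[OF hm])
  have "(\<integral>\<^sup>+x. ennreal (norm (case x of (w, y) => ?h w y)) \<partial>(P \<Otimes>\<^sub>M lborel_pi m))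
    \<le> (\<integral>\<^sup>+x. ennreal B * ennreal (gauss_kernel m eps (V (fst x)) (snd x)) \<partial>(P \<Otimes>\<^sub>M lborel_pi m))"
  proof (rule nn_integral_mono)
   fix x :: "'a \<times> (nat => real)"
   show "ennreal (norm (case x of (w, y) => ?h w y)) \<le> ennreal B * ennreal (gauss_kernel m eps (V (fst x)) (snd x))"
    using mult_right_mono[OF B gauss_kernel_nonneg, of "snd x" m eps "V (fst x)" "snd x"] B0
    by (simp add: case_prod_unfold abs_mult gauss_kernel_nonneg flip: ennreal_mult)
  qed
  also have "... = ennreal B * (\<integral>\<^sup>+w. (\<integral>\<^sup>+y. ennreal (gauss_kernel m eps (V w) y) \<partial>lborel_pi m) \<partial>P)"
   by (subst nn_integral_cmult, measurable, subst L.nn_integral_fst[symmetric]) simp_all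
  also have "... = ennreal B" by (simp add: gauss_kernel_integral[OF eps] P.emeasure_space_1)
  finally show "(\<integral>\<^sup>+x. ennreal (norm (case x of (w, y) => ?h w y)) \<partial>(P \<Otimes>\<^sub>M lborel_pi m)) < \<infinity>"
   by (rule le_less_trans) simp
 qed
 show "integrable (lborel_pi m) (%y. g y * smooth_density m eps P V y)"
  using PL.integrable_snd[OF int] by (simp add: smooth_density_def)
 show "integrable P (%w. \<integral>y. ?h w y \<partial>lborel_pi m)"
  by (rule PL.integrable_fst[OF int])
 show "(LINT y|lborel_pi m. g y * smooth_density m eps P V y) = (LINT w|P. (LINT y|lborel_pi m. ?h w y))"
  using PL.Fubini_integral[OF int] by (simp add: smooth_density_def)
qed

text \<open>Fourier inversion for the smoothed law: with the kernel written through exponentials,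
  Fubini's theorem moves the expectation inside, where the characteristic function of
  \<open>V\<close> at -u/eps appears.\<close>

lemma smooth_density_char:
 assumes "prob_space P" and V: "\<And>j. j < m ==> (%w. V w j) \<in> borel_measurable P" and eps: "eps > 0"
 shows "complex_of_real (smooth_density m eps P V y) = of_real (1 / sqrt (2 * pi * eps\<^sup>2)) ^ m *
  (LINT u|normal_pi m. iexp (\<Sum>j<m. y j / eps * u j) * (LINT w|P. iexp (\<Sum>j<m. (- u j / eps) * V w j)))"
proof -
 interpret P: prob_space P by fact
 interpret N: prob_space "normal_pi m" by (rule prob_normal_pi)
 interpret S: prob_space std_normal_distribution by (rule prob_normal)
 interpret psf: product_sigma_finite "%_::nat. std_normal_distribution" by (rule psf_normal)
 interpret PN: pair_sigma_finite P "normal_pi m" ..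
 define \<kappa> where "\<kappa> = complex_of_real (1 / sqrt (2 * pi * eps\<^sup>2))"
 have k: "complex_of_real (gauss_kernel m eps (V w) y)
   = \<kappa> ^ m * (LINT u|normal_pi m. iexp (\<Sum>j<m. (y j - V w j) / eps * u j))" for w
 proof -
  have "(LINT u|normal_pi m. (\<Prod>j\<in>{..<m}. iexp ((y j - V w j) / eps * u j)))
    = (\<Prod>j\<in>{..<m}. \<integral>x. iexp ((y j - V w j) / eps * x) \<partial>std_normal_distribution)"
   by (rule psf.product_integral_prod) (simp, rule S.integrable_const_bound[of _ 1], simp, measurable)
  moreover have "(\<Prod>j\<in>{..<m}. iexp ((y j - V w j) / eps * u j)) = iexp (\<Sum>j<m. (y j - V w j) / eps * u j)" for u
   by (simp add: exp_sum sum_distrib_left)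
  ultimately show ?thesis
   unfolding gauss_kernel_def of_real_prod normal_density_char[OF eps] prod.distrib \<kappa>_def by simp
 qed
 let ?F = "%w u. iexp (\<Sum>j<m. (y j - V w j) / eps * u j)"
 have Fm: "bmeas (P \<Otimes>\<^sub>M normal_pi m) (%x. iexp (\<Sum>j<m. (y j - V (fst x) j) / eps * snd x j))"
 proof -
  have "bmeas (P \<Otimes>\<^sub>M normal_pi m) (%x. \<Sum>j<m. (y j - V (fst x) j) / eps * snd x j)"
  proof (rule borel_measurable_sum)
   fix j assume "j \<in> {..<m}"
   then have [measurable]: "bmeas P (%w. V w j)" "bmeas (normal_pi m) (%u. u j)"
    using V coordinate_measurable' by auto
   show "bmeas (P \<Otimes>\<^sub>M normal_pi m) (%x. (y j - V (fst x) j) / eps * snd x j)" by measurable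
  qed
  then show ?thesis by measurable
 qed
 interpret PNp: prob_space "P \<Otimes>\<^sub>M normal_pi m" by (rule prob_space_pair) unfold_locales
 have Fi: "integrable (P \<Otimes>\<^sub>M normal_pi m) (%(w, u). ?F w u)"
  unfolding case_prod_unfold
  by (rule PNp.integrable_const_bound[of _ 1, OF _ Fm]) simp
 have "complex_of_real (smooth_density m eps P V y) = (LINT w|P. complex_of_real (gauss_kernel m eps (V w) y))"
  unfolding smooth_density_def by (rule integral_complex_of_real[symmetric])
 also have "... = \<kappa> ^ m * (LINT w|P. (LINT u|normal_pi m. ?F w u))"
  unfolding k by simp
 also have "(LINT w|P. (LINT u|normal_pi m. ?F w u)) = (LINT u|normal_pi m. (LINT w|P. ?F w u))"
  by (rule PN.Fubini_integral[OF Fi, symmetric])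
 also have "... = (LINT u|normal_pi m. iexp (\<Sum>j<m. y j / eps * u j) * (LINT w|P. iexp (\<Sum>j<m. (- u j / eps) * V w j)))"
 proof (rule Bintegral_cong[OF refl])
  fix u
  have "(\<Sum>j<m. (y j - V w j) / eps * u j) = (\<Sum>j<m. y j / eps * u j) + (\<Sum>j<m. (- u j / eps) * V w j)" for w
   unfolding sum.distrib[symmetric] by (rule sum.cong) (simp_all add: algebra_simps diff_divide_distrib)
  then have "?F w u = iexp (\<Sum>j<m. y j / eps * u j) * iexp (\<Sum>j<m. (- u j / eps) * V w j)" for w
   by (simp only: of_real_add distrib_left exp_add)
  then show "(LINT w|P. ?F w u) = iexp (\<Sum>j<m. y j / eps * u j) * (LINT w|P. iexp (\<Sum>j<m. (- u j / eps) * V w j))"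
   by (simp only: integral_mult_right_zero)
 qed
 finally show ?thesis unfolding \<kappa>_def .
qed

text \<open>Convergence of the characteristic functions gives pointwise convergence of the smoothed
  densities, and Scheffe's lemma makes it convergence in L1. Smoothing changes expectations of a
  Lipschitz function by an amount independent of n, so the noise level can be chosen first.\<close>

proposition multivariate_levy_lipschitz:
 fixes V :: "nat => 'w => nat => real" and W :: "'v => nat => real"
 assumes P: "prob_space P" and Q: "prob_space Q"
  and V: "\<And>n j. j < m ==> (%w. V n w j) \<in> borel_measurable P"
  and W: "\<And>j. j < m ==> (%w. W w j) \<in> borel_measurable Q"
  and char: "\<And>u. (%n. \<integral>w. iexp (\<Sum>j<m. u j * V n w j) \<partial>P) \<longlonglongrightarrow> (LINT w|Q. iexp (\<Sum>j<m. u j * W w j))"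
  and g: "bmeas (lborel_pi m) g" and B: "\<And>v. \<bar>g v\<bar> \<le> B"
  and K: "\<And>v v'. \<bar>g v - g v'\<bar> \<le> K * (\<Sum>j<m. \<bar>v j - v' j\<bar>)" and K0: "0 \<le> K"
  and gV: "\<And>n. (%w. g (V n w)) \<in> borel_measurable P" and gW: "bmeas Q (%w. g (W w))"
 shows "(%n. \<integral>w. g (V n w) \<partial>P) \<longlonglongrightarrow> (LINT w|Q. g (W w))"
proof -
 interpret P: prob_space P by (rule P)
 let ?p = "%eps n. smooth_density m eps P (V n)" and ?q = "%eps. smooth_density m eps Q W"
 let ?I = "%eps n. \<integral>y. g y * ?p eps n y \<partial>lborel_pi m" and ?J = "%eps. \<integral>y. g y * ?q eps y \<partial>lborel_pi m"
 let ?D = "%eps n. \<integral>y. \<bar>?p eps n y - ?q eps y\<bar> \<partial>lborel_pi m"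
 interpret Q: prob_space Q by (rule Q)
 interpret N: prob_space "normal_pi m" by (rule prob_normal_pi)
 have B0: "0 \<le> B" using B[of undefined] by linarith
 have err: "\<bar>(LINT w|R. g (U w)) - (LINT y|lborel_pi m. g y * smooth_density m eps R U y)\<bar> \<le> K * real m * eps"
  if eps: "eps > 0" and R: "prob_space R" and U: "\<And>j. j < m ==> (%w. U w j) \<in> borel_measurable R"
   and gU: "bmeas R (%w. g (U w))"
  for eps and R :: "'r measure" and U
 proof -
  interpret R: prob_space R by (rule R)
  note sf = smooth_density_facts[OF R U eps g B]
  have gi: "integrable R (%w. g (U w))" by (rule R.integrable_const_bound[of _ B]) (use B gU in auto)
  have c: "\<bar>g (U w) - (LINT y|lborel_pi m. g y * gauss_kernel m eps (U w) y)\<bar> \<le> K * real m * eps" for w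
   using gauss_smoothing_error[OF eps g B K K0, of "U w"] by (simp add: abs_minus_commute)
  have "\<bar>(LINT w|R. g (U w)) - (LINT y|lborel_pi m. g y * smooth_density m eps R U y)\<bar>
    = \<bar>\<integral>w. g (U w) - (LINT y|lborel_pi m. g y * gauss_kernel m eps (U w) y) \<partial>R\<bar>"
   by (simp only: Bintegral_diff[OF gi sf(2)] sf(3))
  also have "... \<le> (LINT w|R. \<bar>g (U w) - (LINT y|lborel_pi m. g y * gauss_kernel m eps (U w) y)\<bar>)"
   by (rule integral_abs_bound)
  also have "... \<le> (LINT w|R. K * real m * eps)"
   by (intro integral_mono integrable_abs Bintegrable_diff gi sf(2) c R.integrable_const)
  finally show ?thesis by (simp add: R.prob_space)
 qed
 have lim: "(%n. \<integral>y. g y * ?p eps n y \<partial>lborel_pi m) \<longlonglongrightarrow> ?J eps"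
  if eps: "eps > 0" for eps
 proof -
  have one: "bmeas (lborel_pi m) (%_. 1 :: real)" "\<And>v :: nat => real. \<bar>1 :: real\<bar> \<le> 1" by auto
  note sP = smooth_density_facts[OF P V eps one] and sQ = smooth_density_facts[OF Q W eps one]
  have nn: "0 \<le> ?p eps n y" "0 \<le> ?q eps y" for n y
   unfolding smooth_density_def by (intro Bochner_Integration.integral_nonneg gauss_kernel_nonneg)+
  have iP: "integrable (lborel_pi m) (?p eps n)" for n using sP(1) by simp
  have iQ: "integrable (lborel_pi m) (?q eps)" using sQ(1) by simp
  have tP: "(LINT y|lborel_pi m. ?p eps n y) = 1" for n
   using sP(3) by (simp add: gauss_kernel_integral[OF eps] P.prob_space)
  have tQ: "(LINT y|lborel_pi m. ?q eps y) = 1"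
   using sQ(3) by (simp add: gauss_kernel_integral[OF eps] Q.prob_space)
  have pw: "(%n. ?p eps n y) \<longlonglongrightarrow> ?q eps y" for y
  proof -
   have cm: "bmeas (normal_pi m) (%u. \<integral>w. iexp (\<Sum>j<m. (- u j / eps) * U w j) \<partial>R)"
    if R: "prob_space R" and U: "\<And>j. j < m ==> (%w. U w j) \<in> borel_measurable R"
    for R :: "'r measure" and U
   proof -
    interpret R: prob_space R by (rule R)
    have "bmeas (normal_pi m \<Otimes>\<^sub>M R) (%x. \<Sum>j<m. (- fst x j / eps) * U (snd x) j)"
    proof (rule borel_measurable_sum)
     fix j assume "j \<in> {..<m}"
     then have [measurable]: "bmeas R (%w. U w j)" "bmeas (normal_pi m) (%u. u j)"
      using U coordinate_measurable' by auto
     show "bmeas (normal_pi m \<Otimes>\<^sub>M R) (%x. (- fst x j / eps) * U (snd x) j)" by measurable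
    qed
    then have "bmeas (normal_pi m \<Otimes>\<^sub>M R) (%(u, w). iexp (\<Sum>j<m. (- u j / eps) * U w j))"
     unfolding case_prod_unfold by measurable
    then show ?thesis by (rule R.borel_measurable_lebesgue_integral)
   qed
   have ym: "bmeas (normal_pi m) (%u. iexp (\<Sum>j<m. y j / eps * u j))"
   proof -
    have "bmeas (normal_pi m) (%u. \<Sum>j<m. y j / eps * u j)"
     by (intro borel_measurable_sum borel_measurable_times coordinate_measurable') auto
    then show ?thesis by measurable
   qed
   have le1: "cmod (LINT w|P. iexp (f w)) \<le> 1" for f
   proof -
    have "cmod (LINT w|P. iexp (f w)) \<le> (LINT w|P. cmod (iexp (f w)))" by (rule integral_norm_bound)
    also have "... = 1" by (simp add: P.prob_space)
    finally show ?thesis .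
   qed
   have "(%n. \<integral>u. iexp (\<Sum>j<m. y j / eps * u j) * (LINT w|P. iexp (\<Sum>j<m. (- u j / eps) * V n w j)) \<partial>normal_pi m)
    \<longlonglongrightarrow> (LINT u|normal_pi m. iexp (\<Sum>j<m. y j / eps * u j) * (LINT w|Q. iexp (\<Sum>j<m. (- u j / eps) * W w j)))"
   proof (rule integral_dominated_convergence[where w = "%_. 1"])
    show "AE u in normal_pi m. (%n. iexp (\<Sum>j<m. y j / eps * u j) * (LINT w|P. iexp (\<Sum>j<m. (- u j / eps) * V n w j)))
     \<longlonglongrightarrow> iexp (\<Sum>j<m. y j / eps * u j) * (LINT w|Q. iexp (\<Sum>j<m. (- u j / eps) * W w j))"
     by (intro AE_I2 tendsto_mult tendsto_const char)
    show "AE u in normal_pi m. norm (iexp (\<Sum>j<m. y j / eps * u j) * (LINT w|P. iexp (\<Sum>j<m. (- u j / eps) * V n w j))) \<le> 1" for n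
     by (intro AE_I2) (simp only: norm_mult norm_exp_i_times mult_1_left le1)
   qed (rule borel_measurable_times[OF ym cm[OF Q W]], assumption, rule borel_measurable_times[OF ym cm[OF P V]], assumption, simp)
   then have "(%n. complex_of_real (?p eps n y)) \<longlonglongrightarrow> complex_of_real (?q eps y)"
    by (simp only: smooth_density_char[OF P V eps] smooth_density_char[OF Q W eps])
     (rule tendsto_mult[OF tendsto_const])
   then show ?thesis by (simp only: tendsto_of_real_iff)
  qed
  have n1: "(\<integral>\<^sup>+y. ennreal (norm (?p eps n y)) \<partial>lborel_pi m) = 1" for n
   using nn_integral_eq_integral[OF iP] tP[of n] nn by simp
  have n2: "(\<integral>\<^sup>+y. ennreal (norm (?q eps y)) \<partial>lborel_pi m) = 1"
   using nn_integral_eq_integral[OF iQ] tQ nn by simp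
  have "null_seq (%n. \<integral>\<^sup>+y. ennreal (norm (?p eps n y - ?q eps y)) \<partial>lborel_pi m)"
   by (rule Scheffe_lemma2) (use iP iQ pw n1 n2 in auto)
  moreover have "(\<integral>\<^sup>+y. ennreal (norm (?p eps n y - ?q eps y)) \<partial>lborel_pi m)
    = ennreal (?D eps n)" for n
   using iP[of n] iQ by (subst nn_integral_eq_integral[symmetric]) auto
  ultimately have "(%n. ennreal (?D eps n)) \<longlonglongrightarrow> ennreal 0"
   by simp
  then have s0: "null_seq (%n. \<integral>y. \<bar>?p eps n y - ?q eps y\<bar> \<partial>lborel_pi m)"
   by (subst (asm) tendsto_ennreal_iff) auto
  have gP: "integrable (lborel_pi m) (%y. g y * ?p eps n y)" for n
   by (rule smooth_density_facts(1)[OF P V eps g B])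
  have gQ: "integrable (lborel_pi m) (%y. g y * ?q eps y)"
   by (rule smooth_density_facts(1)[OF Q W eps g B])
  show ?thesis
  proof (rule LIM_zero_cancel, rule Lim_null_comparison)
   show "null_seq (%n. B * (?D eps n))"
    by (rule tendsto_mult_right_zero[OF s0])
   show "\<forall>\<^sub>F n in sequentially. norm (?I eps n - ?J eps)
    \<le> B * (?D eps n)"
   proof (rule always_eventually, rule allI)
    fix n
    have "?I eps n - ?J eps
      = (LINT y|lborel_pi m. g y * ?p eps n y - g y * ?q eps y)"
     by (rule Bintegral_diff[OF gP gQ, symmetric])
    moreover have "\<bar>\<integral>y. g y * ?p eps n y - g y * ?q eps y \<partial>lborel_pi m\<bar>
      \<le> (LINT y|lborel_pi m. \<bar>g y * ?p eps n y - g y * ?q eps y\<bar>)"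
     by (rule integral_abs_bound)
    moreover have "... \<le> (LINT y|lborel_pi m. B * \<bar>?p eps n y - ?q eps y\<bar>)"
    proof (rule integral_mono)
     show "\<bar>g y * ?p eps n y - g y * ?q eps y\<bar>
      \<le> B * \<bar>?p eps n y - ?q eps y\<bar>" for y
      unfolding right_diff_distrib[symmetric] abs_mult by (rule mult_right_mono[OF B]) simp
    qed (intro integrable_abs Bintegrable_diff gP gQ,
       intro integrable_mult_right integrable_abs Bintegrable_diff iP iQ)
    ultimately show "norm (?I eps n - ?J eps)
     \<le> B * (?D eps n)"
     unfolding real_norm_def integral_mult_right_zero by linarith
   qed
  qed
 qed
 show ?thesis
 proof (rule LIMSEQ_I)
  fix r :: real assume r: "r > 0"
  \<comment> \<open>The smoothing errors before and after the limit get r/4 each, and so does the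
    distance of the smoothed expectations.\<close>
  define eps where "eps = r / (4 * (K * real m + 1))"
  have km: "0 \<le> K * real m" using K0 by simp
  have eps: "eps > 0" using r km by (simp add: eps_def)
  have small: "K * real m * eps \<le> r / 4"
  proof -
   have "K * real m * eps \<le> (K * real m + 1) * eps" using eps by (simp add: distrib_right)
   also have "... = r / 4" using km by (simp add: eps_def field_simps)
   finally show ?thesis .
  qed
  obtain n0 where n0: "\<And>n. n \<ge> n0 ==> norm (?I eps n - ?J eps) < r / 4"
   using LIMSEQ_D[OF lim[OF eps], of "r / 4"] r by auto
  have "norm ((LINT w|P. g (V n w)) - (LINT w|Q. g (W w))) < r" if n: "n \<ge> n0" for n
  proof -
   note 1 = err[OF eps P V gV, of n] and 2 = err[OF eps Q W gW]
   show ?thesis using 1 2 n0[OF n] small r unfolding real_norm_def abs_less_iff abs_le_iff by linarith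
  qed
  then show "\<exists>no. \<forall>n\<ge>no. norm ((LINT w|P. g (V n w)) - (LINT w|Q. g (W w))) < r" by blast
 qed
qed

section \<open>Independent standard normal variables\<close>

text \<open>Pythagoras with the norms kept as weights, so that vanishing members of the system
  contribute 0.\<close>

lemma nrm_orthonormal_sum:
 assumes e: "orthonormal0 M e" and J: "finite J"
 shows "(nrm M (%x. \<Sum>j\<in>J. a j * e j x))\<^sup>2 = (\<Sum>j\<in>J. (a j)\<^sup>2 * (nrm M (e j))\<^sup>2)"
proof -
 have L: "L2fun M (e j)" for j using e by (simp add: orthonormal0_def)
 let ?s = "%x. \<Sum>j\<in>J. a j * e j x"
 have sL: "L2fun M ?s" by (intro L2fun_sum L2fun_cmult L)
 have 1: "inner2 M ?s (e i) = a i * (nrm M (e i))\<^sup>2" if i: "i \<in> J" for i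
 proof -
  have "inner2 M ?s (e i) = (\<Sum>j\<in>J. a j * inner2 M (e j) (e i))"
   by (simp add: inner2_sum_left inner2_cmult_left L L2fun_cmult)
  also have "... = (\<Sum>j\<in>J. if j = i then a i * (nrm M (e i))\<^sup>2 else 0)"
   by (rule sum.cong) (use e in \<open>auto simp: orthonormal0_def inner2_self\<close>)
  also have "... = a i * (nrm M (e i))\<^sup>2" using J i by (simp add: sum.delta)
  finally show ?thesis .
 qed
 have "(nrm M ?s)\<^sup>2 = inner2 M ?s ?s" by (rule inner2_self[symmetric])
 also have "... = (\<Sum>i\<in>J. a i * inner2 M (e i) ?s)"
  using sL by (simp add: inner2_sum_left inner2_cmult_left L L2fun_cmult)
 also have "... = (\<Sum>i\<in>J. (a i)\<^sup>2 * (nrm M (e i))\<^sup>2)"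
  by (rule sum.cong) (simp_all add: inner2_commute[of M _ ?s] 1 power2_eq_square)
 finally show ?thesis .
qed

lemma tendsto_integral_iexp:
 assumes "prob_space M" and Y: "\<And>n. L2fun M (Y n)" and Z: "\<And>n. L2fun M (Z n)"
  and lim: "null_seq (%n. nrm M (%x. Y n x - Z n x))"
 shows "null_seq (%n. (LINT x|M. iexp (Y n x)) - (LINT x|M. iexp (Z n x)))"
proof (rule Lim_null_comparison[OF always_eventually lim], rule allI)
 interpret prob_space M by fact
 fix n
 have [measurable]: "bmeas M (Y n)" "bmeas M (Z n)"
  using Y Z by (auto simp: L2fun_def)
 have i: "integrable M (%x. iexp (f x))" if "bmeas M f" for f :: "'a => real"
  by (rule integrable_const_bound[of _ 1]) (use that in simp_all)
 have d: "L2fun M (%x. Y n x - Z n x)" by (rule L2fun_diff[OF Y Z])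
 have pt: "cmod (iexp a - iexp b) \<le> \<bar>a - b\<bar>" for a b
 proof -
  have "iexp a - iexp b = iexp b * (iexp (a - b) - 1)"
   by (simp add: right_diff_distrib flip: exp_add)
  then have "cmod (iexp a - iexp b) = cmod (iexp (a - b) - 1)" by (simp only: norm_mult norm_exp_i_times mult_1_left)
  also have "... \<le> \<bar>a - b\<bar>" using iexp_approx1[of "a - b" 0] by simp
  finally show ?thesis .
 qed
 have "norm ((LINT x|M. iexp (Y n x)) - (LINT x|M. iexp (Z n x))) = norm (LINT x|M. iexp (Y n x) - iexp (Z n x))"
  by (subst Bintegral_diff) (auto intro!: i)
 also have "... \<le> (LINT x|M. norm (iexp (Y n x) - iexp (Z n x)))" by (rule integral_norm_bound)
 also have "... \<le> (LINT x|M. \<bar>Y n x - Z n x\<bar>)"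
  by (intro integral_mono pt integrable_norm Bintegrable_diff i integrable_abs L2fun_integrable Y Z) simp_all
 also have "... \<le> nrm M (%x. Y n x - Z n x)" by (rule L2fun_norm1_le[OF d])
 finally show "norm ((LINT x|M. iexp (Y n x)) - (LINT x|M. iexp (Z n x))) \<le> nrm M (%x. Y n x - Z n x)" .
qed

definition normal_seq :: "(nat => real) measure" where
 "normal_seq = Pi\<^sub>M UNIV (%_. std_normal_distribution)"

lemma prob_normal_seq: "prob_space normal_seq"
 unfolding normal_seq_def by (rule prob_space_PiM) (rule prob_normal)

lemma normal_seq_coordinate: "bmeas normal_seq (%z. z j)"
 unfolding normal_seq_def
 using measurable_component_singleton[of j UNIV "%_. std_normal_distribution"] by simp

lemma distr_normal_seq: "distr normal_seq borel (%z. z j) = std_normal_distribution"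
proof -
 have "distr normal_seq std_normal_distribution (%z. z j) = std_normal_distribution"
  unfolding normal_seq_def by (rule distr_PiM_component) (auto intro: prob_normal)
 moreover have "distr normal_seq std_normal_distribution (%z. z j) = distr normal_seq borel (%z. z j)"
  by (rule distr_cong) simp_all
 ultimately show ?thesis by simp
qed

lemma indep_normal_seq: "prob_space.indep_vars normal_seq (%_. borel) (%j z. z j) UNIV"
proof -
 interpret prob_space normal_seq by (rule prob_normal_seq)
 have m: "(%z. z j) \<in> measurable normal_seq std_normal_distribution" for j
  using normal_seq_coordinate[of j] by simp
 have "indep_vars (%_. std_normal_distribution) (%j z. z j) UNIV"
 proof (subst indep_vars_iff_distr_eq_PiM')
  have "distr normal_seq std_normal_distribution (%z. z j) = std_normal_distribution" for j
   unfolding normal_seq_def by (rule distr_PiM_component) (auto intro: prob_normal)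
  then show "distr normal_seq (Pi\<^sub>M UNIV (%_. std_normal_distribution)) (%x. \<lambda>i\<in>UNIV. x i) =
    Pi\<^sub>M UNIV (%i. distr normal_seq std_normal_distribution (%z. z i))"
   by (simp add: normal_seq_def restrict_UNIV distr_id2)
 qed (use m in simp_all)
 then have "indep_vars (%_. borel) (%j z. (%x. x) (z j)) UNIV"
  by (rule indep_vars_compose2) simp
 then show ?thesis by simp
qed

lemma normal_seq_moments:
 "(LINT z|normal_seq. z j) = 0" "L2fun normal_seq (%z. z j)" "nrm normal_seq (%z. z j) = 1"
proof -
 note c = normal_seq_coordinate[of j]
 have "(LINT z|normal_seq. z j) = (\<integral>x. x \<partial>distr normal_seq borel (%z. z j))"
  by (rule integral_distr[symmetric, OF c]) simp
 then show "(LINT z|normal_seq. z j) = 0"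
  unfolding distr_normal_seq using integral_std_normal_distribution_moment_odd[of 1] by simp
 have "integrable (distr normal_seq borel (%z. z j)) (%x. x\<^sup>2)"
  unfolding distr_normal_seq by (rule integrable_std_normal_distribution_moment)
 then have "integrable normal_seq (%z. (z j)\<^sup>2)"
  by (subst (asm) integrable_distr_eq[OF c]) simp_all
 then show "L2fun normal_seq (%z. z j)" using c by (simp add: L2fun_def)
 have "(LINT z|normal_seq. (z j)\<^sup>2) = (\<integral>x. x\<^sup>2 \<partial>distr normal_seq borel (%z. z j))"
  by (rule integral_distr[symmetric, OF c]) simp
 also have "... = 1"
  unfolding distr_normal_seq using std_normal_distribution_even_moments(1)[of 1] by simp
 finally show "nrm normal_seq (%z. z j) = 1" by (simp add: nrm_def)
qed

lemma orthonormal_normal_seq: "orthonormal0 normal_seq (%j z. z j)"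
 unfolding orthonormal0_def
proof (intro conjI allI impI)
 interpret prob_space normal_seq by (rule prob_normal_seq)
 show "L2fun normal_seq (%z. z i)" "nrm normal_seq (%z. z i) \<in> {0, 1}" for i
  by (simp_all add: normal_seq_moments)
 fix i j :: nat assume ij: "i \<noteq> j"
 have "indep_vars (%_. borel) (%j z. z j) {i, j}"
  by (rule indep_vars_subset[OF indep_normal_seq]) simp
 then have "(LINT z|normal_seq. (\<Prod>k\<in>{i, j}. z k)) = (\<Prod>k\<in>{i, j}. \<integral>z. z k \<partial>normal_seq)"
  by (intro indep_vars_lebesgue_integral) (auto intro: L2fun_integrable normal_seq_moments)
 then show "inner2 normal_seq (%z. z i) (%z. z j) = 0"
  using ij by (simp add: inner2_def normal_seq_moments)
qed

lemma char_normal_seq_sum: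
 assumes "finite J"
 shows "(LINT z|normal_seq. iexp (\<Sum>j\<in>J. a j * z j)) = of_real (exp (- (\<Sum>j\<in>J. (a j)\<^sup>2) / 2))"
proof -
 interpret prob_space normal_seq by (rule prob_normal_seq)
 have "indep_vars (%_. borel) (%j z. z j) J"
  by (rule indep_vars_subset[OF indep_normal_seq]) simp
 then have ind: "indep_vars (%_. borel) (%j z. (%x. a j * x) (z j)) J"
  by (rule indep_vars_compose2) simp
 have [measurable]: "bmeas normal_seq (%z. z j)" for j by (rule normal_seq_coordinate)
 have "(LINT z|normal_seq. iexp (\<Sum>j\<in>J. a j * z j)) = char (distr normal_seq borel (%z. \<Sum>j\<in>J. a j * z j)) 1"
  unfolding char_def by (subst integral_distr) simp_all
 also have "... = (\<Prod>j\<in>J. char (distr normal_seq borel (%z. a j * z j)) 1)"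
  by (rule char_distr_sum[OF ind])
 also have "... = (\<Prod>j\<in>J. of_real (exp (- (a j)\<^sup>2 / 2)))"
 proof (rule prod.cong[OF refl])
  fix j
  have "char (distr normal_seq borel (%z. a j * z j)) 1 = (LINT z|normal_seq. iexp (a j * z j))"
   unfolding char_def by (subst integral_distr) simp_all
  also have "... = (\<integral>x. iexp (a j * x) \<partial>distr normal_seq borel (%z. z j))"
   by (subst integral_distr) simp_all
  also have "... = char std_normal_distribution (a j)" by (simp add: distr_normal_seq char_def)
  finally show "char (distr normal_seq borel (%z. a j * z j)) 1 = of_real (exp (- (a j)\<^sup>2 / 2))"
   by (simp add: char_std_normal_distribution)
 qed
 also have "... = of_real (exp (\<Sum>j\<in>J. - (a j)\<^sup>2 / 2))"
  using assms by (simp only: exp_sum of_real_prod)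
 also have "(\<Sum>j\<in>J. - (a j)\<^sup>2 / 2) = - (\<Sum>j\<in>J. (a j)\<^sup>2) / 2"
  by (simp add: sum_negf sum_divide_distrib)
 finally show ?thesis .
qed

text \<open>For \<sigma> = 0 the variable is almost surely 0, the point mass allowed by
  \<open>real_gaussian\<close>; otherwise the law is identified by uniqueness of characteristic
  functions.\<close>

lemma gaussian_of_char:
 assumes "prob_space M" and Y: "L2fun M Y" and \<sigma>: "\<sigma> = nrm M Y"
  and ch: "\<And>t. (LINT x|M. iexp (t * Y x)) = of_real (exp (- (t * \<sigma>)\<^sup>2 / 2))"
 shows "real_gaussian M Y"
proof (cases "\<sigma> = 0")
 case True
 then have "AE x in M. Y x = 0" using nrm_eq_0_AE[OF Y] \<sigma> by simp
 then show ?thesis using Y by (auto simp: real_gaussian_def L2fun_def)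
next
 case False
 interpret prob_space M by fact
 interpret N: prob_space std_normal_distribution by (rule prob_normal)
 have s: "\<sigma> > 0" using False \<sigma> nrm_nonneg[of M Y] by linarith
 have [measurable]: "bmeas M Y" using Y by (simp add: L2fun_def)
 have "distributed std_normal_distribution lborel (%x. x) std_normal_density"
  unfolding distributed_def
 proof (intro conjI)
  show "distr std_normal_distribution lborel (%x. x) = density lborel (%x. ennreal (std_normal_density x))"
   by (rule distr_id2) simp
 qed simp_all
 from N.normal_density_affine[OF this, of \<sigma> 0] s
 have "distributed std_normal_distribution lborel (%x. \<sigma> * x) (normal_density 0 \<sigma>)" by simp
 then have d: "distr std_normal_distribution lborel (%x. \<sigma> * x) = density lborel (normal_density 0 \<sigma>)"
  by (simp add: distributed_def)
 have "distr std_normal_distribution lborel (%x. \<sigma> * x) = distr std_normal_distribution borel (%x. \<sigma> * x)"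
  by (rule distr_cong) simp_all
 with d have d': "density lborel (normal_density 0 \<sigma>) = distr std_normal_distribution borel (%x. \<sigma> * x)" by simp
 have "distr M borel Y = distr std_normal_distribution borel (%x. \<sigma> * x)"
 proof (rule Levy_uniqueness)
  show "real_distribution (distr M borel Y)" by (rule real_distribution_distr) simp
  show "real_distribution (distr std_normal_distribution borel (%x. \<sigma> * x))"
   by (rule N.real_distribution_distr) simp
  show "char (distr M borel Y) = char (distr std_normal_distribution borel (%x. \<sigma> * x))"
  proof
   fix t
   have "char (distr M borel Y) t = (LINT x|M. iexp (t * Y x))"
    unfolding char_def by (subst integral_distr) simp_all
   moreover have "char (distr std_normal_distribution borel (%x. \<sigma> * x)) t = (LINT x|std_normal_distribution. iexp (t * (\<sigma> * x)))"
    unfolding char_def by (subst integral_distr) simp_all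
   moreover have "... = char std_normal_distribution (t * \<sigma>)"
    unfolding char_def by (simp only: mult.assoc)
   ultimately show "char (distr M borel Y) t = char (distr std_normal_distribution borel (%x. \<sigma> * x)) t"
    by (simp only: ch char_std_normal_distribution)
  qed
 qed
 moreover have "distr M lborel Y = distr M borel Y" by (rule distr_cong) simp_all
 ultimately have "distr M lborel Y = density lborel (normal_density 0 \<sigma>)" using d' by simp
 then have "distributed M lborel Y (normal_density 0 \<sigma>)"
  unfolding distributed_def by simp
 then show ?thesis using s unfolding real_gaussian_def by auto
qed

lemma mixn_space_cong:
 assumes "\<And>w t. w \<in> space P ==> t \<in> space mu ==> Y w t = Z w t"
 shows "mixn P mu Y = mixn P mu Z"
 unfolding mixn_def norm2_def
 by (intro nn_integral_cong if_cong arg_cong[where f = ennreal] arg_cong[where f = sqrt] arg_cong[where f = Not]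
   Bintegral_cong Bintegrable_cong refl) (auto simp: assms)

context shift_mu begin

lemma L1_pair_diff:
 assumes "f \<in> Linfty mu" "integrable mu x" "integrable mu y"
 shows "L1_pair mu f (%t. x t - y t) = L1_pair mu f x - L1_pair mu f y"
 unfolding L1_pair_def right_diff_distrib
 by (intro Bintegral_diff Linfty_mult_integrable assms)

lemma L1_pair_tendsto:
 assumes Q: "prob_space Q" and f: "f \<in> Linfty mu" and Y: "\<And>n. L1_random_variable Q mu (Y n)"
  and Z: "\<And>n. L1_random_variable Q mu (Z n)"
  and Yf: "\<And>n. mixn Q mu (Y n) < \<infinity>" and Zf: "\<And>n. mixn Q mu (Z n) < \<infinity>"
  and lim: "null_seq (%n. mixn Q mu (%w t. Y n w t - Z n w t))"
 shows "null_seq (%n. nrm Q (%w. L1_pair mu f (Y n w) - L1_pair mu f (Z n w)))"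
proof -
 obtain C where C: "0 \<le> C" "AE t in mu. \<bar>f t\<bar> \<le> C" using Linfty_bound[OF f] .
 have Ym [measurable]: "joint_meas Q mu (Y n)"
  and Zm [measurable]: "joint_meas Q mu (Z n)" for n
  using Y Z by (auto simp: L1_random_variable_def)
 have YZ: "joint_meas Q mu (%w t. Y n w t - Z n w t)" for n by measurable
 have L: "L2fun Q (%w. L1_pair mu f (Y n w) - L1_pair mu f (Z n w))" for n
  by (intro L2fun_diff L1_pair_L2[OF Q f] Ym Zm Yf Zf)
 have le: "ennreal (nrm Q (%w. L1_pair mu f (Y n w) - L1_pair mu f (Z n w)))
   \<le> ennreal C * mixn Q mu (%w t. Y n w t - Z n w t)" for n
 proof -
  have "norm2 Q (%w. L1_pair mu f (Y n w) - L1_pair mu f (Z n w)) = norm2 Q (%w. L1_pair mu f (%t. Y n w t - Z n w t))"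
  proof (rule norm2_cong_AE)
   show "AE w in Q. L1_pair mu f (Y n w) - L1_pair mu f (Z n w) = L1_pair mu f (%t. Y n w t - Z n w t)"
    using Y Z by (intro AE_I2 L1_pair_diff[symmetric] f) (auto simp: L1_random_variable_def)
  qed (use L1_pair_measurable[OF f YZ] L in \<open>auto simp: L2fun_def\<close>)
  then show ?thesis using norm2_L1_pair[OF Q f C YZ, of n] by (simp add: norm2_L2[OF L])
 qed
 have "(%n. ennreal C * mixn Q mu (%w t. Y n w t - Z n w t)) \<longlonglongrightarrow> ennreal C * 0"
  by (rule ennreal_tendsto_cmult[OF _ lim]) simp
 then have "(%n. ennreal (nrm Q (%w. L1_pair mu f (Y n w) - L1_pair mu f (Z n w)))) \<longlonglongrightarrow> ennreal 0"
  by (simp only: mult_zero_right ennreal_0)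
   (rule tendsto_sandwich[OF always_eventually always_eventually tendsto_const], simp, rule allI, rule le)
 then show ?thesis by (subst (asm) tendsto_ennreal_iff) auto
qed

end

section \<open>Construction of the Gaussian limit\<close>

text \<open>Separates the construction of the limit from the stationary sequence: only the
  square-integrable random function \<open>S\<close> and an orthonormal system of bounded
  functionals of it enter.\<close>

locale l1_expansion = shift_mu P T F0 mu for P :: "'w measure" and T F0 and mu :: "'t measure" +
 fixes S :: "'w => 't => real" and f :: "nat => 't => real"
 assumes S_rv: "L1_random_variable P mu S" and S_fin: "mixn P mu S < \<infinity>"
  and f_Linfty: "\<And>j. f j \<in> Linfty mu"
  and f_orth: "orthonormal0 P (%j w. L1_pair mu (f j) (S w))"
  and f_dense: "AE t in mu. \<forall>eps>0. \<exists>j b. norm2 P (%w. S w t - (\<Sum>i<Suc j. b i * L1_pair mu (f i) (S w))) < ennreal eps"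
begin

definition e :: "nat => 'w => real" where "e j w = L1_pair mu (f j) (S w)"

definition c :: "nat => 't => real" where "c j t = inner2 P (%w. S w t) (e j)"

definition proj :: "nat => 'w => 't => real" where "proj m w t = (\<Sum>j<m. c j t * e j w)"

lemma S_m [measurable]: "joint_meas P mu S"
 and S_i: "w \<in> space P ==> integrable mu (S w)"
 using S_rv by (auto simp: L1_random_variable_def)

lemma e_orth: "orthonormal0 P e"
 using f_orth by (simp add: e_def[abs_def])

lemma e_L2: "L2fun P (e j)" and e_nrm: "nrm P (e j) \<in> {0, 1}"
 using e_orth by (auto simp: orthonormal0_def)

lemma e_m [measurable]: "bmeas P (e j)"
 using e_L2 by (simp add: L2fun_def)

lemma c_m [measurable]: "bmeas mu (c j)"
proof -
 have "joint_meas mu P (%t w. S w t * e j w)" by measurable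
 then have "bmeas mu (%t. \<integral>w. S w t * e j w \<partial>P)" by (rule borel_measurable_lebesgue_integral)
 then show ?thesis by (simp add: c_def[abs_def] inner2_def)
qed

text \<open>By Cauchy-Schwarz the coefficient at t is at most the L2 norm of \<open>S\<close> at t,
  because \<open>e j\<close> has norm at most 1; the finite mixed norm is the integral of this
  bound.\<close>

lemma c_integrable: "integrable mu (c j)"
proof (rule integrableI_bounded[OF c_m])
 have le1: "norm2 P (e j) \<le> 1" using e_nrm[of j] by (auto simp: norm2_L2[OF e_L2])
 have "(\<integral>\<^sup>+t. ennreal (norm (c j t)) \<partial>mu) \<le> (\<integral>\<^sup>+t. norm2 P (%w. S w t) \<partial>mu)"
 proof (rule nn_integral_mono)
  fix t assume t: "t \<in> space mu"
  have [measurable]: "bmeas P (%w. S w t)" by (rule joint_section[OF S_m t])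
  have "ennreal (norm (c j t)) \<le> (\<integral>\<^sup>+w. ennreal (norm (S w t * e j w)) \<partial>P)"
  proof (cases "integrable P (%w. S w t * e j w)")
   case True
   then show ?thesis unfolding c_def inner2_def by (rule integral_norm_bound_ennreal)
  qed (simp add: c_def inner2_def not_integrable_integral_eq)
  also have "... = (\<integral>\<^sup>+w. ennreal \<bar>S w t\<bar> * ennreal \<bar>e j w\<bar> \<partial>P)"
   by (simp add: abs_mult ennreal_mult)
  also have "... \<le> norm2 P (%w. S w t) * norm2 P (e j)" by (rule norm2_CS) measurable
  also have "... \<le> norm2 P (%w. S w t) * 1" by (rule mult_left_mono[OF le1]) simp
  finally show "ennreal (norm (c j t)) \<le> norm2 P (%w. S w t)" by simp
 qed
 also have "... < \<infinity>" using S_fin by (simp add: mixn_def)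
 finally show "(\<integral>\<^sup>+t. ennreal (norm (c j t)) \<partial>mu) < \<infinity>" .
qed

text \<open>A coefficient with \<open>e j = 0\<close> vanishes, so the degenerate members of the orthonormal system are harmless.\<close>

lemma c_nrm: "nrm P (e j) * c j t = c j t"
 using e_nrm[of j] inner2_zero_AE[OF e_L2, of j "%w. S w t"] by (auto simp: c_def)

lemma proj_m [measurable]: "joint_meas P mu (proj m)"
 unfolding proj_def by measurable

lemma proj_rv: "L1_random_variable P mu (proj m)"
 unfolding L1_random_variable_def
proof (intro conjI ballI)
 fix w
 show "integrable mu (proj m w)"
  unfolding proj_def[abs_def] by (intro Bintegrable_sum integrable_mult_left c_integrable)
qed (rule proj_m)

lemma S_proj_m [measurable]: "joint_meas P mu (%w t. S w t - proj m w t)"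
 by measurable

lemma norm2_residual_le:
 assumes "L2fun P (%w. S w t)"
 shows "norm2 P (%w. S w t - proj m w t) \<le> norm2 P (%w. S w t - (\<Sum>i<m. b i * e i w))"
proof -
 have L: "L2fun P (%w. S w t - (\<Sum>i<m. a i * e i w))" for a
  by (intro L2fun_diff assms L2fun_sum L2fun_cmult e_L2)
 have "nrm P (%w. S w t - proj m w t) \<le> nrm P (%w. S w t - (\<Sum>i<m. b i * e i w))"
  unfolding proj_def c_def by (rule best_approximation[OF e_orth assms])
 then show ?thesis unfolding proj_def by (simp only: norm2_L2[OF L] ennreal_leI)
qed

lemma norm2_residual_le_S:
 assumes "L2fun P (%w. S w t)"
 shows "norm2 P (%w. S w t - proj m w t) \<le> norm2 P (%w. S w t)"
 using norm2_residual_le[OF assms, of m "%_. 0"] by simp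

text \<open>For almost every t, \<open>f_dense\<close> and the best approximation property of
  projections make the remainder tend to 0; it is dominated by the L2 norm of \<open>S\<close> at
  t.\<close>

lemma mixn_proj_tendsto: "null_seq (%m. mixn P mu (%w t. S w t - proj m w t))"
proof -
 have "(%m. \<integral>\<^sup>+t. norm2 P (%w. S w t - proj m w t) \<partial>mu) \<longlonglongrightarrow> (\<integral>\<^sup>+t. 0 \<partial>mu)"
 proof (rule nn_integral_dominated_convergence[where w = "%t. norm2 P (%w. S w t)"])
  show "bmeas mu (%t. norm2 P (%w. S w t - proj m w t))" for m
   by (rule norm2_measurable_P[OF P S_proj_m])
  show "bmeas mu (%t. norm2 P (%w. S w t))" by (rule norm2_measurable_P[OF P S_m])
  show "(\<integral>\<^sup>+t. norm2 P (%w. S w t) \<partial>mu) < \<infinity>" using S_fin by (simp add: mixn_def)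
  show "AE t in mu. norm2 P (%w. S w t - proj m w t) \<le> norm2 P (%w. S w t)" for m
   using mixn_L2_AE[OF P S_m S_fin] by eventually_elim (rule norm2_residual_le_S)
  show "AE t in mu. (%m. norm2 P (%w. S w t - proj m w t)) \<longlonglongrightarrow> 0"
   using mixn_L2_AE[OF P S_m S_fin] f_dense
  proof eventually_elim
   case (elim t)
   show ?case
   proof (rule tendsto_0_if_Limsup_eq_0_ennreal, rule antisym)
    show "limsup (%m. norm2 P (%w. S w t - proj m w t)) \<le> 0"
    proof (rule ennreal_le_epsilon)
     fix eps :: real assume "eps > 0"
     then obtain j b where jb: "norm2 P (%w. S w t - (\<Sum>i<Suc j. b i * e i w)) < ennreal eps"
      using elim(2) unfolding e_def by blast
     have "\<forall>\<^sub>F m in sequentially. norm2 P (%w. S w t - proj m w t) \<le> ennreal eps"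
     proof (rule eventually_sequentiallyI[of "Suc j"])
      fix m assume m: "Suc j \<le> m"
      have "(\<Sum>i<m. (if i < Suc j then b i else 0) * e i w) = (\<Sum>i<Suc j. b i * e i w)" for w
       by (rule sum.mono_neutral_cong_right) (use m in auto)
      then have "norm2 P (%w. S w t - proj m w t) \<le> norm2 P (%w. S w t - (\<Sum>i<Suc j. b i * e i w))"
       using norm2_residual_le[OF elim(1), of m "%i. if i < Suc j then b i else 0"] by (simp only:)
      then show "norm2 P (%w. S w t - proj m w t) \<le> ennreal eps" using jb by simp
     qed
     then show "limsup (%m. norm2 P (%w. S w t - proj m w t)) \<le> 0 + ennreal eps"
      by (simp add: Limsup_bounded)
    qed
   qed simp
  qed
 qed simp_all
 then show ?thesis by (simp add: mixn_def)
qed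

lemma mixn_S_proj_fin: "mixn P mu (%w t. S w t - proj m w t) < \<infinity>"
proof -
 have "mixn P mu (%w t. S w t - proj m w t) \<le> mixn P mu S"
  unfolding mixn_def
  by (rule nn_integral_mono_AE) (use mixn_L2_AE[OF P S_m S_fin] norm2_residual_le_S in \<open>auto elim: eventually_mono\<close>)
 then show ?thesis using S_fin by (rule le_less_trans)
qed

definition gpart :: "nat => (nat => real) => 't => real" where "gpart m z t = (\<Sum>j<m. c j t * z j)"

lemma gpart_m [measurable]: "joint_meas normal_seq mu (gpart m)"
proof -
 have [measurable]: "bmeas normal_seq (%z. z j)" for j by (rule normal_seq_coordinate)
 show ?thesis unfolding gpart_def by measurable
qed

lemma gpart_rv: "L1_random_variable normal_seq mu (gpart m)"
 unfolding L1_random_variable_def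
proof (intro conjI ballI)
 fix z
 show "integrable mu (gpart m z)"
  unfolding gpart_def[abs_def] by (intro Bintegrable_sum integrable_mult_left c_integrable)
qed (rule gpart_m)

text \<open>Written without ordering m and m', so that Pythagoras applies to one sum in either
  case.\<close>

lemma gpart_diff_eq:
 "(\<Sum>j<m. c j t * x j) - (\<Sum>j<m'. c j t * x j)
  = (\<Sum>j<max m m'. ((if j < m then c j t else 0) - (if j < m' then c j t else 0)) * x j)"
proof -
 have "(\<Sum>j<k. c j t * x j) = (\<Sum>j<max m m'. (if j < k then c j t else 0) * x j)" if "k \<le> max m m'" for k
  by (rule sum.mono_neutral_cong_left) (use that in auto)
 from this[of m] this[of m'] show ?thesis by (simp add: left_diff_distrib sum_subtractf)
qed

text \<open>The mixed norm sees only second moments, so partial sums of \<open>G\<close> are Cauchy because those of \<open>S\<close> are.\<close>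

lemma mixn_gpart_diff:
 "mixn normal_seq mu (%z t. gpart m z t - gpart m' z t) = mixn P mu (%w t. proj m w t - proj m' w t)"
 unfolding mixn_def
proof (rule nn_integral_cong)
 fix t
 define a where "a j = (if j < m then c j t else 0) - (if j < m' then c j t else 0)" for j
 have a0: "(a j)\<^sup>2 * (nrm P (e j))\<^sup>2 = (a j)\<^sup>2" for j
  using c_nrm[of j t] e_nrm[of j] by (auto simp: a_def)
 have g: "gpart m z t - gpart m' z t = (\<Sum>j<max m m'. a j * z j)" for z
  unfolding gpart_def gpart_diff_eq a_def ..
 have p: "proj m w t - proj m' w t = (\<Sum>j<max m m'. a j * e j w)" for w
  unfolding proj_def gpart_diff_eq a_def ..
 have Lg: "L2fun normal_seq (%z. \<Sum>j<max m m'. a j * z j)"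
  by (intro L2fun_sum L2fun_cmult normal_seq_moments)
 have Lp: "L2fun P (%w. \<Sum>j<max m m'. a j * e j w)"
  by (intro L2fun_sum L2fun_cmult e_L2)
 have "(nrm normal_seq (%z. \<Sum>j<max m m'. a j * z j))\<^sup>2 = (nrm P (%w. \<Sum>j<max m m'. a j * e j w))\<^sup>2"
  by (simp add: nrm_orthonormal_sum[OF orthonormal_normal_seq] nrm_orthonormal_sum[OF e_orth] normal_seq_moments a0)
 then have "nrm normal_seq (%z. \<Sum>j<max m m'. a j * z j) = nrm P (%w. \<Sum>j<max m m'. a j * e j w)"
  by (rule power2_eq_imp_eq) simp_all
 then show "norm2 normal_seq (%z. gpart m z t - gpart m' z t) = norm2 P (%w. proj m w t - proj m' w t)"
  unfolding g p norm2_L2[OF Lg] norm2_L2[OF Lp] by simp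
qed

lemma mixn_proj_diff_le:
 "mixn P mu (%w t. proj m w t - proj m' w t)
  \<le> mixn P mu (%w t. S w t - proj m w t) + mixn P mu (%w t. S w t - proj m' w t)"
proof -
 have "mixn P mu (%w t. proj m w t - proj m' w t)
   \<le> mixn P mu (%w t. proj m w t - S w t) + mixn P mu (%w t. S w t - proj m' w t)"
  by (rule mixn_triangle3[OF P]) measurable
 then show ?thesis by (simp only: mixn_commute[of P mu "proj m" S])
qed

text \<open>Along indices with summable distances the increments of the partial sums form a series
  convergent in the mixed norm, which has a jointly measurable sum; the triangle inequality then
  extends convergence to all partial sums.\<close>

lemma gaussian_limit_exists:
 "\<exists>G. L1_random_variable normal_seq mu G \<and> (%m. mixn normal_seq mu (%z t. G z t - gpart m z t)) \<longlonglongrightarrow> 0"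
proof -
 interpret Q: prob_space normal_seq by (rule prob_normal_seq)
 define a where "a m = mixn P mu (%w t. S w t - proj m w t)" for m
 have "\<exists>m. a m < ennreal ((1/2) ^ k)" for k
  using order_tendstoD(2)[OF mixn_proj_tendsto, of "ennreal ((1/2) ^ k)"]
  by (auto simp: a_def eventually_sequentially)
 then obtain r0 where r0: "\<And>k. a (r0 k) < ennreal ((1/2) ^ k)" by metis
 \<comment> \<open>Starting at 0 makes the increments telescope to the partial sum itself. The
   indices need not increase, since increments are measured through distances to
   \<open>S\<close>.\<close>
 define r where "r k = (if k = 0 then 0 else r0 k)" for k
 have afin: "a m < \<infinity>" for m unfolding a_def by (rule mixn_S_proj_fin)
 define D where "D k z t = gpart (r (Suc k)) z t - gpart (r k) z t" for k z t
 have Dm [measurable]: "joint_meas normal_seq mu (D k)" for k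
  unfolding D_def by measurable
 have Dle: "mixn normal_seq mu (D k) \<le> a (r (Suc k)) + a (r k)" for k
  unfolding D_def[abs_def] mixn_gpart_diff a_def by (rule mixn_proj_diff_le)
 have suma: "(\<Sum>k. a (r (Suc k))) < \<infinity>"
 proof -
  have "(\<Sum>k. a (r (Suc k))) \<le> (\<Sum>k. ennreal ((1/2) ^ Suc k))"
   by (intro suminf_le less_imp_le) (simp_all add: r_def r0 del: power_Suc)
  also have "... = ennreal (\<Sum>k. (1/2) ^ Suc k)"
   by (rule suminf_ennreal2) (simp_all add: summable_geometric summable_mult)
  also have "... < \<infinity>" by simp
  finally show ?thesis .
 qed
 have fin: "(\<integral>\<^sup>+k. mixn normal_seq mu (D k) \<partial>counting) < \<infinity>"
 proof -
  have "(\<integral>\<^sup>+k. mixn normal_seq mu (D k) \<partial>counting) = (\<Sum>k. mixn normal_seq mu (D k))"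
   by (rule nn_integral_count_space_nat)
  also have "... \<le> (\<Sum>k. a (r (Suc k)) + a (r k))" by (intro suminf_le Dle) simp_all
  also have "... = (\<Sum>k. a (r (Suc k))) + (\<Sum>k. a (r k))" by (rule suminf_add[symmetric]) simp_all
  also have "(\<Sum>k. a (r k)) = (\<Sum>k. a (r (Suc k))) + a (r 0)"
   using suminf_offset[of "%k. a (r k)" 1] by (simp add: add.commute)
  also have "(\<Sum>k. a (r (Suc k))) + ((\<Sum>k. a (r (Suc k))) + a (r 0)) < \<infinity>"
   using suma afin[of "r 0"] by (simp add: less_top)
  finally show ?thesis .
 qed
 note ser = mixn_serfun_tendsto[OF prob_normal_seq mu Dm fin] serfun_L1_has_sum(2)[OF prob_normal_seq mu Dm fin]
 have sub: "subalgebra normal_seq normal_seq" by (simp add: subalgebra_def)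
 obtain G where Gm [measurable]: "joint_meas normal_seq mu G"
  and Grv: "L1_random_variable normal_seq mu G"
  and Geq: "AE z in normal_seq. \<forall>t. G z t = serfun D z t"
  using L1_modification[OF sub mu serfun_measurable[OF Dm] ser(2)] by blast
 have serm [measurable]: "joint_meas normal_seq mu (serfun D)"
  by (rule serfun_measurable[OF Dm])
 have sumD: "(\<Sum>k<K. D k z t) = gpart (r K) z t" for K z t
  unfolding D_def by (induction K) (simp_all add: r_def gpart_def)
 have "filterlim lessThan (finite_subsets_at_top UNIV) sequentially"
  by (rule filterlim_lessThan_at_top)
 from filterlim_compose[OF ser(1) this]
 have "null_seq (%K. mixn normal_seq mu (%z t. serfun D z t - (\<Sum>k<K. D k z t)))" .
 moreover have "mixn normal_seq mu (%z t. serfun D z t - (\<Sum>k<K. D k z t)) = mixn normal_seq mu (%z t. G z t - gpart (r K) z t)" for K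
  unfolding sumD
 proof (rule mixn_cong)
  show "AE z in normal_seq. serfun D z t - gpart (r K) z t = G z t - gpart (r K) z t" for t
   using Geq by eventually_elim simp
 qed measurable
 ultimately have GK: "null_seq (%K. mixn normal_seq mu (%z t. G z t - gpart (r K) z t))" by simp
 have "null_seq (%m. mixn normal_seq mu (%z t. G z t - gpart m z t))"
 proof (rule tendsto_0_if_Limsup_eq_0_ennreal, rule antisym)
  show "limsup (%m. mixn normal_seq mu (%z t. G z t - gpart m z t)) \<le> 0"
  proof (rule ennreal_le_epsilon)
   fix eps :: real assume eps: "eps > 0"
   have e3: "ennreal (eps / 3) > 0" using eps by simp
   have rK: "null_seq (%K. a (r (Suc K)))"
   proof (rule tendsto_sandwich[OF always_eventually always_eventually tendsto_const])
    show "\<forall>K. a (r (Suc K)) \<le> ennreal ((1/2) ^ Suc K)"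
     using less_imp_le[OF r0] by (simp add: r_def del: power_Suc)
    have "(%K. ennreal ((1/2) ^ Suc K)) \<longlonglongrightarrow> ennreal 0"
     by (intro tendsto_ennrealI LIMSEQ_Suc LIMSEQ_power_zero) simp
    then show "null_seq (%K. ennreal ((1/2) ^ Suc K))" by simp
   qed simp
   have "\<forall>\<^sub>F K in sequentially. a (r (Suc K)) < ennreal (eps / 3)
     \<and> mixn normal_seq mu (%z t. G z t - gpart (r (Suc K)) z t) < ennreal (eps / 3)"
    using order_tendstoD(2)[OF rK e3] order_tendstoD(2)[OF LIMSEQ_Suc[OF GK] e3] by eventually_elim simp
   then obtain k where k: "a (r k) < ennreal (eps / 3)" "mixn normal_seq mu (%z t. G z t - gpart (r k) z t) < ennreal (eps / 3)"
    by (auto simp: eventually_sequentially)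
   have "\<forall>\<^sub>F m in sequentially. a m < ennreal (eps / 3)"
    using order_tendstoD(2)[OF mixn_proj_tendsto e3] by (simp add: a_def)
   then have "\<forall>\<^sub>F m in sequentially. mixn normal_seq mu (%z t. G z t - gpart m z t) \<le> ennreal eps"
   proof eventually_elim
    case (elim m)
    have "mixn normal_seq mu (%z t. G z t - gpart m z t)
      \<le> mixn normal_seq mu (%z t. G z t - gpart (r k) z t) + mixn normal_seq mu (%z t. gpart (r k) z t - gpart m z t)"
     by (rule mixn_triangle3[OF prob_normal_seq]) measurable
    also have "mixn normal_seq mu (%z t. gpart (r k) z t - gpart m z t) \<le> a (r k) + a m"
     unfolding mixn_gpart_diff a_def by (rule mixn_proj_diff_le)
    finally have "mixn normal_seq mu (%z t. G z t - gpart m z t)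
      \<le> mixn normal_seq mu (%z t. G z t - gpart (r k) z t) + (a (r k) + a m)" by (simp add: add_left_mono)
    also have "... \<le> ennreal (eps / 3) + (ennreal (eps / 3) + ennreal (eps / 3))"
     using k elim by (intro add_mono) auto
    also have "... = ennreal eps" using eps by (simp flip: ennreal_plus)
    finally show ?case .
   qed
   then show "limsup (%m. mixn normal_seq mu (%z t. G z t - gpart m z t)) \<le> 0 + ennreal eps"
    by (simp add: Limsup_bounded)
  qed
 qed simp
 then show ?thesis using Grv by blast
qed

end

section \<open>Convergence in law\<close>

lemma L1_triangle:
 fixes x y z :: "'t => real"
 assumes "integrable mu x" "integrable mu y" "integrable mu z"
 shows "(dL1 mu x z) \<le> (dL1 mu x y) + (dL1 mu y z)"
proof -
 have "(dL1 mu x z) \<le> (LINT t|mu. \<bar>x t - y t\<bar> + \<bar>y t - z t\<bar>)"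
  by (intro integral_mono Bintegrable_add integrable_abs Bintegrable_diff assms) linarith
 also have "... = (dL1 mu x y) + (dL1 mu y z)"
  by (intro Bintegral_add integrable_abs Bintegrable_diff assms)
 finally show ?thesis .
qed

text \<open>Functionals are taken on functions instead of classes; the bound forces equal values on
  integrable functions that agree almost everywhere.\<close>

definition L1_lipschitz :: "'t measure => real => (('t => real) => real) => bool" where
 "L1_lipschitz mu K H \<longleftrightarrow> 0 \<le> K \<and>
   (\<forall>x y. integrable mu x \<longrightarrow> integrable mu y \<longrightarrow> \<bar>H x - H y\<bar> \<le> K * (dL1 mu x y))"

definition L1_continuous :: "'t measure => (('t => real) => real) => bool" where
 "L1_continuous mu H \<longleftrightarrow> (\<forall>x eps. integrable mu x \<longrightarrow> eps > 0 \<longrightarrow>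
   (\<exists>\<delta>>0. \<forall>y. integrable mu y \<longrightarrow> (dL1 mu x y) < \<delta> \<longrightarrow> \<bar>H x - H y\<bar> < eps))"

definition L1_bounded :: "'t measure => real => (('t => real) => real) => bool" where
 "L1_bounded mu B H \<longleftrightarrow> (\<forall>x. integrable mu x \<longrightarrow> \<bar>H x\<bar> \<le> B)"

lemma L1_lipschitz_imp_continuous:
 assumes "L1_lipschitz mu K H" shows "L1_continuous mu H"
 unfolding L1_continuous_def
proof (intro allI impI)
 fix x :: "'a => real" and eps :: real assume x: "integrable mu x" and eps: "eps > 0"
 have K0: "0 \<le> K" using assms by (simp add: L1_lipschitz_def)
 show "\<exists>\<delta>>0. \<forall>y. integrable mu y \<longrightarrow> (dL1 mu x y) < \<delta> \<longrightarrow> \<bar>H x - H y\<bar> < eps"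
 proof (intro exI[of _ "eps / (K + 1)"] conjI allI impI)
  show "eps / (K + 1) > 0" using eps K0 by simp
  fix y :: "'a => real" assume y: "integrable mu y" and d: "(dL1 mu x y) < eps / (K + 1)"
  have "\<bar>H x - H y\<bar> \<le> K * (dL1 mu x y)" using assms x y by (simp add: L1_lipschitz_def)
  also have "... \<le> (K + 1) * (dL1 mu x y)" by (intro mult_right_mono) simp_all
  also have "... < (K + 1) * (eps / (K + 1))" using d K0 by (intro mult_strict_left_mono) auto
  also have "... = eps" using K0 by simp
  finally show "\<bar>H x - H y\<bar> < eps" .
 qed
qed

lemma L1_continuous_measurable:
 assumes "sigma_finite_measure mu" "L1_random_variable P mu Z" "L1_continuous mu H"
 shows "bmeas P (%w. H (Z w))"
 by (rule L1_continuous_functional_measurable[OF assms(1,2)]) (use assms(3) in \<open>simp add: L1_continuous_def\<close>)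

lemma L1_continuous_integrable:
 assumes "sigma_finite_measure mu" "prob_space P" "L1_random_variable P mu Z" "L1_continuous mu H" "L1_bounded mu B H"
 shows "integrable P (%w. H (Z w))"
proof -
 interpret prob_space P by fact
 show ?thesis
  by (rule integrable_const_bound[of _ B, OF _ L1_continuous_measurable[OF assms(1,3,4)]])
   (use assms(3,5) in \<open>auto simp: L1_bounded_def L1_random_variable_def\<close>)
qed

text \<open>A bounded continuous functional is the increasing limit of its Lipschitz inf-convolutions \<open>h k\<close>.\<close>

lemma law_lower_bound:
 fixes Y :: "nat => 'w => 't => real" and G :: "'v => 't => real"
 assumes mu: "sigma_finite_measure mu" and P: "prob_space P" and Q: "prob_space Q"
  and Y: "\<And>n. L1_random_variable P mu (Y n)" and G: "L1_random_variable Q mu G"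
  and lip: "\<And>H B K. L1_bounded mu B H ==> L1_lipschitz mu K H ==>
   (%n. \<integral>w. H (Y n w) \<partial>P) \<longlonglongrightarrow> (LINT z|Q. H (G z))"
  and B: "L1_bounded mu B H" and cont: "L1_continuous mu H" and eps: "eps > 0"
 shows "\<forall>\<^sub>F n in sequentially. (LINT z|Q. H (G z)) - eps < (LINT w|P. H (Y n w))"
proof -
 interpret Q: prob_space Q by (rule Q)
 define h where "h k x = (INF y\<in>{y. integrable mu y}. H y + real k * (dL1 mu x y))" for k :: nat and x
 have ne: "{y. integrable mu y} \<noteq> {}" by (auto intro: exI[of _ "%_. 0"])
 have lb: "- B \<le> H y + real k * (dL1 mu x y)" if "integrable mu y" for k x y
 proof -
  have "0 \<le> real k * (dL1 mu x y)" by (intro mult_nonneg_nonneg) simp_all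
  moreover have "\<bar>H y\<bar> \<le> B" using B that by (simp add: L1_bounded_def)
  ultimately show ?thesis by linarith
 qed
 have bdd: "bdd_below ((%y. H y + real k * (dL1 mu x y)) ` {y. integrable mu y})" for k x
  using lb by (intro bdd_belowI2[of _ "- B"]) simp
 have upper: "h k x \<le> H y + real k * (dL1 mu x y)" if "integrable mu y" for k x y
  unfolding h_def by (rule cINF_lower[OF bdd]) (use that in simp)
 have lower: "c \<le> h k x" if "\<And>y. integrable mu y ==> c \<le> H y + real k * (dL1 mu x y)" for c k x
  unfolding h_def by (rule cINF_greatest[OF ne]) (use that in simp)
 have hH: "h k x \<le> H x" if "integrable mu x" for k x
  using upper[OF that, of k x] by simp
 have hB: "L1_bounded mu B (h k)" for k
  unfolding L1_bounded_def
 proof (intro allI impI)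
  fix x :: "'t => real" assume x: "integrable mu x"
  have "- B \<le> h k x" by (rule lower) (rule lb)
  moreover have "h k x \<le> B" using hH[OF x, of k] B x by (auto simp: L1_bounded_def abs_le_iff intro: order_trans)
  ultimately show "\<bar>h k x\<bar> \<le> B" by linarith
 qed
 have hL: "L1_lipschitz mu (real k) (h k)" for k
  unfolding L1_lipschitz_def
 proof (intro conjI allI impI)
  have 1: "h k x \<le> h k y + real k * (dL1 mu x y)" if x: "integrable mu x" and y: "integrable mu y" for x y
  proof -
   have "h k x - real k * (dL1 mu x y) \<le> h k y"
   proof (rule lower)
    fix u :: "'t => real" assume u: "integrable mu u"
    have "real k * (dL1 mu x u) \<le> real k * ((dL1 mu x y) + (dL1 mu y u))"
     by (intro mult_left_mono L1_triangle x y u) simp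
    then show "h k x - real k * (dL1 mu x y) \<le> H u + real k * (dL1 mu y u)"
     using upper[OF u, of k x] by (simp add: distrib_left)
   qed
   then show ?thesis by linarith
  qed
  fix x y :: "'t => real" assume x: "integrable mu x" and y: "integrable mu y"
  show "\<bar>h k x - h k y\<bar> \<le> real k * (dL1 mu x y)"
   using 1[OF x y] 1[OF y x] by (simp add: abs_le_iff abs_minus_commute)
 qed simp
 have lim: "(%k. h k x) \<longlonglongrightarrow> H x" if x: "integrable mu x" for x
 proof (rule LIMSEQ_I)
  fix r :: real assume r: "r > 0"
  then obtain \<delta> where \<delta>: "\<delta> > 0" "\<And>y. integrable mu y ==> (dL1 mu x y) < \<delta> ==> \<bar>H x - H y\<bar> < r / 2"
   using cont x unfolding L1_continuous_def by (meson half_gt_zero)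
  \<comment> \<open>Beyond the distance \<delta> the penalty k0 * \<delta> exceeds 2B, the largest
    possible oscillation of \<open>H\<close>, so only nearby y matter for the infimum.\<close>
  obtain k0 :: nat where k0: "2 * B < real k0 * \<delta>" using reals_Archimedean3[OF \<delta>(1)] by blast
  have "norm (h k x - H x) < r" if k: "k0 \<le> k" for k
  proof -
   have "H x - r / 2 \<le> h k x"
   proof (rule lower)
    fix y :: "'t => real" assume y: "integrable mu y"
    have d0: "0 \<le> (dL1 mu x y)" by simp
    show "H x - r / 2 \<le> H y + real k * (dL1 mu x y)"
    proof (cases "(dL1 mu x y) < \<delta>")
     case True
     have "0 \<le> real k * (dL1 mu x y)" using d0 by (intro mult_nonneg_nonneg) simp_all
     then show ?thesis using \<delta>(2)[OF y True] by linarith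
    next
     case False
     have "real k0 * \<delta> \<le> real k * (dL1 mu x y)"
      using False k \<delta>(1) by (intro mult_mono) auto
     moreover have "\<bar>H x\<bar> \<le> B" "\<bar>H y\<bar> \<le> B" using B x y by (simp_all add: L1_bounded_def)
     ultimately show ?thesis using k0 r by linarith
    qed
   qed
   then show ?thesis using hH[OF x, of k] r by simp
  qed
  then show "\<exists>no. \<forall>n\<ge>no. norm (h n x - H x) < r" by blast
 qed
 have Gi: "z \<in> space Q ==> integrable mu (G z)" for z using G by (simp add: L1_random_variable_def)
 have hc: "L1_continuous mu (h k)" for k by (rule L1_lipschitz_imp_continuous[OF hL])
 have "(%k. \<integral>z. h k (G z) \<partial>Q) \<longlonglongrightarrow> (LINT z|Q. H (G z))"
 proof (rule integral_dominated_convergence[where w = "%_. B"])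
  show "bmeas Q (%z. H (G z))" by (rule L1_continuous_measurable[OF mu G cont])
  show "bmeas Q (%z. h k (G z))" for k by (rule L1_continuous_measurable[OF mu G hc])
  show "AE z in Q. (%k. h k (G z)) \<longlonglongrightarrow> H (G z)" using lim Gi by (intro AE_I2) simp
  show "AE z in Q. norm (h k (G z)) \<le> B" for k using hB[of k] Gi by (intro AE_I2) (simp add: L1_bounded_def)
 qed simp
 from order_tendstoD(1)[OF this, of "(LINT z|Q. H (G z)) - eps"] eps
 obtain k where k: "(LINT z|Q. H (G z)) - eps < (LINT z|Q. h k (G z))"
  by (auto simp: eventually_sequentially)
 from order_tendstoD(1)[OF lip[OF hB hL] k] show ?thesis
 proof eventually_elim
  case (elim n)
  have "(LINT w|P. h k (Y n w)) \<le> (LINT w|P. H (Y n w))"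
   by (intro integral_mono L1_continuous_integrable[OF mu P Y hc hB] L1_continuous_integrable[OF mu P Y cont B] hH)
    (use Y in \<open>simp add: L1_random_variable_def\<close>)
  then show ?case using elim by linarith
 qed
qed

text \<open>A continuous functional on classes is read as one on functions, and the one-sided bound
  is applied to it and to its negative.\<close>

lemma law_of_lipschitz:
 fixes Y :: "nat => 'w => 't => real" and G :: "'v => 't => real"
 assumes mu: "sigma_finite_measure mu" and P: "prob_space P" and Q: "prob_space Q"
  and Y: "\<And>n. L1_random_variable P mu (Y n)" and G: "L1_random_variable Q mu G"
  and lip: "\<And>H B K. L1_bounded mu B H ==> L1_lipschitz mu K H ==>
   (%n. \<integral>w. H (Y n w) \<partial>P) \<longlonglongrightarrow> (LINT z|Q. H (G z))"
 shows "L1_converges_in_law P mu Y Q G"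
 unfolding L1_converges_in_law_def
proof (intro allI impI)
 fix h assume h: "continuous_map (mtopology_of (L1_space mu)) euclideanreal h \<and> bounded (h ` mspace (L1_space mu))"
 define H where "H x = h (L1_class mu x)" for x
 obtain B where B: "\<And>A. A \<in> L1_carrier mu ==> \<bar>h A\<bar> \<le> B"
  using h by (auto simp: mspace_L1_space bounded_iff)
 have HB: "L1_bounded mu B H"
  using B by (simp add: L1_bounded_def H_def L1_carrier_def)
 interpret L1: Metric_space "L1_carrier mu" "L1_dist mu" by (rule Metric_space_L1)
 have hc: "continuous_map L1.mtopology euclideanreal h"
  using h by (simp add: mtopology_of_def mspace_L1_space mdist_L1_space)
 have Hc: "L1_continuous mu H"
  unfolding L1_continuous_def
 proof (intro allI impI)
  fix x :: "'t => real" and eps :: real assume x: "integrable mu x" and eps: "eps > 0"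
  have car: "L1_class mu y \<in> L1_carrier mu" if "integrable mu y" for y :: "'t => real"
   using that by (auto simp: L1_carrier_def)
  let ?U = "{A \<in> topspace L1.mtopology. h A \<in> ball (H x) eps}"
  have "openin L1.mtopology ?U" using hc by (rule openin_continuous_map_preimage) simp
  moreover have "L1_class mu x \<in> ?U" using car[OF x] eps by (simp add: H_def)
  ultimately obtain \<delta> where \<delta>: "\<delta> > 0" "L1.mball (L1_class mu x) \<delta> \<subseteq> ?U"
   unfolding L1.openin_mtopology by blast
  show "\<exists>\<delta>>0. \<forall>y. integrable mu y \<longrightarrow> (dL1 mu x y) < \<delta> \<longrightarrow> \<bar>H x - H y\<bar> < eps"
  proof (intro exI[of _ \<delta>] conjI \<delta>(1) allI impI)
   fix y :: "'t => real" assume y: "integrable mu y" and d: "(dL1 mu x y) < \<delta>"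
   have "L1_class mu y \<in> L1.mball (L1_class mu x) \<delta>"
    using car x y d by (simp add: L1.in_mball L1_dist_class)
   then have "L1_class mu y \<in> ?U" using \<delta>(2) by blast
   then show "\<bar>H x - H y\<bar> < eps" by (simp add: H_def dist_real_def)
  qed
 qed
 have mB: "L1_bounded mu B (%x. - H x)" using HB by (simp add: L1_bounded_def)
 have mc: "L1_continuous mu (%x. - H x)"
  using Hc unfolding L1_continuous_def by (simp add: abs_minus_commute)
 have "(%n. \<integral>w. H (Y n w) \<partial>P) \<longlonglongrightarrow> (LINT z|Q. H (G z))"
 proof (rule LIMSEQ_I)
  fix r :: real assume r: "r > 0"
  have 1: "\<forall>\<^sub>F n in sequentially. (LINT z|Q. H (G z)) - r < (LINT w|P. H (Y n w))"
   by (rule law_lower_bound[OF mu P Q Y G lip HB Hc r])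
  have 2: "\<forall>\<^sub>F n in sequentially. (LINT z|Q. - H (G z)) - r < (LINT w|P. - H (Y n w))"
   by (rule law_lower_bound[OF mu P Q Y G lip mB mc r])
  from 1 2 have "\<forall>\<^sub>F n in sequentially. norm ((LINT w|P. H (Y n w)) - (LINT z|Q. H (G z))) < r"
   by eventually_elim (simp add: abs_less_iff)
  then show "\<exists>no. \<forall>n\<ge>no. norm ((LINT w|P. H (Y n w)) - (LINT z|Q. H (G z))) < r"
   by (simp add: eventually_sequentially)
 qed
 then show "(%n. \<integral>w. h (L1_class mu (Y n w)) \<partial>P) \<longlonglongrightarrow> (LINT z|Q. h (L1_class mu (G z)))"
  by (simp add: H_def)
qed

text \<open>The mixed norm dominates the expected L1 distance, by Fubini and the comparison of first
  with second moments.\<close>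

lemma lipschitz_expectation:
 assumes mu: "sigma_finite_measure mu" and Q: "prob_space Q"
  and Y: "L1_random_variable Q mu Y" and Z: "L1_random_variable Q mu Z"
  and B: "L1_bounded mu B H" and K: "L1_lipschitz mu K H"
 shows "ennreal \<bar>(LINT w|Q. H (Y w)) - (LINT w|Q. H (Z w))\<bar> \<le> ennreal K * mixn Q mu (%w t. Y w t - Z w t)"
proof -
 interpret Q: prob_space Q by (rule Q)
 interpret mu: sigma_finite_measure mu by (rule mu)
 interpret Qmu: pair_sigma_finite Q mu ..
 have Ym [measurable]: "joint_meas Q mu Y" and Yi: "w \<in> space Q ==> integrable mu (Y w)"
  and Zm [measurable]: "joint_meas Q mu Z" and Zi: "w \<in> space Q ==> integrable mu (Z w)" for w
  using Y Z by (auto simp: L1_random_variable_def)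
 note c = L1_lipschitz_imp_continuous[OF K]
 note iY = L1_continuous_integrable[OF mu Q Y c B] and iZ = L1_continuous_integrable[OF mu Q Z c B]
 have "ennreal \<bar>(LINT w|Q. H (Y w)) - (LINT w|Q. H (Z w))\<bar> = ennreal (norm (LINT w|Q. H (Y w) - H (Z w)))"
  by (simp add: Bintegral_diff[OF iY iZ])
 also have "... \<le> (\<integral>\<^sup>+w. ennreal (norm (H (Y w) - H (Z w))) \<partial>Q)"
  by (rule integral_norm_bound_ennreal[OF Bintegrable_diff[OF iY iZ]])
 also have "... \<le> (\<integral>\<^sup>+w. ennreal K * (\<integral>\<^sup>+t. ennreal \<bar>Y w t - Z w t\<bar> \<partial>mu) \<partial>Q)"
 proof (rule nn_integral_mono)
  fix w assume w: "w \<in> space Q"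
  have "(\<integral>\<^sup>+t. ennreal \<bar>Y w t - Z w t\<bar> \<partial>mu) = ennreal (dL1 mu (Y w) (Z w))"
   using Yi[OF w] Zi[OF w] by (intro nn_integral_eq_integral) auto
  then show "ennreal (norm (H (Y w) - H (Z w))) \<le> ennreal K * (\<integral>\<^sup>+t. ennreal \<bar>Y w t - Z w t\<bar> \<partial>mu)"
   using K Yi[OF w] Zi[OF w] by (simp add: L1_lipschitz_def ennreal_leI flip: ennreal_mult)
 qed
 also have "... = ennreal K * (\<integral>\<^sup>+w. (\<integral>\<^sup>+t. ennreal \<bar>Y w t - Z w t\<bar> \<partial>mu) \<partial>Q)"
  by (rule nn_integral_cmult) measurable
 also have "(\<integral>\<^sup>+w. (\<integral>\<^sup>+t. ennreal \<bar>Y w t - Z w t\<bar> \<partial>mu) \<partial>Q) = (\<integral>\<^sup>+t. (\<integral>\<^sup>+w. ennreal \<bar>Y w t - Z w t\<bar> \<partial>Q) \<partial>mu)"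
  by (rule Qmu.Fubini'[symmetric]) measurable
 also have "... \<le> mixn Q mu (%w t. Y w t - Z w t)"
  unfolding mixn_def
  by (intro nn_integral_mono Q.norm1_le_norm2 borel_measurable_diff joint_section[OF Ym] joint_section[OF Zm])
 finally show ?thesis by (simp add: mult_left_mono)
qed

section \<open>The law of the functionals of the limit\<close>

locale l1_gaussian = l1_expansion P T F0 mu S f
 for P :: "'w measure" and T F0 and mu :: "'t measure" and S f +
 fixes G :: "(nat => real) => 't => real"
 assumes G_rv: "L1_random_variable normal_seq mu G"
  and G_lim: "null_seq (%m. mixn normal_seq mu (%z t. G z t - gpart m z t))"
begin

lemma G_m [measurable]: "joint_meas normal_seq mu G"
 using G_rv by (simp add: L1_random_variable_def)

lemma L1_pair_sum_c:
 assumes "g \<in> Linfty mu"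
 shows "L1_pair mu g (%t. \<Sum>j<m. c j t * x j) = (\<Sum>j<m. L1_pair mu g (c j) * x j)"
proof -
 have "L1_pair mu g (%t. \<Sum>j<m. c j t * x j) = (LINT t|mu. (\<Sum>j<m. g t * c j t * x j))"
  by (simp add: L1_pair_def sum_distrib_left mult.assoc)
 also have "... = (\<Sum>j<m. L1_pair mu g (c j) * x j)"
  unfolding L1_pair_def
  by (subst Bintegral_sum)
   (auto intro!: integrable_mult_left Linfty_mult_integrable assms c_integrable)
 finally show ?thesis .
qed

lemma gpart_fin: "mixn normal_seq mu (gpart m) < \<infinity>"
proof -
 have "mixn normal_seq mu (%z t. gpart m z t - gpart 0 z t) < \<infinity>"
  unfolding mixn_gpart_diff
  by (rule le_less_trans[OF mixn_proj_diff_le]) (use mixn_S_proj_fin[of m] mixn_S_proj_fin[of 0] in simp)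
 then show ?thesis by (simp add: gpart_def[abs_def])
qed

lemma proj_fin: "mixn P mu (proj m) < \<infinity>"
proof -
 have "mixn P mu (%w t. proj m w t - proj 0 w t) < \<infinity>"
  by (rule le_less_trans[OF mixn_proj_diff_le]) (use mixn_S_proj_fin[of m] mixn_S_proj_fin[of 0] in simp)
 then show ?thesis by (simp add: proj_def[abs_def])
qed

lemma G_fin: "mixn normal_seq mu G < \<infinity>"
proof -
 obtain m where m: "mixn normal_seq mu (%z t. G z t - gpart m z t) < 1"
  using order_tendstoD(2)[OF G_lim, of 1] by (auto simp: eventually_sequentially)
 have "mixn normal_seq mu (%z t. (G z t - gpart m z t) + gpart m z t)
   \<le> mixn normal_seq mu (%z t. G z t - gpart m z t) + mixn normal_seq mu (gpart m)"
  by (rule mixn_triangle[OF prob_normal_seq]) measurable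
 also have "... < \<infinity>" using m gpart_fin[of m] by (auto simp: less_top dest: order_less_trans[OF _ ennreal_one_less_top])
 finally show ?thesis by simp
qed

context
 fixes g assumes g: "g \<in> Linfty mu"
begin

lemma G_pair_L2: "L2fun normal_seq (%z. L1_pair mu g (G z))"
 and gpart_pair_L2: "L2fun normal_seq (%z. L1_pair mu g (gpart m z))"
 and S_pair_L2: "L2fun P (%w. L1_pair mu g (S w))"
 and proj_pair_L2: "L2fun P (%w. L1_pair mu g (proj m w))"
 by (intro L1_pair_L2 prob_normal_seq P g G_m gpart_m S_m proj_m G_fin gpart_fin S_fin proj_fin)+

lemma G_pair_tendsto:
 "null_seq (%m. nrm normal_seq (%z. L1_pair mu g (G z) - L1_pair mu g (gpart m z)))"
 by (rule L1_pair_tendsto[OF prob_normal_seq g G_rv gpart_rv G_fin gpart_fin G_lim])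

text \<open>Pythagoras gives the sum of the squares of \<open>L1_pair mu g (c j)\<close> on both
  sides, because \<open>c j\<close> vanishes wherever \<open>e j\<close> has norm 0.\<close>

lemma nrm_gpart_pair: "nrm normal_seq (%z. L1_pair mu g (gpart m z)) = nrm P (%w. L1_pair mu g (proj m w))"
  (is ?A) and nrm_gpart_pair2:
 "(nrm normal_seq (%z. L1_pair mu g (gpart m z)))\<^sup>2 = (\<Sum>j<m. (L1_pair mu g (c j))\<^sup>2)"
  (is ?B)
proof -
 have c0: "(L1_pair mu g (c j))\<^sup>2 * (nrm P (e j))\<^sup>2 = (L1_pair mu g (c j))\<^sup>2" for j
 proof (cases "nrm P (e j) = 0")
  case True
  then have "c j t = 0" for t using c_nrm[of j t] by simp
  then show ?thesis by (simp add: L1_pair_def)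
 next
  case False
  then show ?thesis using e_nrm[of j] by simp
 qed
 show B: ?B
  unfolding gpart_def L1_pair_sum_c[OF g]
  by (simp add: nrm_orthonormal_sum[OF orthonormal_normal_seq] normal_seq_moments)
 have "(nrm P (%w. L1_pair mu g (proj m w)))\<^sup>2 = (\<Sum>j<m. (L1_pair mu g (c j))\<^sup>2)"
  unfolding proj_def L1_pair_sum_c[OF g] by (simp add: nrm_orthonormal_sum[OF e_orth] c0)
 then have "(nrm normal_seq (%z. L1_pair mu g (gpart m z)))\<^sup>2 = (nrm P (%w. L1_pair mu g (proj m w)))\<^sup>2"
  using B by (simp only:)
 then show ?A by (rule power2_eq_imp_eq) simp_all
qed

lemma nrm_gpart_pair_tendsto:
 "(%m. nrm normal_seq (%z. L1_pair mu g (gpart m z))) \<longlonglongrightarrow> nrm normal_seq (%z. L1_pair mu g (G z))"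
proof (rule LIM_zero_cancel, rule Lim_null_comparison[OF always_eventually G_pair_tendsto], rule allI)
 fix m
 show "norm (nrm normal_seq (%z. L1_pair mu g (gpart m z)) - nrm normal_seq (%z. L1_pair mu g (G z)))
  \<le> nrm normal_seq (%z. L1_pair mu g (G z) - L1_pair mu g (gpart m z))"
  using nrm_abs_diff_le[OF G_pair_L2 gpart_pair_L2, of m] by (simp add: abs_minus_commute)
qed

lemma nrm_G_pair: "nrm normal_seq (%z. L1_pair mu g (G z)) = nrm P (%w. L1_pair mu g (S w))"
proof (rule LIMSEQ_unique[OF nrm_gpart_pair_tendsto])
 have lim: "null_seq (%m. nrm P (%w. L1_pair mu g (S w) - L1_pair mu g (proj m w)))"
  by (rule L1_pair_tendsto[OF P g S_rv proj_rv S_fin proj_fin mixn_proj_tendsto])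
 show "(%m. nrm normal_seq (%z. L1_pair mu g (gpart m z))) \<longlonglongrightarrow> nrm P (%w. L1_pair mu g (S w))"
 proof (rule LIM_zero_cancel, rule Lim_null_comparison[OF always_eventually lim], rule allI)
  fix m
  show "norm (nrm normal_seq (%z. L1_pair mu g (gpart m z)) - nrm P (%w. L1_pair mu g (S w)))
   \<le> nrm P (%w. L1_pair mu g (S w) - L1_pair mu g (proj m w))"
   using nrm_abs_diff_le[OF S_pair_L2 proj_pair_L2, of m] unfolding nrm_gpart_pair by (simp add: abs_minus_commute)
 qed
qed

text \<open>A functional of a partial sum is a finite combination of independent normal variables.
  Its characteristic function and its variance both pass to the limit, because the pairings converge
  in L2.\<close>

lemma char_G_pair:
 "(LINT z|normal_seq. iexp (t * L1_pair mu g (G z))) = of_real (exp (- (t * nrm normal_seq (%z. L1_pair mu g (G z)))\<^sup>2 / 2))"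
proof -
 let ?G = "%m. \<integral>z. iexp (t * L1_pair mu g (gpart m z)) \<partial>normal_seq"
 have "null_seq (%m. nrm normal_seq (%z. t * L1_pair mu g (G z) - t * L1_pair mu g (gpart m z)))"
  unfolding right_diff_distrib[symmetric] nrm_cmult by (rule tendsto_mult_right_zero[OF G_pair_tendsto])
 then have "null_seq (%m. (LINT z|normal_seq. iexp (t * L1_pair mu g (G z))) - ?G m)"
  by (rule tendsto_integral_iexp[OF prob_normal_seq L2fun_cmult[OF G_pair_L2] L2fun_cmult[OF gpart_pair_L2]])
 from tendsto_minus[OF this]
 have "null_seq (%m. ?G m - (LINT z|normal_seq. iexp (t * L1_pair mu g (G z))))"
  by (simp only: minus_diff_eq minus_zero)
 then have 1: "?G \<longlonglongrightarrow> (LINT z|normal_seq. iexp (t * L1_pair mu g (G z)))" by (rule LIM_zero_cancel)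
 have "?G m = of_real (exp (- (t * nrm normal_seq (%z. L1_pair mu g (gpart m z)))\<^sup>2 / 2))" for m
 proof -
  have "t * L1_pair mu g (gpart m z) = (\<Sum>j<m. (t * L1_pair mu g (c j)) * z j)" for z
   unfolding gpart_def L1_pair_sum_c[OF g] by (simp add: sum_distrib_left mult.assoc)
  then have "?G m = (LINT z|normal_seq. iexp (\<Sum>j<m. (t * L1_pair mu g (c j)) * z j))" by (simp only:)
  also have "... = of_real (exp (- (\<Sum>j<m. (t * L1_pair mu g (c j))\<^sup>2) / 2))"
   by (rule char_normal_seq_sum) simp
  also have "(\<Sum>j<m. (t * L1_pair mu g (c j))\<^sup>2) = (t * nrm normal_seq (%z. L1_pair mu g (gpart m z)))\<^sup>2"
   unfolding power_mult_distrib nrm_gpart_pair2 by (simp add: sum_distrib_left)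
  finally show ?thesis .
 qed
 moreover have "(%m. complex_of_real (exp (- (t * nrm normal_seq (%z. L1_pair mu g (gpart m z)))\<^sup>2 / 2)))
   \<longlonglongrightarrow> of_real (exp (- (t * nrm normal_seq (%z. L1_pair mu g (G z)))\<^sup>2 / 2))"
  by (intro tendsto_intros nrm_gpart_pair_tendsto) simp
 ultimately have "?G \<longlonglongrightarrow> of_real (exp (- (t * nrm normal_seq (%z. L1_pair mu g (G z)))\<^sup>2 / 2))" by simp
 then show ?thesis by (rule LIMSEQ_unique[OF 1])
qed

lemma G_pair_gaussian: "real_gaussian normal_seq (%z. L1_pair mu g (G z))"
 by (rule gaussian_of_char[OF prob_normal_seq G_pair_L2 refl char_G_pair])

lemma G_pair_mean: "(LINT z|normal_seq. L1_pair mu g (G z)) = 0"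
proof -
 interpret Q: prob_space normal_seq by (rule prob_normal_seq)
 have iG: "integrable normal_seq (%z. L1_pair mu g (G z))" by (rule Q.L2fun_integrable[OF G_pair_L2])
 have ig: "integrable normal_seq (%z. L1_pair mu g (gpart m z))" for m by (rule Q.L2fun_integrable[OF gpart_pair_L2])
 have i0: "(LINT z|normal_seq. L1_pair mu g (gpart m z)) = 0" for m
  unfolding gpart_def L1_pair_sum_c[OF g]
  by (subst Bintegral_sum)
   (auto intro!: integrable_mult_right Q.L2fun_integrable normal_seq_moments simp: normal_seq_moments)
 have "\<bar>\<integral>z. L1_pair mu g (G z) \<partial>normal_seq\<bar> \<le> nrm normal_seq (%z. L1_pair mu g (G z) - L1_pair mu g (gpart m z))" for m
 proof -
  have "(LINT z|normal_seq. L1_pair mu g (G z)) = (LINT z|normal_seq. L1_pair mu g (G z) - L1_pair mu g (gpart m z))"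
   by (simp add: Bintegral_diff[OF iG ig] i0)
  also have "\<bar>...\<bar> \<le> (LINT z|normal_seq. \<bar>L1_pair mu g (G z) - L1_pair mu g (gpart m z)\<bar>)"
   by (rule integral_abs_bound)
  also have "... \<le> nrm normal_seq (%z. L1_pair mu g (G z) - L1_pair mu g (gpart m z))"
   by (rule Q.L2fun_norm1_le[OF L2fun_diff[OF G_pair_L2 gpart_pair_L2]])
  finally show ?thesis .
 qed
 then have "\<bar>\<integral>z. L1_pair mu g (G z) \<partial>normal_seq\<bar> \<le> 0"
  by (intro LIMSEQ_le_const[OF G_pair_tendsto]) blast
 then show ?thesis by simp
qed

lemma G_pair_covariance: "L1_covariance normal_seq mu G g g = (LINT w|P. (L1_pair mu g (S w))\<^sup>2)"
proof -
 have "(nrm normal_seq (%z. L1_pair mu g (G z)))\<^sup>2 = (nrm P (%w. L1_pair mu g (S w)))\<^sup>2"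
  by (simp only: nrm_G_pair)
 then show ?thesis unfolding L1_covariance_def nrm_power2 by (simp add: power2_eq_square)
qed

end

lemma G_gaussian: "L1_gaussian normal_seq mu G"
 unfolding L1_gaussian_def using G_rv G_pair_gaussian by blast

lemma G_centered: "L1_centered normal_seq mu G"
proof -
 interpret Q: prob_space normal_seq by (rule prob_normal_seq)
 show ?thesis unfolding L1_centered_def using Q.L2fun_integrable[OF G_pair_L2] G_pair_mean by blast
qed

end

section \<open>Finite-rank approximation of the normalised sums\<close>

context l1_gaussian begin

definition cmap :: "nat => (nat => real) => 't => real" where "cmap m v t = (\<Sum>j<m. c j t * v j)"

text \<open>The finite-rank operator on L1(mu) whose value at \<open>S\<close> is
  \<open>proj m\<close>. It factors through m real coordinates by \<open>cmap\<close>, which is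
  where the finite-dimensional limit theorem enters.\<close>

definition restr :: "nat => ('t => real) => 't => real" where
 "restr m x = cmap m (%j. L1_pair mu (f j) x)"

lemma cmap_integrable: "integrable mu (cmap m v)"
 unfolding cmap_def[abs_def] by (intro Bintegrable_sum integrable_mult_left c_integrable)

lemma cmap_dist: "(LINT t|mu. \<bar>cmap m v t - cmap m v' t\<bar>) \<le> (\<Sum>j<m. (LINT t|mu. \<bar>c j t\<bar>)) * (\<Sum>j<m. \<bar>v j - v' j\<bar>)"
proof -
 have pt: "\<bar>cmap m v t - cmap m v' t\<bar> \<le> (\<Sum>j<m. \<bar>c j t\<bar> * \<bar>v j - v' j\<bar>)" for t
 proof -
  have "cmap m v t - cmap m v' t = (\<Sum>j<m. c j t * (v j - v' j))"
   by (simp add: cmap_def right_diff_distrib sum_subtractf)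
  then show ?thesis by (simp only: flip: abs_mult) (rule sum_abs)
 qed
 have "(LINT t|mu. \<bar>cmap m v t - cmap m v' t\<bar>) \<le> (LINT t|mu. (\<Sum>j<m. \<bar>c j t\<bar> * \<bar>v j - v' j\<bar>))"
  by (intro integral_mono pt integrable_abs Bintegrable_diff cmap_integrable
    Bintegrable_sum integrable_mult_left c_integrable)
 also have "... = (\<Sum>j<m. (LINT t|mu. \<bar>c j t\<bar>) * \<bar>v j - v' j\<bar>)"
  by (subst Bintegral_sum) (auto intro!: integrable_mult_left integrable_abs c_integrable)
 also have "... \<le> (\<Sum>j<m. (\<Sum>j<m. (LINT t|mu. \<bar>c j t\<bar>)) * \<bar>v j - v' j\<bar>)"
  by (intro sum_mono mult_right_mono member_le_sum) auto
 also have "... = (\<Sum>j<m. (LINT t|mu. \<bar>c j t\<bar>)) * (\<Sum>j<m. \<bar>v j - v' j\<bar>)"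
  by (simp only: sum_distrib_left)
 finally show ?thesis .
qed

lemma cmap_measurable:
 assumes "\<And>j. j < m ==> (%x. V x j) \<in> borel_measurable M"
 shows "joint_meas M mu (%x t. cmap m (V x) t)"
proof -
 have "bmeas (M \<Otimes>\<^sub>M mu) (%p. \<Sum>j<m. c j (snd p) * V (fst p) j)"
 proof (rule borel_measurable_sum)
  fix j assume "j \<in> {..<m}"
  then have [measurable]: "bmeas M (%x. V x j)" using assms by simp
  show "bmeas (M \<Otimes>\<^sub>M mu) (%p. c j (snd p) * V (fst p) j)" by measurable
 qed
 then show ?thesis by (simp add: cmap_def case_prod_unfold)
qed

lemma cmap_rv:
 assumes "\<And>j. j < m ==> (%x. V x j) \<in> borel_measurable M"
 shows "L1_random_variable M mu (%x. cmap m (V x))"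
 unfolding L1_random_variable_def
 by (intro conjI ballI cmap_integrable, rule cmap_measurable, rule assms)

lemma restr_rv:
 assumes "L1_random_variable P mu Y" shows "L1_random_variable P mu (%w. restr m (Y w))"
 unfolding restr_def
 by (rule cmap_rv) (rule L1_pair_measurable[OF f_Linfty], use assms in \<open>simp add: L1_random_variable_def\<close>)

text \<open>Needed to push the martingale approximation error through \<open>restr m\<close>. The
  constant may grow with m, since m is fixed before n tends to infinity.\<close>

lemma mixn_restr_le:
 "\<exists>C\<ge>0. \<forall>Y. L1_random_variable P mu Y \<longrightarrow> mixn P mu (%w. restr m (Y w)) \<le> ennreal C * mixn P mu Y"
proof -
 have "\<exists>C. \<forall>j. 0 \<le> C j \<and> (AE t in mu. \<bar>f j t\<bar> \<le> C j)"
  by (rule choice) (use Linfty_bound[OF f_Linfty] in metis)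
 then obtain C where C: "\<And>j. 0 \<le> C j" "\<And>j. AE t in mu. \<bar>f j t\<bar> \<le> C j" by blast
 let ?C = "\<Sum>j<m. (LINT t|mu. \<bar>c j t\<bar>) * C j"
 have le: "mixn P mu (%w. restr m (Y w)) \<le> ennreal ?C * mixn P mu Y" if Y: "L1_random_variable P mu Y" for Y
 proof -
  have Ym [measurable]: "joint_meas P mu Y"
   using Y by (simp add: L1_random_variable_def)
  have pm [measurable]: "bmeas P (%w. L1_pair mu (f j) (Y w))" for j
   by (rule L1_pair_measurable[OF f_Linfty Ym])
  have term1: "mixn P mu (%w t. c j t * L1_pair mu (f j) (Y w)) \<le> ennreal ((LINT t|mu. \<bar>c j t\<bar>) * C j) * mixn P mu Y" for j
  proof -
   have "mixn P mu (%w t. c j t * L1_pair mu (f j) (Y w)) = (\<integral>\<^sup>+t. norm2 P (%w. L1_pair mu (f j) (Y w)) * ennreal \<bar>c j t\<bar> \<partial>mu)"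
    unfolding mixn_def by (intro nn_integral_cong) (subst norm2_cmult[OF pm], rule mult.commute)
   also have "... = norm2 P (%w. L1_pair mu (f j) (Y w)) * (\<integral>\<^sup>+t. ennreal \<bar>c j t\<bar> \<partial>mu)"
    by (rule nn_integral_cmult) measurable
   also have "(\<integral>\<^sup>+t. ennreal \<bar>c j t\<bar> \<partial>mu) = ennreal (LINT t|mu. \<bar>c j t\<bar>)"
    by (rule nn_integral_eq_integral) (auto intro: c_integrable)
   also have "norm2 P (%w. L1_pair mu (f j) (Y w)) * ennreal (LINT t|mu. \<bar>c j t\<bar>)
     \<le> (ennreal (C j) * mixn P mu Y) * ennreal (LINT t|mu. \<bar>c j t\<bar>)"
    by (rule mult_right_mono[OF norm2_L1_pair[OF P f_Linfty C Ym]]) simp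
   also have "... = ennreal ((LINT t|mu. \<bar>c j t\<bar>) * C j) * mixn P mu Y"
    using C(1)[of j] by (simp add: ennreal_mult mult_ac)
   finally show ?thesis .
  qed
  have "mixn P mu (%w. restr m (Y w)) \<le> (\<Sum>j<m. mixn P mu (%w t. c j t * L1_pair mu (f j) (Y w)))"
   unfolding restr_def cmap_def[abs_def] by (rule mixn_sum[OF P]) measurable
  also have "... \<le> (\<Sum>j<m. ennreal ((LINT t|mu. \<bar>c j t\<bar>) * C j) * mixn P mu Y)"
   by (intro sum_mono term1)
  also have "... = ennreal ?C * mixn P mu Y"
   using C(1) by (simp add: sum_ennreal flip: sum_distrib_right)
  finally show ?thesis .
 qed
 have "0 \<le> ?C" using C(1) by (intro sum_nonneg mult_nonneg_nonneg) simp_all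
 then show ?thesis using le by blast
qed

lemma restr_diff:
 assumes "integrable mu x" "integrable mu y"
 shows "restr m (%t. x t - y t) t = restr m x t - restr m y t"
 by (simp add: restr_def cmap_def L1_pair_diff[OF f_Linfty assms] right_diff_distrib sum_subtractf)

definition S_avg :: "nat => 'w => 't => real" where
 "S_avg n w t = (1 / sqrt (real n)) * (\<Sum>i=1..n. S (tau (int i) w) t)"

lemma S_avg_rv: "L1_random_variable P mu (S_avg n)"
 unfolding L1_random_variable_def
proof (intro conjI ballI)
 have [measurable]: "joint_meas P mu (%w t. \<Sum>i=1..n. S (tau (int i) w) t)"
  by (rule joint_tau_sum[OF S_m])
 have "bmeas (P \<Otimes>\<^sub>M mu) (%x. (1 / sqrt (real n)) * (case x of (w, t) => \<Sum>i=1..n. S (tau (int i) w) t))"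
  by measurable
 then show "joint_meas P mu (S_avg n)"
  by (simp add: S_avg_def case_prod_unfold)
 fix w assume w: "w \<in> space P"
 show "integrable mu (S_avg n w)"
  unfolding S_avg_def[abs_def]
  by (intro integrable_mult_right Bintegrable_sum S_i tau_space w)
qed

lemma restr_S_avg:
 assumes w: "w \<in> space P"
 shows "restr m (S_avg n w) t = (1 / sqrt (real n)) * (\<Sum>i=1..n. proj m (tau (int i) w) t)"
proof -
 have "L1_pair mu (f j) (S_avg n w) = (1 / sqrt (real n)) * (\<Sum>i=1..n. e j (tau (int i) w))" for j
 proof -
  have "L1_pair mu (f j) (S_avg n w) = (LINT t|mu. (1 / sqrt (real n)) * (\<Sum>i=1..n. f j t * S (tau (int i) w) t))"
   by (simp add: L1_pair_def S_avg_def sum_distrib_left mult_ac)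
  also have "... = (1 / sqrt (real n)) * (LINT t|mu. (\<Sum>i=1..n. f j t * S (tau (int i) w) t))"
   by (rule integral_mult_right_zero)
  also have "(LINT t|mu. (\<Sum>i=1..n. f j t * S (tau (int i) w) t)) = (\<Sum>i=1..n. \<integral>t. f j t * S (tau (int i) w) t \<partial>mu)"
   by (rule Bintegral_sum) (intro Linfty_mult_integrable f_Linfty S_i tau_space w)
  finally show ?thesis by (simp add: e_def L1_pair_def)
 qed
 then have "restr m (S_avg n w) t = (\<Sum>j<m. \<Sum>i=1..n. (1 / sqrt (real n)) * (c j t * e j (tau (int i) w)))"
  unfolding restr_def cmap_def by (simp add: sum_distrib_left mult_ac)
 also have "... = (\<Sum>i=1..n. \<Sum>j<m. (1 / sqrt (real n)) * (c j t * e j (tau (int i) w)))"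
  by (rule sum.swap)
 finally show ?thesis by (simp add: proj_def sum_distrib_left)
qed

text \<open>\<open>restr m\<close> commutes with sums along the orbit, and the remainder of
  \<open>S\<close> is a martingale difference for almost every t, so n steps cost exactly sqrt n,
  cancelled by the normalisation. For n = 0 the left side is 0, which is why this is an
  inequality.\<close>

lemma mixn_S_avg_restr:
 assumes S_F0: "joint_meas F0 mu S" and S_mds: "AE t in mu. mds (%w. S w t)"
 shows "mixn P mu (%w t. S_avg n w t - restr m (S_avg n w) t) \<le> mixn P mu (%w t. S w t - proj m w t)"
proof -
 have "mds (e j)" for j
  unfolding e_def[abs_def] by (rule mds_L1_pair[OF f_Linfty S_F0 S_fin S_mds])
 then have pm: "mds (%w. proj m w t)" for t
  unfolding proj_def by (intro mds_sum mds_cmult)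
 have rm: "AE t in mu. mds (%w. S w t - proj m w t)"
  using S_mds by eventually_elim (intro mds_diff pm)
 have [measurable]: "joint_meas P mu (%w t. \<Sum>i=1..n. S (tau (int i) w) t - proj m (tau (int i) w) t)"
  using joint_tau_sum[OF S_proj_m[of m], of int "{1..n}"] by simp
 have "mixn P mu (%w t. S_avg n w t - restr m (S_avg n w) t)
   = mixn P mu (%w t. (1 / sqrt (real n)) * (\<Sum>i=1..n. S (tau (int i) w) t - proj m (tau (int i) w) t))"
  by (rule mixn_space_cong) (simp add: restr_S_avg S_avg_def sum_subtractf right_diff_distrib diff_divide_distrib)
 also have "... = ennreal \<bar>1 / sqrt (real n)\<bar> * mixn P mu (%w t. \<Sum>i=1..n. S (tau (int i) w) t - proj m (tau (int i) w) t)"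
  by (rule mixn_cmult[OF P]) measurable
 also have "mixn P mu (%w t. \<Sum>i=1..n. S (tau (int i) w) t - proj m (tau (int i) w) t)
   = ennreal (sqrt n) * mixn P mu (%w t. S w t - proj m w t)"
  using mixn_mds_sum[OF S_proj_m rm, of n] by simp
 also have "ennreal \<bar>1 / sqrt (real n)\<bar> * (ennreal (sqrt n) * mixn P mu (%w t. S w t - proj m w t))
   = ennreal (\<bar>1 / sqrt (real n)\<bar> * sqrt n) * mixn P mu (%w t. S w t - proj m w t)"
  by (simp only: ennreal_mult[OF abs_ge_zero real_sqrt_ge_zero[OF of_nat_0_le_iff]] mult.assoc)
 also have "... \<le> 1 * mixn P mu (%w t. S w t - proj m w t)"
  by (rule mult_right_mono) (auto simp: ennreal_le_1)
 finally show ?thesis by simp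
qed

text \<open>Cramer-Wold device: a linear combination of the f_j is itself a bounded functional, so
  \<open>char\<close> supplies the joint characteristic function of the coordinates, and
  orthogonality of the e_j identifies it with that of independent normal variables.\<close>

lemma finite_dim_convergence:
 assumes Y: "\<And>n. L1_random_variable P mu (Y n)"
  and char: "\<And>g. g \<in> Linfty mu ==> (%n. \<integral>w. iexp (L1_pair mu g (Y n w)) \<partial>P)
   \<longlonglongrightarrow> of_real (exp (- (nrm P (%w. L1_pair mu g (S w)))\<^sup>2 / 2))"
  and B: "L1_bounded mu B H" and K: "L1_lipschitz mu K H"
 shows "(%n. \<integral>w. H (restr m (Y n w)) \<partial>P) \<longlonglongrightarrow> (LINT z|normal_seq. H (gpart m z))"
proof -
 \<comment> \<open>Coordinates with e_j = 0 must have the limit 0; this scaling does not affect the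
   random function, since c_j vanishes there too.\<close>
 define W where "W z j = nrm P (e j) * z j" for z :: "nat => real" and j
 define C where "C = (\<Sum>j<m. (LINT t|mu. \<bar>c j t\<bar>))"
 have C0: "0 \<le> C" unfolding C_def by (intro sum_nonneg) simp
 have K0: "0 \<le> K" using K by (simp add: L1_lipschitz_def)
 note Hc = L1_lipschitz_imp_continuous[OF K]
 have gW: "cmap m (W z) = gpart m z" for z
 proof
  fix t
  have eq: "c j t * (nrm P (e j) * z j) = c j t * z j" for j
   using c_nrm[of j t] by (metis mult.assoc mult.commute)
  show "cmap m (W z) t = gpart m z t" by (simp only: cmap_def W_def gpart_def eq)
 qed
 have Vm: "bmeas P (%w. L1_pair mu (f j) (Y n w))" for n j
  by (rule L1_pair_measurable[OF f_Linfty]) (use Y in \<open>simp add: L1_random_variable_def\<close>)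
 have Wm: "bmeas normal_seq (%z. W z j)" for j
  unfolding W_def using normal_seq_coordinate[of j] by measurable
 have ch: "(%n. \<integral>w. iexp (\<Sum>j<m. u j * L1_pair mu (f j) (Y n w)) \<partial>P) \<longlonglongrightarrow> (LINT z|normal_seq. iexp (\<Sum>j<m. u j * W z j))" for u
 proof -
  define g where "g t = (\<Sum>j<m. u j * f j t)" for t
  have g: "g \<in> Linfty mu" unfolding g_def[abs_def] by (intro Linfty_sum Linfty_cmult f_Linfty)
  have gx: "L1_pair mu g x = (\<Sum>j<m. u j * L1_pair mu (f j) x)" if "integrable mu x" for x
   unfolding g_def[abs_def]
   by (subst L1_pair_sum[OF _ that]) (simp_all add: Linfty_cmult f_Linfty L1_pair_cmult)
  have 1: "(LINT w|P. iexp (L1_pair mu g (Y n w))) = (LINT w|P. iexp (\<Sum>j<m. u j * L1_pair mu (f j) (Y n w)))" for n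
   by (rule Bintegral_cong[OF refl])
    (use gx Y in \<open>simp add: L1_random_variable_def\<close>)
  have "(LINT w|P. (L1_pair mu g (S w))\<^sup>2) = (LINT w|P. (\<Sum>j<m. u j * e j w)\<^sup>2)"
   by (rule Bintegral_cong[OF refl]) (simp add: gx S_i e_def)
  then have 2: "(nrm P (%w. L1_pair mu g (S w)))\<^sup>2 = (\<Sum>j<m. (u j)\<^sup>2 * (nrm P (e j))\<^sup>2)"
   by (simp only: nrm_power2[symmetric] nrm_orthonormal_sum[OF e_orth finite_lessThan])
  have "(LINT z|normal_seq. iexp (\<Sum>j<m. u j * W z j)) = (LINT z|normal_seq. iexp (\<Sum>j<m. (u j * nrm P (e j)) * z j))"
   by (simp only: W_def mult.assoc)
  also have "... = of_real (exp (- (\<Sum>j<m. (u j * nrm P (e j))\<^sup>2) / 2))"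
   by (rule char_normal_seq_sum) simp
  finally have 3: "(LINT z|normal_seq. iexp (\<Sum>j<m. u j * W z j)) = of_real (exp (- (nrm P (%w. L1_pair mu g (S w)))\<^sup>2 / 2))"
   by (simp only: 2 power_mult_distrib)
  show ?thesis using char[OF g] unfolding 1 3 .
 qed
 have "(%n. \<integral>w. H (cmap m ((%j. L1_pair mu (f j) (Y n w)))) \<partial>P) \<longlonglongrightarrow> (LINT z|normal_seq. H (cmap m (W z)))"
 proof (rule multivariate_levy_lipschitz[where m = m and B = B and K = "K * C" and g = "%v. H (cmap m v)"
    and V = "%n w j. L1_pair mu (f j) (Y n w)" and W = W])
  show "bmeas (lborel_pi m) (%v. H (cmap m v))"
   by (rule L1_continuous_measurable[OF mu cmap_rv Hc]) (rule coordinate_measurable)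
  show "\<bar>H (cmap m v)\<bar> \<le> B" for v using B cmap_integrable by (simp add: L1_bounded_def)
  show "\<bar>H (cmap m v) - H (cmap m v')\<bar> \<le> K * C * (\<Sum>j<m. \<bar>v j - v' j\<bar>)" for v v'
  proof -
   have "\<bar>H (cmap m v) - H (cmap m v')\<bar> \<le> K * (LINT t|mu. \<bar>cmap m v t - cmap m v' t\<bar>)"
    using K cmap_integrable by (simp add: L1_lipschitz_def)
   also have "... \<le> K * (C * (\<Sum>j<m. \<bar>v j - v' j\<bar>))"
    unfolding C_def by (rule mult_left_mono[OF cmap_dist K0])
   finally show ?thesis by (simp add: mult.assoc)
  qed
  show "0 \<le> K * C" using K0 C0 by simp
  show "bmeas P (%w. H (cmap m (%j. L1_pair mu (f j) (Y n w))))" for n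
   by (rule L1_continuous_measurable[OF mu cmap_rv Hc]) (rule Vm)
  show "bmeas normal_seq (%z. H (cmap m (W z)))"
   by (rule L1_continuous_measurable[OF mu cmap_rv Hc]) (rule Wm)
 qed (rule P prob_normal_seq Vm Wm ch)+
 then show ?thesis by (simp only: gW restr_def)
qed

text \<open>Replacing Y_n by its finite-rank image costs little for a suitable m once n is large,
  and so does replacing \<open>G\<close> by its m-th partial sum. With m fixed, the
  finite-dimensional theorem connects the two.\<close>

lemma lipschitz_convergence:
 assumes Y: "\<And>n. L1_random_variable P mu (Y n)"
  and S_F0: "joint_meas F0 mu S" and S_mds: "AE t in mu. mds (%w. S w t)"
  and approx: "null_seq (%n. mixn P mu (%w t. Y n w t - S_avg n w t))"
  and char: "\<And>g. g \<in> Linfty mu ==> (%n. \<integral>w. iexp (L1_pair mu g (Y n w)) \<partial>P)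
   \<longlonglongrightarrow> of_real (exp (- (nrm P (%w. L1_pair mu g (S w)))\<^sup>2 / 2))"
  and B: "L1_bounded mu B H" and K: "L1_lipschitz mu K H"
 shows "(%n. \<integral>w. H (Y n w) \<partial>P) \<longlonglongrightarrow> (LINT z|normal_seq. H (G z))"
proof (rule LIMSEQ_I)
 fix r :: real assume r: "r > 0"
 have K0: "0 \<le> K" using K by (simp add: L1_lipschitz_def)
 \<comment> \<open>Three fifths go to the finite-rank replacement of Y_n, whose bound has three
   terms; one to the finite-dimensional limit; one to the replacement of \<open>G\<close>.\<close>
 define eps where "eps = ennreal (r / 5)"
 have eps0: "eps > 0" using r by (simp add: eps_def)
 have small: "null_seq (%n. ennreal K * a n)" if "a \<longlonglongrightarrow> 0" for a :: "nat => ennreal"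
  using ennreal_tendsto_cmult[OF _ that, of "ennreal K"] by simp
 have "\<forall>\<^sub>F m in sequentially. ennreal K * mixn P mu (%w t. S w t - proj m w t) < eps
   \<and> ennreal K * mixn normal_seq mu (%z t. G z t - gpart m z t) < eps"
  using order_tendstoD(2)[OF small[OF mixn_proj_tendsto] eps0] order_tendstoD(2)[OF small[OF G_lim] eps0]
  by eventually_elim simp
 then obtain m where m1: "ennreal K * mixn P mu (%w t. S w t - proj m w t) < eps"
  and m2: "ennreal K * mixn normal_seq mu (%z t. G z t - gpart m z t) < eps"
  by (auto simp: eventually_sequentially)
 obtain C where C0: "0 \<le> C" and C: "\<And>Z. L1_random_variable P mu Z ==> mixn P mu (%w. restr m (Z w)) \<le> ennreal C * mixn P mu Z"
  using mixn_restr_le[of m] by blast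
 have Ym [measurable]: "joint_meas P mu (Y n)"
  and Yi: "w \<in> space P ==> integrable mu (Y n w)" for n w using Y by (auto simp: L1_random_variable_def)
 have Am [measurable]: "joint_meas P mu (S_avg n)"
  and Ai: "w \<in> space P ==> integrable mu (S_avg n w)" for n w using S_avg_rv by (auto simp: L1_random_variable_def)
 have rY [measurable]: "joint_meas P mu (%w t. restr m (Y n w) t)" for n
  using restr_rv[OF Y] by (simp add: L1_random_variable_def)
 have rA [measurable]: "joint_meas P mu (%w t. restr m (S_avg n w) t)" for n
  using restr_rv[OF S_avg_rv] by (simp add: L1_random_variable_def)
 define \<delta> where "\<delta> n = mixn P mu (%w t. Y n w t - S_avg n w t)" for n
 have drv: "L1_random_variable P mu (%w t. S_avg n w t - Y n w t)" for n
  unfolding L1_random_variable_def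
  by (intro conjI ballI Bintegrable_diff Ai Yi) measurable
 have main: "mixn P mu (%w t. Y n w t - restr m (Y n w) t)
   \<le> \<delta> n + (mixn P mu (%w t. S w t - proj m w t) + ennreal C * \<delta> n)" for n
 proof -
  have "mixn P mu (%w t. Y n w t - restr m (Y n w) t)
    \<le> \<delta> n + mixn P mu (%w t. S_avg n w t - restr m (Y n w) t)"
   unfolding \<delta>_def by (rule mixn_triangle3[OF P]) measurable
  also have "mixn P mu (%w t. S_avg n w t - restr m (Y n w) t)
    \<le> mixn P mu (%w t. S_avg n w t - restr m (S_avg n w) t) + mixn P mu (%w t. restr m (S_avg n w) t - restr m (Y n w) t)"
   by (rule mixn_triangle3[OF P]) measurable
  also have "mixn P mu (%w t. restr m (S_avg n w) t - restr m (Y n w) t) = mixn P mu (%w. restr m (%t. S_avg n w t - Y n w t))"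
   by (rule mixn_space_cong) (simp add: restr_diff Ai Yi)
  also have "... \<le> ennreal C * mixn P mu (%w t. S_avg n w t - Y n w t)" by (rule C[OF drv])
  also have "mixn P mu (%w t. S_avg n w t - Y n w t) = \<delta> n" unfolding \<delta>_def by (rule mixn_commute)
  also have "mixn P mu (%w t. S_avg n w t - restr m (S_avg n w) t) \<le> mixn P mu (%w t. S w t - proj m w t)"
   by (rule mixn_S_avg_restr[OF S_F0 S_mds])
  finally show ?thesis by (simp add: add_mono)
 qed
 have \<delta>lim: "\<delta> \<longlonglongrightarrow> 0" using approx by (simp add: \<delta>_def[abs_def])
 have \<delta>C: "null_seq (%n. ennreal C * \<delta> n)" using ennreal_tendsto_cmult[OF _ \<delta>lim, of "ennreal C"] by simp
 have fd: "(%n. \<integral>w. H (restr m (Y n w)) \<partial>P) \<longlonglongrightarrow> (LINT z|normal_seq. H (gpart m z))"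
  by (rule finite_dim_convergence[OF Y char B K])
 have r5: "r / 5 > 0" using r by simp
 have "\<forall>\<^sub>F n in sequentially. norm ((LINT w|P. H (Y n w)) - (LINT z|normal_seq. H (G z))) < r"
  using order_tendstoD(2)[OF small[OF \<delta>lim] eps0] order_tendstoD(2)[OF small[OF \<delta>C] eps0]
   tendstoD[OF fd r5]
 proof eventually_elim
  case (elim n)
  have lt: "x \<le> r / 5" if "ennreal x \<le> b" "b < eps" for x b
  proof -
   have "ennreal x \<le> ennreal (r / 5)" using that unfolding eps_def by simp
   then show ?thesis using r by (simp add: ennreal_le_iff)
  qed
  have "ennreal \<bar>(LINT w|P. H (Y n w)) - (LINT w|P. H (restr m (Y n w)))\<bar>
    \<le> ennreal K * mixn P mu (%w t. Y n w t - restr m (Y n w) t)"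
   by (rule lipschitz_expectation[OF mu P Y restr_rv[OF Y] B K])
  also have "... \<le> ennreal K * (\<delta> n + (mixn P mu (%w t. S w t - proj m w t) + ennreal C * \<delta> n))"
   by (rule mult_left_mono[OF main]) simp
  also have "... = ennreal K * \<delta> n + (ennreal K * mixn P mu (%w t. S w t - proj m w t) + ennreal K * (ennreal C * \<delta> n))"
   by (simp add: distrib_left)
  also have "... \<le> eps + (eps + eps)" using elim m1 by (intro add_mono) auto
  also have "... = ennreal (3 * (r / 5))" unfolding eps_def using r by (simp flip: ennreal_plus)
  finally have 1: "\<bar>(LINT w|P. H (Y n w)) - (LINT w|P. H (restr m (Y n w)))\<bar> \<le> 3 * (r / 5)"
   using r by (simp add: ennreal_le_iff)
  have 2: "\<bar>(LINT z|normal_seq. H (G z)) - (LINT z|normal_seq. H (gpart m z))\<bar> \<le> r / 5"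
   by (rule lt[OF lipschitz_expectation[OF mu prob_normal_seq G_rv gpart_rv B K] m2])
  show ?case using 1 2 elim(3) r unfolding dist_real_def real_norm_def abs_less_iff abs_le_iff by linarith
 qed
 then show "\<exists>no. \<forall>n\<ge>no. norm ((LINT w|P. H (Y n w)) - (LINT z|normal_seq. H (G z))) < r"
  by (simp add: eventually_sequentially)
qed

lemma G_limit_in_law:
 assumes Y: "\<And>n. L1_random_variable P mu (Y n)"
  and S_F0: "joint_meas F0 mu S" and S_mds: "AE t in mu. mds (%w. S w t)"
  and approx: "null_seq (%n. mixn P mu (%w t. Y n w t - S_avg n w t))"
  and char: "\<And>g. g \<in> Linfty mu ==> (%n. \<integral>w. iexp (L1_pair mu g (Y n w)) \<partial>P)
   \<longlonglongrightarrow> of_real (exp (- (nrm P (%w. L1_pair mu g (S w)))\<^sup>2 / 2))"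
 shows "L1_converges_in_law P mu Y normal_seq G"
proof (rule law_of_lipschitz[OF mu P prob_normal_seq Y G_rv])
 fix H :: "('t => real) => real" and B K
 assume B: "L1_bounded mu B H" and K: "L1_lipschitz mu K H"
 show "(%n. \<integral>w. H (Y n w) \<partial>P) \<longlonglongrightarrow> (LINT z|normal_seq. H (G z))"
  by (rule lipschitz_convergence[OF Y S_F0 S_mds approx char B K])
qed

end

section \<open>The limit theorem\<close>

context ergodic_hannan begin

definition normed_sum :: "nat => 'w => 't => real" where
 "normed_sum n w t = (\<Sum>i=1..n. X0 (tau (int i) w) t) / sqrt (real n)"

lemma L1_pair_sum_right:
 assumes g: "g \<in> Linfty mu" and x: "\<And>i. i \<in> I ==> integrable mu (x i)"
 shows "L1_pair mu g (%t. \<Sum>i\<in>I. x i t) = (\<Sum>i\<in>I. L1_pair mu g (x i))"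
 unfolding L1_pair_def sum_distrib_left
 by (intro Bintegral_sum Linfty_mult_integrable g x)

lemma tau_average_rv:
 assumes "L1_random_variable P mu Z"
 shows "L1_random_variable P mu (%w t. (\<Sum>i=1..n. Z (tau (int i) w) t) / sqrt (real n))"
 unfolding L1_random_variable_def
proof (intro conjI ballI)
 have [measurable]: "joint_meas P mu (%w t. \<Sum>i=1..n. Z (tau (int i) w) t)"
  by (rule joint_tau_sum) (use assms in \<open>simp add: L1_random_variable_def\<close>)
 have "bmeas (P \<Otimes>\<^sub>M mu) (%x. (case x of (w, t) => \<Sum>i=1..n. Z (tau (int i) w) t) / sqrt (real n))"
  by measurable
 then show "joint_meas P mu (%w t. (\<Sum>i=1..n. Z (tau (int i) w) t) / sqrt (real n))"
  by (simp add: case_prod_unfold)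
 fix w assume w: "w \<in> space P"
 show "integrable mu (%t. (\<Sum>i=1..n. Z (tau (int i) w) t) / sqrt (real n))"
  by (intro integrable_divide Bintegrable_sum)
   (use assms tau_space[OF w] in \<open>auto simp: L1_random_variable_def\<close>)
qed

lemma mixn_tau_average:
 assumes Z: "L1_random_variable P mu Z" and fin: "mixn P mu Z < \<infinity>"
 shows "mixn P mu (%w t. (\<Sum>i=1..n. Z (tau (int i) w) t) / sqrt (real n)) < \<infinity>"
proof -
 have Zm: "joint_meas P mu Z" using Z by (simp add: L1_random_variable_def)
 have "mixn P mu (%w t. (\<Sum>i=1..n. Z (tau (int i) w) t) / sqrt (real n))
   = mixn P mu (%w t. (1 / sqrt (real n)) * (\<Sum>i=1..n. Z (tau (int i) w) t))" by simp
 also have "... = ennreal \<bar>1 / sqrt (real n)\<bar> * mixn P mu (%w t. \<Sum>i=1..n. Z (tau (int i) w) t)"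
  by (rule mixn_cmult[OF P joint_tau_sum[OF Zm]])
 also have "... \<le> ennreal \<bar>1 / sqrt (real n)\<bar> * (of_nat n * mixn P mu Z)"
  by (intro mult_left_mono mixn_sum_tau_le Zm) simp
 also have "... < \<infinity>"
  using fin by (simp add: ennreal_mult_less_top ennreal_of_nat_eq_real_of_nat)
 finally show ?thesis .
qed

lemma normed_sum_rv: "L1_random_variable P mu (normed_sum n)"
 unfolding normed_sum_def[abs_def] by (rule tau_average_rv[OF X0])

lemma normed_sum_approx:
 "null_seq (%n. mixn P mu (%w t. normed_sum n w t - (\<Sum>i=1..n. S (tau (int i) w) t) / sqrt (real n)))"
proof -
 have "normed_sum n w t - (\<Sum>i=1..n. S (tau (int i) w) t) / sqrt (real n) = (1 / sqrt (real n)) *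
   ((\<Sum>i=1..n. X0 (tau (int i) w) t) - (\<Sum>i=1..n. S (tau (int i) w) t))" for n w t
  by (simp add: normed_sum_def diff_divide_distrib)
 then show ?thesis using martingale_approximation by (simp only:)
qed

section \<open>One functional of the normalised sums\<close>

context
 fixes g assumes g: "g \<in> Linfty mu"
begin

lemma pair_mds: "mds (%w. L1_pair mu g (S w))"
 by (rule mds_L1_pair[OF g S_F0 mixn_S S_mds])

lemma pair_X0_L2: "L2fun P (%w. L1_pair mu g (X0 w))"
 by (rule L1_pair_L2[OF P g X0_joint mixn_X0])

lemma psum_pair:
 assumes "L1_random_variable P mu Z" "w \<in> space P"
 shows "psum (%w. L1_pair mu g (Z w)) n w / sqrt (real n) = L1_pair mu g (%t. (\<Sum>i=1..n. Z (tau (int i) w) t) / sqrt (real n))"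
proof -
 have "L1_pair mu g (%t. (\<Sum>i=1..n. Z (tau (int i) w) t)) = (\<Sum>i=1..n. L1_pair mu g (Z (tau (int i) w)))"
  by (rule L1_pair_sum_right[OF g]) (use assms tau_space in \<open>auto simp: L1_random_variable_def\<close>)
 then show ?thesis by (simp add: psum_def L1_pair_def)
qed

lemma pair_psum_approx:
 "null_seq (%n. nrm P (%w. psum (%w. L1_pair mu g (X0 w)) n w / sqrt (real n) - psum (%w. L1_pair mu g (S w)) n w / sqrt (real n)))"
proof -
 have "null_seq (%n. nrm P (%w. L1_pair mu g (normed_sum n w) - L1_pair mu g (%t. (\<Sum>i=1..n. S (tau (int i) w) t) / sqrt (real n))))"
  unfolding normed_sum_def[abs_def]
  by (rule L1_pair_tendsto[OF P g tau_average_rv[OF X0] tau_average_rv[OF S_L1] mixn_tau_average[OF X0 mixn_X0]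
     mixn_tau_average[OF S_L1 mixn_S] normed_sum_approx[unfolded normed_sum_def]])
 moreover have "nrm P (%w. L1_pair mu g (normed_sum n w) - L1_pair mu g (%t. (\<Sum>i=1..n. S (tau (int i) w) t) / sqrt (real n)))
   = nrm P (%w. psum (%w. L1_pair mu g (X0 w)) n w / sqrt (real n) - psum (%w. L1_pair mu g (S w)) n w / sqrt (real n))" for n
  unfolding nrm_def normed_sum_def[abs_def]
  by (intro arg_cong[where f = sqrt] Bintegral_cong refl) (simp only: psum_pair[OF X0] psum_pair[OF S_L1])
 ultimately show ?thesis by (simp only:)
qed

lemma pair_ergodic:
 "null_seq (%L. \<integral>w. \<bar>(1 / real L) * (\<Sum>l<L. (psum (%w. L1_pair mu g (X0 w)) r (tau (int l) w))\<^sup>2)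
   - (LINT w|P. (psum (%w. L1_pair mu g (X0 w)) r w)\<^sup>2)\<bar> \<partial>P)"
proof (rule ergodic_average_L1)
 show "integrable P (%w. (psum (%w. L1_pair mu g (X0 w)) r w)\<^sup>2)"
  by (rule L2fun_square[OF psum_L2[OF pair_X0_L2]])
 show "prob (exceeds (%w. (psum (%w. L1_pair mu g (X0 w)) r w)\<^sup>2) \<alpha>) \<in> {0, 1}" for \<alpha>
  using exceeds_zero_one[OF g, of 1 r \<alpha>] by (simp add: psum_def)
 show "prob (exceeds (%w. - (psum (%w. L1_pair mu g (X0 w)) r w)\<^sup>2) \<alpha>) \<in> {0, 1}" for \<alpha>
  using exceeds_zero_one[OF g, of "- 1" r \<alpha>] by (simp add: psum_def)
qed simp

text \<open>The closeness of the two normalised sums in L2 is used twice: as the premise under which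
  the martingale theorem borrows ergodicity from \<open>X0\<close>, and to carry its conclusion back
  from \<open>S\<close> to \<open>X0\<close>.\<close>

lemma pair_clt:
 "(%n. \<integral>w. iexp (L1_pair mu g (normed_sum n w)) \<partial>P) \<longlonglongrightarrow> of_real (exp (- (nrm P (%w. L1_pair mu g (S w)))\<^sup>2 / 2))"
proof -
 let ?y = "%w. L1_pair mu g (X0 w)" and ?d = "%w. L1_pair mu g (S w)"
 have yL: "L2fun P (%w. psum ?y n w / sqrt (real n))" and dL: "L2fun P (%w. psum ?d n w / sqrt (real n))" for n
  using L2fun_cmult[OF psum_L2[OF pair_X0_L2], of "1 / sqrt (real n)" n]
   L2fun_cmult[OF psum_L2[OF mds_L2[OF pair_mds]], of "1 / sqrt (real n)" n] by simp_all
 have "nrm P (%w. psum ?y n w - psum ?d n w) / sqrt (real n)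
   = nrm P (%w. psum ?y n w / sqrt (real n) - psum ?d n w / sqrt (real n))" for n
  using nrm_cmult[of P "1 / sqrt (real n)" "%w. psum ?y n w - psum ?d n w"] by (simp add: diff_divide_distrib)
 then have "null_seq (%n. nrm P (%w. psum ?y n w - psum ?d n w) / sqrt (real n))"
  using pair_psum_approx by simp
 then have 1: "(%n. \<integral>w. iexp (psum ?d n w / sqrt (real n)) \<partial>P) \<longlonglongrightarrow> of_real (exp (- (nrm P ?d)\<^sup>2 / 2))"
  by (rule martingale_clt[OF pair_mds pair_X0_L2 _ pair_ergodic])
 have 2: "null_seq (%n. (LINT w|P. iexp (psum ?y n w / sqrt (real n))) - (LINT w|P. iexp (psum ?d n w / sqrt (real n))))"
  by (rule tendsto_integral_iexp[OF P yL dL pair_psum_approx])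
 have 3: "(%n. \<integral>w. iexp (psum ?y n w / sqrt (real n)) \<partial>P) \<longlonglongrightarrow> of_real (exp (- (nrm P ?d)\<^sup>2 / 2))"
  using tendsto_add[OF 2 1] by (simp only: diff_add_cancel add_0)
 have "(LINT w|P. iexp (psum ?y n w / sqrt (real n))) = (LINT w|P. iexp (L1_pair mu g (normed_sum n w)))" for n
  by (rule Bintegral_cong[OF refl]) (simp only: psum_pair[OF X0] normed_sum_def[abs_def])
 then show ?thesis using 3 by (simp only:)
qed

text \<open>The functional is bounded by C times the mixed norm, so the norms of its values at the
  \<open>D k\<close> are summable and the real covariance series applies to them.\<close>

lemma pair_covariance_has_sum:
 "((%k. \<integral>w. L1_pair mu g (X0 w) * L1_pair mu g (X0 (tau k w)) \<partial>P) has_sum (LINT w|P. (L1_pair mu g (S w))\<^sup>2)) UNIV"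
proof -
 let ?q = "%k w. L1_pair mu g (D k w)"
 obtain C where C: "0 \<le> C" "AE t in mu. \<bar>g t\<bar> \<le> C" using Linfty_bound[OF g] .
 have q: "mds (?q k)" for k by (rule mds_L1_pair[OF g D_F0 mixn_D_fin D_mds])
 have "integrable counting (%k. nrm P (?q k))"
 proof (rule integrableI_bounded)
  have "(\<integral>\<^sup>+k. ennreal (norm (nrm P (?q k))) \<partial>counting) \<le> (\<integral>\<^sup>+k. ennreal C * mixn P mu (D k) \<partial>counting)"
   using norm2_L1_pair[OF P g C D_joint] by (intro nn_integral_mono) (simp add: norm2_L2[OF mds_L2[OF q]])
  also have "... = ennreal C * (\<integral>\<^sup>+k. mixn P mu (D k) \<partial>counting)" by (rule nn_integral_cmult) simp
  also have "... < \<infinity>" using D_fin by (simp add: ennreal_mult_less_top)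
  finally show "(\<integral>\<^sup>+k. ennreal (norm (nrm P (?q k))) \<partial>counting) < \<infinity>" .
 qed simp
 from integrable_count_space_has_sum[OF this] have sq: "(%k. nrm P (?q k)) summable_on UNIV"
  by (rule has_sum_imp_summable)
 have Di: "w \<in> space P ==> integrable mu (D k w)" for k w using D_L1 by (simp add: L1_random_variable_def)
 have sum_rv: "L1_random_variable P mu (%w t. \<Sum>k\<in>K. D k (tau (h k) w) t)" for K and h :: "int => int"
  unfolding L1_random_variable_def
 proof (intro conjI ballI)
  have "bmeas (P \<Otimes>\<^sub>M mu) (%x. \<Sum>k\<in>K. (%(w, t). D k (tau (h k) w) t) x)"
   by (rule borel_measurable_sum) (rule joint_tau[OF D_joint])
  then show "joint_meas P mu (%w t. \<Sum>k\<in>K. D k (tau (h k) w) t)"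
   by (simp add: case_prod_unfold)
  show "integrable mu (%t. \<Sum>k\<in>K. D k (tau (h k) w) t)" if "w \<in> space P" for w
   by (intro Bintegrable_sum Di tau_space that)
 qed
 have sum_fin: "mixn P mu (%w t. \<Sum>k\<in>K. D k (tau (h k) w) t) < \<infinity>" if "finite K" for K and h :: "int => int"
 proof -
  have "mixn P mu (%w t. \<Sum>k\<in>K. D k (tau (h k) w) t) \<le> (\<Sum>k\<in>K. mixn P mu (%w t. D k (tau (h k) w) t))"
   by (intro mixn_sum P joint_tau D_joint)
  also have "... < \<infinity>" using that mixn_D_fin by (simp add: mixn_tau[OF D_joint])
  finally show ?thesis .
 qed
 have pairq: "L1_pair mu g (%t. \<Sum>k\<in>K. D k (tau (h k) w) t) = (\<Sum>k\<in>K. ?q k (tau (h k) w))"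
  if "w \<in> space P" for w K and h :: "int => int"
  by (rule L1_pair_sum_right[OF g]) (intro Di tau_space that)
 \<comment> \<open>Covers two expansions at once: that of \<open>X0\<close>, with the shifts -k, and
   that of \<open>S\<close>, without shift.\<close>
 have conv: "null_seq (%K. nrm P (%w. L1_pair mu g (Z w) - (\<Sum>k\<in>{- int K..int K}. ?q k (tau (h k) w))))"
  if Z: "L1_random_variable P mu Z" "mixn P mu Z < \<infinity>"
   and lim: "null_seq (%K. mixn P mu (%w t. Z w t - (\<Sum>k\<in>{- int K..int K}. D k (tau (h k) w) t)))"
  for Z and h :: "int => int"
 proof -
  have "null_seq (%K. nrm P (%w. L1_pair mu g (Z w) - L1_pair mu g (%t. \<Sum>k\<in>{- int K..int K}. D k (tau (h k) w) t)))"
   by (rule L1_pair_tendsto[OF P g Z(1) sum_rv Z(2) sum_fin lim]) simp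
  moreover have "nrm P (%w. L1_pair mu g (Z w) - L1_pair mu g (%t. \<Sum>k\<in>{- int K..int K}. D k (tau (h k) w) t))
    = nrm P (%w. L1_pair mu g (Z w) - (\<Sum>k\<in>{- int K..int K}. ?q k (tau (h k) w)))" for K
   unfolding nrm_def
   by (intro arg_cong[where f = sqrt] Bintegral_cong refl) (simp only: pairq)
  ultimately show ?thesis by (simp only:)
 qed
 have yq: "null_seq (%K. nrm P (%w. L1_pair mu g (X0 w) - (\<Sum>k\<in>{- int K..int K}. ?q k (tau (- k) w))))"
  by (rule conv[OF X0 mixn_X0]) (use mixn_R_tendsto in \<open>simp only: R_def[abs_def]\<close>)
 have dq: "null_seq (%K. nrm P (%w. L1_pair mu g (S w) - (\<Sum>k\<in>{- int K..int K}. ?q k w)))"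
  using conv[OF S_L1 mixn_S, of "%_. 0"] mixn_S_tendsto by (simp add: tau_0)
 show ?thesis
  using covariance_has_sum[OF q sq pair_X0_L2 mds_L2[OF pair_mds] yq dq] by (simp only: nrm_power2)
qed

end

text \<open>The approximating functionals of \<open>S\<close> are not orthogonal. Gram-Schmidt makes
  them so without losing density, since each old one is almost surely a combination of new
  ones.\<close>

lemma gaussian_limit:
 "\<exists>G. L1_gaussian normal_seq mu G \<and> L1_centered normal_seq mu G \<and>
  L1_converges_in_law P mu normed_sum normal_seq G \<and>
  (\<forall>g\<in>Linfty mu. L1_covariance normal_seq mu G g g = (LINT w|P. (L1_pair mu g (S w))\<^sup>2))"
proof -
 have Si: "w \<in> space P ==> integrable mu (S w)" for w using S_L1 by (simp add: L1_random_variable_def)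
 obtain F :: "nat => 't => real" where F: "\<And>j. F j \<in> Linfty mu"
  and Fd: "AE t in mu. \<forall>eps>0. \<exists>j. norm2 P (%w. S w t - L1_pair mu (F j) (S w)) < ennreal eps"
  using dense_functionals[OF S_L1 mixn_S] by blast
 have pL: "L2fun P (%w. L1_pair mu h (S w))" if "h \<in> Linfty mu" for h
  by (rule L1_pair_L2[OF P that S_joint mixn_S])
 have "\<exists>f :: nat => 't => real. (\<forall>j. f j \<in> Linfty mu) \<and> orthonormal0 P (%j w. L1_pair mu (f j) (S w)) \<and>
   (\<forall>j. \<exists>b. AE w in P. L1_pair mu (F j) (S w) = (\<Sum>i<Suc j. b i * L1_pair mu (f i) (S w)))"
  by (rule gram_schmidt[OF F Si pL])
 then obtain f :: "nat => 't => real" where f: "\<And>j. f j \<in> Linfty mu" "orthonormal0 P (%j w. L1_pair mu (f j) (S w))"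
  and fb: "\<And>j. \<exists>b. AE w in P. L1_pair mu (F j) (S w) = (\<Sum>i<Suc j. b i * L1_pair mu (f i) (S w))"
  by blast
 have pm: "bmeas P (%w. L1_pair mu h (S w))" if "h \<in> Linfty mu" for h
  by (rule L1_pair_measurable[OF that S_joint])
 have "AE t in mu. t \<in> space mu" by simp
 with Fd have fd: "AE t in mu. \<forall>eps>0. \<exists>j b. norm2 P (%w. S w t - (\<Sum>i<Suc j. b i * L1_pair mu (f i) (S w))) < ennreal eps"
 proof eventually_elim
  case (elim t)
  show ?case
  proof (intro allI impI)
   fix eps :: real assume "eps > 0"
   then obtain j where j: "norm2 P (%w. S w t - L1_pair mu (F j) (S w)) < ennreal eps" using elim(1) by blast
   obtain b where b: "AE w in P. L1_pair mu (F j) (S w) = (\<Sum>i<Suc j. b i * L1_pair mu (f i) (S w))" using fb by blast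
   note [measurable] = joint_section[OF S_joint elim(2)] pm[OF F] pm[OF f(1)]
   have "norm2 P (%w. S w t - L1_pair mu (F j) (S w)) = norm2 P (%w. S w t - (\<Sum>i<Suc j. b i * L1_pair mu (f i) (S w)))"
    by (rule norm2_cong_AE) (use b in \<open>auto elim!: eventually_mono\<close>)
   then show "\<exists>j b. norm2 P (%w. S w t - (\<Sum>i<Suc j. b i * L1_pair mu (f i) (S w))) < ennreal eps"
    using j by (intro exI[of _ j] exI[of _ b]) (simp only:)
  qed
 qed
 interpret ex: l1_expansion P T F0 mu S f
  by unfold_locales (rule S_L1 mixn_S f fd)+
 obtain G where G: "L1_random_variable normal_seq mu G"
  "null_seq (%m. mixn normal_seq mu (%z t. G z t - ex.gpart m z t))"
  using ex.gaussian_limit_exists by blast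
 interpret ga: l1_gaussian P T F0 mu S f G
  by unfold_locales (rule G)+
 have approx: "null_seq (%n. mixn P mu (%w t. normed_sum n w t - ga.S_avg n w t))"
  using normed_sum_approx by (simp add: ga.S_avg_def)
 have "L1_converges_in_law P mu normed_sum normal_seq G"
  by (rule ga.G_limit_in_law[OF normed_sum_rv S_F0 S_mds approx pair_clt])
 then show ?thesis using ga.G_gaussian ga.G_centered ga.G_pair_covariance by blast
qed

end

theorem theorem2p2:
  fixes P :: "'w measure" and mu :: "'t measure"
    and T :: "'w \<Rightarrow> 'w" and F0 :: "'w measure"
    and X0 :: "'w \<Rightarrow> 't \<Rightarrow> real"
  defines "X \<equiv> translates P T X0"
  assumes "sigma_finite_measure mu"
    and "prob_space P"
    and "preserving_bijection P T"
    and "subalgebra P F0"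
    and "sets F0 \<subseteq> {T -` A \<inter> space P | A. A \<in> sets F0}"
    and "L1_random_variable P mu X0"
    and "L1_centered P mu X0"
    and "L1_ergodic_sequence P mu X"
    and "\<And>t. t \<in> space mu \<Longrightarrow>
           AE \<omega> in P. real_cond_exp P (filt_minf P T F0) (\<lambda>\<omega>'. X0 \<omega>' t) \<omega> = 0"
    and "\<And>t. t \<in> space mu \<Longrightarrow>
           AE \<omega> in P. real_cond_exp P (filt_inf P T F0) (\<lambda>\<omega>'. X0 \<omega>' t) \<omega> = X0 \<omega> t"
    and "(\<integral>\<^sup>+ t. norm2 P (\<lambda>\<omega>. X0 \<omega> t) \<partial>mu) < \<infinity>"
    and "(\<Sum>\<^sub>\<infinity>k::int. \<integral>\<^sup>+ t. norm2 P (P0 P T F0 (\<lambda>\<omega>. X k \<omega> t)) \<partial>mu) < \<infinity>"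
  shows "\<exists>(D :: int \<Rightarrow> 'w \<Rightarrow> 't \<Rightarrow> real) (S :: 'w \<Rightarrow> 't \<Rightarrow> real).
      (\<forall>k. L1_version_P0 P mu T F0 (X k) (D k)) \<and>
      L1_random_variable P mu S \<and>
      (AE \<omega> in P. L1_has_sum mu (\<lambda>k. D k \<omega>) (S \<omega>)) \<and>
      (\<exists>(Q :: (nat \<Rightarrow> real) measure) (G :: (nat \<Rightarrow> real) \<Rightarrow> 't \<Rightarrow> real).
         prob_space Q \<and> L1_gaussian Q mu G \<and> L1_centered Q mu G \<and>
         L1_converges_in_law P mu
           (\<lambda>n \<omega> t. (\<Sum>i=1..n. X (int i) \<omega> t) / sqrt (real n)) Q G \<and>
         (\<forall>f\<in>Linfty mu.
            integrable P (\<lambda>\<omega>. (L1_pair mu f (S \<omega>))\<^sup>2) \<and>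
            L1_covariance Q mu G f f = (\<integral>\<omega>. (L1_pair mu f (S \<omega>))\<^sup>2 \<partial>P) \<and>
            ((\<lambda>k. Cov P (\<lambda>\<omega>. L1_pair mu f (X 0 \<omega>)) (\<lambda>\<omega>. L1_pair mu f (X k \<omega>)))
               has_sum L1_covariance Q mu G f f) (UNIV :: int set)))"
proof -
 have Xe: "X k w t = X0 (int_iterate P T k w) t" for k w t by (simp add: X_def translates_def)
 have erg: "L1_ergodic_sequence P mu (translates P T X0)" using assms(9) unfolding X_def .
 have fin: "(\<Sum>\<^sub>\<infinity>k::int. \<integral>\<^sup>+ t. norm2 P (P0 P T F0 (%\<omega>. X0 (int_iterate P T k \<omega>) t)) \<partial>mu) < \<infinity>"
  using assms(13) unfolding Xe .
 interpret eh: ergodic_hannan P T F0 mu X0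
  unfolding ergodic_hannan_def hannan_def shift_mu_def shift_def shift_axioms_def shift_mu_axioms_def
   hannan_axioms_def ergodic_hannan_axioms_def
  using assms(2-7,10-12) fin erg by simp
 have Xt: "X k w = X0 (eh.tau k w)" for k w by (simp add: Xe fun_eq_iff)
 have DP: "L1_version_P0 P mu T F0 (X k) (eh.D k)" for k
  unfolding L1_version_P0_def Xt using eh.D_L1 eh.D_P0 by (auto intro: AE_I2)
 obtain G where G: "L1_gaussian normal_seq mu G" "L1_centered normal_seq mu G"
  "L1_converges_in_law P mu eh.normed_sum normal_seq G"
  "\<And>f. f \<in> Linfty mu ==> L1_covariance normal_seq mu G f f = (LINT w|P. (L1_pair mu f (eh.S w))\<^sup>2)"
  using eh.gaussian_limit by blast
 have law: "L1_converges_in_law P mu (%n \<omega> t. (\<Sum>i=1..n. X (int i) \<omega> t) / sqrt (real n)) normal_seq G"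
  using G(3) unfolding eh.normed_sum_def[abs_def] Xt .
 have cov: "((%k. Cov P (%\<omega>. L1_pair mu f (X 0 \<omega>)) (%\<omega>. L1_pair mu f (X k \<omega>)))
   has_sum L1_covariance normal_seq mu G f f) UNIV" if f: "f \<in> Linfty mu" for f
 proof -
  \<comment> \<open>Centering, together with stationarity, removes the means in
    \<open>Cov\<close>.\<close>
  have m0: "(LINT w|P. L1_pair mu f (X0 w)) = 0" using \<open>L1_centered P mu X0\<close> f by (simp add: L1_centered_def)
  have pm: "bmeas P (%w. L1_pair mu f (X0 w))" by (rule eh.L1_pair_measurable[OF f eh.X0_joint])
  have mk: "(LINT w|P. L1_pair mu f (X k w)) = 0" for k
   unfolding Xt using eh.integral_tau[OF pm, of k] m0 by simp
  have "Cov P (%\<omega>. L1_pair mu f (X 0 \<omega>)) (%\<omega>. L1_pair mu f (X k \<omega>))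
    = (LINT w|P. L1_pair mu f (X0 w) * L1_pair mu f (X0 (eh.tau k w)))" for k
   unfolding Cov_def mk by (simp add: Xt eh.tau_0)
  then show ?thesis using eh.pair_covariance_has_sum[OF f] G(4)[OF f] by simp
 qed
 have sq: "integrable P (%\<omega>. (L1_pair mu f (eh.S \<omega>))\<^sup>2)" if f: "f \<in> Linfty mu" for f
  by (rule L2fun_square[OF eh.mds_L2[OF eh.pair_mds[OF f]]])
 show ?thesis
  by (intro exI[of _ eh.D] exI[of _ eh.S] exI[of _ normal_seq] exI[of _ G] conjI allI ballI
    DP eh.S_L1 eh.S_has_sum prob_normal_seq G(1,2) law sq G(4) cov)
qed

end
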